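(* Let $\mathcal{D}$ be $\tilde{\mathcal{D}}_0$ or $\mathcal{D}_1$. Then for any $\mu\in M(H)$ there exists a unique solution $(\gamma_t)_{t\ge0}\subset M(H)$ to the measure equation $$\begin{cases}\dfrac{d}{dt}\displaystyle\int_Hf(x)\,\gamma_t(dx)=\int_H\mathcal{L}_0f(x)\,\gamma_t(dx),\quad f\in\mathcal{D},\ t\ge0,\\ \gamma_0=\mu.\end{cases}$$ Moreover, such solution is given by $(P_t^*\mu)_{t\ge0}$.
   Context: Let $H$ be a real separable Hilbert space with inner product $\langle\cdot,\cdot\rangle$ and norm $|\cdot|$, and $L_2(H)$ the Hilbert space of Hilbert--Schmidt operators on $H$. $C_b(H)$ (resp. $C_b(H,H)$) is the space of bounded continuous functions from $H$ to $\mathbb{R}$ (resp. to $H$). Let $Q:H\to H$ be a non-negative symmetric trace-class operator, $a\in H$, and $\nu$ a $\sigma$-finite Borel measure on $H$ with $\nu(\{0\})=0$ and $\int_H(1\wedge|y|^2)\,\nu(dy)<\infty$. Let $Z=(Z_t)_{t\ge0}$ be an $H$-valued Lévy process with $\mathbb{E}[e^{i\langle Z_t,h\rangle}]=e^{-t\psi(h)}$, where $$\psi(h)=\tfrac12\langle Qh,h\rangle-i\langle a,h\rangle-\int_H\big(e^{i\langle h,y\rangle}-1-i\langle h,y\rangle\mathbf{1}_{\{|y|\le1\}}\big)\,\nu(dy),\quad h\in H.$$ Let $A:D(A)\subset H\to H$ generate a $C_0$-semigroup $(e^{tA})$ on $H$, with adjoint $A^*:D(A^* )\subset H\to H$, which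 generates $(e^{tA^*})$. Put $X_t^x=e^{tA}x+Y_t$, $Y_t=\int_0^te^{(t-s)A}\,dZ_s$. The law $\mu_t$ of $Y_t$ is the Borel probability measure on $H$ with characteristic function $\hat\mu_t(h)=\exp\big(-\int_0^t\psi(e^{sA^*}h)\,ds\big)$, $h\in H$. The Ornstein--Uhlenbeck semigroup is, for $f:H\to\mathbb{R}$ bounded and Borel, $$P_tf(x)=\mathbb{E}[f(X_t^x)]=\int_Hf(e^{tA}x+y)\,\mu_t(dy),\quad t\ge0,\ x\in H$$ (extended linearly to complex-valued $f$). $C_b^2(H)$ is the space of $f\in C_b(H)$, twice Fréchet differentiable on $H$, with $Df\in C_b(H,H)$, $D^2f(x)\in L_2(H)$ for all $x$, and $D^2f:H\to L_2(H)$ bounded and continuous. $C_A^2(H)$ is the set of $f\in C_b^2(H)$ with $Df(x)\in D(A^* )$ for all $x\in H$ and $A^*Df\in C_b(H,H)$. For $f\in C_A^2(H)$, $x\in H$, $$\mathcal{L}_0f(x)=\langle x,A^*Df(x)\rangle+\int_H\big(f(x+y)-f(x)-\mathbf{1}_{\{|y|\le1\}}\langle y,Df(x)\rangle\big)\,\nu(dy)+\tfrac12\mathrm{Tr}(QD^2f(x))+\langle a,Df(x)\rangle.$$ $\tilde{\mathcal{D}}_0=\{f\in C_A^2(H):\ x\mapsto\langle x,A^*Df(x)\rangle\in C_b(H)\}$. $\mathcal{D}_1$ is the (real) linear span of the real and imaginary parts of the maps $\phi_{b,h}:H\to\mathbb{C}$, $$\phi_{b,h}(x)=\int_0^bP_s\big(e^{i\langle\cdot,h\rangle}\big)(x)\,ds=\int_0^be^{i\langle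 e^{sA}x,h\rangle}e^{-\int_0^s\psi(e^{rA^*}h)\,dr}\,ds,\qquad h\in D(A^* ),\ b>0;$$ one has $\mathcal{D}_1\subset\tilde{\mathcal{D}}_0$, and $\mathcal{L}_0f\in C_b(H)$ for $f\in\tilde{\mathcal{D}}_0$. $M(H)$ is the Banach space of all finite signed Borel measures on $H$ with the total variation norm $\|\cdot\|_{TV}$. Given $\mu\in M(H)$, a family $(\gamma_t)_{t\ge0}\subset M(H)$ is called a solution to the measure equation if: (i) for any $T>0$, the real map $t\mapsto\|\gamma_t\|_{TV}$ belongs to $L^1(0,T)$; (ii) for any $f\in\mathcal{D}$, the real function $t\mapsto\int_Hf(x)\,\gamma_t(dx)$ is absolutely continuous on each $[0,T]$, $T>0$, and $$\int_Hf(x)\,\gamma_t(dx)-\int_Hf(x)\,\mu(dx)=\int_0^t\Big(\int_H\mathcal{L}_0f(x)\,\gamma_s(dx)\Big)ds,\quad t\ge0;$$ together with $\gamma_0=\mu$. The dual semigroup $P_t^*:M(H)\to M(H)$, $t\ge0$, is given by $P_t^*\mu(B)=\int_HP_t(\mathbf{1}_B)(x)\,\mu(dx)$ for Borel sets $B\subset H$. *)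

theory Defs
  imports "HOL-Probability.Probability"
begin

text \<open>The real separable Hilbert space is a type of class \<open>{real_inner, polish_space}\<close>:
  \<open>polish_space\<close> adds completeness and second countability, and the latter
  is separability in a metric space.\<close>

section \<open>Operators on a Hilbert space\<close>

definition orthonormal_basis :: "'h::real_inner set \<Rightarrow> bool" where
  "orthonormal_basis B \<longleftrightarrow>
     (\<forall>e\<in>B. norm e = 1) \<and> (\<forall>e\<in>B. \<forall>f\<in>B. e \<noteq> f \<longrightarrow> e \<bullet> f = 0) \<and> closure (span B) = UNIV"

text \<open>A fixed orthonormal basis. For Hilbert--Schmidt (respectively trace-class) operators the
  sums below do not depend on the basis.\<close>

definition the_onb :: "'h::real_inner set" where
  "the_onb = (SOME B. orthonormal_basis B)"

definition hilbert_schmidt :: "('h::real_inner \<Rightarrow> 'h) \<Rightarrow> bool" where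
  "hilbert_schmidt T \<longleftrightarrow> bounded_linear T \<and> (\<lambda>e. (norm (T e))\<^sup>2) summable_on the_onb"

definition hs_norm :: "('h::real_inner \<Rightarrow> 'h) \<Rightarrow> real" where
  "hs_norm T = sqrt (\<Sum>\<^sub>\<infinity>e\<in>the_onb. (norm (T e))\<^sup>2)"

definition trace_class :: "('h::real_inner \<Rightarrow> 'h) \<Rightarrow> bool" where
  "trace_class T \<longleftrightarrow> (\<exists>u v :: nat \<Rightarrow> 'h.
     summable (\<lambda>k. norm (u k) * norm (v k)) \<and>
     (\<forall>x. (\<lambda>k. (u k \<bullet> x) *\<^sub>R v k) sums T x))"

definition trace_op :: "('h::real_inner \<Rightarrow> 'h) \<Rightarrow> real" where
  "trace_op T = (\<Sum>\<^sub>\<infinity>e\<in>the_onb. T e \<bullet> e)"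

definition nonneg_symmetric :: "('h::real_inner \<Rightarrow> 'h) \<Rightarrow> bool" where
  "nonneg_symmetric T \<longleftrightarrow>
     bounded_linear T \<and> (\<forall>x y. T x \<bullet> y = x \<bullet> T y) \<and> (\<forall>x. 0 \<le> T x \<bullet> x)"

text \<open>Only the values \<open>S t\<close> for \<open>t \<ge> 0\<close> matter. An unbounded operator with domain \<open>D\<close> is a pair
  \<open>D\<close>, \<open>A\<close>, where \<open>A\<close> is only meaningful on \<open>D\<close>.\<close>

definition C0_semigroup :: "(real \<Rightarrow> 'h::real_normed_vector \<Rightarrow> 'h) \<Rightarrow> bool" where
  "C0_semigroup S \<longleftrightarrow>
     (\<forall>t\<ge>0. bounded_linear (S t)) \<and> (\<forall>x. S 0 x = x) \<and>
     (\<forall>s\<ge>0. \<forall>t\<ge>0. \<forall>x. S (s + t) x = S s (S t x)) \<and>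
     (\<forall>x. ((\<lambda>t. S t x) \<longlongrightarrow> x) (at_right 0))"

definition generates ::
    "'h::real_normed_vector set \<Rightarrow> ('h \<Rightarrow> 'h) \<Rightarrow> (real \<Rightarrow> 'h \<Rightarrow> 'h) \<Rightarrow> bool" where
  "generates D A S \<longleftrightarrow> C0_semigroup S \<and>
     D = {x. \<exists>y. ((\<lambda>t. (S t x - x) /\<^sub>R t) \<longlongrightarrow> y) (at_right 0)} \<and>
     (\<forall>x\<in>D. ((\<lambda>t. (S t x - x) /\<^sub>R t) \<longlongrightarrow> A x) (at_right 0))"

definition adj_dom :: "'h::real_inner set \<Rightarrow> ('h \<Rightarrow> 'h) \<Rightarrow> 'h set" where
  "adj_dom D A = {y. \<exists>z. \<forall>x\<in>D. A x \<bullet> y = x \<bullet> z}"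

definition adj_op :: "'h::real_inner set \<Rightarrow> ('h \<Rightarrow> 'h) \<Rightarrow> 'h \<Rightarrow> 'h" where
  "adj_op D A y = (THE z. \<forall>x\<in>D. A x \<bullet> y = x \<bullet> z)"

section \<open>The driving Levy process and the stochastic convolution\<close>

definition jump_measure :: "'h::real_inner measure \<Rightarrow> bool" where
  "jump_measure \<nu> \<longleftrightarrow> sets \<nu> = sets borel \<and> sigma_finite_measure \<nu> \<and>
     emeasure \<nu> {0} = 0 \<and> integrable \<nu> (\<lambda>y. min 1 ((norm y)\<^sup>2))"

definition levy_exponent ::
    "('h::real_inner \<Rightarrow> 'h) \<Rightarrow> 'h \<Rightarrow> 'h measure \<Rightarrow> 'h \<Rightarrow> complex" where
  "levy_exponent Q a \<nu> h =
     of_real (1/2 * (Q h \<bullet> h)) - \<i> * of_real (a \<bullet> h) -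
     (LINT y|\<nu>. exp (\<i> * of_real (h \<bullet> y)) - 1 -
        \<i> * of_real (h \<bullet> y) * of_real (indicator {y. norm y \<le> 1} y))"

definition levy_process ::
    "'w measure \<Rightarrow> (real \<Rightarrow> 'w \<Rightarrow> 'h::{real_inner, polish_space}) \<Rightarrow> bool" where
  "levy_process M Z \<longleftrightarrow> prob_space M \<and>
     (\<forall>t\<ge>0. Z t \<in> borel_measurable M) \<and>
     (AE \<omega> in M. Z 0 \<omega> = 0) \<and>
     (\<forall>n \<tau>. 0 \<le> \<tau> 0 \<and> (\<forall>k<n. \<tau> k \<le> \<tau> (Suc k)) \<longrightarrow>
        prob_space.indep_vars M (\<lambda>_::nat. borel)
          (\<lambda>k \<omega>. Z (\<tau> (Suc k)) \<omega> - Z (\<tau> k) \<omega>) {..<n}) \<and>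
     (\<forall>s\<ge>0. \<forall>t\<ge>0. distr M borel (\<lambda>\<omega>. Z (s + t) \<omega> - Z s \<omega>) = distr M borel (Z t)) \<and>
     (\<forall>t\<ge>0. \<forall>\<epsilon>>0.
        ((\<lambda>s. measure M {\<omega>\<in>space M. norm (Z s \<omega> - Z t \<omega>) > \<epsilon>}) \<longlongrightarrow> 0) (at t within {0..}))"

text \<open>\<open>Y t\<close> is the stochastic integral over \<open>[0,t]\<close> of the deterministic integrand \<open>s \<mapsto> S (t - s)\<close>
  against \<open>Z\<close>, i.e. the limit in probability of its Riemann sums as the mesh tends to 0.\<close>

definition stochastic_convolution ::
    "'w measure \<Rightarrow> (real \<Rightarrow> 'h \<Rightarrow> 'h) \<Rightarrow> (real \<Rightarrow> 'w \<Rightarrow> 'h::{real_inner, polish_space}) \<Rightarrow>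
     (real \<Rightarrow> 'w \<Rightarrow> 'h) \<Rightarrow> bool" where
  "stochastic_convolution M S Z Y \<longleftrightarrow> (\<forall>t\<ge>0. Y t \<in> borel_measurable M \<and>
     (\<forall>\<epsilon>>0. \<exists>\<delta>>0. \<forall>(n::nat) \<tau>.
        \<tau> 0 = 0 \<and> \<tau> n = t \<and> (\<forall>k<n. \<tau> k \<le> \<tau> (Suc k) \<and> \<tau> (Suc k) - \<tau> k < \<delta>) \<longrightarrow>
        measure M {\<omega>\<in>space M.
          norm ((\<Sum>k<n. S (t - \<tau> k) (Z (\<tau> (Suc k)) \<omega> - Z (\<tau> k) \<omega>)) - Y t \<omega>) > \<epsilon>} < \<epsilon>))"

text \<open>The transition operators, for real-valued and for complex-valued functions at once.\<close>

definition ou_semigroup ::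
    "'w measure \<Rightarrow> (real \<Rightarrow> 'h \<Rightarrow> 'h) \<Rightarrow> (real \<Rightarrow> 'w \<Rightarrow> 'h::{real_inner, polish_space}) \<Rightarrow>
     real \<Rightarrow> ('h \<Rightarrow> 'b::{banach, second_countable_topology}) \<Rightarrow> 'h \<Rightarrow> 'b" where
  "ou_semigroup M S Y t f x = (LINT \<omega>|M. f (S t x + Y t \<omega>))"

section \<open>Test functions and the generator\<close>

definition grad :: "('h::real_inner \<Rightarrow> real) \<Rightarrow> 'h \<Rightarrow> 'h" where
  "grad f x = (THE g. GDERIV f x :> g)"

definition hess :: "('h::real_inner \<Rightarrow> real) \<Rightarrow> 'h \<Rightarrow> 'h \<Rightarrow> 'h" where
  "hess f x = frechet_derivative (grad f) (at x)"

definition Cb2 :: "('h::{real_inner, polish_space} \<Rightarrow> real) set" where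
  "Cb2 = {f. f \<in> bcontfun \<and>
     (\<forall>x. f differentiable (at x)) \<and> (\<forall>x. grad f differentiable (at x)) \<and>
     grad f \<in> bcontfun \<and>
     (\<forall>x. hilbert_schmidt (hess f x)) \<and>
     (\<exists>C. \<forall>x. hs_norm (hess f x) \<le> C) \<and>
     (\<forall>x. ((\<lambda>y. hs_norm (\<lambda>v. hess f y v - hess f x v)) \<longlongrightarrow> 0) (at x))}"

definition CA2 ::
    "'h set \<Rightarrow> ('h \<Rightarrow> 'h) \<Rightarrow> ('h::{real_inner, polish_space} \<Rightarrow> real) set" where
  "CA2 D A = {f \<in> Cb2. (\<forall>x. grad f x \<in> adj_dom D A) \<and> (\<lambda>x. adj_op D A (grad f x)) \<in> bcontfun}"

definition L0 ::
    "'h set \<Rightarrow> ('h \<Rightarrow> 'h) \<Rightarrow> ('h \<Rightarrow> 'h) \<Rightarrow> 'h \<Rightarrow> 'h measure \<Rightarrow>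
     ('h::{real_inner, polish_space} \<Rightarrow> real) \<Rightarrow> 'h \<Rightarrow> real" where
  "L0 D A Q a \<nu> f x =
     x \<bullet> adj_op D A (grad f x) +
     (LINT y|\<nu>. f (x + y) - f x - indicator {y. norm y \<le> 1} y * (y \<bullet> grad f x)) +
     1/2 * trace_op (\<lambda>v. Q (hess f x v)) + a \<bullet> grad f x"

definition D0_tilde ::
    "'h set \<Rightarrow> ('h \<Rightarrow> 'h) \<Rightarrow> ('h::{real_inner, polish_space} \<Rightarrow> real) set" where
  "D0_tilde D A = {f \<in> CA2 D A. (\<lambda>x. x \<bullet> adj_op D A (grad f x)) \<in> bcontfun}"

definition phi ::
    "'w measure \<Rightarrow> (real \<Rightarrow> 'h \<Rightarrow> 'h) \<Rightarrow> (real \<Rightarrow> 'w \<Rightarrow> 'h::{real_inner, polish_space}) \<Rightarrow>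
     real \<Rightarrow> 'h \<Rightarrow> 'h \<Rightarrow> complex" where
  "phi M S Y b h x =
     (LINT s:{0..b}|lborel. ou_semigroup M S Y s (\<lambda>z. exp (\<i> * of_real (z \<bullet> h))) x)"

text \<open>The linear span is written out because real-valued functions are not an instance of
  \<open>real_vector\<close> in the library.\<close>

definition D1 ::
    "'w measure \<Rightarrow> (real \<Rightarrow> 'h \<Rightarrow> 'h) \<Rightarrow> (real \<Rightarrow> 'w \<Rightarrow> 'h::{real_inner, polish_space}) \<Rightarrow>
     'h set \<Rightarrow> ('h \<Rightarrow> 'h) \<Rightarrow> ('h \<Rightarrow> real) set" where
  "D1 M S Y D A =
     {f. \<exists>(n::nat) c g. f = (\<lambda>x. \<Sum>i<n. c i * g i x) \<and>
        (\<forall>i<n. \<exists>b>0. \<exists>h\<in>adj_dom D A.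
           g i = (\<lambda>x. Re (phi M S Y b h x)) \<or> g i = (\<lambda>x. Im (phi M S Y b h x)))}"

section \<open>Finite signed Borel measures\<close>

text \<open>A signed measure is a set function; it is set to 0 outside the Borel sets so that equality of
  signed measures is equality of functions.\<close>

definition signed_measures :: "('h::topological_space set \<Rightarrow> real) set" where
  "signed_measures = {\<gamma>.
     (\<forall>B. B \<notin> sets borel \<longrightarrow> \<gamma> B = 0) \<and> \<gamma> {} = 0 \<and>
     (\<forall>F :: nat \<Rightarrow> 'h set. range F \<subseteq> sets borel \<and> disjoint_family F \<longrightarrow>
        (\<lambda>n. \<gamma> (F n)) sums \<gamma> (\<Union>n. F n))}"

text \<open>Jordan decomposition: \<open>pos_part \<gamma>\<close> is the upper variation of \<open>\<gamma>\<close> and \<open>pos_part (\<lambda>B. - \<gamma> B)\<close> the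
  lower variation. The function \<open>ennreal\<close> maps negative numbers to 0, which is harmless as
  \<open>C = {}\<close> already contributes the value 0 to the supremum.\<close>

definition pos_part :: "('h::topological_space set \<Rightarrow> real) \<Rightarrow> 'h measure" where
  "pos_part \<gamma> = measure_of UNIV (sets borel)
     (\<lambda>B. SUP C\<in>{C \<in> sets borel. C \<subseteq> B}. ennreal (\<gamma> C))"

definition neg_part :: "('h::topological_space set \<Rightarrow> real) \<Rightarrow> 'h measure" where
  "neg_part \<gamma> = pos_part (\<lambda>B. - \<gamma> B)"

definition tv_norm :: "('h::topological_space set \<Rightarrow> real) \<Rightarrow> real" where
  "tv_norm \<gamma> = measure (pos_part \<gamma>) UNIV + measure (neg_part \<gamma>) UNIV"

definition signed_integral ::
    "('h::topological_space set \<Rightarrow> real) \<Rightarrow> ('h \<Rightarrow> real) \<Rightarrow> real" where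
  "signed_integral \<gamma> f = integral\<^sup>L (pos_part \<gamma>) f - integral\<^sup>L (neg_part \<gamma>) f"

definition dual_semigroup ::
    "'w measure \<Rightarrow> (real \<Rightarrow> 'h \<Rightarrow> 'h) \<Rightarrow> (real \<Rightarrow> 'w \<Rightarrow> 'h::{real_inner, polish_space}) \<Rightarrow>
     real \<Rightarrow> ('h set \<Rightarrow> real) \<Rightarrow> 'h set \<Rightarrow> real" where
  "dual_semigroup M S Y t \<mu> B =
     (if B \<in> sets borel
      then signed_integral \<mu> (\<lambda>x. ou_semigroup M S Y t (indicator B :: 'h \<Rightarrow> real) x) else 0)"

section \<open>The measure equation\<close>

definition abs_continuous_on_Icc :: "real \<Rightarrow> real \<Rightarrow> (real \<Rightarrow> real) \<Rightarrow> bool" where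
  "abs_continuous_on_Icc p q F \<longleftrightarrow>
     (\<forall>\<epsilon>>0. \<exists>\<delta>>0. \<forall>(n::nat) u v.
        (\<forall>i<n. p \<le> u i \<and> u i \<le> v i \<and> v i \<le> q) \<and>
        (\<forall>i<n. \<forall>j<n. i \<noteq> j \<longrightarrow> {u i<..<v i} \<inter> {u j<..<v j} = {}) \<and>
        (\<Sum>i<n. v i - u i) < \<delta> \<longrightarrow>
        (\<Sum>i<n. \<bar>F (v i) - F (u i)\<bar>) < \<epsilon>)"

text \<open>Here \<open>L\<close> is the generator and \<open>\<D>\<close> the class of test functions. Integrability of
  \<open>s \<mapsto> \<integral> L f d\<gamma>\<^sub>s\<close> is implicit in writing its time integral; it has to be made explicit since
  the Bochner integral of a non-integrable function is 0.\<close>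

definition measure_equation_solution ::
    "(('h::topological_space \<Rightarrow> real) \<Rightarrow> 'h \<Rightarrow> real) \<Rightarrow> ('h \<Rightarrow> real) set \<Rightarrow>
     ('h set \<Rightarrow> real) \<Rightarrow> (real \<Rightarrow> 'h set \<Rightarrow> real) \<Rightarrow> bool" where
  "measure_equation_solution L \<D> \<mu> \<gamma> \<longleftrightarrow>
     (\<forall>t\<ge>0. \<gamma> t \<in> signed_measures) \<and>
     (\<forall>T>0. (\<lambda>t. tv_norm (\<gamma> t)) absolutely_integrable_on {0<..<T}) \<and>
     (\<forall>f\<in>\<D>.
        (\<forall>T>0. abs_continuous_on_Icc 0 T (\<lambda>t. signed_integral (\<gamma> t) f)) \<and>
        (\<forall>t\<ge>0. (\<lambda>s. signed_integral (\<gamma> s) (L f)) absolutely_integrable_on {0..t} \<and>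
           signed_integral (\<gamma> t) f - signed_integral \<mu> f =
             (LINT s:{0..t}|lebesgue. signed_integral (\<gamma> s) (L f)))) \<and>
     \<gamma> 0 = \<mu>"

end

theory Submission
  imports Defs
begin

text \<open>Existence: every \<open>f \<in> D0_tilde\<close> satisfies \<open>\<bar>P\<^sub>t f - f\<bar> \<le> K t\<close> and
  \<open>(P\<^sub>t f - f) / t \<longlonglongrightarrow> L\<^sub>0 f\<close> pointwise as \<open>t\<close> tends to 0. The only analytic input is the forward
  equation \<open>E f (x + Y\<^sub>t) - f x = \<integral>\<^sub>0\<^sup>t E (L\<^sub>s f) (x + Y\<^sub>s) ds\<close>: it holds for complex exponentials by
  the formula for the characteristic function of \<open>Y\<^sub>t\<close>, for periodic functions of finitely many
  coordinates by comparing Fourier coefficients, and in general because \<open>f\<close> is the limit, with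
  bounded derivatives, of \<open>f\<close> composed with \<open>x \<mapsto> \<Sum>\<^sub>e R sin (\<langle>x, e\<rangle> / R) e\<close>. Hence
  \<open>t \<mapsto> \<integral> P\<^sub>t f d\<mu>\<close> is Lipschitz with right derivative \<open>\<integral> L\<^sub>0 f d(P\<^sub>t\<^sup>* \<mu>)\<close>.

  Uniqueness: since \<open>L\<^sub>0 \<phi>\<^sub>b\<^sub>,\<^sub>h = P\<^sub>b e\<^sub>h - e\<^sub>h\<close>, testing the difference of two solutions with
  \<open>\<phi>\<^sub>b\<^sub>,\<^sub>h\<close> shows that \<open>w(t, r)\<close>, the integral of \<open>P\<^sub>r e\<^sub>h\<close> at time \<open>t\<close>, satisfies
  \<open>\<integral>\<^sub>0\<^sup>r w(t, \<rho>) d\<rho> = \<integral>\<^sub>0\<^sup>t (w(s, r) - w(s, 0)) ds\<close>. This is a transport equation along \<open>t + r\<close>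
  with zero initial value, so \<open>w = 0\<close>, and characteristic functions determine signed measures.\<close>

text \<open>The law of \<open>Y t\<close> is accessible only through its characteristic function, so
  every identity about it has to be traced back to exponentials, while Stone-Weierstrass gives no
  control of derivatives. The sine map resolves this: composition with it makes \<open>f\<close>
  periodic in finitely many directions, where Fourier coefficients decide, and the bounds on two
  derivatives survive with a factor 2, whatever the dimension and the period. The operator
  \<open>L_s\<close> depends on time because the exponent of \<open>Y t\<close> is the time integral
  of \<open>\<psi> (Sa s h)\<close>: at time \<open>s\<close> the drift, the covariance and the
  jumps of \<open>Z\<close> arrive transformed by \<open>S s\<close>. The unbounded drift is split
  off by expanding around \<open>S t x\<close>; the flow \<open>f (S t x)\<close> can be
  differentiated because \<open>x \<bullet> As (grad f x)\<close> is bounded and continuous, which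
  carries the formula from \<open>D\<close> to all points. A solution is merely integrable in time,
  so the transport equation is integrated in \<open>t\<close> twice before it is differentiated
  along characteristics. Existence is shown for the larger class and uniqueness is tested with the
  functions \<phi> only, which settles both choices of \<open>\<D>\<close>.\<close>

abbreviation (input) bm :: "('a::topological_space \<Rightarrow> 'b::topological_space) set" where
  "bm \<equiv> borel_measurable borel"

abbreviation (input) recip :: "nat \<Rightarrow> real" where "recip n \<equiv> 1 / real (Suc n)"

section \<open>Hilbert space geometry\<close>

lemma parallelogram_law:
  fixes x y :: "'a::real_inner"
  shows "(norm (x + y))\<^sup>2 + (norm (x - y))\<^sup>2 = 2 * (norm x)\<^sup>2 + 2 * (norm y)\<^sup>2"
  by (simp add: power2_norm_eq_inner inner_add_left inner_add_right inner_diff_left inner_diff_right)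

text \<open>A minimising sequence is Cauchy by the parallelogram law, and its limit lies in the
  closed set \<open>V\<close>. The residual is orthogonal to \<open>V\<close> because moving along
  any \<open>w\<close> cannot decrease the distance.\<close>

lemma projection_exists:
  fixes V :: "'a::{real_inner, complete_space} set"
  assumes "subspace V" "closed V"
  obtains p where "p \<in> V" "\<And>v. v \<in> V \<Longrightarrow> (x - p) \<bullet> v = 0"
proof -
  define d where "d = infdist x V"
  have ne: "V \<noteq> {}" using assms(1) subspace_0 by blast
  have d_le: "d \<le> dist x v" if "v \<in> V" for v
    using that unfolding d_def by (simp add: infdist_le)
  have d0: "d \<ge> 0" unfolding d_def by (rule infdist_nonneg)
  have "\<exists>v\<in>V. dist x v < d + 1 / Suc n" for n
  proof (rule ccontr)
    assume "\<not> ?thesis"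
    hence "\<And>v. v \<in> V \<Longrightarrow> d + 1 / Suc n \<le> dist x v" by force
    hence "d + 1 / Suc n \<le> infdist x V"
      unfolding infdist_def using ne by (auto intro!: cINF_greatest)
    thus False unfolding d_def by simp
  qed
  then obtain v where v: "\<And>n. v n \<in> V" "\<And>n. dist x (v n) < d + 1 / Suc n" by metis
  \<comment> \<open>The midpoint of \<open>v m\<close> and \<open>v n\<close> stays in
    \<open>V\<close>, at distance at least \<open>d\<close> from \<open>x\<close>; the parallelogram
    law then turns near minimality into a bound on their distance.\<close>
  have key: "(dist (v m) (v n))\<^sup>2 \<le> 4 * (d + 1 / Suc N)\<^sup>2 - 4 * d\<^sup>2"
    if "N \<le> m" "N \<le> n" for m n N
  proof -
    have mem: "(1/2) *\<^sub>R (v m + v n) \<in> V"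
      using v(1) assms(1) by (simp add: subspace_add subspace_scale)
    have "d \<le> norm (x - (1/2) *\<^sub>R (v m + v n))"
      using d_le[OF mem] by (simp add: dist_norm)
    also have "x - (1/2) *\<^sub>R (v m + v n) = (1/2) *\<^sub>R ((x - v m) + (x - v n))"
      by (simp add: algebra_simps flip: scaleR_2)
    finally have "2 * d \<le> norm ((x - v m) + (x - v n))" by simp
    hence "(2 * d)\<^sup>2 \<le> (norm ((x - v m) + (x - v n)))\<^sup>2" using d0 by (intro power_mono) auto
    hence "4 * d\<^sup>2 \<le> (norm ((x - v m) + (x - v n)))\<^sup>2" by (simp add: power_mult_distrib)
    moreover have "(norm ((x - v m) - (x - v n)))\<^sup>2 = (dist (v m) (v n))\<^sup>2"
      by (simp add: dist_norm norm_minus_commute)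
    moreover have "dist x (v k) \<le> d + 1 / Suc N" if "N \<le> k" for k
    proof -
      have "recip k \<le> 1 / real (Suc N)" using that by (intro divide_left_mono) auto
      thus ?thesis using v(2)[of k] by linarith
    qed
    from this[OF that(1)] this[OF that(2)]
    have "(norm (x - v m))\<^sup>2 \<le> (d + 1 / Suc N)\<^sup>2" "(norm (x - v n))\<^sup>2 \<le> (d + 1 / Suc N)\<^sup>2"
      by (auto simp: dist_norm intro!: power_mono)
    moreover have aux: "f \<le> 4 * K - c" if "c \<le> a" "b = f" "p \<le> K" "q \<le> K" "a + b = 2 * p + 2 * q"
      for a b c f p q K :: real using that by linarith
    ultimately show ?thesis using parallelogram_law[of "x - v m" "x - v n"] by blast
  qed
  have "(\<lambda>N. 4 * (d + 1 / Suc N)\<^sup>2 - 4 * d\<^sup>2) \<longlonglongrightarrow> 4 * (d + 0)\<^sup>2 - 4 * d\<^sup>2"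
    by (intro tendsto_intros LIMSEQ_Suc lim_1_over_n)
  hence lim0: "(\<lambda>N. 4 * (d + 1 / Suc N)\<^sup>2 - 4 * d\<^sup>2) \<longlonglongrightarrow> 0" by simp
  have "Cauchy v"
    unfolding Cauchy_def
  proof (intro allI impI)
    fix e :: real assume "e > 0"
    hence "\<forall>\<^sub>F N in sequentially. 4 * (d + 1 / Suc N)\<^sup>2 - 4 * d\<^sup>2 < e\<^sup>2"
      using order_tendstoD(2)[OF lim0] by simp
    then obtain N where "4 * (d + 1 / Suc N)\<^sup>2 - 4 * d\<^sup>2 < e\<^sup>2"
      by (auto simp: eventually_sequentially)
    hence "\<forall>m\<ge>N. \<forall>n\<ge>N. (dist (v m) (v n))\<^sup>2 < e\<^sup>2" using key by (meson le_less_trans)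
    thus "\<exists>M. \<forall>m\<ge>M. \<forall>n\<ge>M. dist (v m) (v n) < e"
      using \<open>e > 0\<close> by (meson less_imp_le power_less_imp_less_base)
  qed
  then obtain p where p: "v \<longlonglongrightarrow> p" using convergent_eq_Cauchy by blast
  have pV: "p \<in> V" using assms(2) p v(1) closed_sequentially by blast
  have "(\<lambda>n. d + 1 / Suc n) \<longlonglongrightarrow> d + 0"
    by (intro tendsto_intros LIMSEQ_Suc lim_1_over_n)
  moreover have "(\<lambda>n. dist x (v n)) \<longlonglongrightarrow> dist x p" by (intro tendsto_intros p)
  ultimately have "dist x p \<le> d + 0"
    using v(2) less_imp_le by (intro LIMSEQ_le) blast+
  hence dp: "dist x p \<le> d" by simp
  have "(x - p) \<bullet> w = 0" if w: "w \<in> V" for w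
  proof (cases "w = 0")
    case False
    \<comment> \<open>The minimiser in \<open>t\<close> of the squared distance from
      \<open>x\<close> to \<open>p + t *\<^sub>R w\<close>.\<close>
    define t where "t = ((x - p) \<bullet> w) / (norm w)\<^sup>2"
    have "p + t *\<^sub>R w \<in> V" using pV w assms(1) by (simp add: subspace_add subspace_scale)
    hence "norm (x - p) \<le> norm (x - (p + t *\<^sub>R w))"
      using d_le dp by (metis dist_norm order_trans)
    hence "(norm (x - p))\<^sup>2 \<le> (norm ((x - p) - t *\<^sub>R w))\<^sup>2"
      by (simp add: power_mono diff_diff_eq)
    also have "\<dots> = (norm (x - p))\<^sup>2 - 2 * t * ((x - p) \<bullet> w) + t\<^sup>2 * (norm w)\<^sup>2"
      unfolding power2_norm_eq_inner
      by (simp add: inner_diff_left inner_diff_right inner_commute power2_eq_square algebra_simps)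
    finally have "2 * t * ((x - p) \<bullet> w) \<le> t\<^sup>2 * (norm w)\<^sup>2" by simp
    moreover have "t\<^sup>2 * (norm w)\<^sup>2 = t * ((x - p) \<bullet> w)"
      using False by (simp add: t_def power2_eq_square)
    moreover have "t * ((x - p) \<bullet> w) = ((x - p) \<bullet> w)\<^sup>2 / (norm w)\<^sup>2"
      by (simp add: t_def power2_eq_square)
    ultimately have "((x - p) \<bullet> w)\<^sup>2 / (norm w)\<^sup>2 \<le> 0" by linarith
    thus ?thesis using False by (simp add: divide_le_0_iff)
  qed simp
  thus ?thesis using that pV by blast
qed

text \<open>The kernel has codimension one. A vector \<open>w\<close> orthogonal to it spans the
  complement, and subtracting from \<open>x\<close> the multiple of \<open>w\<close> with the same
  value under \<open>\<phi>\<close> leaves an element of the kernel.\<close>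

lemma riesz_representation:
  fixes \<phi> :: "'a::{real_inner, complete_space} \<Rightarrow> real"
  assumes "bounded_linear \<phi>"
  obtains z where "\<And>x. \<phi> x = x \<bullet> z"
proof (cases "\<forall>x. \<phi> x = 0")
  case True
  thus ?thesis using that[of 0] by simp
next
  case False
  interpret bounded_linear \<phi> by fact
  obtain x0 where x0: "\<phi> x0 \<noteq> 0" using False by blast
  have sub: "subspace {x. \<phi> x = 0}" by (simp add: subspace_def add scaleR)
  have "closed {x. \<phi> x = 0}"
    by (intro closed_Collect_eq continuous_on_const linear_continuous_on assms)
  then obtain p where p: "p \<in> {x. \<phi> x = 0}" "\<And>v. v \<in> {x. \<phi> x = 0} \<Longrightarrow> (x0 - p) \<bullet> v = 0"
    using projection_exists[OF sub] by metis
  define w where "w = x0 - p"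
  have w: "\<phi> w \<noteq> 0" using x0 p(1) by (simp add: w_def diff)
  have w0: "w \<noteq> 0" using w by (auto simp: zero)
  show ?thesis
  proof (rule that[of "(\<phi> w / (norm w)\<^sup>2) *\<^sub>R w"])
    fix x
    have "w \<bullet> (x - (\<phi> x / \<phi> w) *\<^sub>R w) = 0"
      using p(2)[of "x - (\<phi> x / \<phi> w) *\<^sub>R w"] w by (simp add: w_def[symmetric] diff scaleR)
    hence "x \<bullet> w = (\<phi> x / \<phi> w) * (norm w)\<^sup>2"
      by (simp add: inner_diff_right inner_commute power2_norm_eq_inner)
    thus "\<phi> x = x \<bullet> ((\<phi> w / (norm w)\<^sup>2) *\<^sub>R w)" using w w0 by simp
  qed
qed

text \<open>Zorn: a maximal orthonormal set has dense span, since otherwise the normalised residual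
  of a projection onto the closed span could be added. This is what gives the choice in
  \<open>the_onb\<close> its meaning.\<close>

lemma orthonormal_basis_exists: "\<exists>B :: 'a::{real_inner, complete_space} set. orthonormal_basis B"
proof -
  define \<A> where "\<A> = {B :: 'a set. (\<forall>e\<in>B. norm e = 1) \<and> (\<forall>e\<in>B. \<forall>f\<in>B. e \<noteq> f \<longrightarrow> e \<bullet> f = 0)}"
  have "\<Union>C \<in> \<A>" if C: "subset.chain \<A> C" for C
  proof -
    have "e \<bullet> f = 0" if ef: "e \<in> \<Union>C" "f \<in> \<Union>C" "e \<noteq> f" for e f
    proof -
      from ef obtain X Y where XY: "X \<in> C" "Y \<in> C" "e \<in> X" "f \<in> Y" by (auto elim!: UnionE)
      hence "X \<subseteq> Y \<or> Y \<subseteq> X" "X \<in> \<A>" "Y \<in> \<A>" using C unfolding subset.chain_def by blast+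
      thus ?thesis using XY ef unfolding \<A>_def by blast
    qed
    moreover have "norm e = 1" if "e \<in> \<Union>C" for e
      using that C unfolding subset.chain_def \<A>_def by blast
    ultimately show ?thesis unfolding \<A>_def by blast
  qed
  then obtain B where B: "B \<in> \<A>" "\<And>X. X \<in> \<A> \<Longrightarrow> B \<subseteq> X \<Longrightarrow> X = B"
    using subset_Zorn'[of \<A>] by blast
  have "closure (span B) = UNIV"
  proof (rule ccontr)
    assume "closure (span B) \<noteq> UNIV"
    then obtain x where x: "x \<notin> closure (span B)" by blast
    have "subspace (closure (span B))"
      unfolding subspace_def
    proof (intro conjI ballI allI)
      show "0 \<in> closure (span B)" using closure_subset span_zero by blast
    next
      fix x y assume "x \<in> closure (span B)" "y \<in> closure (span B)"
      then obtain u v where "\<And>n. u n \<in> span B" "u \<longlonglongrightarrow> x" "\<And>n. v n \<in> span B" "v \<longlonglongrightarrow> y"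
        unfolding closure_sequential by blast
      thus "x + y \<in> closure (span B)"
        unfolding closure_sequential by (intro exI[of _ "\<lambda>n. u n + v n"] conjI allI span_add tendsto_add)
    next
      fix c x assume "x \<in> closure (span B)"
      then obtain u where "\<And>n. u n \<in> span B" "u \<longlonglongrightarrow> x" unfolding closure_sequential by blast
      thus "c *\<^sub>R x \<in> closure (span B)"
        unfolding closure_sequential by (intro exI[of _ "\<lambda>n. c *\<^sub>R u n"] conjI allI span_scale tendsto_intros)
    qed
    then obtain p where p: "p \<in> closure (span B)" "\<And>v. v \<in> closure (span B) \<Longrightarrow> (x - p) \<bullet> v = 0"
      using projection_exists[of "closure (span B)" x] by auto
    define e where "e = (1 / norm (x - p)) *\<^sub>R (x - p)"
    have ne: "x - p \<noteq> 0" using x p(1) by auto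
    hence n1: "norm e = 1" by (simp add: e_def)
    have orth: "e \<bullet> f = 0" if "f \<in> B" for f
    proof -
      have "f \<in> closure (span B)" using that closure_subset span_base by blast
      thus ?thesis using p(2)[of f] by (simp add: e_def)
    qed
    have "insert e B \<in> \<A>" using B(1) n1 orth unfolding \<A>_def by (auto simp: inner_commute)
    hence "e \<in> B" using B(2) by blast
    hence "e \<bullet> e = 0" using orth by blast
    thus False using n1 by (simp add: norm_eq_1)
  qed
  moreover from B(1) have "(\<forall>e\<in>B. norm e = 1) \<and> (\<forall>e\<in>B. \<forall>f\<in>B. e \<noteq> f \<longrightarrow> e \<bullet> f = 0)"
    unfolding \<A>_def by (rule CollectD)
  ultimately have "orthonormal_basis B" unfolding orthonormal_basis_def by (intro conjI; elim conjE) assumption+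
  thus ?thesis by (rule exI)
qed

lemma the_onb: "orthonormal_basis (the_onb :: 'a::{real_inner, complete_space} set)"
  unfolding the_onb_def by (rule someI_ex) (rule orthonormal_basis_exists)

lemma onb_norm [simp]: "e \<in> the_onb \<Longrightarrow> norm (e :: 'a::{real_inner, complete_space}) = 1"
  using the_onb unfolding orthonormal_basis_def by blast

lemma onb_inner:
  "e \<in> the_onb \<Longrightarrow> f \<in> the_onb \<Longrightarrow> (e :: 'a::{real_inner, complete_space}) \<bullet> f = (if e = f then 1 else 0)"
  using the_onb onb_norm[of e] unfolding orthonormal_basis_def by (auto simp: norm_eq_1)

section \<open>Orthogonal expansions: Bessel, Fourier series, Parseval\<close>

lemma inner_sum_onb:
  fixes e :: "'a::{real_inner, complete_space}"
  assumes "finite E" "E \<subseteq> the_onb" "e \<in> E"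
  shows "(\<Sum>f\<in>E. c f *\<^sub>R f) \<bullet> e = c e"
proof -
  have "(\<Sum>f\<in>E. c f *\<^sub>R f) \<bullet> e = (\<Sum>f\<in>E. c f * (if f = e then 1 else 0))"
    unfolding inner_sum_left using assms by (intro sum.cong) (auto simp: onb_inner subset_iff)
  thus ?thesis using assms by (simp add: if_distrib sum.delta cong: if_cong)
qed

lemma norm_sum_onb:
  fixes E :: "'a::{real_inner, complete_space} set"
  assumes "finite E" "E \<subseteq> the_onb"
  shows "(norm (\<Sum>e\<in>E. c e *\<^sub>R e))\<^sup>2 = (\<Sum>e\<in>E. (c e)\<^sup>2)"
proof -
  have "(norm (\<Sum>e\<in>E. c e *\<^sub>R e))\<^sup>2 = (\<Sum>e\<in>E. c e * ((\<Sum>f\<in>E. c f *\<^sub>R f) \<bullet> e))"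
    unfolding power2_norm_eq_inner by (subst inner_sum_right) simp
  also have "\<dots> = (\<Sum>e\<in>E. (c e)\<^sup>2)"
    using assms by (intro sum.cong) (simp_all add: inner_sum_onb power2_eq_square)
  finally show ?thesis .
qed

text \<open>Pythagoras: the residual of the orthogonal projection is perpendicular to the span of
  \<open>E\<close>. With \<open>c = 0\<close> this contains Bessel's inequality, and for general
  \<open>c\<close> it says that Fourier coefficients are optimal.\<close>

lemma onb_best_approx:
  fixes x :: "'a::{real_inner, complete_space}"
  assumes "finite E" "E \<subseteq> the_onb"
  shows "(norm (x - (\<Sum>e\<in>E. c e *\<^sub>R e)))\<^sup>2 =
    (norm (x - (\<Sum>e\<in>E. (x \<bullet> e) *\<^sub>R e)))\<^sup>2 + (\<Sum>e\<in>E. (x \<bullet> e - c e)\<^sup>2)"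
proof -
  define p where "p = (\<Sum>e\<in>E. (x \<bullet> e) *\<^sub>R e)"
  have orth: "(x - p) \<bullet> (\<Sum>e\<in>E. d e *\<^sub>R e) = 0" for d
    unfolding inner_sum_right using assms
    by (intro sum.neutral) (auto simp: inner_diff_left p_def inner_sum_onb)
  have eq: "x - (\<Sum>e\<in>E. c e *\<^sub>R e) = (x - p) + (\<Sum>e\<in>E. (x \<bullet> e - c e) *\<^sub>R e)"
    by (simp add: p_def scaleR_diff_left sum_subtractf)
  have "(norm (x - (\<Sum>e\<in>E. c e *\<^sub>R e)))\<^sup>2 =
     (norm (x - p))\<^sup>2 + (norm (\<Sum>e\<in>E. (x \<bullet> e - c e) *\<^sub>R e))\<^sup>2"
    using orth[of "\<lambda>e. x \<bullet> e - c e"] unfolding eq power2_norm_eq_inner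
    by (simp only: inner_add_left inner_add_right inner_commute)
  thus ?thesis using assms by (simp add: norm_sum_onb p_def)
qed

lemma bessel_finite:
  fixes x :: "'a::{real_inner, complete_space}"
  assumes "finite E" "E \<subseteq> the_onb"
  shows "(\<Sum>e\<in>E. (x \<bullet> e)\<^sup>2) \<le> (norm x)\<^sup>2"
  using onb_best_approx[OF assms, of x "\<lambda>_. 0"] by simp

text \<open>Some finite combination of basis vectors is within \<open>\<epsilon>\<close> of
  \<open>x\<close>; the partial Fourier sum over any larger finite set is at least as close.\<close>

lemma onb_expansion:
  fixes x :: "'a::{real_inner, complete_space}"
  shows "((\<lambda>e. (x \<bullet> e) *\<^sub>R e) has_sum x) the_onb"
  unfolding has_sum_def tendsto_iff
proof (intro allI impI)
  fix \<epsilon> :: real assume "\<epsilon> > 0"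
  have "x \<in> closure (span the_onb)" using the_onb[where 'a='a] unfolding orthonormal_basis_def by simp
  then obtain y where y: "y \<in> span the_onb" "dist y x < \<epsilon>"
    using \<open>\<epsilon> > 0\<close> by (auto simp: closure_approachable)
  then obtain t r where t: "finite t" "t \<subseteq> the_onb" "y = (\<Sum>a\<in>t. r a *\<^sub>R a)"
    unfolding span_explicit by blast
  have "dist (\<Sum>e\<in>F. (x \<bullet> e) *\<^sub>R e) x < \<epsilon>" if F: "finite F" "t \<subseteq> F" "F \<subseteq> the_onb" for F
  proof -
    have yF: "y = (\<Sum>a\<in>F. (if a \<in> t then r a else 0) *\<^sub>R a)"
      unfolding t(3) using F by (intro sum.mono_neutral_cong_left) auto
    have "(norm (x - (\<Sum>e\<in>F. (x \<bullet> e) *\<^sub>R e)))\<^sup>2 \<le> (norm (x - y))\<^sup>2"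
      unfolding yF using onb_best_approx[OF F(1,3), of x "\<lambda>a. if a \<in> t then r a else 0"]
      by (simp add: sum_nonneg)
    hence "norm (x - (\<Sum>e\<in>F. (x \<bullet> e) *\<^sub>R e)) \<le> norm (x - y)"
      by (rule power2_le_imp_le) simp
    thus ?thesis using y(2) by (simp add: dist_norm norm_minus_commute)
  qed
  thus "\<forall>\<^sub>F F in finite_subsets_at_top the_onb. dist (\<Sum>e\<in>F. (x \<bullet> e) *\<^sub>R e) x < \<epsilon>"
    unfolding eventually_finite_subsets_at_top using t(1,2) by blast
qed

lemma parseval:
  fixes x y :: "'a::{real_inner, complete_space}"
  shows "((\<lambda>e. (x \<bullet> e) * (y \<bullet> e)) has_sum (x \<bullet> y)) the_onb"
  using has_sum_bounded_linear[OF bounded_linear_inner_left onb_expansion, of x y]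
  by (simp add: inner_commute)


text \<open>Distinct basis vectors are at distance \<open>sqrt 2\<close>, so the balls of radius 1/2
  around them pick distinct points of a countable dense set.\<close>

lemma countable_onb: "countable (the_onb :: 'a::{real_inner, polish_space} set)"
proof -
  obtain D :: "'a set" where D: "countable D" "\<And>X. open X \<Longrightarrow> X \<noteq> {} \<Longrightarrow> \<exists>d\<in>D. d \<in> X"
    using countable_dense_setE by blast
  have "\<exists>d\<in>D. dist e d < 1/2" for e
    using D(2)[of "ball e (1/2)"] by auto
  then obtain g where g: "\<And>e. g e \<in> D" "\<And>e :: 'a. dist e (g e) < 1/2" by metis
  have "inj_on g the_onb"
  proof (rule inj_onI, rule ccontr)
    fix e f :: 'a assume ef: "e \<in> the_onb" "f \<in> the_onb" "g e = g f" "e \<noteq> f"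
    have "dist e f < 1" using g(2)[of e] g(2)[of f] ef(3) by (metis dist_triangle_half_l dist_commute)
    hence "(norm (e - f))\<^sup>2 < 1" by (simp add: dist_norm power_less_one_iff)
    moreover have "(norm (e - f))\<^sup>2 = 2"
      using ef by (simp add: power2_norm_eq_inner inner_diff_left inner_diff_right onb_inner)
    ultimately show False by simp
  qed
  thus ?thesis using D(1) g(1) by (meson countable_image_inj_on countable_subset image_subsetI)
qed

text \<open>An exhaustion of the fixed orthonormal basis, so that sequential dominated convergence
  applies to coordinate truncations.\<close>

definition onb_upto :: "nat \<Rightarrow> 'a::{real_inner, polish_space} set" where
  "onb_upto n = {e \<in> the_onb. to_nat_on the_onb e < n}"

lemma finite_onb_upto: "finite (onb_upto n)"
  and onb_upto_subset: "onb_upto n \<subseteq> the_onb"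
proof -
  have "inj_on (to_nat_on (the_onb :: 'a set)) (onb_upto n)"
    by (rule inj_on_subset[OF inj_on_to_nat_on[OF countable_onb]]) (auto simp: onb_upto_def)
  moreover have "to_nat_on (the_onb :: 'a set) ` onb_upto n \<subseteq> {..<n}" by (auto simp: onb_upto_def)
  ultimately show "finite (onb_upto n :: 'a set)" by (meson finite_imageD finite_lessThan finite_subset)
qed (auto simp: onb_upto_def)

text \<open>The sets \<open>onb_upto n\<close> eventually contain every finite part of the basis, so
  they run through the net that defines \<open>has_sum\<close>.\<close>

lemma onb_upto_LIMSEQ:
  assumes "(f has_sum l) the_onb"
  shows "(\<lambda>n. sum f (onb_upto n)) \<longlonglongrightarrow> l"
proof -
  have "filterlim (onb_upto :: nat \<Rightarrow> 'a set) (finite_subsets_at_top the_onb) sequentially"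
  proof (rule filterlim_finite_subsets_at_top[THEN iffD2], intro allI impI)
    fix X :: "'a set" assume X: "finite X \<and> X \<subseteq> the_onb"
    obtain N where N: "\<And>e. e \<in> X \<Longrightarrow> to_nat_on (the_onb :: 'a set) e < N"
      using X finite_nat_set_iff_bounded[of "to_nat_on (the_onb :: 'a set) ` X"] by auto
    have "finite (onb_upto n) \<and> X \<subseteq> onb_upto n \<and> onb_upto n \<subseteq> the_onb" if "n \<ge> N" for n
      using N X that finite_onb_upto[of n] by (force simp: onb_upto_def)
    thus "\<forall>\<^sub>F n in sequentially. finite (onb_upto n) \<and> X \<subseteq> onb_upto n \<and> onb_upto n \<subseteq> the_onb"
      by (auto simp: eventually_sequentially)
  qed
  thus ?thesis using assms unfolding has_sum_def by (rule filterlim_compose[rotated])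
qed

section \<open>Adjoints of bounded operators and uniform boundedness\<close>

definition hadjoint :: "('a::{real_inner, complete_space} \<Rightarrow> 'a) \<Rightarrow> 'a \<Rightarrow> 'a" where
  "hadjoint T y = (THE z. \<forall>x. T x \<bullet> y = x \<bullet> z)"

lemma hadjoint:
  fixes T :: "'a::{real_inner, complete_space} \<Rightarrow> 'a"
  assumes "bounded_linear T"
  shows "T x \<bullet> y = x \<bullet> hadjoint T y"
proof -
  have "bounded_linear (\<lambda>x. T x \<bullet> y)"
    using assms bounded_linear_compose[OF bounded_linear_inner_left] by blast
  then obtain z where "\<And>x. T x \<bullet> y = x \<bullet> z" using riesz_representation by blast
  hence "\<exists>!z. \<forall>x. T x \<bullet> y = x \<bullet> z" by (metis inner_commute vector_eq_ldot)
  from theI'[OF this] show ?thesis unfolding hadjoint_def by blast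
qed

lemma norm_le_of_inner:
  fixes z :: "'a::real_inner"
  assumes "\<And>x. x \<bullet> z \<le> C * norm x" "0 \<le> C"
  shows "norm z \<le> C"
proof (cases "z = 0")
  case False
  have "norm z * norm z \<le> C * norm z"
    using assms(1)[of z] by (metis power2_eq_square power2_norm_eq_inner)
  thus ?thesis using False by simp
qed (use assms in simp)

text \<open>Baire: the sets on which all \<open>T n\<close> are bounded by \<open>k\<close> are
  closed and cover the space, so one of them contains a ball; differences of points of this ball
  bound the operators near 0.\<close>

lemma uniform_boundedness_sequence:
  fixes T :: "nat \<Rightarrow> 'a::{real_normed_vector, complete_space} \<Rightarrow> 'b::real_normed_vector"
  assumes lin: "\<And>n. bounded_linear (T n)" and bdd: "\<And>x. \<exists>C. \<forall>n. norm (T n x) \<le> C"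
  obtains M where "\<And>n x. norm (T n x) \<le> M * norm x"
proof -
  define G where "G k = {x. \<forall>n. norm (T n x) \<le> real k}" for k
  have cl: "closed (G k)" for k
    unfolding G_def using lin
    by (intro closed_Collect_all closed_Collect_le continuous_intros linear_continuous_on)
  have un: "(\<Union>k. G k) = UNIV"
  proof -
    have "\<exists>k. x \<in> G k" for x
    proof -
      obtain C where C: "\<And>n. norm (T n x) \<le> C" using bdd by blast
      obtain k :: nat where "C \<le> real k" using real_arch_simple by blast
      thus ?thesis using C order_trans unfolding G_def by blast
    qed
    thus ?thesis by blast
  qed
  have "\<exists>k. interior (G k) \<noteq> {}"
  proof (rule ccontr)
    assume none: "\<not> ?thesis"
    have "Met_TC.mcomplete TYPE('a)"
      by (simp add: mcomplete_iff_complete complete_UNIV)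
    hence "Met_TC.mtopology interior_of \<Union>(range G) = {}"
      by (rule Met_TC.metric_Baire_category_alt) (use none cl in auto)
    thus False using un by simp
  qed
  then obtain k z where "z \<in> interior (G k)" by blast
  then obtain r where r: "r > 0" "ball z r \<subseteq> G k" by (meson mem_interior)
  have "norm (T n x) \<le> (4 * real k / r) * norm x" for n x
  proof (cases "x = 0")
    case False
    interpret bounded_linear "T n" by (rule lin)
    define u where "u = (r / (2 * norm x)) *\<^sub>R x"
    have "norm u = r / 2" using False r by (simp add: u_def)
    hence "z + u \<in> ball z r" "z \<in> ball z r" using r by (auto simp: dist_norm)
    hence "norm (T n (z + u)) \<le> k" "norm (T n z) \<le> k" using r(2) unfolding G_def by blast+
    moreover have "T n u = T n (z + u) - T n z" by (simp add: add)
    ultimately have "norm (T n u) \<le> 2 * k" using norm_triangle_ineq4[of "T n (z + u)" "T n z"] by simp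
    moreover have "norm (T n u) = r / (2 * norm x) * norm (T n x)" using r by (simp add: u_def scaleR)
    ultimately show ?thesis using False r by (simp add: field_simps)
  qed (use linear_0[OF bounded_linear.linear[OF lin]] in simp)
  thus ?thesis using that by blast
qed

section \<open>Finite signed measures\<close>

text \<open>A monotone class principle for bounded Borel functions. The uniform bounds are carried
  along because they are what makes integrals against a signed measure additive and compatible with
  pointwise limits.\<close>

lemma bounded_borel_induct [consumes 2, case_names indicator scale add lim]:
  fixes f :: "'a::topological_space \<Rightarrow> real"
  assumes f: "f \<in> bm" "\<And>x. \<bar>f x\<bar> \<le> C"
    and ind: "\<And>B. B \<in> sets borel \<Longrightarrow> P (indicator B)"
    and scale: "\<And>u c D. u \<in> bm \<Longrightarrow> (\<And>x. \<bar>u x\<bar> \<le> D) \<Longrightarrow> P u \<Longrightarrow> P (\<lambda>x. c * u x)"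
    and add: "\<And>u v D. u \<in> bm \<Longrightarrow> v \<in> bm \<Longrightarrow>
        (\<And>x. \<bar>u x\<bar> \<le> D) \<Longrightarrow> (\<And>x. \<bar>v x\<bar> \<le> D) \<Longrightarrow> P u \<Longrightarrow> P v \<Longrightarrow> P (\<lambda>x. u x + v x)"
    and lim: "\<And>U u D. (\<And>n::nat. U n \<in> bm) \<Longrightarrow> (\<And>n x. \<bar>U n x\<bar> \<le> D) \<Longrightarrow>
        (\<And>x. (\<lambda>n. U n x) \<longlonglongrightarrow> u x) \<Longrightarrow> (\<And>n. P (U n)) \<Longrightarrow> P u"
  shows "P f"
proof -
  have nonneg: "(\<exists>D. \<forall>x. \<bar>g x\<bar> \<le> D) \<longrightarrow> P g" if "g \<in> bm" "\<And>x. 0 \<le> g x" for g :: "'a \<Rightarrow> real"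
    using that
  proof (induct rule: borel_measurable_induct_real)
    case (set A) thus ?case using ind by blast
  next
    case (mult u c)
    show ?case
    proof (intro impI, elim exE)
      fix D assume D: "\<forall>x. \<bar>c * u x\<bar> \<le> D"
      show "P (\<lambda>x. c * u x)"
      proof (cases "c = 0")
        case True
        hence "(\<lambda>x. c * u x) = (indicator {} :: 'a \<Rightarrow> real)" by (auto simp: indicator_def)
        thus ?thesis using ind[of "{}"] by simp
      next
        case False
        hence bd: "\<bar>u x\<bar> \<le> D / \<bar>c\<bar>" for x using D by (simp add: field_simps abs_mult)
        thus ?thesis using mult scale by blast
      qed
    qed
  next
    case (add u v)
    show ?case
    proof (intro impI, elim exE)
      fix D assume D: "\<forall>x. \<bar>v x + u x\<bar> \<le> D"
      have "\<bar>u x\<bar> \<le> D" "\<bar>v x\<bar> \<le> D" for x using D[rule_format, of x] add(2)[of x] add(5)[of x] by linarith+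
      thus "P (\<lambda>x. v x + u x)" using add assms(5)[of v u D] by blast
    qed
  next
    case (seq U)
    show ?case
    proof (intro impI, elim exE)
      fix D assume D: "\<forall>x. \<bar>g x\<bar> \<le> D"
      have tend: "(\<lambda>i. U i x) \<longlonglongrightarrow> g x" for x using seq(5) by simp
      have le: "U i x \<le> g x" for i x
        by (rule incseq_le[OF _ tend]) (use seq(4) in \<open>auto simp: incseq_def le_fun_def\<close>)
      hence bd: "\<bar>U i x\<bar> \<le> D" for i x using D[rule_format, of x] le[of i x] seq(2)[of i x] by linarith
      hence PU: "P (U i)" for i using seq(3) by blast
      show "P g" by (rule lim[of U D g, OF seq(1) bd tend PU])
    qed
  qed
  have C0: "0 \<le> C" using f(2) by (meson abs_ge_zero order_trans)
  \<comment> \<open>Adding the constant \<open>C\<close> makes \<open>f\<close> nonnegative; it is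
    taken off again as a multiple of the indicator of the whole space.\<close>
  have "P (\<lambda>x. f x + C)"
  proof (rule nonneg[rule_format])
    show "(\<lambda>x. f x + C) \<in> bm" using f(1) by simp
    show "0 \<le> f x + C" for x using f(2)[of x] by linarith
    have "\<bar>f x + C\<bar> \<le> 2 * C" for x using f(2)[of x] by linarith
    thus "\<exists>D. \<forall>x. \<bar>f x + C\<bar> \<le> D" by blast
  qed
  moreover have "P (\<lambda>x. (- C) * indicator UNIV x)"
  proof (rule scale)
    show "P (indicator UNIV)" by (rule ind) simp
    show "\<bar>indicator UNIV x\<bar> \<le> (1 :: real)" for x :: 'a by simp
  qed simp
  ultimately have "P (\<lambda>x. (f x + C) + (- C) * indicator UNIV x)"
  proof (rule add[rotated 4, of _ _ ])
    show "\<bar>f x + C\<bar> \<le> 2 * C" "\<bar>(- C) * indicator UNIV x\<bar> \<le> 2 * C" for x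
      using f(2)[of x] C0 by auto
  qed (use f in auto)
  thus ?thesis by simp
qed

section \<open>Boundedness and the Jordan decomposition\<close>

lemma signed_measures_borel: "\<gamma> \<in> signed_measures \<Longrightarrow> B \<notin> sets borel \<Longrightarrow> \<gamma> B = 0"
  and signed_measures_empty: "\<gamma> \<in> signed_measures \<Longrightarrow> \<gamma> {} = 0"
  and signed_measures_sums: "\<gamma> \<in> signed_measures \<Longrightarrow> range F \<subseteq> sets borel \<Longrightarrow> disjoint_family F \<Longrightarrow>
        (\<lambda>n. \<gamma> (F n)) sums \<gamma> (\<Union>n::nat. F n)"
  by (auto simp: signed_measures_def)

lemma signed_measures_Un:
  assumes g: "\<gamma> \<in> signed_measures" and AB: "A \<in> sets borel" "B \<in> sets borel" "A \<inter> B = {}"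
  shows "\<gamma> (A \<union> B) = \<gamma> A + \<gamma> B"
proof -
  have "(\<lambda>n. \<gamma> (binaryset A B n)) sums \<gamma> (\<Union>n. binaryset A B n)"
    using AB by (intro signed_measures_sums[OF g])
      (auto simp: range_binaryset_eq disjoint_family_on_def binaryset_def)
  moreover have "(\<lambda>n. \<gamma> (binaryset A B n)) sums (\<gamma> A + \<gamma> B)"
    by (rule binaryset_sums) (rule signed_measures_empty[OF g])
  ultimately show ?thesis by (simp add: UN_binaryset_eq sums_unique2)
qed

lemma signed_measures_split:
  assumes "\<gamma> \<in> signed_measures" "A \<in> sets borel" "B \<in> sets borel"
  shows "\<gamma> A = \<gamma> (A \<inter> B) + \<gamma> (A - B)"
  using signed_measures_Un[OF assms(1), of "A \<inter> B" "A - B"] assms(2,3) by (simp add: Int_Diff_Un Int_Diff_disjoint)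

lemma signed_measures_uminus: "\<gamma> \<in> signed_measures \<Longrightarrow> (\<lambda>B. - \<gamma> B) \<in> signed_measures"
  unfolding signed_measures_def mem_Collect_eq
  by (elim conjE, intro conjI allI impI) (simp_all add: sums_minus)

lemma signed_measures_diff:
  assumes "\<gamma> \<in> signed_measures" "\<gamma>' \<in> signed_measures"
  shows "(\<lambda>B. \<gamma> B - \<gamma>' B) \<in> signed_measures"
  unfolding signed_measures_def mem_Collect_eq
  using assms signed_measures_borel[OF assms(1)] signed_measures_borel[OF assms(2)]
  by (intro conjI allI impI)
    (simp_all add: signed_measures_empty, elim conjE, intro sums_diff signed_measures_sums)

lemma signed_measures_ext:
  assumes "\<gamma> \<in> signed_measures" "\<gamma>' \<in> signed_measures" "\<And>B. B \<in> sets borel \<Longrightarrow> \<gamma> B = \<gamma>' B"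
  shows "\<gamma> = \<gamma>'"
proof
  fix B show "\<gamma> B = \<gamma>' B"
    using assms(3)[of B] signed_measures_borel[OF assms(1), of B] signed_measures_borel[OF assms(2), of B]
    by (cases "B \<in> sets borel") simp_all
qed

text \<open>If \<open>\<gamma>\<close> is unbounded on the subsets of some set, a piece with
  \<open>\<bar>\<gamma>\<bar> \<ge> 1\<close> can be cut off such that the rest is still unbounded.
  Iteration gives disjoint pieces, and countable additivity would force their values to tend to
  0.\<close>

lemma signed_measures_bounded:
  assumes g: "\<gamma> \<in> signed_measures"
  shows "\<exists>K. \<forall>B\<in>sets borel. \<bar>\<gamma> B\<bar> \<le> K"
proof -
  define unb where "unb B \<longleftrightarrow> B \<in> sets borel \<and> (\<forall>K. \<exists>C\<in>sets borel. C \<subseteq> B \<and> \<bar>\<gamma> C\<bar> > K)" for B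
  have step: "\<exists>A\<in>sets borel. A \<subseteq> B \<and> \<bar>\<gamma> A\<bar> \<ge> 1 \<and> unb (B - A)" if B: "unb B" for B
  proof -
    have Bb: "B \<in> sets borel" using B unfolding unb_def by blast
    \<comment> \<open>The margin \<open>\<bar>\<gamma> B\<bar> + 1\<close> makes the values on both
      \<open>C\<close> and \<open>B - C\<close> at least 1 in absolute value, so either one may be
      cut off, depending on where \<open>\<gamma>\<close> stays unbounded.\<close>
    obtain C where C: "C \<in> sets borel" "C \<subseteq> B" "\<bar>\<gamma> C\<bar> > \<bar>\<gamma> B\<bar> + 1" using B unfolding unb_def by blast
    have BC: "B - C \<in> sets borel" "B \<inter> C = C" "B - (B - C) = C" using Bb C by auto
    have "\<gamma> B = \<gamma> C + \<gamma> (B - C)" using signed_measures_split[OF g Bb C(1)] BC(2) by simp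
    hence big: "\<bar>\<gamma> C\<bar> \<ge> 1" "\<bar>\<gamma> (B - C)\<bar> \<ge> 1" using C(3) by auto
    have "unb C \<or> unb (B - C)"
    proof (rule ccontr)
      assume "\<not> ?thesis"
      then obtain K1 K2 where K: "\<And>E. E \<in> sets borel \<Longrightarrow> E \<subseteq> C \<Longrightarrow> \<bar>\<gamma> E\<bar> \<le> K1"
        "\<And>E. E \<in> sets borel \<Longrightarrow> E \<subseteq> B - C \<Longrightarrow> \<bar>\<gamma> E\<bar> \<le> K2"
        using C(1) BC(1) unfolding unb_def by (meson linorder_not_less)
      obtain E where E: "E \<in> sets borel" "E \<subseteq> B" "\<bar>\<gamma> E\<bar> > K1 + K2" using B unfolding unb_def by blast
      have "E \<inter> C \<in> sets borel" "E - C \<in> sets borel" using E(1) C(1) by auto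
      hence "\<bar>\<gamma> (E \<inter> C)\<bar> \<le> K1" "\<bar>\<gamma> (E - C)\<bar> \<le> K2" using E(2) by (auto intro!: K)
      thus False using E(3) signed_measures_split[OF g E(1) C(1)] by linarith
    qed
    thus ?thesis
    proof
      assume "unb C"
      thus ?thesis using big(2) BC by (intro bexI[of _ "B - C"]) auto
    next
      assume "unb (B - C)"
      thus ?thesis using big(1) C by (intro bexI[of _ C]) auto
    qed
  qed
  have "\<not> unb UNIV"
  proof
    assume U: "unb UNIV"
    obtain nxt where nxt: "\<And>B. unb B \<Longrightarrow> nxt B \<in> sets borel \<and> nxt B \<subseteq> B \<and> \<bar>\<gamma> (nxt B)\<bar> \<ge> 1 \<and> unb (B - nxt B)"
      using step by metis
    define Bs where "Bs n = ((\<lambda>B. B - nxt B) ^^ n) UNIV" for n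
    have Bs_Suc: "Bs (Suc n) = Bs n - nxt (Bs n)" for n by (simp add: Bs_def)
    have unbBs: "unb (Bs n)" for n
      by (induction n) (use U nxt in \<open>auto simp: Bs_Suc\<close>, simp add: Bs_def)
    have anti: "decseq Bs" by (rule decseq_SucI) (auto simp: Bs_Suc)
    have dis1: "nxt (Bs m) \<inter> nxt (Bs n) = {}" if "m < n" for m n
    proof -
      have "nxt (Bs n) \<subseteq> Bs (Suc m)"
        using nxt[OF unbBs[of n]] decseqD[OF anti, of "Suc m" n] that by auto
      thus ?thesis by (auto simp: Bs_Suc)
    qed
    have "disjoint_family (\<lambda>n. nxt (Bs n))"
      unfolding disjoint_family_on_def using dis1 by (metis Int_commute linorder_neqE_nat)
    moreover have "range (\<lambda>n. nxt (Bs n)) \<subseteq> sets borel" using nxt unbBs by blast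
    ultimately have "summable (\<lambda>n. \<gamma> (nxt (Bs n)))"
      using signed_measures_sums[OF g] by (meson sums_summable)
    hence "(\<lambda>n. \<bar>\<gamma> (nxt (Bs n))\<bar>) \<longlonglongrightarrow> 0" using summable_LIMSEQ_zero tendsto_rabs_zero by blast
    hence "\<forall>\<^sub>F n in sequentially. \<bar>\<gamma> (nxt (Bs n))\<bar> < 1" by (rule order_tendstoD) simp
    then obtain n where "\<bar>\<gamma> (nxt (Bs n))\<bar> < 1" by (auto simp: eventually_sequentially)
    thus False using nxt[OF unbBs[of n]] by linarith
  qed
  thus ?thesis unfolding unb_def by (simp add: not_less)
qed

text \<open>The supremum behind \<open>pos_part\<close>, taken in the reals: boundedness of
  \<open>\<gamma>\<close> makes it finite, so sums and limits can be treated before passing to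
  \<open>ennreal\<close>.\<close>

definition upper_var :: "('a::topological_space set \<Rightarrow> real) \<Rightarrow> 'a set \<Rightarrow> real" where
  "upper_var \<gamma> B = (SUP C\<in>{C \<in> sets borel. C \<subseteq> B}. \<gamma> C)"

context
  fixes \<gamma> :: "'a::topological_space set \<Rightarrow> real"
  assumes g: "\<gamma> \<in> signed_measures"
begin

lemma upper_var_bdd: "bdd_above (\<gamma> ` {C \<in> sets borel. C \<subseteq> B})"
proof -
  obtain K where "\<forall>B\<in>sets borel. \<bar>\<gamma> B\<bar> \<le> K" using signed_measures_bounded[OF g] by blast
  thus ?thesis by (intro bdd_aboveI2[of _ _ K]) (auto simp: abs_le_iff)
qed

lemma upper_var_upper: "C \<in> sets borel \<Longrightarrow> C \<subseteq> B \<Longrightarrow> \<gamma> C \<le> upper_var \<gamma> B"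
  unfolding upper_var_def by (rule cSUP_upper[OF _ upper_var_bdd]) simp

lemma upper_var_least: "(\<And>C. C \<in> sets borel \<Longrightarrow> C \<subseteq> B \<Longrightarrow> \<gamma> C \<le> u) \<Longrightarrow> upper_var \<gamma> B \<le> u"
  unfolding upper_var_def by (rule cSUP_least) auto

lemma upper_var_nonneg: "0 \<le> upper_var \<gamma> B"
  using upper_var_upper[of "{}" B] signed_measures_empty[OF g] by simp

lemma upper_var_mono: "A \<subseteq> B \<Longrightarrow> upper_var \<gamma> A \<le> upper_var \<gamma> B"
  by (rule upper_var_least) (auto intro: upper_var_upper)

lemma upper_var_superadd:
  assumes "A \<inter> B = {}"
  shows "upper_var \<gamma> A + upper_var \<gamma> B \<le> upper_var \<gamma> (A \<union> B)"
proof -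
  have "upper_var \<gamma> A \<le> upper_var \<gamma> (A \<union> B) - upper_var \<gamma> B"
  proof (rule upper_var_least)
    fix C assume C: "C \<in> sets borel" "C \<subseteq> A"
    have "upper_var \<gamma> B \<le> upper_var \<gamma> (A \<union> B) - \<gamma> C"
    proof (rule upper_var_least)
      fix E assume E: "E \<in> sets borel" "E \<subseteq> B"
      have "\<gamma> (C \<union> E) = \<gamma> C + \<gamma> E" using C E assms by (intro signed_measures_Un[OF g]) auto
      moreover have "\<gamma> (C \<union> E) \<le> upper_var \<gamma> (A \<union> B)" using C E by (intro upper_var_upper) auto
      ultimately show "\<gamma> E \<le> upper_var \<gamma> (A \<union> B) - \<gamma> C" by simp
    qed
    thus "\<gamma> C \<le> upper_var \<gamma> (A \<union> B) - upper_var \<gamma> B" by simp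
  qed
  thus ?thesis by simp
qed

text \<open>Superadditivity on disjoint sets bounds the partial sums from above; splitting a
  competitor \<open>C\<close> along the \<open>F n\<close> gives the reverse inequality.\<close>

lemma upper_var_sums:
  assumes F: "range F \<subseteq> sets borel" "disjoint_family F"
  shows "(\<lambda>n::nat. upper_var \<gamma> (F n)) sums upper_var \<gamma> (\<Union>n. F n)"
proof -
  have part: "(\<Sum>i<n. upper_var \<gamma> (F i)) \<le> upper_var \<gamma> (\<Union>i<n. F i)" for n
  proof (induction n)
    case 0 thus ?case by (simp add: upper_var_nonneg)
  next
    case (Suc n)
    have "F i \<inter> F n = {}" if "i < n" for i
      using disjoint_family_onD[OF F(2), of i n] that by simp
    hence "(\<Union>i<n. F i) \<inter> F n = {}" by blast
    from upper_var_superadd[OF this]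
    have "upper_var \<gamma> (\<Union>i<n. F i) + upper_var \<gamma> (F n) \<le> upper_var \<gamma> (\<Union>i<Suc n. F i)"
      by (simp add: lessThan_Suc Un_commute)
    with Suc show ?case by simp
  qed
  have part2: "(\<Sum>i<n. upper_var \<gamma> (F i)) \<le> upper_var \<gamma> (\<Union>i. F i)" for n
    by (rule order_trans[OF part upper_var_mono]) blast
  have sm: "summable (\<lambda>n. upper_var \<gamma> (F n))"
    using part2 by (intro summableI_nonneg_bounded) (auto simp: upper_var_nonneg)
  have "upper_var \<gamma> (\<Union>i. F i) \<le> (\<Sum>n. upper_var \<gamma> (F n))"
  proof (rule upper_var_least)
    fix C assume C: "C \<in> sets borel" "C \<subseteq> (\<Union>i. F i)"
    have "(\<lambda>n. \<gamma> (C \<inter> F n)) sums \<gamma> (\<Union>n. C \<inter> F n)"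
    proof (rule signed_measures_sums[OF g])
      show "range (\<lambda>n. C \<inter> F n) \<subseteq> sets borel" using C F by auto
      show "disjoint_family (\<lambda>n. C \<inter> F n)" by (rule disjoint_family_subset[OF F(2)]) blast
    qed
    moreover have "(\<Union>n. C \<inter> F n) = C" using C by blast
    ultimately have "(\<lambda>n. \<gamma> (C \<inter> F n)) sums \<gamma> C" by simp
    thus "\<gamma> C \<le> (\<Sum>n. upper_var \<gamma> (F n))"
      using C F(1) by (intro sums_le[OF _ _ summable_sums[OF sm]]) (auto intro!: upper_var_upper)
  qed
  moreover have "(\<Sum>n. upper_var \<gamma> (F n)) \<le> upper_var \<gamma> (\<Union>i. F i)"
    by (rule suminf_le_const[OF sm part2])
  ultimately have "(\<Sum>n. upper_var \<gamma> (F n)) = upper_var \<gamma> (\<Union>i. F i)" by (rule antisym[rotated])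
  thus ?thesis using summable_sums[OF sm] by simp
qed

lemma sets_pos_part [simp]: "sets (pos_part \<gamma>) = sets borel"
  unfolding pos_part_def using sets.sets_measure_of_eq[of borel] by (simp add: space_borel[symmetric] del: space_borel)

lemma space_pos_part [simp]: "space (pos_part \<gamma>) = UNIV"
  by (simp add: pos_part_def space_measure_of_conv)

lemma emeasure_pos_part: "B \<in> sets borel \<Longrightarrow> emeasure (pos_part \<gamma>) B = ennreal (upper_var \<gamma> B)"
proof -
  assume B: "B \<in> sets borel"
  have eq: "(SUP C\<in>{C \<in> sets borel. C \<subseteq> B}. ennreal (\<gamma> C)) = ennreal (upper_var \<gamma> B)" for B
  proof (rule antisym)
    show "(SUP C\<in>{C \<in> sets borel. C \<subseteq> B}. ennreal (\<gamma> C)) \<le> ennreal (upper_var \<gamma> B)"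
      by (rule SUP_least) (auto intro!: ennreal_leI upper_var_upper)
    show "ennreal (upper_var \<gamma> B) \<le> (SUP C\<in>{C \<in> sets borel. C \<subseteq> B}. ennreal (\<gamma> C))"
    proof (rule ennreal_le_epsilon)
      fix e :: real assume e: "e > 0"
      have "\<exists>C\<in>{C \<in> sets borel. C \<subseteq> B}. upper_var \<gamma> B - e < \<gamma> C"
        unfolding upper_var_def using e upper_var_bdd
        by (subst less_cSUP_iff[symmetric]) auto
      then obtain C where C: "C \<in> sets borel" "C \<subseteq> B" "upper_var \<gamma> B \<le> \<gamma> C + e" by force
      have "ennreal (upper_var \<gamma> B) \<le> ennreal (\<gamma> C + e)" by (rule ennreal_leI[OF C(3)])
      \<comment> \<open>Holds for negative \<open>\<gamma> C\<close> too: then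
        \<open>\<gamma> C + e\<close> is at most \<open>e\<close>, and \<open>ennreal\<close> sends
        \<open>\<gamma> C\<close> to 0.\<close>
      also have "\<dots> \<le> ennreal (\<gamma> C) + ennreal e"
        using e by (cases "0 \<le> \<gamma> C") (auto simp: ennreal_plus[symmetric] ennreal_neg intro!: ennreal_leI simp del: ennreal_plus)
      also have "\<dots> \<le> (SUP C\<in>{C \<in> sets borel. C \<subseteq> B}. ennreal (\<gamma> C)) + ennreal e"
        using C by (intro add_right_mono SUP_upper) auto
      finally show "ennreal (upper_var \<gamma> B) \<le> (SUP C\<in>{C \<in> sets borel. C \<subseteq> B}. ennreal (\<gamma> C)) + ennreal e" .
    qed
  qed
  have pp: "pos_part \<gamma> = measure_of UNIV (sets borel) (\<lambda>B. ennreal (upper_var \<gamma> B))"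
    unfolding pos_part_def eq ..
  show ?thesis unfolding pp
  proof (rule emeasure_measure_of_sigma[OF _ _ _ B])
    show "sigma_algebra UNIV (sets borel :: 'a set set)"
      using sets.sigma_algebra_axioms[of "borel :: 'a measure"] by simp
    have "upper_var \<gamma> {} \<le> 0" by (rule upper_var_least) (simp add: signed_measures_empty[OF g])
    thus "positive (sets borel) (\<lambda>B. ennreal (upper_var \<gamma> B))" by (simp add: positive_def ennreal_neg)
    show "countably_additive (sets borel) (\<lambda>B. ennreal (upper_var \<gamma> B))"
      unfolding countably_additive_def
    proof (intro allI impI)
      fix F :: "nat \<Rightarrow> 'a set" assume F: "range F \<subseteq> sets borel" "disjoint_family F"
      show "(\<Sum>i. ennreal (upper_var \<gamma> (F i))) = ennreal (upper_var \<gamma> (\<Union>i. F i))"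
        using upper_var_sums[OF F] by (intro suminf_ennreal_eq) (auto simp: upper_var_nonneg)
    qed
  qed
qed

lemma finite_pos_part: "finite_measure (pos_part \<gamma>)"
  by (rule finite_measureI) (simp add: emeasure_pos_part)

lemma measure_pos_part: "B \<in> sets borel \<Longrightarrow> measure (pos_part \<gamma>) B = upper_var \<gamma> B"
  by (simp add: measure_def emeasure_pos_part upper_var_nonneg)

end

lemma
  assumes g: "\<gamma> \<in> signed_measures"
  shows sets_neg_part [simp]: "sets (neg_part \<gamma>) = sets borel"
    and space_neg_part [simp]: "space (neg_part \<gamma>) = UNIV"
    and finite_neg_part: "finite_measure (neg_part \<gamma>)"
    and measure_neg_part: "B \<in> sets borel \<Longrightarrow> measure (neg_part \<gamma>) B = upper_var (\<lambda>B. - \<gamma> B) B"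
  unfolding neg_part_def
  using signed_measures_uminus[OF g] by (simp_all add: finite_pos_part measure_pos_part)

text \<open>Passing from \<open>C\<close> to \<open>B - C\<close> exchanges the two suprema, because
  \<open>\<gamma> C = \<gamma> B - \<gamma> (B - C)\<close> shifts all values by the constant
  \<open>\<gamma> B\<close>.\<close>

lemma jordan_decomposition:
  assumes g: "\<gamma> \<in> signed_measures" and B: "B \<in> sets borel"
  shows "\<gamma> B = measure (pos_part \<gamma>) B - measure (neg_part \<gamma>) B"
proof -
  note g' = signed_measures_uminus[OF g]
  have "upper_var \<gamma> B \<le> \<gamma> B + upper_var (\<lambda>B. - \<gamma> B) B"
  proof (rule upper_var_least[OF g])
    fix C assume C: "C \<in> sets borel" "C \<subseteq> B"
    hence "\<gamma> B = \<gamma> C + \<gamma> (B - C)" using signed_measures_split[OF g B C(1)] by (simp add: Int_absorb1)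
    moreover have "- \<gamma> (B - C) \<le> upper_var (\<lambda>B. - \<gamma> B) B"
      using B C upper_var_upper[OF g', of "B - C" B] by auto
    ultimately show "\<gamma> C \<le> \<gamma> B + upper_var (\<lambda>B. - \<gamma> B) B" by simp
  qed
  moreover have "upper_var (\<lambda>B. - \<gamma> B) B \<le> upper_var \<gamma> B - \<gamma> B"
  proof (rule upper_var_least[OF g'])
    fix C assume C: "C \<in> sets borel" "C \<subseteq> B"
    hence "\<gamma> B = \<gamma> C + \<gamma> (B - C)" using signed_measures_split[OF g B C(1)] by (simp add: Int_absorb1)
    moreover have "\<gamma> (B - C) \<le> upper_var \<gamma> B"
      using B C upper_var_upper[OF g, of "B - C" B] by auto
    ultimately show "- \<gamma> C \<le> upper_var \<gamma> B - \<gamma> B" by simp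
  qed
  ultimately show ?thesis by (simp add: measure_pos_part[OF g B] measure_neg_part[OF g B])
qed


lemma (in finite_measure) integrable_bounded:
  fixes f :: "'a \<Rightarrow> 'b::{banach, second_countable_topology}"
  shows "f \<in> borel_measurable M \<Longrightarrow> (\<And>x. norm (f x) \<le> C) \<Longrightarrow> integrable M f"
  by (rule integrable_const_bound[of _ C]) auto

lemma
  fixes f :: "'a::topological_space \<Rightarrow> real"
  assumes g: "\<gamma> \<in> signed_measures" and f: "f \<in> bm" "\<And>x. \<bar>f x\<bar> \<le> C"
  shows integrable_pos_part: "integrable (pos_part \<gamma>) f"
    and integrable_neg_part: "integrable (neg_part \<gamma>) f"
  using finite_measure.integrable_bounded[OF finite_pos_part[OF g], of f C]
    finite_measure.integrable_bounded[OF finite_neg_part[OF g], of f C] f g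
  by (simp_all add: measurable_cong_sets[OF sets_pos_part[OF g] refl] measurable_cong_sets[OF sets_neg_part[OF g] refl])

section \<open>Integration against a signed measure\<close>

lemma signed_integral_indicator:
  assumes "\<gamma> \<in> signed_measures" "B \<in> sets borel"
  shows "signed_integral \<gamma> (indicator B) = \<gamma> B"
  using assms by (simp add: signed_integral_def jordan_decomposition)

lemma signed_integral_cmult:
  "signed_integral \<gamma> (\<lambda>x. c * f x) = c * signed_integral \<gamma> f"
  by (simp add: signed_integral_def right_diff_distrib)

lemma signed_integral_add:
  assumes g: "\<gamma> \<in> signed_measures"
    and f: "f \<in> bm" "\<And>x. \<bar>f x\<bar> \<le> C" and h: "h \<in> bm" "\<And>x. \<bar>h x\<bar> \<le> D"
  shows "signed_integral \<gamma> (\<lambda>x. f x + h x) = signed_integral \<gamma> f + signed_integral \<gamma> h"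
  unfolding signed_integral_def
  using integrable_pos_part[OF g f] integrable_neg_part[OF g f] integrable_pos_part[OF g h] integrable_neg_part[OF g h]
  by simp

lemma signed_integral_diff:
  assumes g: "\<gamma> \<in> signed_measures"
    and f: "f \<in> bm" "\<And>x. \<bar>f x\<bar> \<le> C" and h: "h \<in> bm" "\<And>x. \<bar>h x\<bar> \<le> D"
  shows "signed_integral \<gamma> (\<lambda>x. f x - h x) = signed_integral \<gamma> f - signed_integral \<gamma> h"
  unfolding signed_integral_def
  using integrable_pos_part[OF g f] integrable_neg_part[OF g f] integrable_pos_part[OF g h] integrable_neg_part[OF g h]
  by simp

lemma tv_norm_nonneg: "0 \<le> tv_norm \<gamma>"
  by (simp add: tv_norm_def)

lemma signed_integral_bound:
  assumes g: "\<gamma> \<in> signed_measures"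
    and f: "f \<in> bm" "\<And>x. \<bar>f x\<bar> \<le> C"
  shows "\<bar>signed_integral \<gamma> f\<bar> \<le> C * tv_norm \<gamma>"
proof -
  interpret P: finite_measure "pos_part \<gamma>" by (rule finite_pos_part[OF g])
  interpret N: finite_measure "neg_part \<gamma>" by (rule finite_neg_part[OF g])
  have "\<bar>integral\<^sup>L (pos_part \<gamma>) f\<bar> \<le> (LINT x|pos_part \<gamma>. C)"
    using integrable_pos_part[OF g f] f(2)
    by (intro order_trans[OF integral_abs_bound] integral_mono) auto
  moreover have "\<bar>integral\<^sup>L (neg_part \<gamma>) f\<bar> \<le> (LINT x|neg_part \<gamma>. C)"
    using integrable_neg_part[OF g f] f(2)
    by (intro order_trans[OF integral_abs_bound] integral_mono) auto
  ultimately show ?thesis using g by (simp add: signed_integral_def tv_norm_def algebra_simps)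
qed

lemma signed_integral_dominated_convergence:
  assumes g: "\<gamma> \<in> signed_measures"
    and f: "\<And>n::nat. f n \<in> bm" "\<And>n x. \<bar>f n x\<bar> \<le> C" "\<And>x. (\<lambda>n. f n x) \<longlonglongrightarrow> h x"
  shows "(\<lambda>n. signed_integral \<gamma> (f n)) \<longlonglongrightarrow> signed_integral \<gamma> h"
proof -
  interpret P: finite_measure "pos_part \<gamma>" by (rule finite_pos_part[OF g])
  interpret N: finite_measure "neg_part \<gamma>" by (rule finite_neg_part[OF g])
  have h: "h \<in> bm" using f(3) by (rule borel_measurable_LIMSEQ_real[OF _ f(1)])
  show ?thesis
    unfolding signed_integral_def
    by (intro tendsto_diff integral_dominated_convergence[where w="\<lambda>_. C"])
      (use f h g in \<open>auto simp: measurable_cong_sets[OF sets_pos_part[OF g] refl] measurable_cong_sets[OF sets_neg_part[OF g] refl]\<close>)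
qed

text \<open>The integral is characterised as the functional that is linear, continuous under bounded
  pointwise convergence and correct on indicators. This identifies integrals against differences,
  finite measures and images under the dual semigroup without determining their Jordan
  parts.\<close>

lemma signed_integral_unique:
  fixes J :: "('a::topological_space \<Rightarrow> real) \<Rightarrow> real"
  assumes g: "\<gamma> \<in> signed_measures"
    and f: "f \<in> bm" "\<And>x. \<bar>f x\<bar> \<le> C"
    and ind: "\<And>B. B \<in> sets borel \<Longrightarrow> J (indicator B) = \<gamma> B"
    and scale: "\<And>u c D. u \<in> bm \<Longrightarrow> (\<And>x. \<bar>u x\<bar> \<le> D) \<Longrightarrow> J (\<lambda>x. c * u x) = c * J u"
    and add: "\<And>u v D. u \<in> bm \<Longrightarrow> v \<in> bm \<Longrightarrow>
        (\<And>x. \<bar>u x\<bar> \<le> D) \<Longrightarrow> (\<And>x. \<bar>v x\<bar> \<le> D) \<Longrightarrow> J (\<lambda>x. u x + v x) = J u + J v"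
    and lim: "\<And>U u D. (\<And>n::nat. U n \<in> bm) \<Longrightarrow> (\<And>n x. \<bar>U n x\<bar> \<le> D) \<Longrightarrow>
        (\<And>x. (\<lambda>n. U n x) \<longlonglongrightarrow> u x) \<Longrightarrow> (\<lambda>n. J (U n)) \<longlonglongrightarrow> J u"
  shows "signed_integral \<gamma> f = J f"
  using f
proof (induct rule: bounded_borel_induct)
  case (indicator B)
  thus ?case by (simp add: signed_integral_indicator g ind)
next
  case (scale u c D)
  thus ?case using assms(5)[of u D c] by (simp add: signed_integral_cmult)
next
  case (add u v D)
  thus ?case using assms(6)[of u v D] signed_integral_add[OF g, of u D v D] by simp
next
  case (lim U u D)
  have "(\<lambda>n. signed_integral \<gamma> (U n)) \<longlonglongrightarrow> signed_integral \<gamma> u"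
    by (rule signed_integral_dominated_convergence[OF g lim(1,2,3)])
  moreover have "(\<lambda>n. J (U n)) \<longlonglongrightarrow> J u" by (rule assms(7)[OF lim(1,2,3)])
  ultimately show ?case using lim(4) LIMSEQ_unique by simp
qed

lemma signed_integral_diff_measure:
  assumes g: "\<gamma> \<in> signed_measures" "\<gamma>' \<in> signed_measures"
    and f: "f \<in> bm" "\<And>x. \<bar>f x\<bar> \<le> C"
  shows "signed_integral (\<lambda>B. \<gamma> B - \<gamma>' B) f = signed_integral \<gamma> f - signed_integral \<gamma>' f"
proof (rule signed_integral_unique[OF signed_measures_diff[OF g] f])
  fix u v :: "'a \<Rightarrow> real" and D
  assume uv: "u \<in> bm" "v \<in> bm" "\<And>x. \<bar>u x\<bar> \<le> D" "\<And>x. \<bar>v x\<bar> \<le> D"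
  show "signed_integral \<gamma> (\<lambda>x. u x + v x) - signed_integral \<gamma>' (\<lambda>x. u x + v x) =
      signed_integral \<gamma> u - signed_integral \<gamma>' u + (signed_integral \<gamma> v - signed_integral \<gamma>' v)"
    using signed_integral_add[OF g(1) uv(1,3,2,4)] signed_integral_add[OF g(2) uv(1,3,2,4)] by simp
qed (auto simp: signed_integral_indicator g signed_integral_cmult right_diff_distrib
    intro!: tendsto_diff signed_integral_dominated_convergence[OF g(1)] signed_integral_dominated_convergence[OF g(2)])

text \<open>Both variations are suprema of values of \<open>\<gamma>\<close> or its negative, so
  one-sided bounds on these values bound the norm.\<close>

lemma tv_norm_le:
  assumes g: "\<gamma> \<in> signed_measures"
    and le: "\<And>B. B \<in> sets borel \<Longrightarrow> \<gamma> B \<le> p" "\<And>B. B \<in> sets borel \<Longrightarrow> - \<gamma> B \<le> q"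
  shows "tv_norm \<gamma> \<le> p + q"
  unfolding tv_norm_def measure_pos_part[OF g sets.top[of borel, unfolded space_borel]]
    measure_neg_part[OF g sets.top[of borel, unfolded space_borel]]
  by (intro add_mono upper_var_least[OF g] upper_var_least[OF signed_measures_uminus[OF g]] le)

section \<open>Density of trigonometric polynomials\<close>

text \<open>A smooth substitute for the projection onto the span of \<open>E\<close>: for
  orthonormal \<open>E\<close> it is bounded, of period \<open>2 * pi * R\<close> in each direction,
  and close to the projection when \<open>R\<close> is large.\<close>

definition sine_map :: "real \<Rightarrow> 'a::real_inner set \<Rightarrow> 'a \<Rightarrow> 'a" where
  "sine_map R E x = (\<Sum>e\<in>E. (R * sin ((x \<bullet> e) / R)) *\<^sub>R e)"

lemma sin_minus_bound: "\<bar>R * sin (s / R) - s\<bar> \<le> s\<^sup>2 / R" if "R > 0" for s R :: real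
proof -
  have "\<bar>sin (s / R) - (\<Sum>m<2. sin_coeff m * (s / R) ^ m)\<bar> \<le> inverse (fact 2) * \<bar>s / R\<bar> ^ 2"
    by (rule Maclaurin_sin_bound)
  hence "\<bar>sin (s / R) - s / R\<bar> \<le> (1/2) * (s / R)\<^sup>2" by (simp add: sin_coeff_def numeral_2_eq_2)
  also have "\<dots> \<le> (s / R)\<^sup>2" by simp
  finally have "R * \<bar>sin (s / R) - s / R\<bar> \<le> R * (s / R)\<^sup>2" using that by (intro mult_left_mono) auto
  moreover have "R * \<bar>sin (s / R) - s / R\<bar> = \<bar>R * (sin (s / R) - s / R)\<bar>" using that by (simp add: abs_mult)
  moreover have "R * (sin (s / R) - s / R) = R * sin (s / R) - s" using that by (simp add: right_diff_distrib)
  moreover have "R * (s / R)\<^sup>2 = s\<^sup>2 / R" using that by (simp add: power2_eq_square)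
  ultimately show ?thesis by simp
qed

lemma norm_diag_onb_le:
  fixes x :: "'a::{real_inner, complete_space}"
  assumes "finite E" "E \<subseteq> the_onb" "0 \<le> K" "\<And>e. e \<in> E \<Longrightarrow> \<bar>c e\<bar> \<le> K * \<bar>x \<bullet> e\<bar>"
  shows "norm (\<Sum>e\<in>E. c e *\<^sub>R e) \<le> K * norm x"
proof (rule power2_le_imp_le)
  have "(norm (\<Sum>e\<in>E. c e *\<^sub>R e))\<^sup>2 = (\<Sum>e\<in>E. (c e)\<^sup>2)" by (rule norm_sum_onb[OF assms(1,2)])
  also have "\<dots> \<le> (\<Sum>e\<in>E. K\<^sup>2 * (x \<bullet> e)\<^sup>2)"
  proof (rule sum_mono)
    fix e assume "e \<in> E"
    hence "\<bar>c e\<bar>\<^sup>2 \<le> (K * \<bar>x \<bullet> e\<bar>)\<^sup>2" using assms(4) by (intro power_mono) auto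
    thus "(c e)\<^sup>2 \<le> K\<^sup>2 * (x \<bullet> e)\<^sup>2" by (simp add: power_mult_distrib)
  qed
  also have "\<dots> = K\<^sup>2 * (\<Sum>e\<in>E. (x \<bullet> e)\<^sup>2)" by (simp add: sum_distrib_left)
  also have "\<dots> \<le> K\<^sup>2 * (norm x)\<^sup>2" by (intro mult_left_mono bessel_finite assms) auto
  finally show "(norm (\<Sum>e\<in>E. c e *\<^sub>R e))\<^sup>2 \<le> (K * norm x)\<^sup>2" by (simp add: power_mult_distrib)
qed (use assms in auto)

lemma onb_inner_le: "e \<in> the_onb \<Longrightarrow> \<bar>x \<bullet> e\<bar> \<le> norm (x :: 'a::{real_inner, complete_space})"
  using Cauchy_Schwarz_ineq2[of x e] by simp

text \<open>The error in the coordinate \<open>e\<close> is at most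
  \<open>(x \<bullet> e)\<^sup>2 / R\<close>, hence at most \<open>norm x / R\<close> times
  \<open>\<bar>x \<bullet> e\<bar>\<close>; Bessel sums these errors with a bound independent of the
  number of coordinates.\<close>

lemma sine_map_LIMSEQ:
  fixes x :: "'a::{real_inner, polish_space}"
  shows "(\<lambda>n. sine_map (real (Suc n)) (onb_upto n) x) \<longlonglongrightarrow> x"
proof -
  have "(\<lambda>n. \<Sum>e\<in>onb_upto n. (x \<bullet> e) *\<^sub>R e) \<longlonglongrightarrow> x" by (rule onb_upto_LIMSEQ[OF onb_expansion])
  moreover have "(\<lambda>n. sine_map (real (Suc n)) (onb_upto n) x - (\<Sum>e\<in>onb_upto n. (x \<bullet> e) *\<^sub>R e)) \<longlonglongrightarrow> 0"
  proof (rule Lim_null_comparison)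
    show "\<forall>\<^sub>F n in sequentially. norm (sine_map (real (Suc n)) (onb_upto n) x - (\<Sum>e\<in>onb_upto n. (x \<bullet> e) *\<^sub>R e))
       \<le> (norm x * norm x) * (recip n)"
    proof (rule always_eventually, rule allI)
      fix n
      have "norm (\<Sum>e\<in>onb_upto n. (real (Suc n) * sin ((x \<bullet> e) / real (Suc n)) - x \<bullet> e) *\<^sub>R e) \<le> (norm x / real (Suc n)) * norm x"
      proof (rule norm_diag_onb_le[OF finite_onb_upto onb_upto_subset])
        fix e :: 'a assume "e \<in> onb_upto n"
        hence e: "e \<in> the_onb" using onb_upto_subset by blast
        have "\<bar>real (Suc n) * sin ((x \<bullet> e) / real (Suc n)) - x \<bullet> e\<bar> \<le> (x \<bullet> e)\<^sup>2 / real (Suc n)"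
          by (rule sin_minus_bound) simp
        also have "(x \<bullet> e)\<^sup>2 / real (Suc n) = \<bar>x \<bullet> e\<bar> / real (Suc n) * \<bar>x \<bullet> e\<bar>" by (simp add: power2_eq_square)
        also have "\<dots> \<le> (norm x / real (Suc n)) * \<bar>x \<bullet> e\<bar>"
          by (intro mult_right_mono divide_right_mono onb_inner_le e) auto
        finally show "\<bar>real (Suc n) * sin ((x \<bullet> e) / real (Suc n)) - x \<bullet> e\<bar> \<le> (norm x / real (Suc n)) * \<bar>x \<bullet> e\<bar>" .
      qed simp
      thus "norm (sine_map (real (Suc n)) (onb_upto n) x - (\<Sum>e\<in>onb_upto n. (x \<bullet> e) *\<^sub>R e)) \<le> (norm x * norm x) * (recip n)"
        by (simp add: sine_map_def scaleR_diff_left sum_subtractf)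
    qed
    have "(\<lambda>n. (norm x * norm x) * (recip n)) \<longlonglongrightarrow> (norm x * norm x) * 0"
      by (intro tendsto_intros LIMSEQ_Suc lim_1_over_n)
    thus "(\<lambda>n. (norm x * norm x) * (recip n)) \<longlonglongrightarrow> 0" by simp
  qed
  ultimately show ?thesis using tendsto_add by fastforce
qed

lemma continuous_sine_map [continuous_intros]: "continuous_on S (sine_map R E)"
  unfolding sine_map_def divide_inverse by (intro continuous_intros)

text \<open>The free phase makes constants and sines instances, and the product-to-sum formula gives
  closure under products.\<close>

inductive trig_poly :: "('a::real_inner \<Rightarrow> real) \<Rightarrow> bool" where
  trig_cos: "trig_poly (\<lambda>x. cos (x \<bullet> h + c))"
| trig_add: "trig_poly f \<Longrightarrow> trig_poly g \<Longrightarrow> trig_poly (\<lambda>x. f x + g x)"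
| trig_scale: "trig_poly f \<Longrightarrow> trig_poly (\<lambda>x. c * f x)"

lemma trig_poly_const: "trig_poly (\<lambda>x. c)"
  using trig_scale[OF trig_cos[of 0 0], of c] by simp

lemma trig_poly_sin: "trig_poly (\<lambda>x. sin (x \<bullet> h))"
proof -
  have "(\<lambda>x. sin (x \<bullet> h)) = (\<lambda>x. cos (x \<bullet> h + (- pi / 2)))"
    by (rule ext) (simp add: cos_diff)
  thus ?thesis using trig_cos[of h "- pi / 2"] by simp
qed

lemma trig_poly_mult:
  assumes "trig_poly f" "trig_poly g"
  shows "trig_poly (\<lambda>x. f x * g x)"
  using assms(1)
proof induct
  case (trig_cos h c)
  show ?case using assms(2)
  proof induct
    case (trig_cos k d)
    have "trig_poly (\<lambda>x. (1/2) * cos (x \<bullet> (h - k) + (c - d)) + (1/2) * cos (x \<bullet> (h + k) + (c + d)))"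
      by (intro trig_poly.intros)
    moreover have "(\<lambda>x. (1/2) * cos (x \<bullet> (h - k) + (c - d)) + (1/2) * cos (x \<bullet> (h + k) + (c + d))) =
        (\<lambda>x. cos (x \<bullet> h + c) * cos (x \<bullet> k + d))"
      by (rule ext) (simp add: cos_times_cos inner_diff_right inner_add_right algebra_simps)
    ultimately show ?case by simp
  next
    case (trig_add f g)
    thus ?case using trig_poly.trig_add by (simp add: distrib_left)
  next
    case (trig_scale f c')
    have "(\<lambda>x. cos (x \<bullet> h + c) * (c' * f x)) = (\<lambda>x. c' * (cos (x \<bullet> h + c) * f x))" by (simp add: mult.left_commute)
    thus ?case using trig_scale(2) trig_poly.trig_scale by simp
  qed
next
  case (trig_add f g)
  thus ?case using trig_poly.trig_add by (simp add: distrib_right)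
next
  case (trig_scale f c)
  thus ?case using trig_poly.trig_scale by (simp add: mult.assoc)
qed

lemma trig_poly_continuous_bounded:
  "trig_poly f \<Longrightarrow> continuous_on UNIV f \<and> (\<exists>C. \<forall>x. \<bar>f x\<bar> \<le> C)"
proof (induct rule: trig_poly.induct)
  case (trig_cos h c)
  have "continuous_on UNIV (\<lambda>x. cos (x \<bullet> h + c))" by (intro continuous_intros)
  thus ?case using abs_cos_le_one by blast
next
  case (trig_add f g)
  then obtain C D where "\<And>x. \<bar>f x\<bar> \<le> C" "\<And>x. \<bar>g x\<bar> \<le> D" by blast
  hence "\<bar>f x + g x\<bar> \<le> C + D" for x by (meson abs_triangle_ineq add_mono order_trans)
  thus ?case using trig_add by (blast intro: continuous_on_add)
next
  case (trig_scale f c)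
  then obtain C where "\<And>x. \<bar>f x\<bar> \<le> C" by blast
  hence "\<bar>c * f x\<bar> \<le> \<bar>c\<bar> * C" for x by (simp add: abs_mult mult_left_mono)
  thus ?case using trig_scale by (blast intro: continuous_on_mult_left)
qed

text \<open>By induction on \<open>E\<close>: the box is the sum of a segment and a box over fewer
  vectors. It contains the range of the sine map and is the compact space on which Stone-Weierstrass
  is applied.\<close>

lemma compact_onb_box:
  fixes E :: "'a::real_normed_vector set"
  assumes "finite E"
  shows "compact {\<Sum>e\<in>E. c e *\<^sub>R e |c. \<forall>e\<in>E. \<bar>c e\<bar> \<le> R}"
  using assms
proof induct
  case empty
  have "{\<Sum>e\<in>{}. c e *\<^sub>R e |c. \<forall>e\<in>{}. \<bar>c e\<bar> \<le> R} = {0 :: 'a}" by auto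
  thus ?case by simp
next
  case (insert a E)
  let ?K = "{\<Sum>e\<in>E. c e *\<^sub>R e |c. \<forall>e\<in>E. \<bar>c e\<bar> \<le> R}"
  let ?L = "(\<lambda>t. t *\<^sub>R a) ` {-R..R}"
  have "{\<Sum>e\<in>insert a E. c e *\<^sub>R e |c. \<forall>e\<in>insert a E. \<bar>c e\<bar> \<le> R} = {x + y |x y. x \<in> ?L \<and> y \<in> ?K}"
    (is "?A = ?B")
  proof
    show "?A \<subseteq> ?B"
    proof
      fix z assume "z \<in> ?A"
      then obtain c where c: "z = c a *\<^sub>R a + (\<Sum>e\<in>E. c e *\<^sub>R e)" "\<bar>c a\<bar> \<le> R" "\<forall>e\<in>E. \<bar>c e\<bar> \<le> R"
        using insert(1,2) by auto
      moreover have "c a *\<^sub>R a \<in> ?L" using c(2) by (intro imageI) (auto simp: abs_le_iff)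
      ultimately show "z \<in> ?B" by blast
    qed
    show "?B \<subseteq> ?A"
    proof
      fix z assume "z \<in> ?B"
      then obtain t c where c: "z = t *\<^sub>R a + (\<Sum>e\<in>E. c e *\<^sub>R e)" "\<bar>t\<bar> \<le> R" "\<forall>e\<in>E. \<bar>c e\<bar> \<le> R"
        by (auto simp: abs_le_iff)
      have "(\<Sum>e\<in>E. (c(a := t)) e *\<^sub>R e) = (\<Sum>e\<in>E. c e *\<^sub>R e)"
        using insert(2) by (intro sum.cong) auto
      hence "z = (\<Sum>e\<in>insert a E. (c(a := t)) e *\<^sub>R e)" using insert(1,2) c(1) by simp
      moreover have "\<forall>e\<in>insert a E. \<bar>(c(a := t)) e\<bar> \<le> R" using c by simp
      ultimately show "z \<in> ?A" by blast
    qed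
  qed
  moreover have "compact ?L" by (intro compact_continuous_image continuous_intros compact_Icc)
  ultimately show ?case using compact_sums[OF _ insert(3), of ?L] by simp
qed

text \<open>Stone-Weierstrass on the box that contains the range of the sine map. The algebra
  consists of those continuous \<open>g\<close> whose composition with the sine map is a
  trigonometric polynomial; the coordinates belong to it and separate points.\<close>

lemma sine_map_approx:
  fixes f :: "'a::{real_inner, complete_space} \<Rightarrow> real"
  assumes f: "continuous_on UNIV f" and E: "finite E" "E \<subseteq> the_onb" and R: "R > 0" and e: "\<epsilon> > 0"
  obtains g where "trig_poly g" "\<And>x. \<bar>f (sine_map R E x) - g x\<bar> < \<epsilon>"
proof -
  define K where "K = {\<Sum>e\<in>E. c e *\<^sub>R e |c. \<forall>e\<in>E. \<bar>c e\<bar> \<le> R}"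
  define \<R> where "\<R> = {g :: 'a \<Rightarrow> real. continuous_on UNIV g \<and> trig_poly (\<lambda>x. g (sine_map R E x))}"
  interpret function_ring_on \<R> K
  proof
    show "compact K" unfolding K_def by (rule compact_onb_box[OF E(1)])
    show "continuous_on K g" if "g \<in> \<R>" for g
      using that unfolding \<R>_def by (blast intro: continuous_on_subset)
    show "(\<lambda>x. g x + h x) \<in> \<R>" "(\<lambda>x. g x * h x) \<in> \<R>" if "g \<in> \<R>" "h \<in> \<R>" for g h
      using that unfolding \<R>_def by (auto intro: continuous_intros trig_add trig_poly_mult)
    show "(\<lambda>_. c) \<in> \<R>" for c unfolding \<R>_def by (auto simp: trig_poly_const)
    show "\<exists>g\<in>\<R>. g x \<noteq> g y" if xy: "x \<in> K" "y \<in> K" "x \<noteq> y" for x y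
    proof -
      obtain c d where cd: "x = (\<Sum>e\<in>E. c e *\<^sub>R e)" "y = (\<Sum>e\<in>E. d e *\<^sub>R e)" using xy unfolding K_def by blast
      obtain e where e: "e \<in> E" "c e \<noteq> d e" using xy(3) cd by (metis (mono_tags, lifting) sum.cong)
      have "x \<bullet> e \<noteq> y \<bullet> e" using e cd inner_sum_onb[OF E e(1)] by simp
      moreover have "(\<lambda>z. z \<bullet> e) \<in> \<R>"
      proof -
        have "(\<lambda>x. sine_map R E x \<bullet> e) = (\<lambda>x. R * sin (x \<bullet> ((1/R) *\<^sub>R e)))"
          using inner_sum_onb[OF E e(1)] by (simp add: sine_map_def)
        moreover have "trig_poly (\<lambda>x. R * sin (x \<bullet> ((1/R) *\<^sub>R e)))" by (intro trig_scale trig_poly_sin)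
        moreover have "continuous_on UNIV (\<lambda>z :: 'a. z \<bullet> e)" by (intro continuous_intros)
        ultimately show ?thesis unfolding \<R>_def mem_Collect_eq by simp
      qed
      ultimately show ?thesis by (rule bexI)
    qed
  qed
  obtain g where g: "g \<in> \<R>" "\<forall>x\<in>K. \<bar>f x - g x\<bar> < \<epsilon>"
    using Stone_Weierstrass_basic[OF continuous_on_subset[OF f] e] by auto
  have "sine_map R E x \<in> K" for x
  proof -
    have "\<bar>R * sin (x \<bullet> e / R)\<bar> \<le> R" for e
      using R abs_sin_le_one[of "x \<bullet> e / R"] by (simp add: abs_mult mult_left_le)
    thus ?thesis unfolding K_def sine_map_def by (intro CollectI exI[of _ "\<lambda>e. R * sin (x \<bullet> e / R)"]) simp
  qed
  moreover have "trig_poly (\<lambda>x. g (sine_map R E x))" using g(1) unfolding \<R>_def by simp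
  ultimately show ?thesis using that g(2) by simp
qed

text \<open>Two limits: for fixed \<open>n\<close> the composition of \<open>f\<close> with the sine
  map is approximated uniformly by trigonometric polynomials; then \<open>n\<close> tends to
  infinity pointwise. Both sequences are bounded, the first by \<open>C + 1\<close> and the second
  by \<open>C\<close>.\<close>

lemma bounded_continuous_trig_induct [consumes 2, case_names cos scale add lim]:
  fixes f :: "'a::{real_inner, polish_space} \<Rightarrow> real"
  assumes f: "continuous_on UNIV f" "\<And>x. \<bar>f x\<bar> \<le> C"
    and cos: "\<And>h c. P (\<lambda>x. cos (x \<bullet> h + c))"
    and scale: "\<And>u c D. continuous_on UNIV u \<Longrightarrow> (\<And>x. \<bar>u x\<bar> \<le> D) \<Longrightarrow> P u \<Longrightarrow> P (\<lambda>x. c * u x)"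
    and add: "\<And>u v D D'. continuous_on UNIV u \<Longrightarrow> continuous_on UNIV v \<Longrightarrow>
        (\<And>x. \<bar>u x\<bar> \<le> D) \<Longrightarrow> (\<And>x. \<bar>v x\<bar> \<le> D') \<Longrightarrow> P u \<Longrightarrow> P v \<Longrightarrow> P (\<lambda>x. u x + v x)"
    and lim: "\<And>U u D. (\<And>n::nat. continuous_on UNIV (U n)) \<Longrightarrow> (\<And>n x. \<bar>U n x\<bar> \<le> D) \<Longrightarrow>
        (\<And>x. (\<lambda>n. U n x) \<longlonglongrightarrow> u x) \<Longrightarrow> (\<And>n. P (U n)) \<Longrightarrow> P u"
  shows "P f"
proof -
  have trigP: "P g" if "trig_poly g" for g
    using that
  proof induct
    case (trig_cos h c) show ?case by (rule cos)
  next
    case (trig_add u v)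
    obtain D D' where "\<And>x. \<bar>u x\<bar> \<le> D" "\<And>x. \<bar>v x\<bar> \<le> D'"
      using trig_poly_continuous_bounded[OF trig_add(1)] trig_poly_continuous_bounded[OF trig_add(3)] by blast
    thus ?case
      using assms(5)[of u v D D'] trig_add trig_poly_continuous_bounded by blast
  next
    case (trig_scale u c)
    thus ?case using scale trig_poly_continuous_bounded by blast
  qed
  have Pn: "P (\<lambda>x. f (sine_map (real (Suc n)) (onb_upto n) x))" for n
  proof -
    have "\<exists>g. trig_poly g \<and> (\<forall>x. \<bar>f (sine_map (real (Suc n)) (onb_upto n) x) - g x\<bar> < recip m)" for m
      by (rule sine_map_approx[OF f(1) finite_onb_upto onb_upto_subset, of "real (Suc n)" "recip m" n]) auto
    then obtain G where G: "\<And>m. trig_poly (G m)"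
      "\<And>m x. \<bar>f (sine_map (real (Suc n)) (onb_upto n) x) - G m x\<bar> < recip m" by metis
    show ?thesis
    proof (rule lim)
      show "continuous_on UNIV (G m)" for m using trig_poly_continuous_bounded[OF G(1)] by blast
      show "P (G m)" for m by (rule trigP[OF G(1)])
      show "\<bar>G m x\<bar> \<le> C + 1" for m x
      proof -
        have "recip m \<le> 1" by simp
        thus ?thesis using G(2)[of x m] f(2)[of "sine_map (real (Suc n)) (onb_upto n) x"] by linarith
      qed
      show "(\<lambda>m. G m x) \<longlonglongrightarrow> f (sine_map (real (Suc n)) (onb_upto n) x)" for x
      proof (rule LIM_zero_cancel, rule Lim_null_comparison)
        show "\<forall>\<^sub>F m in sequentially. norm (G m x - f (sine_map (real (Suc n)) (onb_upto n) x)) \<le> recip m"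
          using G(2)[of x] by (intro always_eventually allI) (simp add: abs_minus_commute less_imp_le)
        show "(\<lambda>m. recip m) \<longlonglongrightarrow> 0" by (intro LIMSEQ_Suc lim_1_over_n)
      qed
    qed
  qed
  show ?thesis
  proof (rule lim[of "\<lambda>n x. f (sine_map (real (Suc n)) (onb_upto n) x)" C f])
    show "continuous_on UNIV (\<lambda>x. f (sine_map (real (Suc n)) (onb_upto n) x))" for n
      by (rule continuous_on_compose2[OF f(1) continuous_sine_map]) simp
    show "(\<lambda>n. f (sine_map (real (Suc n)) (onb_upto n) x)) \<longlonglongrightarrow> f x" for x
      using f(1) by (intro isCont_tendsto_compose[OF _ sine_map_LIMSEQ]) (simp add: continuous_on_eq_continuous_at)
  qed (use f(2) Pn in auto)
qed

section \<open>Signed measures are determined by their characteristic functions\<close>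

lemma closed_indicator_approx:
  fixes F :: "'a::metric_space set"
  assumes F: "closed F" "F \<noteq> {}"
  obtains u :: "nat \<Rightarrow> 'a \<Rightarrow> real" where "\<And>n. continuous_on UNIV (u n)" "\<And>n x. \<bar>u n x\<bar> \<le> 1"
    "\<And>x. (\<lambda>n. u n x) \<longlonglongrightarrow> indicator F x"
proof
  define u where "u n x = max 0 (1 - real n * infdist x F)" for n x
  show "continuous_on UNIV (u n)" for n unfolding u_def by (intro continuous_intros)
  show "\<bar>u n x\<bar> \<le> 1" for n x unfolding u_def using infdist_nonneg[of x F] by (auto simp: max_def)
  show "(\<lambda>n. u n x) \<longlonglongrightarrow> indicator F x" for x
  proof (cases "x \<in> F")
    case True thus ?thesis by (simp add: u_def)
  next
    case False
    hence pos: "infdist x F > 0" using F by (simp add: infdist_pos_not_in_closed)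
    obtain N :: nat where N: "1 < real N * infdist x F" using pos reals_Archimedean3 by blast
    have "u n x = 0" if "n \<ge> N" for n
    proof -
      have "real N * infdist x F \<le> real n * infdist x F" using that pos by (intro mult_right_mono) auto
      thus ?thesis using N by (simp add: u_def)
    qed
    hence "\<forall>\<^sub>F n in sequentially. u n x = 0" by (auto simp: eventually_sequentially)
    thus ?thesis using False by (simp add: tendsto_eventually)
  qed
qed

text \<open>Indicators of closed sets are bounded limits of continuous functions, and closed sets
  form an intersection-stable generator. The induction runs over complements and disjoint unions,
  which a set function with signs respects.\<close>

lemma signed_measure_eq_0_of_continuous:
  fixes \<gamma> :: "'a::metric_space set \<Rightarrow> real"
  assumes g: "\<gamma> \<in> signed_measures"
    and z: "\<And>f C. continuous_on UNIV f \<Longrightarrow> (\<And>x. \<bar>f x\<bar> \<le> C) \<Longrightarrow> signed_integral \<gamma> f = 0"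
    and B: "B \<in> sets borel"
  shows "\<gamma> B = 0"
proof -
  have cl: "\<gamma> F = 0" if F: "closed F" for F
  proof (cases "F = {}")
    case False
    obtain u :: "nat \<Rightarrow> 'a \<Rightarrow> real" where cu: "\<And>n. continuous_on UNIV (u n)" and bu: "\<And>n x. \<bar>u n x\<bar> \<le> 1"
      and lu: "\<And>x. (\<lambda>n. u n x) \<longlonglongrightarrow> indicator F x"
      using closed_indicator_approx[OF F False] by blast
    have "(\<lambda>n. signed_integral \<gamma> (u n)) \<longlonglongrightarrow> signed_integral \<gamma> (indicator F)"
      by (rule signed_integral_dominated_convergence[OF g borel_measurable_continuous_onI[OF cu] bu lu])
    moreover have "signed_integral \<gamma> (u n) = 0" for n by (rule z[OF cu bu])
    ultimately have "signed_integral \<gamma> (indicator F) = 0" by (simp add: LIMSEQ_const_iff)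
    thus ?thesis using signed_integral_indicator[OF g, of F] F by simp
  qed (simp add: signed_measures_empty[OF g])
  have gen: "sets (borel :: 'a measure) = sigma_sets UNIV {F. closed F}"
    by (simp add: borel_eq_closed sets_measure_of_conv)
  have ist: "Int_stable {F :: 'a set. closed F}" by (auto simp: Int_stable_def)
  have "B \<in> sigma_sets UNIV {F. closed F}" using B gen by simp
  from ist subset_UNIV[of "{F. closed F}", folded Pow_UNIV] this show ?thesis
  proof (induct rule: sigma_sets_induct_disjoint[consumes 3, case_names basic empty compl union])
    case (basic A) thus ?case using cl by simp
  next
    case empty show ?case by (rule signed_measures_empty[OF g])
  next
    case (compl A)
    have "A \<in> sets borel" using compl(1) gen by simp
    hence "\<gamma> UNIV = \<gamma> A + \<gamma> (UNIV - A)" using signed_measures_split[OF g, of UNIV A] by simp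
    thus ?case using compl(2) cl[of UNIV] by simp
  next
    case (union A)
    have "(\<lambda>n. \<gamma> (A n)) sums \<gamma> (\<Union>n. A n)"
      using union gen by (intro signed_measures_sums[OF g]) auto
    hence "(\<lambda>n. 0) sums \<gamma> (\<Union>n. A n)" using union(3) by simp
    thus ?case using sums_zero sums_unique2 by blast
  qed
qed

lemma inner_borel_measurable [measurable]: "(\<lambda>x. x \<bullet> h) \<in> bm"
  for h :: "'a::real_inner"
  by (intro borel_measurable_continuous_onI continuous_intros)

text \<open>Bounded continuous functions are reached from cosines with a phase, and the addition
  theorem splits these into the two given transforms.\<close>

lemma signed_measure_char_eq_0:
  fixes \<gamma> :: "'a::{real_inner, polish_space} set \<Rightarrow> real"
  assumes g: "\<gamma> \<in> signed_measures"
    and c: "\<And>h. signed_integral \<gamma> (\<lambda>x. cos (x \<bullet> h)) = 0" and s: "\<And>h. signed_integral \<gamma> (\<lambda>x. sin (x \<bullet> h)) = 0"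
    and B: "B \<in> sets borel"
  shows "\<gamma> B = 0"
proof (rule signed_measure_eq_0_of_continuous[OF g _ B])
  fix f :: "'a \<Rightarrow> real" and C assume "continuous_on UNIV f" "\<And>x. \<bar>f x\<bar> \<le> C"
  thus "signed_integral \<gamma> f = 0"
  proof (induct rule: bounded_continuous_trig_induct)
    case (cos h d)
    have "(\<lambda>x. cos (x \<bullet> h + d)) = (\<lambda>x. cos d * cos (x \<bullet> h) + (- sin d) * sin (x \<bullet> h))"
      by (simp add: cos_add mult.commute)
    moreover have "signed_integral \<gamma> (\<lambda>x. cos d * cos (x \<bullet> h) + (- sin d) * sin (x \<bullet> h)) =
      signed_integral \<gamma> (\<lambda>x. cos d * cos (x \<bullet> h)) + signed_integral \<gamma> (\<lambda>x. (- sin d) * sin (x \<bullet> h))"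
      by (rule signed_integral_add[OF g, of _ 1 _ 1])
        (auto simp: abs_mult intro!: mult_le_one)
    ultimately show ?case by (simp only: signed_integral_cmult c s)
  next
    case (scale u c D) thus ?case by (simp add: signed_integral_cmult)
  next
    case (add u v D D')
    thus ?case using signed_integral_add[OF g _ add(3) _ add(4)] by (simp add: borel_measurable_continuous_onI)
  next
    case (lim U u D)
    have "(\<lambda>n. signed_integral \<gamma> (U n)) \<longlonglongrightarrow> signed_integral \<gamma> u"
      using lim by (intro signed_integral_dominated_convergence[OF g]) (auto intro: borel_measurable_continuous_onI)
    thus ?case using lim(4) by (simp add: LIMSEQ_const_iff)
  qed
qed

lemma finite_measure_signed:
  fixes m :: "'a::topological_space measure"
  assumes "finite_measure m" "sets m = sets borel"
  shows "measure m \<in> signed_measures"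
proof -
  interpret finite_measure m by fact
  show ?thesis
    unfolding signed_measures_def mem_Collect_eq
    using assms(2) finite_measure_UNION[unfolded assms(2)] by (auto simp: measure_notin_sets)
qed

lemma signed_integral_finite_measure:
  fixes f :: "'a::topological_space \<Rightarrow> real"
  assumes m: "finite_measure m" "sets m = sets borel"
    and f: "f \<in> bm" "\<And>x. \<bar>f x\<bar> \<le> C"
  shows "signed_integral (measure m) f = integral\<^sup>L m f"
proof (rule signed_integral_unique[OF finite_measure_signed[OF m] f])
  interpret finite_measure m by fact
  note [measurable_cong] = m(2)
  fix u v :: "'a \<Rightarrow> real" and D
  assume "u \<in> bm" "v \<in> bm" "\<And>x. \<bar>u x\<bar> \<le> D" "\<And>x. \<bar>v x\<bar> \<le> D"
  hence "integrable m u" "integrable m v" by (auto intro!: integrable_bounded simp: m(2))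
  thus "(LINT x|m. u x + v x) = integral\<^sup>L m u + integral\<^sup>L m v" by simp
next
  interpret finite_measure m by fact
  note [measurable_cong] = m(2)
  fix U :: "nat \<Rightarrow> 'a \<Rightarrow> real" and u D
  assume U: "\<And>n. U n \<in> bm" "\<And>n x. \<bar>U n x\<bar> \<le> D" "\<And>x. (\<lambda>n. U n x) \<longlonglongrightarrow> u x"
  have "u \<in> bm" using U(3) by (rule borel_measurable_LIMSEQ_real[OF _ U(1)])
  with U show "(\<lambda>n. integral\<^sup>L m (U n)) \<longlonglongrightarrow> integral\<^sup>L m u"
    by (intro integral_dominated_convergence[where w="\<lambda>_. D"]) auto
next
  fix B :: "'a set" assume "B \<in> sets borel"
  moreover have "space m = UNIV" using sets_eq_imp_space_eq[OF m(2)] by simp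
  ultimately show "integral\<^sup>L m (indicator B) = measure m B" by simp
qed simp

text \<open>The bridge from characteristic functions to laws: the difference of the two measures is
  a signed measure with vanishing transform.\<close>

lemma integral_eq_of_char_eq:
  fixes m m' :: "'a::{real_inner, polish_space} measure" and f :: "'a \<Rightarrow> real"
  assumes m: "finite_measure m" "sets m = sets borel" and m': "finite_measure m'" "sets m' = sets borel"
    and c: "\<And>h. (LINT x|m. cos (x \<bullet> h)) = (LINT x|m'. cos (x \<bullet> h))"
    and s: "\<And>h. (LINT x|m. sin (x \<bullet> h)) = (LINT x|m'. sin (x \<bullet> h))"
    and f: "f \<in> bm" "\<And>x. \<bar>f x\<bar> \<le> C"
  shows "integral\<^sup>L m f = integral\<^sup>L m' f"
proof -
  note g = finite_measure_signed[OF m] and g' = finite_measure_signed[OF m']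
  note d = signed_measures_diff[OF g g']
  have si: "signed_integral (\<lambda>B. measure m B - measure m' B) u = integral\<^sup>L m u - integral\<^sup>L m' u"
    if "u \<in> bm" "\<And>x. \<bar>u x\<bar> \<le> D" for u D
    using signed_integral_diff_measure[OF g g' that] signed_integral_finite_measure[OF m that]
      signed_integral_finite_measure[OF m' that] by simp
  have "measure m B - measure m' B = 0" if "B \<in> sets borel" for B
  proof (rule signed_measure_char_eq_0[OF d _ _ that])
    show "signed_integral (\<lambda>B. measure m B - measure m' B) (\<lambda>x. cos (x \<bullet> h)) = 0" for h
      by (subst si[where D=1]) (auto simp: c)
    show "signed_integral (\<lambda>B. measure m B - measure m' B) (\<lambda>x. sin (x \<bullet> h)) = 0" for h
      by (subst si[where D=1]) (auto simp: s)
  qed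
  hence "measure m = measure m'" using m(2) m'(2) by (intro signed_measures_ext[OF g g']) simp
  thus ?thesis using signed_integral_finite_measure[OF m f] signed_integral_finite_measure[OF m' f] by simp
qed

section \<open>Strongly continuous semigroups and their adjoints\<close>

lemma forward_average_LIMSEQ:
  fixes u :: "real \<Rightarrow> real"
  assumes u: "continuous_on {0..} u" and T: "T \<ge> 0"
  shows "(\<lambda>n. real (Suc n) * integral {T..T + recip n} u) \<longlonglongrightarrow> u T"
proof (rule LIMSEQ_I)
  fix e :: real assume e: "e > 0"
  have "continuous (at T within {0..}) u" using u T by (simp add: continuous_on_eq_continuous_within)
  then obtain d where d: "d > 0" "\<And>s. s \<ge> 0 \<Longrightarrow> dist s T < d \<Longrightarrow> dist (u s) (u T) < e / 2"
    unfolding continuous_within_eps_delta using e half_gt_zero by (metis atLeast_iff)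
  obtain N where N: "1 / real (Suc N) < d" using d(1) nat_approx_posE by blast
  have "norm (real (Suc n) * integral {T..T + recip n} u - u T) < e" if n: "n \<ge> N" for n
  proof -
    let ?h = "recip n"
    have hd: "?h \<le> 1 / real (Suc N)" using n by (intro divide_left_mono) auto
    have int: "u integrable_on {T..T + ?h}"
      by (intro integrable_continuous_real continuous_on_subset[OF u]) (use T in auto)
    have "norm (integral (cbox T (T + ?h)) (\<lambda>s. u s - u T)) \<le> (e / 2) * measure lborel (cbox T (T + ?h))"
    proof (rule integrable_bound)
      show "(\<lambda>s. u s - u T) integrable_on cbox T (T + ?h)"
        using int by (intro integrable_diff) (auto simp: integrable_const_ivl)
      show "norm (u s - u T) \<le> e / 2" if "s \<in> cbox T (T + ?h)" for s
        using d(2)[of s] that T hd N by (auto simp: dist_real_def less_imp_le)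
    qed (use e in auto)
    moreover have "integral (cbox T (T + ?h)) (\<lambda>s. u s - u T) = integral {T..T + ?h} u - ?h * u T"
      using int by (simp add: integral_diff integrable_const_ivl)
    ultimately have le: "\<bar>integral {T..T + ?h} u - ?h * u T\<bar> \<le> (e / 2) * ?h" by simp
    have "real (Suc n) * integral {T..T + ?h} u - u T = real (Suc n) * (integral {T..T + ?h} u - ?h * u T)"
      by (simp add: field_simps)
    hence "\<bar>real (Suc n) * integral {T..T + ?h} u - u T\<bar> = real (Suc n) * \<bar>integral {T..T + ?h} u - ?h * u T\<bar>"
      by (simp only: abs_mult abs_of_nat)
    also have "\<dots> \<le> real (Suc n) * ((e / 2) * ?h)" using le by (intro mult_left_mono) auto
    also have "\<dots> = e / 2" by (simp add: divide_simps)
    finally show ?thesis using e by simp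
  qed
  thus "\<exists>N. \<forall>n\<ge>N. norm (real (Suc n) * integral {T..T + recip n} u - u T) < e" by blast
qed

text \<open>Integrating difference quotients instead of differentiating: only right derivatives are needed.\<close>

lemma right_derivative_integral:
  fixes u v :: "real \<Rightarrow> real"
  assumes u: "continuous_on {0..} u" and T: "T \<ge> 0"
    and bd: "\<And>n t. n \<ge> N \<Longrightarrow> 0 \<le> t \<Longrightarrow> t \<le> T \<Longrightarrow> \<bar>real (Suc n) * (u (t + recip n) - u t)\<bar> \<le> K"
    and lim: "\<And>t. 0 \<le> t \<Longrightarrow> t \<le> T \<Longrightarrow> (\<lambda>n. real (Suc n) * (u (t + recip n) - u t)) \<longlonglongrightarrow> v t"
  shows "set_integrable lborel {0..T} v" and "(LINT t:{0..T}|lborel. v t) = u T - u 0"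
proof -
  define q where "q n t = real (Suc n) * (u (t + recip n) - u t)" for n t
  define F where "F n t = indicator {0..T} t *\<^sub>R q (n + N) t" for n t
  have ush: "continuous_on {0..} (\<lambda>t. u (t + h))" if "h \<ge> 0" for h
    by (rule continuous_on_compose2[OF u]) (use that in \<open>auto intro!: continuous_intros\<close>)
  have cq: "continuous_on {0..T} (q n)" for n
    unfolding q_def by (intro continuous_intros continuous_on_subset[OF u] continuous_on_subset[OF ush]) auto
  have Fi: "set_integrable lborel {0..T} (q n)" for n
    by (rule borel_integrable_atLeastAtMost'[OF cq])
  have Fm: "F n \<in> borel_measurable lborel" for n
    using Fi[of "n + N"] unfolding set_integrable_def F_def by (rule borel_measurable_integrable)
  have Fl: "(\<lambda>n. F n t) \<longlonglongrightarrow> indicator {0..T} t *\<^sub>R v t" for t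
  proof (cases "t \<in> {0..T}")
    case True
    thus ?thesis using LIMSEQ_ignore_initial_segment[OF lim[of t], of N] by (simp add: F_def q_def)
  qed (simp add: F_def)
  have dom: "norm (F n t) \<le> indicator {0..T} t * K" for n t
    using bd[of "n + N" t] by (auto simp: F_def q_def indicator_def)
  have Ki: "integrable lborel (\<lambda>t. indicator {0..T} t * K)"
    using borel_integrable_atLeastAtMost'[of 0 T "\<lambda>_. K"] unfolding set_integrable_def by simp
  have vm: "(\<lambda>t. indicator {0..T} t *\<^sub>R v t) \<in> borel_measurable lborel"
    by (rule borel_measurable_LIMSEQ_metric[OF Fm Fl])
  show "set_integrable lborel {0..T} v"
    unfolding set_integrable_def
    by (rule integrable_dominated_convergence[where s=F, OF vm Fm Ki]) (use Fl dom in auto)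
  have "(\<lambda>n. LINT t|lborel. F n t) \<longlonglongrightarrow> (LINT t:{0..T}|lborel. v t)"
    unfolding set_lebesgue_integral_def
    by (rule integral_dominated_convergence[where s=F, OF vm Fm Ki]) (use Fl dom in auto)
  moreover have "(\<lambda>n. LINT t|lborel. F n t) \<longlonglongrightarrow> u T - u 0"
  proof -
    \<comment> \<open>The shifted and the unshifted integral of \<open>u\<close> overlap except on
      two end pieces of the length of the step. Divided by the step, these are averages that tend to
      \<open>u T\<close> and \<open>u 0\<close>.\<close>
    have "(LINT t|lborel. F n t) = real (Suc (n + N)) * integral {T..T + 1 / real (Suc (n + N))} u
        - real (Suc (n + N)) * integral {0..0 + 1 / real (Suc (n + N))} u" for n
    proof -
      define h where "h = 1 / real (Suc (n + N))"
      have h: "h > 0" by (simp add: h_def)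
      have ui: "u integrable_on {a..b}" if "a \<ge> 0" for a b
        by (intro integrable_continuous_real continuous_on_subset[OF u]) (use that in auto)
      have "(LINT t|lborel. F n t) = integral {0..T} (q (n + N))"
        using set_borel_integral_eq_integral(2)[OF Fi[of "n + N"]] by (simp add: F_def set_lebesgue_integral_def)
      also have "\<dots> = real (Suc (n + N)) * (integral {0..T} (\<lambda>t. u (t + h)) - integral {0..T} u)"
      proof -
        have "(\<lambda>t. u (t + h)) integrable_on {0..T}"
          by (intro integrable_continuous_real continuous_on_subset[OF ush]) (use h in auto)
        thus ?thesis using ui[of 0 T] unfolding q_def h_def[symmetric] by (simp add: integral_diff)
      qed
      also have "integral {0..T} (\<lambda>t. u (t + h)) = integral {h..T + h} u"
      proof -
        have "integral {h..T + h} u = integral {h - h..T + h - h} (\<lambda>t. u (t + h))"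
          by (rule integral_shift_real_ivl[symmetric])
        thus ?thesis by simp
      qed
      also have "integral {h..T + h} u - integral {0..T} u = integral {T..T + h} u - integral {0..h} u"
      proof -
        have "integral {0..h} u + integral {h..T + h} u = integral {0..T + h} u"
          by (rule Henstock_Kurzweil_Integration.integral_combine) (use h T ui in auto)
        moreover have "integral {0..T} u + integral {T..T + h} u = integral {0..T + h} u"
          by (rule Henstock_Kurzweil_Integration.integral_combine) (use h T ui in auto)
        ultimately show ?thesis by linarith
      qed
      finally show ?thesis by (simp add: h_def right_diff_distrib)
    qed
    moreover have "(\<lambda>n. real (Suc (n + N)) * integral {T..T + 1 / real (Suc (n + N))} u
        - real (Suc (n + N)) * integral {0..0 + 1 / real (Suc (n + N))} u) \<longlonglongrightarrow> u T - u 0"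
      using LIMSEQ_ignore_initial_segment[OF forward_average_LIMSEQ[OF u T], of N]
        LIMSEQ_ignore_initial_segment[OF forward_average_LIMSEQ[OF u, of 0], of N]
      by (intro tendsto_diff) auto
    ultimately show ?thesis by simp
  qed
  ultimately show "(LINT t:{0..T}|lborel. v t) = u T - u 0" by (rule LIMSEQ_unique)
qed

locale c0_semigroup =
  fixes S :: "real \<Rightarrow> 'h::{real_inner, polish_space} \<Rightarrow> 'h"
  assumes C0: "C0_semigroup S"
begin

lemma S_lin: "t \<ge> 0 \<Longrightarrow> bounded_linear (S t)"
  and S_0 [simp]: "S 0 x = x"
  and S_add: "s \<ge> 0 \<Longrightarrow> t \<ge> 0 \<Longrightarrow> S (s + t) x = S s (S t x)"
  and S_right: "((\<lambda>t. S t x) \<longlongrightarrow> x) (at_right 0)"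
  using C0 unfolding C0_semigroup_def by auto

lemma S_plus: "t \<ge> 0 \<Longrightarrow> S t (x + y) = S t x + S t y"
  and S_minus: "t \<ge> 0 \<Longrightarrow> S t (x - y) = S t x - S t y"
  and S_scaleR: "t \<ge> 0 \<Longrightarrow> S t (c *\<^sub>R x) = c *\<^sub>R S t x"
  and S_zero: "t \<ge> 0 \<Longrightarrow> S t 0 = 0"
  using S_lin[of t] by (auto simp: bounded_linear.linear linear_add linear_diff linear_scale linear_0)

lemma S_seq_0:
  assumes t: "\<And>n. t n \<ge> 0" "t \<longlonglongrightarrow> 0"
  shows "(\<lambda>n. S (t n) x) \<longlonglongrightarrow> x"
proof (rule LIMSEQ_I)
  fix e :: real assume "e > 0"
  hence "\<forall>\<^sub>F r in at_right 0. dist (S r x) x < e" using S_right[of x] tendstoD by blast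
  then obtain d where d: "d > 0" "\<And>r. 0 < r \<Longrightarrow> r < d \<Longrightarrow> dist (S r x) x < e"
    unfolding eventually_at_right_field by blast
  have "\<forall>\<^sub>F n in sequentially. t n < d" using order_tendstoD(2)[OF t(2) d(1)] .
  then obtain N where N: "\<And>n. n \<ge> N \<Longrightarrow> t n < d" by (auto simp: eventually_sequentially)
  have "norm (S (t n) x - x) < e" if "n \<ge> N" for n
    using d(2)[of "t n"] N[OF that] t(1)[of n] \<open>e > 0\<close> by (cases "t n = 0") (auto simp: dist_norm)
  thus "\<exists>N. \<forall>n\<ge>N. norm (S (t n) x - x) < e" by blast
qed

text \<open>Without a bound near 0 there would be times \<open>t n\<close> tending to 0 that violate
  uniform boundedness, since \<open>S (t n) y\<close> converges for every \<open>y\<close>. The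
  semigroup law then covers any bounded interval.\<close>

lemma S_bound: "\<exists>M\<ge>1. \<forall>t x. 0 \<le> t \<longrightarrow> t \<le> T \<longrightarrow> norm (S t x) \<le> M * norm x"
proof -
  have "\<exists>n::nat. \<forall>t x. 0 \<le> t \<longrightarrow> t \<le> recip n \<longrightarrow> norm (S t x) \<le> real n * norm x"
  proof (rule ccontr)
    assume "\<not> ?thesis"
    hence "\<forall>n::nat. \<exists>t x. 0 \<le> t \<and> t \<le> recip n \<and> real n * norm x < norm (S t x)"
      by (simp add: not_le)
    then obtain t x where tx: "\<And>n::nat. 0 \<le> t n" "\<And>n. t n \<le> recip n"
      "\<And>n. real n * norm (x n) < norm (S (t n) (x n))" by metis
    have t0: "t \<longlonglongrightarrow> 0"
      by (rule tendsto_sandwich[OF _ _ tendsto_const LIMSEQ_Suc[OF lim_1_over_n]]) (use tx in auto)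
    have "\<exists>C. \<forall>n. norm (S (t n) y) \<le> C" for y
      using S_seq_0[OF tx(1) t0, of y] convergent_imp_Bseq[of "\<lambda>n. S (t n) y"] Bseq_eq_bounded
      by (meson BseqE convergentI)
    then obtain M where M: "\<And>n y. norm (S (t n) y) \<le> M * norm y"
      using uniform_boundedness_sequence[of "\<lambda>n. S (t n)"] S_lin[OF tx(1)] by metis
    obtain n :: nat where "M \<le> real n" using real_arch_simple by blast
    hence "M * norm (x n) \<le> real n * norm (x n)" by (intro mult_right_mono) auto
    thus False using M[of n "x n"] tx(3)[of n] by linarith
  qed
  then obtain n0 :: nat where n0: "\<And>t x. 0 \<le> t \<Longrightarrow> t \<le> 1 / real (Suc n0) \<Longrightarrow> norm (S t x) \<le> real n0 * norm x" by blast
  define d M where "d = 1 / real (Suc n0)" and "M = real (Suc n0)"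
  have d: "d > 0" and M: "M \<ge> 1" by (auto simp: d_def M_def)
  have small: "norm (S t x) \<le> M * norm x" if "0 \<le> t" "t \<le> d" for t x
  proof -
    have "real n0 * norm x \<le> M * norm x" unfolding M_def by (intro mult_right_mono) auto
    thus ?thesis using n0[of t x] that unfolding d_def by linarith
  qed
  \<comment> \<open>Steps of length \<open>d\<close> are peeled off one at a time;
    \<open>M \<ge> 1\<close> makes the powers increase, which covers times shorter than one
    step.\<close>
  have step: "norm (S t x) \<le> M ^ (Suc k) * norm x" if "0 \<le> t" "t \<le> real (Suc k) * d" for k t x
    using that
  proof (induction k arbitrary: t)
    case 0 thus ?case using small by simp
  next
    case (Suc k)
    show ?case
    proof (cases "t \<le> d")
      case True
      have "M ^ 1 \<le> M ^ Suc (Suc k)" by (rule power_increasing) (use M in auto)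
      hence "M * norm x \<le> M ^ Suc (Suc k) * norm x" by (intro mult_right_mono) auto
      thus ?thesis using small[OF Suc.prems(1) True, of x] by linarith
    next
      case False
      hence td: "0 \<le> t - d" by simp
      have "S t x = S d (S (t - d) x)" using S_add[of d "t - d" x] d td by simp
      hence "norm (S t x) \<le> M * norm (S (t - d) x)" using small d by simp
      also have "\<dots> \<le> M * (M ^ Suc k * norm x)"
        using Suc.IH[of "t - d"] Suc.prems td M by (intro mult_left_mono) (auto simp: algebra_simps)
      finally show ?thesis by (simp add: mult.assoc)
    qed
  qed
  obtain k :: nat where "T / d \<le> real k" using real_arch_simple by blast
  hence "T \<le> real k * d" using d by (simp add: field_simps)
  also have "\<dots> \<le> real (Suc k) * d" using d by (intro mult_right_mono) auto
  finally have "T \<le> real (Suc k) * d" .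
  hence "\<forall>t x. 0 \<le> t \<longrightarrow> t \<le> T \<longrightarrow> norm (S t x) \<le> M ^ Suc k * norm x" using step by (meson order_trans)
  moreover have "1 \<le> M ^ Suc k" using M by (rule one_le_power)
  ultimately show ?thesis by blast
qed

definition Mb :: "real \<Rightarrow> real" where
  "Mb T = (SOME M. 1 \<le> M \<and> (\<forall>t x. 0 \<le> t \<longrightarrow> t \<le> T \<longrightarrow> norm (S t x) \<le> M * norm x))"

lemma Mb: "1 \<le> Mb T" "0 \<le> t \<Longrightarrow> t \<le> T \<Longrightarrow> norm (S t x) \<le> Mb T * norm x"
  using someI_ex[of "\<lambda>M. 1 \<le> M \<and> (\<forall>t x. 0 \<le> t \<longrightarrow> t \<le> T \<longrightarrow> norm (S t x) \<le> M * norm x)"] S_bound[of T]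
  unfolding Mb_def by auto

lemma Mb_nonneg [simp]: "0 \<le> Mb T" using Mb(1)[of T] by linarith

lemma S_diff_le:
  assumes "0 \<le> s" "s \<le> t" "t \<le> T"
  shows "norm (S t x - S s x) \<le> Mb T * norm (S (t - s) x - x)"
proof -
  have "S t x - S s x = S s (S (t - s) x - x)"
    using S_add[of s "t - s" x] S_minus[of s] assms by simp
  thus ?thesis using Mb(2)[of s T] assms by simp
qed

text \<open>Joint continuity in time and vector. The smaller of \<open>t n\<close> and
  \<open>t0\<close> is factored out, so only \<open>S \<bar>t n - t0\<bar> x0 - x0\<close> remains,
  multiplied by the bound of the semigroup on a common interval.\<close>

lemma S_seq:
  assumes t: "\<And>n. t n \<ge> 0" "t \<longlonglongrightarrow> t0" and x: "x \<longlonglongrightarrow> x0"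
  shows "(\<lambda>n. S (t n) (x n)) \<longlonglongrightarrow> S t0 x0"
proof -
  have t0: "t0 \<ge> 0" using t by (intro LIMSEQ_le_const[OF t(2)]) auto
  have "Bseq t" using convergent_imp_Bseq[of t] t(2) convergent_def by blast
  then obtain T where T: "\<And>n. \<bar>t n\<bar> \<le> T" by (auto simp: Bseq_def)
  hence T0: "t0 \<le> T" by (intro LIMSEQ_le_const2[OF t(2)]) (meson abs_le_D1)
  have le: "norm (S (t n) (x n) - S t0 x0) \<le> Mb T * norm (x n - x0) + Mb T * norm (S \<bar>t n - t0\<bar> x0 - x0)" for n
  proof -
    have "norm (S (t n) x0 - S t0 x0) \<le> Mb T * norm (S \<bar>t n - t0\<bar> x0 - x0)"
    proof (cases "t0 \<le> t n")
      case True
      thus ?thesis using S_diff_le[OF t0 True, of T x0] abs_le_D1[OF T[of n]] by simp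
    next
      case False
      thus ?thesis using S_diff_le[of "t n" t0 T x0] T0 t(1)[of n] by (simp add: abs_if norm_minus_commute)
    qed
    moreover have "norm (S (t n) (x n) - S (t n) x0) \<le> Mb T * norm (x n - x0)"
      using Mb(2)[of "t n" T "x n - x0"] t(1)[of n] T[of n] S_minus[OF t(1)] by (simp add: abs_le_D1)
    ultimately show ?thesis
      using norm_triangle_ineq[of "S (t n) (x n) - S (t n) x0" "S (t n) x0 - S t0 x0"] by simp
  qed
  have "(\<lambda>n. S \<bar>t n - t0\<bar> x0) \<longlonglongrightarrow> x0"
    by (rule S_seq_0) (auto intro!: tendsto_rabs_zero LIM_zero t(2))
  hence "(\<lambda>n. Mb T * norm (x n - x0) + Mb T * norm (S \<bar>t n - t0\<bar> x0 - x0)) \<longlonglongrightarrow> Mb T * norm (x0 - x0) + Mb T * norm (x0 - x0)"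
    by (intro tendsto_intros x)
  hence lim0: "(\<lambda>n. Mb T * norm (x n - x0) + Mb T * norm (S \<bar>t n - t0\<bar> x0 - x0)) \<longlonglongrightarrow> 0" by simp
  have "(\<lambda>n. S (t n) (x n) - S t0 x0) \<longlonglongrightarrow> 0"
    by (intro Lim_null_comparison[OF _ lim0] always_eventually allI le)
  thus ?thesis by (rule LIM_zero_cancel)
qed

lemma S_cont: "continuous_on {0..} (\<lambda>t. S t x)"
  unfolding continuous_on_sequentially by (auto simp: o_def intro!: S_seq)

lemma S_cont' : "A \<subseteq> {0..} \<Longrightarrow> continuous_on A (\<lambda>t. S t x)"
  using continuous_on_subset[OF S_cont] .

lemma S_borel [measurable]: "t \<ge> 0 \<Longrightarrow> S t \<in> bm"
  by (intro borel_measurable_continuous_onI linear_continuous_on S_lin)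

definition Sa :: "real \<Rightarrow> 'h \<Rightarrow> 'h" where "Sa t = hadjoint (S t)"

lemma Sa: "t \<ge> 0 \<Longrightarrow> S t x \<bullet> h = x \<bullet> Sa t h"
  unfolding Sa_def by (rule hadjoint[OF S_lin])

lemma Sa_unique: "t \<ge> 0 \<Longrightarrow> (\<And>x. S t x \<bullet> h = x \<bullet> z) \<Longrightarrow> Sa t h = z"
  using Sa by (metis inner_commute vector_eq_ldot)

lemma Sa_0 [simp]: "Sa 0 h = h" by (rule Sa_unique) auto

lemma Sa_add: "s \<ge> 0 \<Longrightarrow> t \<ge> 0 \<Longrightarrow> Sa (s + t) h = Sa s (Sa t h)"
  by (rule Sa_unique) (auto simp: add.commute[of s t] S_add Sa)

lemma norm_Sa: "0 \<le> t \<Longrightarrow> t \<le> T \<Longrightarrow> norm (Sa t h) \<le> Mb T * norm h"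
proof (rule norm_le_of_inner)
  fix x assume t: "0 \<le> t" "t \<le> T"
  have "x \<bullet> Sa t h = S t x \<bullet> h" using Sa t by simp
  also have "\<dots> \<le> norm (S t x) * norm h" by (rule norm_cauchy_schwarz)
  also have "\<dots> \<le> (Mb T * norm x) * norm h" using Mb(2)[OF t] by (intro mult_right_mono) auto
  finally show "x \<bullet> Sa t h \<le> Mb T * norm h * norm x" by (simp add: mult_ac)
qed simp

lemma Sa_weak_cont: "A \<subseteq> {0..} \<Longrightarrow> continuous_on A (\<lambda>t. x \<bullet> Sa t h)"
proof -
  assume A: "A \<subseteq> {0..}"
  have "continuous_on A (\<lambda>t. S t x \<bullet> h)" by (intro continuous_intros S_cont' A)
  thus ?thesis by (rule continuous_on_eq) (use A Sa in auto)
qed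

lemma Sa_weak_seq:
  assumes "\<And>n. t n \<ge> 0" "t \<longlonglongrightarrow> t0"
  shows "(\<lambda>n. x \<bullet> Sa (t n) h) \<longlonglongrightarrow> x \<bullet> Sa t0 h"
proof -
  have "t0 \<ge> 0" using assms by (intro LIMSEQ_le_const[OF assms(2)]) auto
  thus ?thesis using tendsto_inner[OF S_seq[OF assms tendsto_const] tendsto_const, of x h] assms(1) by (simp add: Sa)
qed

text \<open>The weak integral of \<open>w r *\<^sub>R Sa r k\<close> over \<open>[0, b]\<close>. The
  orbit of the adjoint semigroup enters through its continuous inner products, so the vector comes
  from Riesz representation.\<close>

definition adj_int :: "real \<Rightarrow> (real \<Rightarrow> real) \<Rightarrow> 'h \<Rightarrow> 'h" where
  "adj_int b w k = (SOME z. \<forall>y. y \<bullet> z = integral {0..b} (\<lambda>r. w r * (S r y \<bullet> k)))"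

lemma inner_S_integral_bound:
  assumes b: "b \<ge> 0" and w: "continuous_on {0..b} w" "\<And>r. 0 \<le> r \<Longrightarrow> r \<le> b \<Longrightarrow> \<bar>w r\<bar> \<le> C"
  shows "\<bar>integral {0..b} (\<lambda>r. w r * (S r y \<bullet> k))\<bar> \<le> (C * Mb b * norm k * b) * norm y"
proof -
  have C: "0 \<le> C" using w(2)[of 0] b by linarith
  have "norm (integral (cbox 0 b) (\<lambda>r. w r * (S r y \<bullet> k))) \<le> (C * (Mb b * norm y * norm k)) * measure lborel (cbox 0 b)"
  proof (rule integrable_bound)
    show "(\<lambda>r. w r * (S r y \<bullet> k)) integrable_on cbox 0 b"
      unfolding cbox_interval by (intro integrable_continuous_real continuous_intros S_cont' w) auto
    fix r assume "r \<in> cbox 0 b"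
    hence r: "0 \<le> r" "r \<le> b" by auto
    have "\<bar>S r y \<bullet> k\<bar> \<le> norm (S r y) * norm k" by (rule Cauchy_Schwarz_ineq2)
    also have "\<dots> \<le> Mb b * norm y * norm k" using Mb(2)[OF r] by (intro mult_right_mono) auto
    finally show "norm (w r * (S r y \<bullet> k)) \<le> C * (Mb b * norm y * norm k)"
      using w(2)[OF r] C by (simp add: abs_mult mult_mono)
  qed (use C in auto)
  thus ?thesis using b by (simp add: mult_ac)
qed

lemma adj_int:
  assumes b: "b \<ge> 0" and w: "continuous_on {0..b} w"
  shows "y \<bullet> adj_int b w k = integral {0..b} (\<lambda>r. w r * (S r y \<bullet> k))"
proof -
  have int: "(\<lambda>r. w r * (S r y \<bullet> k)) integrable_on {0..b}" for y
    by (intro integrable_continuous_real continuous_intros S_cont' w) auto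
  have "bounded (w ` {0..b})" by (intro compact_imp_bounded compact_continuous_image w compact_Icc)
  then obtain C where C: "\<And>r. 0 \<le> r \<Longrightarrow> r \<le> b \<Longrightarrow> \<bar>w r\<bar> \<le> C"
    unfolding bounded_iff by force
  have "bounded_linear (\<lambda>y. integral {0..b} (\<lambda>r. w r * (S r y \<bullet> k)))"
  proof (rule bounded_linear_intro)
    fix x y :: 'h and c :: real
    show "integral {0..b} (\<lambda>r. w r * (S r (x + y) \<bullet> k)) =
        integral {0..b} (\<lambda>r. w r * (S r x \<bullet> k)) + integral {0..b} (\<lambda>r. w r * (S r y \<bullet> k))"
      unfolding integral_add[OF int int, symmetric]
      by (rule integral_cong) (simp add: S_plus inner_add_left distrib_left)
    have "integral {0..b} (\<lambda>r. w r * (S r (c *\<^sub>R x) \<bullet> k)) = integral {0..b} (\<lambda>r. c * (w r * (S r x \<bullet> k)))"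
      by (rule integral_cong) (simp add: S_scaleR mult.left_commute)
    thus "integral {0..b} (\<lambda>r. w r * (S r (c *\<^sub>R x) \<bullet> k)) = c *\<^sub>R integral {0..b} (\<lambda>r. w r * (S r x \<bullet> k))"
      by simp
    show "norm (integral {0..b} (\<lambda>r. w r * (S r x \<bullet> k))) \<le> norm x * (C * Mb b * norm k * b)"
      using inner_S_integral_bound[OF b w C, of x k] by (simp add: mult.commute)
  qed
  then obtain z where "\<And>y. integral {0..b} (\<lambda>r. w r * (S r y \<bullet> k)) = y \<bullet> z"
    using riesz_representation by blast
  hence "\<exists>z. \<forall>y. y \<bullet> z = integral {0..b} (\<lambda>r. w r * (S r y \<bullet> k))" by metis
  from someI_ex[OF this] show ?thesis unfolding adj_int_def by blast
qed

lemma norm_adj_int: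
  assumes b: "b \<ge> 0" and w: "continuous_on {0..b} w" "\<And>r. 0 \<le> r \<Longrightarrow> r \<le> b \<Longrightarrow> \<bar>w r\<bar> \<le> C"
  shows "norm (adj_int b w k) \<le> C * Mb b * norm k * b"
proof (rule norm_le_of_inner)
  show "y \<bullet> adj_int b w k \<le> C * Mb b * norm k * b * norm y" for y
    unfolding adj_int[OF b w(1)] using inner_S_integral_bound[OF b w, of y k] by (simp add: abs_le_iff)
  have "0 \<le> C" using w(2)[of 0] b by linarith
  thus "0 \<le> C * Mb b * norm k * b" using b by simp
qed

lemma adj_int_diff:
  assumes b: "b \<ge> 0" and w: "continuous_on {0..b} w" "continuous_on {0..b} w'"
  shows "adj_int b w k - adj_int b w' k = adj_int b (\<lambda>r. w r - w' r) k"
proof -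
  have int: "(\<lambda>r. w r * (S r y \<bullet> k)) integrable_on {0..b}" if "continuous_on {0..b} w" for y w
    by (intro integrable_continuous_real continuous_intros S_cont' that) auto
  have "y \<bullet> (adj_int b w k - adj_int b w' k) = y \<bullet> adj_int b (\<lambda>r. w r - w' r) k" for y
    using int[OF w(1), of y] int[OF w(2), of y]
    by (simp add: inner_diff_right adj_int[OF b] w continuous_on_diff left_diff_distrib integral_diff)
  thus ?thesis using vector_eq_ldot by blast
qed

end

section \<open>The generator, its domain and its adjoint\<close>

locale c0_generator = c0_semigroup S for S :: "real \<Rightarrow> 'h::{real_inner, polish_space} \<Rightarrow> 'h" +
  fixes D :: "'h set" and A :: "'h \<Rightarrow> 'h"
  assumes gen: "generates D A S"
begin

lemma D_iff: "x \<in> D \<longleftrightarrow> (\<exists>y. ((\<lambda>t. (S t x - x) /\<^sub>R t) \<longlongrightarrow> y) (at_right 0))"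
  and D_lim: "x \<in> D \<Longrightarrow> ((\<lambda>t. (S t x - x) /\<^sub>R t) \<longlongrightarrow> A x) (at_right 0)"
  using gen unfolding generates_def by blast+

lemma D_I: "((\<lambda>t. (S t x - x) /\<^sub>R t) \<longlongrightarrow> y) (at_right 0) \<Longrightarrow> x \<in> D \<and> A x = y"
  using D_iff D_lim tendsto_unique[OF trivial_limit_at_right_real] by blast

lemma S_D:
  assumes x: "x \<in> D" and t: "t \<ge> 0"
  shows "S t x \<in> D" "A (S t x) = S t (A x)"
proof -
  have "((\<lambda>s. S t ((S s x - x) /\<^sub>R s)) \<longlongrightarrow> S t (A x)) (at_right 0)"
    by (rule bounded_linear.tendsto[OF S_lin[OF t] D_lim[OF x]])
  moreover have "\<forall>\<^sub>F s in at_right 0. S t ((S s x - x) /\<^sub>R s) = (S s (S t x) - S t x) /\<^sub>R s"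
    unfolding eventually_at_right_field using t S_add[of _ t x] S_add[of t _ x]
    by (intro exI[of _ 1]) (auto simp: S_scaleR S_minus add.commute)
  ultimately have "((\<lambda>s. (S s (S t x) - S t x) /\<^sub>R s) \<longlongrightarrow> S t (A x)) (at_right 0)"
    by (rule Lim_transform_eventually)
  thus "S t x \<in> D" "A (S t x) = S t (A x)" using D_I by blast+
qed

lemma D_seq:
  assumes x: "x \<in> D"
  shows "(\<lambda>n. real (Suc n) *\<^sub>R (S (recip n) x - x)) \<longlonglongrightarrow> A x"
proof -
  have "filterlim (\<lambda>n. recip n) (at_right 0) sequentially"
    unfolding filterlim_at by (auto intro!: LIMSEQ_Suc lim_1_over_n simp del: of_nat_Suc)
  from filterlim_compose[OF D_lim[OF x] this] show ?thesis by simp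
qed

text \<open>The right difference quotient of the orbit at \<open>s\<close> is \<open>S s\<close>
  applied to the quotient at 0. The latter converges and is therefore bounded, so the right
  derivatives can be integrated.\<close>

lemma S_D_integral:
  assumes x: "x \<in> D" and t: "t \<ge> 0"
  shows "S t x \<bullet> y - x \<bullet> y = integral {0..t} (\<lambda>r. S r (A x) \<bullet> y)"
proof -
  define q where "q n = real (Suc n) *\<^sub>R (S (recip n) x - x)" for n
  have q: "q \<longlonglongrightarrow> A x" unfolding q_def by (rule D_seq[OF x])
  have eq: "real (Suc n) * (S (s + recip n) x \<bullet> y - S s x \<bullet> y) = S s (q n) \<bullet> y" if "s \<ge> 0" for n s
    using that S_add[of s "recip n" x] by (simp add: q_def S_scaleR S_minus inner_diff_left)
  have "Bseq q" using q convergent_imp_Bseq convergentI by blast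
  then obtain K where K: "\<And>n. norm (q n) \<le> K" by (auto simp: Bseq_def)
  have bd: "\<bar>real (Suc n) * (S (s + recip n) x \<bullet> y - S s x \<bullet> y)\<bar> \<le> Mb t * K * norm y"
    if "0 \<le> s" "s \<le> t" for n s
  proof -
    have "\<bar>S s (q n) \<bullet> y\<bar> \<le> norm (S s (q n)) * norm y" by (rule Cauchy_Schwarz_ineq2)
    also have "\<dots> \<le> Mb t * K * norm y"
      using Mb(2)[OF that, of "q n"] mult_left_mono[OF K[of n] Mb_nonneg[of t]] by (intro mult_right_mono) auto
    finally show ?thesis using eq that by simp
  qed
  have lim: "(\<lambda>n. real (Suc n) * (S (s + recip n) x \<bullet> y - S s x \<bullet> y)) \<longlonglongrightarrow> S s (A x) \<bullet> y"
    if "0 \<le> s" for s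
    unfolding eq[OF that] by (intro tendsto_intros S_seq) (use that q in auto)
  have "(LINT r:{0..t}|lborel. S r (A x) \<bullet> y) = S t x \<bullet> y - S 0 x \<bullet> y"
    by (rule right_derivative_integral(2)[OF _ t bd lim]) (auto intro!: continuous_intros S_cont')
  moreover have "(LINT r:{0..t}|lborel. S r (A x) \<bullet> y) = integral {0..t} (\<lambda>r. S r (A x) \<bullet> y)"
    by (intro set_borel_integral_eq_integral borel_integrable_atLeastAtMost' continuous_intros S_cont') auto
  ultimately show ?thesis by simp
qed

text \<open>The averages of the orbit of \<open>x\<close> over \<open>[0, b]\<close> lie in
  \<open>D\<close> and tend to \<open>x\<close> as \<open>b\<close> shrinks. The vector-valued
  integrals are represented weakly through Riesz.\<close>

lemma D_dense: "\<exists>xs. (\<forall>n. xs n \<in> D) \<and> xs \<longlonglongrightarrow> x"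
proof -
  have osc: "\<exists>d>0. \<forall>r. 0 \<le> r \<longrightarrow> r < d \<longrightarrow> norm (S r w - w) < e" if "e > 0" for e w
  proof -
    have "\<forall>\<^sub>F r in at_right 0. dist (S r w) w < e" using S_right[of w] tendstoD that by blast
    then obtain d where d: "d > 0" "\<And>r. 0 < r \<Longrightarrow> r < d \<Longrightarrow> dist (S r w) w < e"
      unfolding eventually_at_right_field by blast
    have "norm (S r w - w) < e" if "0 \<le> r" "r < d" for r
      using d(2)[of r] that \<open>e > 0\<close> by (cases "r = 0") (auto simp: dist_norm)
    thus ?thesis using d(1) by blast
  qed
  have int: "(\<lambda>r. S r w \<bullet> y) integrable_on {a..b}" if "a \<ge> 0" for w y a b
    by (intro integrable_continuous_real continuous_intros S_cont') (use that in auto)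
  have avg: "\<exists>z. \<forall>y. y \<bullet> z = integral {0..b} (\<lambda>r. S r w \<bullet> y)" if b: "b > 0" for b w
  proof -
    have "bounded_linear (\<lambda>y. integral {0..b} (\<lambda>r. S r w \<bullet> y))"
    proof (rule bounded_linear_intro)
      fix y y' :: 'h and c :: real
      show "integral {0..b} (\<lambda>r. S r w \<bullet> (y + y')) = integral {0..b} (\<lambda>r. S r w \<bullet> y) + integral {0..b} (\<lambda>r. S r w \<bullet> y')"
        by (simp add: inner_add_right integral_add int)
      show "integral {0..b} (\<lambda>r. S r w \<bullet> (c *\<^sub>R y)) = c *\<^sub>R integral {0..b} (\<lambda>r. S r w \<bullet> y)"
        by simp
      have "norm (integral (cbox 0 b) (\<lambda>r. S r w \<bullet> y)) \<le> (Mb b * norm w * norm y) * measure lborel (cbox 0 b)"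
      proof (rule integrable_bound)
        fix r assume "r \<in> cbox 0 b"
        hence r: "0 \<le> r" "r \<le> b" by auto
        show "norm (S r w \<bullet> y) \<le> Mb b * norm w * norm y"
          using Cauchy_Schwarz_ineq2[of "S r w" y] mult_right_mono[OF Mb(2)[OF r, of w] norm_ge_zero[of y]] by simp
      qed (use int in auto)
      thus "norm (integral {0..b} (\<lambda>r. S r w \<bullet> y)) \<le> norm y * (Mb b * norm w * b)" using b by (simp add: mult_ac)
    qed
    then obtain z where "\<And>y. integral {0..b} (\<lambda>r. S r w \<bullet> y) = y \<bullet> z" using riesz_representation by blast
    thus ?thesis by metis
  qed
  \<comment> \<open>A weak average of vectors within \<open>e\<close> of \<open>w\<close> is itself
    within \<open>e\<close> of \<open>w\<close>. This serves twice: for the convergence of the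
    averages to \<open>x\<close> and for the difference quotients of \<open>z\<close>.\<close>
  have mean_le: "norm (z /\<^sub>R b - w) \<le> e"
    if b: "b > 0" and z: "\<And>y. y \<bullet> z = integral {0..b} (\<lambda>r. u r \<bullet> y)" and e: "e \<ge> 0"
      and u: "continuous_on {0..b} u" and le: "\<And>r. 0 \<le> r \<Longrightarrow> r \<le> b \<Longrightarrow> norm (u r - w) \<le> e"
    for z w :: 'h and b e and u :: "real \<Rightarrow> 'h"
  proof (rule norm_le_of_inner[OF _ e])
    fix y
    have ui: "(\<lambda>r. u r \<bullet> y) integrable_on {0..b}" by (intro integrable_continuous_real continuous_intros u)
    have "norm (integral (cbox 0 b) (\<lambda>r. u r \<bullet> y - w \<bullet> y)) \<le> (e * norm y) * measure lborel (cbox 0 b)"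
    proof (rule integrable_bound)
      show "(\<lambda>r. u r \<bullet> y - w \<bullet> y) integrable_on cbox 0 b"
        unfolding cbox_interval by (intro integrable_diff ui) (auto simp: integrable_const_ivl)
      fix r assume "r \<in> cbox 0 b"
      hence r: "0 \<le> r" "r \<le> b" by auto
      show "norm (u r \<bullet> y - w \<bullet> y) \<le> e * norm y"
        using Cauchy_Schwarz_ineq2[of "u r - w" y] mult_right_mono[OF le[OF r] norm_ge_zero[of y]]
        by (simp add: inner_diff_left)
    qed (use e in auto)
    moreover have "integral (cbox 0 b) (\<lambda>r. u r \<bullet> y - w \<bullet> y) = b * (y \<bullet> (z /\<^sub>R b - w))"
    proof -
      have "integral {0..b} (\<lambda>r. u r \<bullet> y - w \<bullet> y) = integral {0..b} (\<lambda>r. u r \<bullet> y) - b * (w \<bullet> y)"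
        using b ui by (simp add: integral_diff integrable_const_ivl)
      also have "\<dots> = y \<bullet> z - b * (y \<bullet> w)" by (simp only: z inner_commute[of w y])
      also have "\<dots> = b * (y \<bullet> (z /\<^sub>R b - w))" using b by (simp add: inner_diff_right right_diff_distrib)
      finally show ?thesis by simp
    qed
    ultimately have "b * (y \<bullet> (z /\<^sub>R b - w)) \<le> b * (e * norm y)" using b by (simp add: abs_le_iff mult.commute)
    thus "y \<bullet> (z /\<^sub>R b - w) \<le> e * norm y" using b by simp
  qed
  \<comment> \<open>\<open>S t z - z\<close> is the integral of the orbit over
    \<open>[b, b + t]\<close> minus that over \<open>[0, t]\<close>, that is, the integral over
    \<open>[0, t]\<close> of the orbit of \<open>S b x - x\<close>; its mean tends to
    \<open>S b x - x\<close>.\<close>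
  have mem: "z \<in> D" if b: "b > 0" and z: "\<And>y. y \<bullet> z = integral {0..b} (\<lambda>r. S r x \<bullet> y)" for z b
  proof -
    have "((\<lambda>t. (S t z - z) /\<^sub>R t) \<longlongrightarrow> S b x - x) (at_right 0)"
      unfolding tendsto_iff
    proof (intro allI impI)
      fix e :: real assume e: "e > 0"
      obtain d where d: "d > 0" "\<And>r. 0 \<le> r \<Longrightarrow> r < d \<Longrightarrow> norm (S r (S b x - x) - (S b x - x)) < e / 2"
        using osc[of "e / 2" "S b x - x"] e by auto
      have "dist ((S t z - z) /\<^sub>R t) (S b x - x) < e" if t: "0 < t" "t < d" for t
      proof -
        have "norm ((S t z - z) /\<^sub>R t - (S b x - x)) \<le> e / 2"
        proof (rule mean_le[OF t(1), where u="\<lambda>r. S r (S b x - x)"])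
          show "continuous_on {0..t} (\<lambda>r. S r (S b x - x))" by (intro S_cont') auto
          show "norm (S r (S b x - x) - (S b x - x)) \<le> e / 2" if "0 \<le> r" "r \<le> t" for r
            using d(2)[of r] that t by simp
          fix y
          have "y \<bullet> S t z = z \<bullet> Sa t y" using Sa[of t z y] t by (simp add: inner_commute)
          also have "\<dots> = integral {0..b} (\<lambda>r. S r x \<bullet> Sa t y)" using z[of "Sa t y"] by (simp add: inner_commute)
          also have "\<dots> = integral {0..b} (\<lambda>r. S (r + t) x \<bullet> y)"
            using t S_add[of t] by (intro integral_cong) (simp add: Sa[symmetric] add.commute)
          also have "\<dots> = integral {t..b + t} (\<lambda>r. S r x \<bullet> y)"
          proof -
            have "integral {t..b + t} (\<lambda>r. S r x \<bullet> y) = integral {t - t..b + t - t} (\<lambda>r. S (r + t) x \<bullet> y)"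
              by (rule integral_shift_real_ivl[symmetric])
            thus ?thesis by simp
          qed
          finally have 1: "y \<bullet> S t z = integral {t..b + t} (\<lambda>r. S r x \<bullet> y)" .
          have 2: "integral {0..t} (\<lambda>r. S r x \<bullet> y) + integral {t..b + t} (\<lambda>r. S r x \<bullet> y) = integral {0..b + t} (\<lambda>r. S r x \<bullet> y)"
            by (rule Henstock_Kurzweil_Integration.integral_combine) (use b t int in auto)
          have 3: "integral {0..b} (\<lambda>r. S r x \<bullet> y) + integral {b..b + t} (\<lambda>r. S r x \<bullet> y) = integral {0..b + t} (\<lambda>r. S r x \<bullet> y)"
            by (rule Henstock_Kurzweil_Integration.integral_combine) (use b t int in auto)
          have "integral {b..b + t} (\<lambda>r. S r x \<bullet> y) = integral {b - b..b + t - b} (\<lambda>r. S (r + b) x \<bullet> y)"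
            by (rule integral_shift_real_ivl[symmetric])
          also have "{b - b..b + t - b} = {0..t}" by simp
          also have "integral {0..t} (\<lambda>r. S (r + b) x \<bullet> y) = integral {0..t} (\<lambda>r. S r (S b x) \<bullet> y)"
            by (rule Henstock_Kurzweil_Integration.integral_cong) (use b S_add[of _ b x] in auto)
          finally have 4: "integral {b..b + t} (\<lambda>r. S r x \<bullet> y) = integral {0..t} (\<lambda>r. S r (S b x) \<bullet> y)" .
          have "integral {0..t} (\<lambda>r. S r (S b x - x) \<bullet> y) = integral {0..t} (\<lambda>r. S r (S b x) \<bullet> y - S r x \<bullet> y)"
            by (intro integral_cong) (simp add: S_minus inner_diff_left)
          also have "\<dots> = integral {0..t} (\<lambda>r. S r (S b x) \<bullet> y) - integral {0..t} (\<lambda>r. S r x \<bullet> y)"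
            by (intro integral_diff int) auto
          finally show "y \<bullet> (S t z - z) = integral {0..t} (\<lambda>r. S r (S b x - x) \<bullet> y)"
            using 1 2 3 4 z[of y] by (simp add: inner_diff_right)
        qed (use e in auto)
        thus ?thesis using e by (simp add: dist_norm)
      qed
      thus "\<forall>\<^sub>F t in at_right 0. dist ((S t z - z) /\<^sub>R t) (S b x - x) < e"
        unfolding eventually_at_right_field using d(1) by (intro exI[of _ d]) auto
    qed
    thus ?thesis using D_I by blast
  qed
  have Dscale: "c *\<^sub>R z \<in> D" if "z \<in> D" for c z
  proof -
    have "((\<lambda>t. c *\<^sub>R ((S t z - z) /\<^sub>R t)) \<longlongrightarrow> c *\<^sub>R A z) (at_right 0)" by (intro tendsto_intros D_lim that)
    moreover have "\<forall>\<^sub>F t in at_right 0. c *\<^sub>R ((S t z - z) /\<^sub>R t) = (S t (c *\<^sub>R z) - c *\<^sub>R z) /\<^sub>R t"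
      unfolding eventually_at_right_field by (intro exI[of _ 1]) (auto simp: S_scaleR scaleR_diff_right mult.commute)
    ultimately have "((\<lambda>t. (S t (c *\<^sub>R z) - c *\<^sub>R z) /\<^sub>R t) \<longlongrightarrow> c *\<^sub>R A z) (at_right 0)"
      by (rule Lim_transform_eventually)
    thus ?thesis using D_I by blast
  qed
  have "\<exists>z\<in>D. norm (z - x) \<le> recip n" for n
  proof -
    obtain d where d: "d > 0" "\<And>r. 0 \<le> r \<Longrightarrow> r < d \<Longrightarrow> norm (S r x - x) < recip n"
      using osc[of "recip n" x] by auto
    define b where "b = d / 2"
    have b: "b > 0" "b < d" using d(1) by (auto simp: b_def)
    from avg[OF b(1), of x] obtain z where "\<forall>y. y \<bullet> z = integral {0..b} (\<lambda>r. S r x \<bullet> y)" ..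
    hence z: "y \<bullet> z = integral {0..b} (\<lambda>r. S r x \<bullet> y)" for y by (rule spec)
    have "norm (z /\<^sub>R b - x) \<le> recip n"
    proof (rule mean_le[OF b(1) z])
      show "continuous_on {0..b} (\<lambda>r. S r x)" by (rule S_cont') auto
      show "norm (S r x - x) \<le> recip n" if "0 \<le> r" "r \<le> b" for r
        using d(2)[of r] that b by simp
    qed simp
    thus ?thesis using Dscale[OF mem[OF b(1) z]] by (rule bexI)
  qed
  then obtain xs where xs: "\<And>n. xs n \<in> D" "\<And>n. norm (xs n - x) \<le> recip n" by metis
  have "(\<lambda>n. xs n - x) \<longlonglongrightarrow> 0"
    by (rule Lim_null_comparison[OF always_eventually LIMSEQ_Suc[OF lim_1_over_n]]) (use xs(2) in blast)
  hence "xs \<longlonglongrightarrow> x" by (rule LIM_zero_cancel)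
  thus ?thesis using xs(1) by blast
qed

lemma D_inner_eqI:
  assumes "\<And>x. x \<in> D \<Longrightarrow> x \<bullet> y = x \<bullet> z"
  shows "y = z"
proof -
  have "x \<bullet> y = x \<bullet> z" for x
  proof -
    obtain xs where xs: "\<And>n. xs n \<in> D" "xs \<longlonglongrightarrow> x" using D_dense by blast
    have "(\<lambda>n. xs n \<bullet> y) \<longlonglongrightarrow> x \<bullet> y" "(\<lambda>n. xs n \<bullet> z) \<longlonglongrightarrow> x \<bullet> z" by (intro tendsto_intros xs)+
    thus ?thesis using assms[OF xs(1)] LIMSEQ_unique by simp
  qed
  thus ?thesis using vector_eq_ldot by blast
qed

abbreviation "Ds \<equiv> adj_dom D A"
abbreviation "As \<equiv> adj_op D A"

text \<open>Density of \<open>D\<close> makes the vector in the definite description of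
  \<open>adj_op\<close> unique.\<close>

lemma adj_I:
  assumes "\<And>x. x \<in> D \<Longrightarrow> A x \<bullet> y = x \<bullet> z"
  shows "y \<in> Ds" "As y = z"
proof -
  show "y \<in> Ds" using assms unfolding adj_dom_def by blast
  show "As y = z" unfolding adj_op_def
  proof (rule the_equality)
    show "\<forall>x\<in>D. A x \<bullet> y = x \<bullet> z" using assms by blast
    fix z' assume z': "\<forall>x\<in>D. A x \<bullet> y = x \<bullet> z'"
    show "z' = z" by (rule D_inner_eqI) (use z' assms in auto)
  qed
qed

lemma As: "h \<in> Ds \<Longrightarrow> x \<in> D \<Longrightarrow> A x \<bullet> h = x \<bullet> As h"
  using adj_I(2) unfolding adj_dom_def by blast


text \<open>For \<open>x\<close> in \<open>D\<close> this is the integral formula for the orbit with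
  \<open>A\<close> moved to \<open>h\<close>. Both sides are inner products of \<open>x\<close> with
  fixed vectors, so density of \<open>D\<close> gives the formula for all \<open>x\<close>.\<close>

lemma S_Ds_integral:
  assumes h: "h \<in> Ds" and t: "t \<ge> 0"
  shows "S t x \<bullet> h - x \<bullet> h = integral {0..t} (\<lambda>r. S r x \<bullet> As h)"
proof -
  let ?I = "\<lambda>x. integral {0..t} (\<lambda>r. 1 * (S r x \<bullet> As h))"
  have I: "?I x = x \<bullet> adj_int t (\<lambda>_. 1) (As h)" for x
    by (rule adj_int[symmetric]) (use t in auto)
  have D: "x \<bullet> (Sa t h - h) = x \<bullet> adj_int t (\<lambda>_. 1) (As h)" if "x \<in> D" for x
  proof -
    have "S r (A x) \<bullet> h = S r x \<bullet> As h" if "r \<ge> 0" for r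
      using As[OF h S_D(1)[OF \<open>x \<in> D\<close> that]] S_D(2)[OF \<open>x \<in> D\<close> that] by simp
    hence "integral {0..t} (\<lambda>r. S r (A x) \<bullet> h) = ?I x" by (intro integral_cong) auto
    thus ?thesis using S_D_integral[OF that t, of h] I[of x] Sa[OF t, of x h] by (simp add: inner_diff_right)
  qed
  have "Sa t h - h = adj_int t (\<lambda>_. 1) (As h)" by (rule D_inner_eqI[OF D])
  hence "x \<bullet> (Sa t h - h) = ?I x" by (simp only: I)
  thus ?thesis using Sa[OF t, of x h] by (simp add: inner_diff_right)
qed



lemma adj_int_Ds:
  assumes h: "h \<in> Ds" and b: "b \<ge> 0" and w: "continuous_on {0..b} w"
  shows "adj_int b w h \<in> Ds" "As (adj_int b w h) = adj_int b w (As h)"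
proof -
  have "A x \<bullet> adj_int b w h = x \<bullet> adj_int b w (As h)" if "x \<in> D" for x
  proof -
    have "S r (A x) \<bullet> h = S r x \<bullet> As h" if "r \<ge> 0" for r
      using As[OF h S_D(1)[OF \<open>x \<in> D\<close> that]] S_D(2)[OF \<open>x \<in> D\<close> that] by simp
    thus ?thesis unfolding adj_int[OF b w] by (intro integral_cong) auto
  qed
  thus "adj_int b w h \<in> Ds" "As (adj_int b w h) = adj_int b w (As h)" using adj_I by blast+
qed

text \<open>Weak density suffices below, as \<open>h \<mapsto> \<integral> exp (i \<langle>x, h\<rangle>) d\<gamma>\<close> is weakly sequentially continuous.\<close>

lemma Ds_weakly_dense:
  "\<exists>hs C. (\<forall>n. hs n \<in> Ds) \<and> (\<forall>n. norm (hs n) \<le> C) \<and> (\<forall>x. (\<lambda>n. x \<bullet> hs n) \<longlonglongrightarrow> x \<bullet> h)"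
proof (intro exI conjI allI)
  let ?b = "\<lambda>n. recip n"
  let ?h = "\<lambda>n. adj_int (?b n) (\<lambda>_. real (Suc n)) h"
  show "?h n \<in> Ds" for n
  \<comment> \<open>Averaging the adjoint orbit over \<open>[0, 1/(n+1)]\<close> integrates
    \<open>A\<close> away: the adjoint generator maps the average to the difference quotient of
    \<open>Sa\<close> at \<open>h\<close>.\<close>
  proof (rule adj_I(1)[where z="real (Suc n) *\<^sub>R (Sa (?b n) h - h)"])
    fix x assume x: "x \<in> D"
    have "A x \<bullet> ?h n = real (Suc n) * integral {0..?b n} (\<lambda>r. S r (A x) \<bullet> h)"
      by (subst adj_int) auto
    also have "integral {0..?b n} (\<lambda>r. S r (A x) \<bullet> h) = S (?b n) x \<bullet> h - x \<bullet> h"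
      by (rule S_D_integral[OF x, symmetric]) simp
    finally show "A x \<bullet> ?h n = x \<bullet> (real (Suc n) *\<^sub>R (Sa (?b n) h - h))"
      by (simp add: inner_diff_right Sa)
  qed
  show "norm (?h n) \<le> Mb 1 * norm h" for n
  proof (rule norm_le_of_inner)
    fix x
    have "x \<bullet> ?h n = real (Suc n) * integral {0..?b n} (\<lambda>r. S r x \<bullet> h)" by (subst adj_int) auto
    also have "integral {0..?b n} (\<lambda>r. S r x \<bullet> h) \<le> norm (integral (cbox 0 (?b n)) (\<lambda>r. S r x \<bullet> h))" by simp
    also have "norm (integral (cbox 0 (?b n)) (\<lambda>r. S r x \<bullet> h)) \<le> (Mb 1 * norm x * norm h) * measure lborel (cbox 0 (?b n))"
    proof (rule integrable_bound)
      show "(\<lambda>r. S r x \<bullet> h) integrable_on cbox 0 (?b n)"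
        unfolding cbox_interval by (intro integrable_continuous_real continuous_intros S_cont') auto
      fix r assume "r \<in> cbox 0 (?b n)"
      hence r: "0 \<le> r" "r \<le> ?b n" by auto
      have "?b n \<le> 1" by simp
      hence r1: "r \<le> 1" using r(2) by linarith
      show "norm (S r x \<bullet> h) \<le> Mb 1 * norm x * norm h"
        using Cauchy_Schwarz_ineq2[of "S r x" h] mult_right_mono[OF Mb(2)[OF r(1) r1, of x] norm_ge_zero[of h]] by simp
    qed auto
    finally show "x \<bullet> ?h n \<le> Mb 1 * norm h * norm x" by (simp add: mult_ac)
  qed simp
  show "(\<lambda>n. x \<bullet> ?h n) \<longlonglongrightarrow> x \<bullet> h" for x
  proof -
    have "x \<bullet> ?h n = real (Suc n) * integral {0..0 + ?b n} (\<lambda>r. S r x \<bullet> h)" for n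
      by (subst adj_int) auto
    moreover have "(\<lambda>n. real (Suc n) * integral {0..0 + ?b n} (\<lambda>r. S r x \<bullet> h)) \<longlonglongrightarrow> S 0 x \<bullet> h"
      by (rule forward_average_LIMSEQ) (auto intro!: continuous_intros S_cont')
    ultimately show ?thesis by simp
  qed
qed

end

section \<open>The Levy exponent and the law of the stochastic convolution\<close>

lemma suminf_dominated:
  fixes a :: "nat \<Rightarrow> nat \<Rightarrow> 'a::{real_normed_algebra, banach}"
  assumes "\<And>k. (\<lambda>n. a n k) \<longlonglongrightarrow> b k" "\<And>n k. norm (a n k) \<le> w k" "summable w"
  shows "(\<lambda>n. \<Sum>k. a n k) \<longlonglongrightarrow> (\<Sum>k. b k)"
  using tannerys_theorem[of "\<lambda>k n. a n k" b sequentially w] assms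
  by (auto intro: always_eventually)

lemma iexp_minus_1_bounds:
  "cmod (iexp x - 1) \<le> \<bar>x\<bar>" "cmod (iexp x - 1 - \<i> * of_real x) \<le> x\<^sup>2" "cmod (iexp x - 1) \<le> 2"
proof -
  show "cmod (iexp x - 1) \<le> \<bar>x\<bar>" using iexp_approx1[of x 0] by simp
  have "cmod (iexp x - 1 - \<i> * of_real x) \<le> \<bar>x\<bar>\<^sup>2 / 2"
    using iexp_approx1[of x 1] by (simp add: numeral_2_eq_2 diff_diff_eq)
  also have "\<dots> \<le> x\<^sup>2" by simp
  finally show "cmod (iexp x - 1 - \<i> * of_real x) \<le> x\<^sup>2" .
  show "cmod (iexp x - 1) \<le> 2" using norm_triangle_ineq4[of "iexp x" 1] by simp
qed

lemma cmod_iexp_diff: "cmod (iexp x - iexp y) \<le> \<bar>x - y\<bar>"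
proof -
  have "iexp x - iexp y = iexp y * (iexp (x - y) - 1)"
    by (simp add: algebra_simps flip: exp_add)
  thus ?thesis using iexp_minus_1_bounds(1)[of "x - y"] by (simp add: norm_mult)
qed

lemma partition_integral:
  fixes g :: "real \<Rightarrow> 'a::banach"
  assumes g: "continuous_on {0..t} g" and N: "N > 0" and t: "t \<ge> 0" and m: "m \<le> N"
  shows "integral {0..t * real m / real N} g = (\<Sum>k<m. integral {t * real k / real N..t * real (Suc k) / real N} g)"
  using m
proof (induction m)
  case (Suc m)
  have le: "t * real m / real N \<le> t * real (Suc m) / real N" "t * real (Suc m) / real N \<le> t"
    using t N Suc.prems by (auto intro!: divide_right_mono mult_left_mono simp: divide_le_eq)
  have "integral {0..t * real m / real N} g + integral {t * real m / real N..t * real (Suc m) / real N} g =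
     integral {0..t * real (Suc m) / real N} g"
  proof (rule Henstock_Kurzweil_Integration.integral_combine)
    show "g integrable_on {0..t * real (Suc m) / real N}"
      by (intro integrable_continuous_real continuous_on_subset[OF g]) (use le in auto)
  qed (use le t in auto)
  thus ?case using Suc by simp
qed simp

lemma riemann_sum_LIMSEQ:
  fixes g :: "real \<Rightarrow> 'a::banach"
  assumes g: "continuous_on {0..t} g" and t: "t \<ge> 0"
  shows "(\<lambda>n. \<Sum>k<Suc n. (t / real (Suc n)) *\<^sub>R g (t * real k / real (Suc n))) \<longlonglongrightarrow> integral {0..t} g"
proof (rule LIMSEQ_I)
  fix e :: real assume e: "e > 0"
  define e' where "e' = e / (t + 1)"
  have e': "e' > 0" using e t by (simp add: e'_def)
  have "uniformly_continuous_on {0..t} g" by (rule compact_uniformly_continuous[OF g compact_Icc])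
  then obtain d where d: "d > 0" "\<And>r s. r \<in> {0..t} \<Longrightarrow> s \<in> {0..t} \<Longrightarrow> dist r s < d \<Longrightarrow> dist (g r) (g s) < e'"
    unfolding uniformly_continuous_on_def using e' by metis
  obtain N :: nat where N: "t / d < real N" using reals_Archimedean2 by blast
  have "norm ((\<Sum>k<Suc n. (t / real (Suc n)) *\<^sub>R g (t * real k / real (Suc n))) - integral {0..t} g) < e"
    if n: "n \<ge> N" for n
  proof -
    define m where "m = Suc n"
    have m: "m > 0" "t / real m < d"
    proof -
      have "t / d < real m" using N n by (simp add: m_def)
      thus "t / real m < d" using d(1) by (simp add: m_def field_simps)
    qed (simp add: m_def)
    have piece: "norm ((t / real m) *\<^sub>R g (t * real k / real m) - integral {t * real k / real m..t * real (Suc k) / real m} g) \<le> e' * (t / real m)"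
      if k: "k < m" for k
    proof -
      let ?a = "t * real k / real m" and ?b = "t * real (Suc k) / real m"
      have b: "?b = ?a + t / real m" using m by (simp add: field_simps)
      have "t * real (Suc k) \<le> t * real m" using k t by (intro mult_left_mono) auto
      hence ab: "0 \<le> ?a" "?a \<le> ?b" "?b \<le> t" "?b - ?a = t / real m"
        using m(1) t b pos_divide_le_eq[of "real m" "t * real (Suc k)" t] by simp_all
      have int: "g integrable_on {?a..?b}"
        by (intro integrable_continuous_real continuous_on_subset[OF g]) (use ab in auto)
      have "norm (integral (cbox ?a ?b) (\<lambda>s. g s - g ?a)) \<le> e' * measure lborel (cbox ?a ?b)"
      proof (rule integrable_bound)
        show "(\<lambda>s. g s - g ?a) integrable_on cbox ?a ?b"
          using int by (intro integrable_diff) (auto simp: integrable_const_ivl)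
        show "norm (g s - g ?a) \<le> e'" if "s \<in> cbox ?a ?b" for s
          using d(2)[of s ?a] that ab m(2) by (simp add: dist_norm less_imp_le)
      qed (use e' in simp)
      moreover have "integral (cbox ?a ?b) (\<lambda>s. g s - g ?a) = integral {?a..?b} g - (t / real m) *\<^sub>R g ?a"
        using int ab(2,4) by (simp add: integral_diff integrable_const_ivl)
      moreover have "measure lborel (cbox ?a ?b) = t / real m" using ab by simp
      ultimately show ?thesis by (simp add: norm_minus_commute)
    qed
    have "integral {0..t} g = (\<Sum>k<m. integral {t * real k / real m..t * real (Suc k) / real m} g)"
      using partition_integral[OF g m(1) t order_refl] m(1) by simp
    hence "norm ((\<Sum>k<m. (t / real m) *\<^sub>R g (t * real k / real m)) - integral {0..t} g) =
      norm (\<Sum>k<m. (t / real m) *\<^sub>R g (t * real k / real m) - integral {t * real k / real m..t * real (Suc k) / real m} g)"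
      by (simp add: sum_subtractf)
    also have "\<dots> \<le> (\<Sum>k<m. e' * (t / real m))" by (intro sum_norm_le piece) auto
    also have "\<dots> = e' * t" using m(1) by simp
    also have "\<dots> < e" using e t by (simp add: e'_def field_simps)
    finally show ?thesis by (simp add: m_def)
  qed
  thus "\<exists>N. \<forall>n\<ge>N. norm ((\<Sum>k<Suc n. (t / real (Suc n)) *\<^sub>R g (t * real k / real (Suc n))) - integral {0..t} g) < e"
    by blast
qed

locale ou_setting = c0_generator S D A
  for S :: "real \<Rightarrow> 'h::{real_inner, polish_space} \<Rightarrow> 'h" and D A +
  fixes Q :: "'h \<Rightarrow> 'h" and a :: 'h and \<nu> :: "'h measure"
    and M :: "'w measure" and Z Y :: "real \<Rightarrow> 'w \<Rightarrow> 'h"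
  assumes Q_sym: "nonneg_symmetric Q" and Q_trace: "trace_class Q"
    and jump: "jump_measure \<nu>"
    and levy: "levy_process M Z"
    and levy_char: "\<And>t h. t \<ge> 0 \<Longrightarrow>
           (LINT \<omega>|M. exp (\<i> * of_real (Z t \<omega> \<bullet> h))) = exp (- of_real t * levy_exponent Q a \<nu> h)"
    and conv: "stochastic_convolution M S Z Y"
begin

abbreviation "\<psi> \<equiv> levy_exponent Q a \<nu>"

text \<open>A fixed nuclear representation of \<open>Q\<close>. It turns traces involving
  \<open>Q\<close> into absolutely convergent series whose majorant depends on operator norms only,
  which suits dominated convergence.\<close>

definition uv :: "(nat \<Rightarrow> 'h) \<times> (nat \<Rightarrow> 'h)" where
  "uv = (SOME p. summable (\<lambda>k. norm (fst p k) * norm (snd p k)) \<and>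
     (\<forall>x. (\<lambda>k. (fst p k \<bullet> x) *\<^sub>R snd p k) sums Q x))"

definition "qu = fst uv"
definition "qv = snd uv"

lemma quv: "summable (\<lambda>k. norm (qu k) * norm (qv k))" "(\<lambda>k. (qu k \<bullet> x) *\<^sub>R qv k) sums Q x"
proof -
  have "\<exists>p. summable (\<lambda>k. norm (fst p k) * norm (snd p k)) \<and> (\<forall>x. (\<lambda>k. (fst p k \<bullet> x) *\<^sub>R snd p k) sums Q x)"
    using Q_trace unfolding trace_class_def by simp
  from someI_ex[OF this] show "summable (\<lambda>k. norm (qu k) * norm (qv k))" "(\<lambda>k. (qu k \<bullet> x) *\<^sub>R qv k) sums Q x"
    unfolding qu_def qv_def uv_def by blast+
qed

lemma Q_inner_sums: "(\<lambda>k. (qu k \<bullet> x) * (qv k \<bullet> y)) sums (Q x \<bullet> y)"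
  using bounded_linear.sums[OF bounded_linear_inner_left quv(2)[of x], of y] by simp

lemma \<nu>_sets [measurable_cong, simp]: "sets \<nu> = sets borel"
  and \<nu>_sigma: "sigma_finite_measure \<nu>"
  and \<nu>_int: "integrable \<nu> (\<lambda>y. min 1 ((norm y)\<^sup>2))"
  using jump unfolding jump_measure_def by auto

definition trunc :: "'h \<Rightarrow> real" where "trunc y = indicator {y. norm y \<le> 1} y"

lemma trunc_measurable [measurable]: "trunc \<in> bm"
  unfolding trunc_def by measurable

lemma trunc_simps: "norm y \<le> 1 \<Longrightarrow> trunc y = 1" "1 < norm y \<Longrightarrow> trunc y = 0"
  by (auto simp: trunc_def)

definition lev :: "'h \<Rightarrow> 'h \<Rightarrow> complex" where
  "lev h y = iexp (h \<bullet> y) - 1 - \<i> * of_real (h \<bullet> y) * of_real (trunc y)"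

lemma psi_eq: "\<psi> h = of_real (1/2 * (\<Sum>k. (qu k \<bullet> h) * (qv k \<bullet> h))) - \<i> * of_real (a \<bullet> h) - (LINT y|\<nu>. lev h y)"
  unfolding levy_exponent_def lev_def trunc_def sums_unique[OF Q_inner_sums, symmetric] by simp

lemma lev_measurable [measurable]: "lev h \<in> bm"
  unfolding lev_def by measurable

lemma min1_sq: "norm y \<le> 1 \<Longrightarrow> min 1 ((norm y)\<^sup>2) = (norm (y::'h))\<^sup>2" "1 < norm y \<Longrightarrow> min 1 ((norm y)\<^sup>2) = 1"
  using power_le_one[of "norm y" 2] one_le_power[of "norm y" 2] by (auto simp: min_def)

text \<open>For small \<open>y\<close> the second order Taylor remainder gives
  \<open>C\<^sup>2\<close>; for large \<open>y\<close> the compensator is absent and 2 bounds the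
  rest.\<close>

lemma lev_bound:
  assumes "norm h \<le> C" shows "cmod (lev h y) \<le> (2 + C\<^sup>2) * min 1 ((norm y)\<^sup>2)"
proof (cases "norm y \<le> 1")
  case True
  have "\<bar>h \<bullet> y\<bar> \<le> C * norm y"
    using Cauchy_Schwarz_ineq2[of h y] mult_right_mono[OF assms norm_ge_zero[of y]] by linarith
  hence "\<bar>h \<bullet> y\<bar>\<^sup>2 \<le> (C * norm y)\<^sup>2" by (intro power_mono) auto
  hence "(h \<bullet> y)\<^sup>2 \<le> C\<^sup>2 * (norm y)\<^sup>2" by (simp add: power_mult_distrib)
  also have "\<dots> \<le> (2 + C\<^sup>2) * (norm y)\<^sup>2" by (intro mult_right_mono) auto
  finally show ?thesis
    using iexp_minus_1_bounds(2)[of "h \<bullet> y"] True by (simp add: lev_def trunc_simps min1_sq)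
next
  case False
  thus ?thesis using iexp_minus_1_bounds(3)[of "h \<bullet> y"] zero_le_power2[of C]
    by (simp add: lev_def trunc_simps min1_sq add_increasing2)
qed

lemma lev_integrable: "integrable \<nu> (lev h)"
  by (rule Bochner_Integration.integrable_bound[OF integrable_mult_right[OF \<nu>_int, of "2 + (norm h)\<^sup>2"]])
    (use lev_bound[of h "norm h"] in auto)

text \<open>This replaces strong continuity of the adjoint semigroup throughout.\<close>

lemma psi_weak_seq:
  assumes b: "\<And>n. norm (hs n) \<le> C" and w: "\<And>x. (\<lambda>n. x \<bullet> hs n) \<longlonglongrightarrow> x \<bullet> h"
  shows "(\<lambda>n. \<psi> (hs n)) \<longlonglongrightarrow> \<psi> h"
  unfolding psi_eq
proof (intro tendsto_diff tendsto_of_real tendsto_mult tendsto_const w)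
  \<comment> \<open>Nuclearity yields weak sequential continuity of the quadratic form: each term
    converges along the weakly convergent sequence, with a summable majorant.\<close>
  show "(\<lambda>n. \<Sum>k. (qu k \<bullet> hs n) * (qv k \<bullet> hs n)) \<longlonglongrightarrow> (\<Sum>k. (qu k \<bullet> h) * (qv k \<bullet> h))"
  proof (rule suminf_dominated)
    show "(\<lambda>n. (qu k \<bullet> hs n) * (qv k \<bullet> hs n)) \<longlonglongrightarrow> (qu k \<bullet> h) * (qv k \<bullet> h)" for k
      by (intro tendsto_mult w)
    show "norm ((qu k \<bullet> hs n) * (qv k \<bullet> hs n)) \<le> (norm (qu k) * norm (qv k)) * C\<^sup>2" for n k
    proof -
      have "\<bar>qu k \<bullet> hs n\<bar> \<le> norm (qu k) * C" "\<bar>qv k \<bullet> hs n\<bar> \<le> norm (qv k) * C"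
        using Cauchy_Schwarz_ineq2[of "qu k" "hs n"] mult_left_mono[OF b[of n] norm_ge_zero[of "qu k"]]
         Cauchy_Schwarz_ineq2[of "qv k" "hs n"] mult_left_mono[OF b[of n] norm_ge_zero[of "qv k"]] by linarith+
      hence "\<bar>qu k \<bullet> hs n\<bar> * \<bar>qv k \<bullet> hs n\<bar> \<le> (norm (qu k) * C) * (norm (qv k) * C)"
        by (intro mult_mono) auto
      thus ?thesis by (simp add: abs_mult power2_eq_square mult_ac)
    qed
    show "summable (\<lambda>k. (norm (qu k) * norm (qv k)) * C\<^sup>2)" by (intro summable_mult2 quv)
  qed
  show "(\<lambda>n. LINT y|\<nu>. lev (hs n) y) \<longlonglongrightarrow> (LINT y|\<nu>. lev h y)"
  proof (rule integral_dominated_convergence)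
    show "integrable \<nu> (\<lambda>y. (2 + C\<^sup>2) * min 1 ((norm y)\<^sup>2))" using \<nu>_int by simp
    show "AE y in \<nu>. (\<lambda>n. lev (hs n) y) \<longlonglongrightarrow> lev h y"
    proof (rule AE_I2)
      fix y
      have "(\<lambda>n. hs n \<bullet> y) \<longlonglongrightarrow> h \<bullet> y" using w[of y] by (simp add: inner_commute)
      thus "(\<lambda>n. lev (hs n) y) \<longlonglongrightarrow> lev h y"
        unfolding lev_def by (intro tendsto_diff tendsto_mult tendsto_exp tendsto_of_real tendsto_const)
    qed
    show "AE y in \<nu>. norm (lev (hs n) y) \<le> (2 + C\<^sup>2) * min 1 ((norm y)\<^sup>2)" for n
      using lev_bound[OF b[of n]] by simp
  qed (use lev_integrable in auto)
qed

lemma psi_Sa_cont: "B \<subseteq> {0..} \<Longrightarrow> continuous_on B (\<lambda>s. \<psi> (Sa s h))"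
proof -
  have "continuous_on {0..} (\<lambda>s. \<psi> (Sa s h))"
    unfolding continuous_on_sequentially
  proof (intro allI ballI impI, elim conjE)
    fix t :: "nat \<Rightarrow> real" and t0 assume t0: "t0 \<in> {0..}" and t: "\<forall>n. t n \<in> {0..}" "t \<longlonglongrightarrow> t0"
    have "Bseq t" using t(2) convergent_imp_Bseq convergentI by blast
    then obtain T where T: "\<And>n. \<bar>t n\<bar> \<le> T" by (auto simp: Bseq_def)
    show "((\<lambda>s. \<psi> (Sa s h)) \<circ> t) \<longlonglongrightarrow> \<psi> (Sa t0 h)"
      unfolding o_def
    proof (rule psi_weak_seq)
      show "norm (Sa (t n) h) \<le> Mb T * norm h" for n using norm_Sa[of "t n" T h] t(1) abs_le_D1[OF T[of n]] by simp
      show "(\<lambda>n. x \<bullet> Sa (t n) h) \<longlonglongrightarrow> x \<bullet> Sa t0 h" for x by (rule Sa_weak_seq) (use t in auto)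
    qed
  qed
  thus "B \<subseteq> {0..} \<Longrightarrow> continuous_on B (\<lambda>s. \<psi> (Sa s h))" using continuous_on_subset by blast
qed

section \<open>The characteristic function of the stochastic convolution\<close>

definition Psi :: "real \<Rightarrow> 'h \<Rightarrow> complex" where "Psi t h = integral {0..t} (\<lambda>s. \<psi> (Sa s h))"
definition cc :: "real \<Rightarrow> 'h \<Rightarrow> complex" where "cc t h = exp (- Psi t h)"

sublocale prob_space M using levy unfolding levy_process_def by blast

lemma Z_measurable [measurable]: "t \<ge> 0 \<Longrightarrow> Z t \<in> borel_measurable M"
  using levy unfolding levy_process_def by blast

lemma Y_measurable [measurable]: "t \<ge> 0 \<Longrightarrow> Y t \<in> borel_measurable M"
  using conv unfolding stochastic_convolution_def by blast

lemma Z_stationary: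
  assumes "s \<ge> 0" "t \<ge> 0"
  shows "distr M borel (\<lambda>\<omega>. Z (s + t) \<omega> - Z s \<omega>) = distr M borel (Z t)"
proof -
  from levy have "\<forall>s\<ge>0. \<forall>t\<ge>0. distr M borel (\<lambda>\<omega>. Z (s + t) \<omega> - Z s \<omega>) = distr M borel (Z t)"
    unfolding levy_process_def by (elim conjE)
  thus ?thesis using assms by simp
qed

lemma Z_indep:
  assumes "0 \<le> \<tau> 0" "\<And>k. k < n \<Longrightarrow> \<tau> k \<le> \<tau> (Suc k)"
  shows "indep_vars (\<lambda>_::nat. borel) (\<lambda>k \<omega>. Z (\<tau> (Suc k)) \<omega> - Z (\<tau> k) \<omega>) {..<n}"
proof -
  from levy have "\<forall>n \<tau>. 0 \<le> \<tau> 0 \<and> (\<forall>k<n. \<tau> k \<le> \<tau> (Suc k)) \<longrightarrow>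
        indep_vars (\<lambda>_::nat. borel) (\<lambda>k \<omega>. Z (\<tau> (Suc k)) \<omega> - Z (\<tau> k) \<omega>) {..<n}"
    unfolding levy_process_def by (elim conjE)
  thus ?thesis using assms by simp
qed

lemma Z_increment_char:
  assumes s: "0 \<le> s" "s \<le> t"
  shows "(LINT \<omega>|M. iexp ((Z t \<omega> - Z s \<omega>) \<bullet> k)) = exp (- of_real (t - s) * \<psi> k)"
proof -
  have d: "distr M borel (\<lambda>\<omega>. Z t \<omega> - Z s \<omega>) = distr M borel (Z (t - s))"
    using Z_stationary[of s "t - s"] s by simp
  have t: "0 \<le> t" "0 \<le> t - s" using s by auto
  note [measurable] = Z_measurable[OF t(1)] Z_measurable[OF t(2)] Z_measurable[OF s(1)]
  have "(LINT \<omega>|M. iexp ((Z t \<omega> - Z s \<omega>) \<bullet> k)) = (LINT z|distr M borel (\<lambda>\<omega>. Z t \<omega> - Z s \<omega>). iexp (z \<bullet> k))"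
    by (subst integral_distr) auto
  also have "\<dots> = (LINT \<omega>|M. iexp (Z (t - s) \<omega> \<bullet> k))" unfolding d by (subst integral_distr) auto
  finally show ?thesis using levy_char[OF t(2)] by simp
qed

text \<open>Independence of the increments factorises the expectation; moving
  \<open>S (t - \<tau> n k)\<close> to the other side of the inner product evaluates each factor at
  \<open>Sa (t - \<tau> n k) h\<close>.\<close>

lemma riemann_sum_char:
  assumes t: "t \<ge> 0"
  defines "\<tau> \<equiv> \<lambda>n k. t * real k / real (Suc n)"
  shows "(LINT \<omega>|M. iexp ((\<Sum>k<Suc n. S (t - \<tau> n k) (Z (\<tau> n (Suc k)) \<omega> - Z (\<tau> n k) \<omega>)) \<bullet> h)) =
    exp (- (\<Sum>k<Suc n. (t / real (Suc n)) *\<^sub>R \<psi> (Sa (t - \<tau> n k) h)))"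
proof -
  have \<tau>: "0 \<le> \<tau> n k" "\<tau> n k \<le> \<tau> n (Suc k)" for k
    using t by (auto simp: \<tau>_def intro!: divide_right_mono mult_left_mono)
  have \<tau>t: "\<tau> n k \<le> t" if "k < Suc n" for k using t that by (auto simp: \<tau>_def divide_le_eq intro!: mult_left_mono)
  have \<tau>d: "\<tau> n (Suc k) - \<tau> n k = t / real (Suc n)" for k
    by (simp add: \<tau>_def diff_divide_distrib[symmetric] right_diff_distrib[symmetric])
  have ind: "indep_vars (\<lambda>_. borel) (\<lambda>k \<omega>. Z (\<tau> n (Suc k)) \<omega> - Z (\<tau> n k) \<omega>) {..<Suc n}"
    by (rule Z_indep) (rule \<tau>)+
  let ?X = "\<lambda>k \<omega>. iexp ((Z (\<tau> n (Suc k)) \<omega> - Z (\<tau> n k) \<omega>) \<bullet> Sa (t - \<tau> n k) h)"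
  have ind': "indep_vars (\<lambda>_. borel) ?X {..<Suc n}"
    by (rule indep_vars_compose2[OF ind]) measurable
  have Xm: "?X k \<in> borel_measurable M" for k
    using Z_measurable[OF \<tau>(1)[of k]] Z_measurable[OF \<tau>(1)[of "Suc k"]] by measurable
  have "iexp ((\<Sum>k<Suc n. S (t - \<tau> n k) (Z (\<tau> n (Suc k)) \<omega> - Z (\<tau> n k) \<omega>)) \<bullet> h) = (\<Prod>k<Suc n. ?X k \<omega>)" for \<omega>
  proof -
    have "(\<Sum>k<Suc n. S (t - \<tau> n k) (Z (\<tau> n (Suc k)) \<omega> - Z (\<tau> n k) \<omega>)) \<bullet> h =
       (\<Sum>k<Suc n. (Z (\<tau> n (Suc k)) \<omega> - Z (\<tau> n k) \<omega>) \<bullet> Sa (t - \<tau> n k) h)"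
      unfolding inner_sum_left by (intro sum.cong refl Sa) (use \<tau>t in auto)
    thus ?thesis by (simp only: of_real_sum sum_distrib_left exp_sum[OF finite_lessThan])
  qed
  hence "(LINT \<omega>|M. iexp ((\<Sum>k<Suc n. S (t - \<tau> n k) (Z (\<tau> n (Suc k)) \<omega> - Z (\<tau> n k) \<omega>)) \<bullet> h)) =
     (LINT \<omega>|M. (\<Prod>k<Suc n. ?X k \<omega>))" by simp
  also have "\<dots> = (\<Prod>k<Suc n. (LINT \<omega>|M. ?X k \<omega>))"
    by (rule indep_vars_lebesgue_integral[OF finite_lessThan ind'])
      (rule integrable_bounded[OF Xm, where C=1], simp)
  also have "\<dots> = (\<Prod>k<Suc n. exp (- ((t / real (Suc n)) *\<^sub>R \<psi> (Sa (t - \<tau> n k) h))))"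
    by (intro prod.cong refl, subst Z_increment_char[OF \<tau>]) (simp add: \<tau>d scaleR_conv_of_real)
  also have "\<dots> = exp (\<Sum>k<Suc n. - ((t / real (Suc n)) *\<^sub>R \<psi> (Sa (t - \<tau> n k) h)))"
    by (rule exp_sum[OF finite_lessThan, symmetric])
  finally show ?thesis by (simp only: sum_negf)
qed

text \<open>Where the variables are within \<open>e\<close> the exponentials differ by at most
  \<open>e * norm h\<close>, elsewhere by at most 2.\<close>

lemma iexp_expectation_close:
  assumes [measurable]: "X \<in> borel_measurable M" "X' \<in> borel_measurable M" and e: "e > 0"
  shows "cmod ((LINT \<omega>|M. iexp (X \<omega> \<bullet> h)) - (LINT \<omega>|M. iexp (X' \<omega> \<bullet> h)))
    \<le> e * norm h + 2 * measure M {\<omega>\<in>space M. norm (X \<omega> - X' \<omega> :: 'h) > e}"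
proof -
  let ?B = "{\<omega>\<in>space M. norm (X \<omega> - X' \<omega>) > e}"
  have Bm: "?B \<in> sets M" by measurable
  have int: "integrable M (\<lambda>\<omega>. iexp (X \<omega> \<bullet> h))" "integrable M (\<lambda>\<omega>. iexp (X' \<omega> \<bullet> h))"
    by (rule integrable_bounded[where C=1]; simp)+
  have "cmod ((LINT \<omega>|M. iexp (X \<omega> \<bullet> h)) - (LINT \<omega>|M. iexp (X' \<omega> \<bullet> h))) = cmod (LINT \<omega>|M. iexp (X \<omega> \<bullet> h) - iexp (X' \<omega> \<bullet> h))"
    using int by simp
  also have "\<dots> \<le> (LINT \<omega>|M. cmod (iexp (X \<omega> \<bullet> h) - iexp (X' \<omega> \<bullet> h)))" by (rule integral_norm_bound)
  also have "\<dots> \<le> (LINT \<omega>|M. e * norm h + 2 * indicator ?B \<omega>)"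
  proof (rule integral_mono)
    show "integrable M (\<lambda>\<omega>. cmod (iexp (X \<omega> \<bullet> h) - iexp (X' \<omega> \<bullet> h)))" using int by (intro integrable_norm) auto
    show "integrable M (\<lambda>\<omega>. e * norm h + 2 * indicator ?B \<omega>)"
      using Bm e by (intro integrable_bounded[where C="e * norm h + 2"]) (auto simp: indicator_def)
    fix \<omega> assume \<omega>: "\<omega> \<in> space M"
    show "cmod (iexp (X \<omega> \<bullet> h) - iexp (X' \<omega> \<bullet> h)) \<le> e * norm h + 2 * indicator ?B \<omega>"
    proof (cases "\<omega> \<in> ?B")
      case True
      have "cmod (iexp (X \<omega> \<bullet> h) - iexp (X' \<omega> \<bullet> h)) \<le> 2" using norm_triangle_ineq4[of "iexp (X \<omega> \<bullet> h)" "iexp (X' \<omega> \<bullet> h)"] by simp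
      moreover have "0 \<le> e * norm h" using e by simp
      ultimately show ?thesis using True by simp
    next
      case False
      hence le: "norm (X \<omega> - X' \<omega>) \<le> e" using \<omega> by simp
      have "cmod (iexp (X \<omega> \<bullet> h) - iexp (X' \<omega> \<bullet> h)) \<le> \<bar>(X \<omega> - X' \<omega>) \<bullet> h\<bar>"
        using cmod_iexp_diff[of "X \<omega> \<bullet> h" "X' \<omega> \<bullet> h"] by (simp add: inner_diff_left)
      also have "\<dots> \<le> norm (X \<omega> - X' \<omega>) * norm h" by (rule Cauchy_Schwarz_ineq2)
      also have "\<dots> \<le> e * norm h" using le by (intro mult_right_mono) auto
      finally show ?thesis using False by simp
    qed
  qed
  also have "\<dots> = (LINT \<omega>|M. e * norm h) + (LINT \<omega>|M. 2 * indicator ?B \<omega>)"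
    using Bm by (intro Bochner_Integration.integral_add integrable_bounded[where C=2] integrable_const) (auto simp: indicator_def)
  also have "\<dots> = e * norm h + 2 * measure M ?B" using Bm by (simp add: prob_space)
  finally show ?thesis .
qed

text \<open>The Riemann sums converge to \<open>Y t\<close> in probability, so their characteristic
  functions converge to that of \<open>Y t\<close>; the exponents of these functions are themselves
  Riemann sums for the time integral of \<open>\<psi>\<close>.\<close>

lemma Y_char:
  assumes t: "t \<ge> 0"
  shows "(LINT \<omega>|M. iexp (Y t \<omega> \<bullet> h)) = cc t h"
proof -
  define \<tau> where "\<tau> n k = t * real k / real (Suc n)" for n k
  define X where "X n \<omega> = (\<Sum>k<Suc n. S (t - \<tau> n k) (Z (\<tau> n (Suc k)) \<omega> - Z (\<tau> n k) \<omega>))" for n \<omega>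
  have \<tau>0: "0 \<le> \<tau> n k" for n k using t by (simp add: \<tau>_def)
  have \<tau>t: "\<tau> n k \<le> t" if "k < Suc n" for n k using t that by (auto simp: \<tau>_def divide_le_eq intro!: mult_left_mono)
  have Xm: "X n \<in> borel_measurable M" for n
    unfolding X_def
  proof (rule borel_measurable_sum)
    fix k assume "k \<in> {..<Suc n}"
    hence "t - \<tau> n k \<ge> 0" using \<tau>t by simp
    note [measurable] = S_borel[OF this] Z_measurable[OF \<tau>0[of n k]] Z_measurable[OF \<tau>0[of n "Suc k"]]
    show "(\<lambda>\<omega>. S (t - \<tau> n k) (Z (\<tau> n (Suc k)) \<omega> - Z (\<tau> n k) \<omega>)) \<in> borel_measurable M" by measurable
  qed
  have "(\<lambda>n. LINT \<omega>|M. iexp (X n \<omega> \<bullet> h)) \<longlonglongrightarrow> (LINT \<omega>|M. iexp (Y t \<omega> \<bullet> h))"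
  proof (rule LIMSEQ_I)
    fix r :: real assume r: "r > 0"
    \<comment> \<open>The total error is below \<open>e * norm h + 2 * e\<close>, as the exceptional
      event also has probability less than \<open>e\<close>.\<close>
    define e where "e = r / (norm h + 3)"
    have n3: "norm h + 3 > 0" by (simp add: add_nonneg_pos)
    have e: "e > 0" using r n3 by (simp add: e_def)
    obtain \<delta> where \<delta>: "\<delta> > 0" "\<And>n \<tau>. \<tau> 0 = 0 \<and> \<tau> n = t \<and> (\<forall>k<n. \<tau> k \<le> \<tau> (Suc k) \<and> \<tau> (Suc k) - \<tau> k < \<delta>) \<Longrightarrow>
        measure M {\<omega>\<in>space M. norm ((\<Sum>k<n. S (t - \<tau> k) (Z (\<tau> (Suc k)) \<omega> - Z (\<tau> k) \<omega>)) - Y t \<omega>) > e} < e"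
      using conv t e unfolding stochastic_convolution_def by blast
    obtain N :: nat where N: "t / \<delta> < real N" using reals_Archimedean2 by blast
    have "norm ((LINT \<omega>|M. iexp (X n \<omega> \<bullet> h)) - (LINT \<omega>|M. iexp (Y t \<omega> \<bullet> h))) < r" if n: "n \<ge> N" for n
    proof -
      have "t / \<delta> < real (Suc n)" using N n by simp
      hence mesh: "t / real (Suc n) < \<delta>" using \<delta>(1) by (simp add: field_simps)
      have \<tau>d: "\<tau> n (Suc k) - \<tau> n k = t / real (Suc n)" for k
    by (simp add: \<tau>_def diff_divide_distrib[symmetric] right_diff_distrib[symmetric])
      have part: "\<tau> n 0 = 0 \<and> \<tau> n (Suc n) = t \<and> (\<forall>k<Suc n. \<tau> n k \<le> \<tau> n (Suc k) \<and> \<tau> n (Suc k) - \<tau> n k < \<delta>)"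
      proof (intro conjI allI impI)
        show "\<tau> n k \<le> \<tau> n (Suc k)" for k
          using t by (auto simp: \<tau>_def intro!: divide_right_mono mult_left_mono)
      qed (use mesh \<tau>d in \<open>auto simp: \<tau>_def\<close>)
      have m: "measure M {\<omega>\<in>space M. norm (X n \<omega> - Y t \<omega>) > e} < e" unfolding X_def using \<delta>(2)[OF part] .
      have "norm ((LINT \<omega>|M. iexp (X n \<omega> \<bullet> h)) - (LINT \<omega>|M. iexp (Y t \<omega> \<bullet> h))) \<le>
         e * norm h + 2 * measure M {\<omega>\<in>space M. norm (X n \<omega> - Y t \<omega>) > e}"
        by (rule iexp_expectation_close[OF Xm Y_measurable[OF t] e])
      also have "\<dots> \<le> e * norm h + 2 * e" using m by simp
      also have "\<dots> < e * (norm h + 3)" using e by (simp add: algebra_simps)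
      also have "\<dots> = r" using n3 by (simp add: e_def)
      finally show ?thesis .
    qed
    thus "\<exists>N. \<forall>n\<ge>N. norm ((LINT \<omega>|M. iexp (X n \<omega> \<bullet> h)) - (LINT \<omega>|M. iexp (Y t \<omega> \<bullet> h))) < r" by blast
  qed
  moreover have "(\<lambda>n. LINT \<omega>|M. iexp (X n \<omega> \<bullet> h)) \<longlonglongrightarrow> cc t h"
  proof -
    let ?g = "\<lambda>s. \<psi> (Sa (t - s) h)"
    have cg: "continuous_on {0..t} ?g"
      by (rule continuous_on_compose2[OF psi_Sa_cont[of "{0..}" h]]) (auto intro!: continuous_intros)
    have "(LINT \<omega>|M. iexp (X n \<omega> \<bullet> h)) = exp (- (\<Sum>k<Suc n. (t / real (Suc n)) *\<^sub>R ?g (t * real k / real (Suc n))))" for n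
      unfolding X_def \<tau>_def by (rule riemann_sum_char[OF t])
    moreover have "(\<lambda>n. exp (- (\<Sum>k<Suc n. (t / real (Suc n)) *\<^sub>R ?g (t * real k / real (Suc n))))) \<longlonglongrightarrow> exp (- integral {0..t} ?g)"
      by (intro tendsto_exp tendsto_minus riemann_sum_LIMSEQ[OF cg t])
    \<comment> \<open>Substitution of \<open>s\<close> for \<open>t - s\<close>: the integrand
      \<open>S (t - s)\<close> of the convolution becomes \<open>S s\<close> in the
      exponent.\<close>
    moreover have "integral {0..t} ?g = Psi t h"
    proof -
      have "integral {0..t} ?g = integral {-t..0} (\<lambda>s. \<psi> (Sa (t + s) h))"
        using Henstock_Kurzweil_Integration.integral_reflect_real[where a=0 and b=t and f="\<lambda>s. \<psi> (Sa (t - s) h)"] by simp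
      also have "\<dots> = integral {0 - t..t - t} (\<lambda>s. \<psi> (Sa (s + t) h))" by (simp add: add.commute)
      also have "\<dots> = integral {0..t} (\<lambda>s. \<psi> (Sa s h))" by (rule integral_shift_real_ivl)
      finally show ?thesis by (simp add: Psi_def)
    qed
    ultimately show ?thesis by (simp add: cc_def)
  qed
  ultimately show ?thesis by (rule LIMSEQ_unique)
qed

definition law :: "real \<Rightarrow> 'h measure" where "law t = distr M borel (Y t)"

lemma law_sets [measurable_cong, simp]: "sets (law t) = sets borel"
  and space_law [simp]: "space (law t) = UNIV"
  by (auto simp: law_def)

lemma prob_law: "t \<ge> 0 \<Longrightarrow> prob_space (law t)"
  unfolding law_def by (rule prob_space_distr) measurable

lemma law_char: "t \<ge> 0 \<Longrightarrow> (LINT y|law t. iexp (y \<bullet> h)) = cc t h"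
  unfolding law_def by (subst integral_distr) (auto simp: Y_char)

lemma Psi_add:
  assumes "t \<ge> 0" "s \<ge> 0" shows "Psi (t + s) h = Psi t h + Psi s (Sa t h)"
proof -
  have "integral {0..t} (\<lambda>s. \<psi> (Sa s h)) + integral {t..t + s} (\<lambda>s. \<psi> (Sa s h)) = integral {0..t + s} (\<lambda>s. \<psi> (Sa s h))"
    by (rule Henstock_Kurzweil_Integration.integral_combine)
      (use assms in \<open>auto intro!: integrable_continuous_real psi_Sa_cont\<close>)
  moreover have "integral {t..t + s} (\<lambda>s. \<psi> (Sa s h)) = integral {t - t..t + s - t} (\<lambda>r. \<psi> (Sa (r + t) h))"
    by (rule integral_shift_real_ivl[symmetric])
  moreover have "integral {t - t..t + s - t} (\<lambda>r. \<psi> (Sa (r + t) h)) = Psi s (Sa t h)"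
    unfolding Psi_def using assms(1) by (auto intro!: integral_cong simp: Sa_add)
  ultimately show ?thesis by (simp add: Psi_def)
qed

text \<open>In terms of laws: \<open>Y (t + s)\<close> is distributed as \<open>Y t\<close> plus an
  independent copy of \<open>Y s\<close> transformed by \<open>S t\<close>. This is the source of
  the semigroup law for the transition operators.\<close>

lemma cc_add: "t \<ge> 0 \<Longrightarrow> s \<ge> 0 \<Longrightarrow> cc (t + s) h = cc t h * cc s (Sa t h)"
  by (simp add: cc_def Psi_add flip: exp_add)

lemma cc_0 [simp]: "cc 0 h = 1" by (simp add: cc_def Psi_def)

text \<open>Read off from the probability law whose characteristic function it is.\<close>

lemma cmod_cc: "t \<ge> 0 \<Longrightarrow> cmod (cc t h) \<le> 1"
proof -
  assume t: "t \<ge> 0"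
  interpret L: prob_space "law t" by (rule prob_law[OF t])
  have "cmod (cc t h) \<le> (LINT y|law t. cmod (iexp (y \<bullet> h)))"
    unfolding law_char[OF t, symmetric] by (rule integral_norm_bound)
  also have "\<dots> = 1" using L.prob_space by simp
  finally show ?thesis .
qed

lemma cc_deriv:
  assumes "0 \<le> t" "t \<le> T"
  shows "((\<lambda>t. cc t h) has_vector_derivative (- \<psi> (Sa t h) * cc t h)) (at t within {0..T})"
proof -
  have "((\<lambda>t. Psi t h) has_vector_derivative \<psi> (Sa t h)) (at t within {0..T})"
    unfolding Psi_def by (rule integral_has_vector_derivative) (use assms in \<open>auto intro!: psi_Sa_cont\<close>)
  hence "((\<lambda>t. - Psi t h) has_vector_derivative - \<psi> (Sa t h)) (at t within {0..T})"
    by (rule has_vector_derivative_minus)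
  moreover have "(exp has_field_derivative exp (- Psi t h)) (at (- Psi t h) within (\<lambda>t. - Psi t h) ` {0..T})"
    by (rule DERIV_subset[OF DERIV_exp]) simp
  ultimately show ?thesis
    using field_vector_diff_chain_within[of "\<lambda>t. - Psi t h" "- \<psi> (Sa t h)" t "{0..T}" exp "exp (- Psi t h)"]
    by (simp add: cc_def o_def)
qed

lemma cc_cont: "B \<subseteq> {0..} \<Longrightarrow> continuous_on B (\<lambda>t. cc t h)"
proof -
  assume B: "B \<subseteq> {0..}"
  have "continuous (at t within {0..}) (\<lambda>t. cc t h)" if t: "t \<ge> 0" for t
  proof -
    have "continuous (at t within {0..t + 1}) (\<lambda>t. cc t h)"
      using has_vector_derivative_continuous[OF cc_deriv[of t "t + 1"]] t by simp
    moreover have "at t within {0..t + 1} = at t within {0..}"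
      by (rule at_within_nhd[of _ "{..<t + 1}"]) auto
    ultimately show ?thesis by simp
  qed
  hence "continuous_on {0..} (\<lambda>t. cc t h)" by (simp add: continuous_on_eq_continuous_within)
  thus ?thesis using B continuous_on_subset by blast
qed

end

section \<open>Twice differentiable test functions along lines\<close>

lemma has_vector_derivative_shift_arg:
  assumes "(f has_vector_derivative f') (at (c + x))"
  shows "((\<lambda>t. f (c + t)) has_vector_derivative f') (at (x :: real))"
proof -
  have "((\<lambda>t. c + t) has_vector_derivative 1) (at x)"
    unfolding has_real_derivative_iff_has_vector_derivative[symmetric] by (auto intro!: derivative_eq_intros)
  from vector_diff_chain_at[OF this assms] show ?thesis by (simp add: o_def)
qed

text \<open>The derivative in \<open>c\<close> is \<open>f (pi + c) - f (- pi + c)\<close>, which is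
  0 by periodicity.\<close>

lemma periodic_integral_shift:
  fixes f :: "real \<Rightarrow> complex"
  assumes f: "continuous_on UNIV f" and per: "\<And>u. f (u + 2 * pi) = f u"
  shows "integral {- pi..pi} (\<lambda>u. f (u + c)) = integral {- pi..pi} f"
proof -
  have deriv: "((\<lambda>c. integral (cbox (- pi) pi) (\<lambda>u. f (u + c))) has_vector_derivative 0) (at c within UNIV)" for c
  proof -
    \<comment> \<open>\<open>- B\<close> lies to the left of all intervals
      \<open>[- pi + d, pi + d]\<close> with \<open>d\<close> within 1 of \<open>c\<close>, so one
      primitive serves them all.\<close>
    define B where "B = \<bar>c\<bar> + 1 + pi"
    define U where "U x = integral {- B..x} f" for x
    have fi: "f integrable_on {a..b}" for a b by (intro integrable_continuous_real continuous_on_subset[OF f]) auto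
    have U: "(U has_vector_derivative f x) (at x)" if "- B < x" for x
    proof -
      have "(U has_vector_derivative f x) (at x within {- B..x + 1})"
        unfolding U_def using that by (intro integral_has_vector_derivative continuous_on_subset[OF f]) auto
      thus ?thesis by (subst (asm) at_within_interior) (use that in auto)
    qed
    have "((\<lambda>c. U (pi + c) - U (- pi + c)) has_vector_derivative (f (pi + c) - f (- pi + c))) (at c)"
    proof (intro has_vector_derivative_diff)
      show "((\<lambda>c. U (pi + c)) has_vector_derivative f (pi + c)) (at c)"
        by (intro has_vector_derivative_shift_arg U) (use pi_gt_zero abs_ge_minus_self[of c] in \<open>unfold B_def, linarith\<close>)
      show "((\<lambda>c. U (- pi + c)) has_vector_derivative f (- pi + c)) (at c)"
        by (intro has_vector_derivative_shift_arg U) (use pi_gt_zero abs_ge_minus_self[of c] in \<open>unfold B_def, linarith\<close>)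
    qed
    moreover have "f (pi + c) - f (- pi + c) = 0" using per[of "- pi + c"] by (simp add: add.commute)
    ultimately have d0: "((\<lambda>c. U (pi + c) - U (- pi + c)) has_vector_derivative 0) (at c within UNIV)" by simp
    have ev: "\<forall>\<^sub>F d in nhds c. U (pi + d) - U (- pi + d) = integral (cbox (- pi) pi) (\<lambda>u. f (u + d))"
    proof -
      have "\<forall>\<^sub>F d in nhds c. d \<in> ball c 1" by (rule eventually_nhds_in_open) auto
      thus ?thesis
      proof eventually_elim
        case (elim d)
        hence "\<bar>c - d\<bar> < 1" by (simp add: dist_real_def)
        hence d: "- B \<le> - pi + d" by (simp add: B_def)
        have "integral {- B..- pi + d} f + integral {- pi + d..pi + d} f = integral {- B..pi + d} f"
          by (rule Henstock_Kurzweil_Integration.integral_combine) (use d fi pi_gt_zero in auto)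
        moreover have "integral {- pi + d..pi + d} f = integral {- pi + d - d..pi + d - d} (\<lambda>u. f (u + d))"
          by (rule integral_shift_real_ivl[symmetric])
        ultimately show ?case by (simp add: U_def algebra_simps)
      qed
    qed
    show ?thesis
      using has_vector_derivative_cong_ev[where f="\<lambda>c. U (pi + c) - U (- pi + c)" and S=UNIV and x=c
          and g="\<lambda>c. integral (cbox (- pi) pi) (\<lambda>u. f (u + c))" and f'=0] d0 ev eventually_nhds_x_imp_x[OF ev]
      by simp
  qed
  obtain k where "\<And>c. integral (cbox (- pi) pi) (\<lambda>u. f (u + c)) = k"
    by (rule has_vector_derivative_zero_constant[of UNIV "\<lambda>c. integral (cbox (- pi) pi) (\<lambda>u. f (u + c))"])
      (use deriv in auto)
  from this[of c] this[of 0] show ?thesis by simp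
qed

text \<open>If \<open>g c\<close> were not 0, its translate \<open>k\<close>, normalised to
  \<open>k 0 = 1\<close>, would be orthogonal to all powers \<open>(1 + cos u) ^ N\<close>. These
  concentrate at 0, where the real part of \<open>k\<close> exceeds 1/2, so the integral could not
  vanish for large \<open>N\<close>.\<close>

lemma periodic_fourier_zero:
  fixes g :: "real \<Rightarrow> complex"
  assumes g: "continuous_on UNIV g" and per: "\<And>u. g (u + 2 * pi) = g u"
    and zero: "\<And>j::int. integral {- pi..pi} (\<lambda>u. iexp (- of_int j * u) * g u) = 0"
  shows "g c = 0"
proof (rule ccontr)
  assume nz: "g c \<noteq> 0"
  define k where "k u = g (u + c) / g c" for u
  have ck: "continuous_on UNIV k"
    unfolding k_def using nz by (intro continuous_intros continuous_on_compose2[OF g]) auto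
  have kper: "k (u + 2 * pi) = k u" for u using per[of "u + c"] by (simp add: k_def algebra_simps)
  have ki: "(\<lambda>u. w u * k u) integrable_on {a..b}" if "continuous_on UNIV w" for w a b
    by (intro integrable_continuous_real continuous_on_mult continuous_on_subset[OF that] continuous_on_subset[OF ck]) auto
  have kz: "integral {- pi..pi} (\<lambda>u. iexp (- of_int j * u) * k u) = 0" for j :: int
  proof -
    let ?w = "\<lambda>u. iexp (- of_int j * u) * g u"
    have "?w (u + 2 * pi) = ?w u" for u
    proof -
      have "iexp (- of_int j * (u + 2 * pi)) = iexp (- of_int j * u) * exp (- (of_int (2 * j) * pi * \<i>))"
        by (simp add: algebra_simps flip: exp_add)
      also have "exp (- (of_int (2 * j) * pi * \<i>)) = 1"
        using exp_integer_2pi[of "of_int (- j)"] by (simp add: algebra_simps)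
      finally show ?thesis using per by simp
    qed
    moreover have "continuous_on UNIV ?w" by (intro continuous_intros g)
    ultimately have "integral {- pi..pi} (\<lambda>u. ?w (u + c)) = 0"
      using periodic_integral_shift[of ?w c] zero[of j] by simp
    moreover have "iexp (- of_int j * u) * k u = (iexp (of_int j * c) / g c) * ?w (u + c)" for u
    proof -
      have "iexp (- of_int j * u) = iexp (of_int j * c) * iexp (- of_int j * (u + c))"
        by (simp add: algebra_simps flip: exp_add)
      thus ?thesis by (simp add: k_def)
    qed
    ultimately show ?thesis by simp
  qed
  \<comment> \<open>Multiplication by \<open>1 + cos u\<close> shifts frequencies by at most one, so
    orthogonality to the exponentials is inherited by induction on \<open>N\<close>.\<close>
  have pow: "integral {- pi..pi} (\<lambda>u. (iexp (- of_int j * u) * of_real ((1 + cos u) ^ N)) * k u) = 0" for j :: int and N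
  proof (induction N arbitrary: j)
    case 0 thus ?case using kz by simp
  next
    case (Suc N)
    let ?e = "\<lambda>j u. (iexp (- of_int j * u) * of_real ((1 + cos u) ^ N)) * k u"
    have ei: "?e j integrable_on {- pi..pi}" for j :: int by (intro ki continuous_intros)
    have "(iexp (- of_int j * u) * of_real ((1 + cos u) ^ Suc N)) * k u =
      ?e j u + ((1/2) * ?e (j - 1) u + (1/2) * ?e (j + 1) u)" for u
    proof -
      have "complex_of_real (cos u) = (iexp u + iexp (- u)) / 2"
        by (simp add: cos_of_real[symmetric] cos_exp_eq)
      moreover have "iexp (- of_int (j - 1) * u) = iexp (- of_int j * u) * iexp u"
        "iexp (- of_int (j + 1) * u) = iexp (- of_int j * u) * iexp (- u)"
        by (simp_all add: algebra_simps flip: exp_add)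
      ultimately show ?thesis by (simp add: algebra_simps add_divide_distrib)
    qed
    moreover have "(?e j has_integral 0) {- pi..pi}" for j :: int
      using ei[of j] Suc[of j] by (simp add: has_integral_iff)
    hence "((\<lambda>u. ?e j u + ((1/2) * ?e (j - 1) u + (1/2) * ?e (j + 1) u)) has_integral 0 + ((1/2) * 0 + (1/2) * 0)) {- pi..pi}"
      by (intro has_integral_add has_integral_mult_right)
    ultimately show ?case by (simp only: integral_unique) simp
  qed
  have re0: "integral {- pi..pi} (\<lambda>u. (1 + cos u) ^ N * Re (k u)) = 0" for N
  proof -
    have "(\<lambda>u. of_real ((1 + cos u) ^ N) * k u) integrable_on {- pi..pi}" by (intro ki continuous_intros)
    hence "integral {- pi..pi} (\<lambda>u. Re (of_real ((1 + cos u) ^ N) * k u)) = Re (integral {- pi..pi} (\<lambda>u. of_real ((1 + cos u) ^ N) * k u))"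
      by (rule integral_linear[OF _ bounded_linear_Re, unfolded o_def])
    also have "integral {- pi..pi} (\<lambda>u. of_real ((1 + cos u) ^ N) * k u) = 0" using pow[of 0 N] by simp
    finally show ?thesis by simp
  qed
  have cr: "continuous_on UNIV (\<lambda>u. Re (k u))" by (intro continuous_intros ck)
  have "isCont (\<lambda>u. Re (k u)) 0" using cr by (simp add: continuous_on_eq_continuous_at)
  moreover have "Re (k 0) = 1" using nz by (simp add: k_def)
  ultimately have "\<forall>e>0. \<exists>d>0. \<forall>u. \<bar>u\<bar> < d \<longrightarrow> \<bar>Re (k u) - 1\<bar> < e"
    unfolding continuous_at_eps_delta by (simp add: dist_real_def)
  hence "\<exists>d>0. \<forall>u. \<bar>u\<bar> < d \<longrightarrow> \<bar>Re (k u) - 1\<bar> < 1/2" by (rule allE[of _ "1/2"]) simp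
  then obtain d0 where d0: "d0 > 0" "\<And>u. \<bar>u\<bar> < d0 \<Longrightarrow> \<bar>Re (k u) - 1\<bar> < 1/2" by blast
  define d where "d = min (d0 / 2) 1"
  have d: "0 < d" "d < d0" "d \<le> 1" using d0(1) by (auto simp: d_def)
  have dpi: "d < pi" using d pi_gt3 by linarith
  obtain B where B: "\<And>u. u \<in> {- pi..pi} \<Longrightarrow> \<bar>Re (k u)\<bar> \<le> B"
  proof -
    have "bounded ((\<lambda>u. Re (k u)) ` {- pi..pi})"
      by (intro compact_imp_bounded compact_continuous_image continuous_on_subset[OF cr] compact_Icc) auto
    thus ?thesis using that unfolding bounded_iff by force
  qed
  have B0: "B \<ge> 0" using B[of 0] pi_gt_zero by fastforce
  \<comment> \<open>\<open>p\<close> is the minimum of \<open>1 + cos u\<close> over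
    \<open>\<bar>u\<bar> \<le> d / 2\<close>, \<open>q\<close> its maximum over
    \<open>d \<le> \<bar>u\<bar> \<le> pi\<close>. The inner part grows at least like
    \<open>p ^ N\<close>, the outer part at most like \<open>q ^ N\<close>.\<close>
  define p q where "p = 1 + cos (d / 2)" and "q = 1 + cos d"
  have pq: "0 \<le> q" "q < p" "0 < p"
  proof -
    have "cos d < cos (d / 2)" using d dpi by (intro cos_monotone_0_pi) auto
    thus "0 \<le> q" "q < p" "0 < p" unfolding p_def q_def using cos_ge_minus_one[of d] by linarith+
  qed
  define w where "w N u = (1 + cos u) ^ N * Re (k u)" for N u
  have wi: "w N integrable_on {a..b}" for N a b
    unfolding w_def by (intro integrable_continuous_real continuous_intros continuous_on_subset[OF cr]) auto
  have key: "(d / 2) * p ^ N \<le> 2 * pi * (B * q ^ N)" for N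
  proof -
    have outer: "\<bar>w N u\<bar> \<le> B * q ^ N" if u: "d \<le> \<bar>u\<bar>" "\<bar>u\<bar> \<le> pi" for u
    proof -
      have "cos u = cos \<bar>u\<bar>" by simp
      also have "\<dots> \<le> cos d" using u d by (intro cos_monotone_0_pi_le) auto
      finally have "(1 + cos u) ^ N \<le> q ^ N"
        using cos_ge_minus_one[of u] unfolding q_def by (intro power_mono) linarith+
      moreover have "\<bar>Re (k u)\<bar> \<le> B" using B u by (auto simp: abs_le_iff)
      moreover have "0 \<le> 1 + cos u" using cos_ge_minus_one[of u] by linarith
      ultimately have "(1 + cos u) ^ N * \<bar>Re (k u)\<bar> \<le> q ^ N * B" using pq by (intro mult_mono) auto
      thus ?thesis using \<open>0 \<le> 1 + cos u\<close> by (simp add: w_def abs_mult mult.commute)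
    qed
    have split: "integral {- pi..pi} (w N) = integral {- pi..- d} (w N) + (integral {- d..d} (w N) + integral {d..pi} (w N))"
    proof -
      have "integral {- pi..- d} (w N) + integral {- d..pi} (w N) = integral {- pi..pi} (w N)"
        by (rule Henstock_Kurzweil_Integration.integral_combine) (use d dpi wi in auto)
      moreover have "integral {- d..d} (w N) + integral {d..pi} (w N) = integral {- d..pi} (w N)"
        by (rule Henstock_Kurzweil_Integration.integral_combine) (use d dpi wi in auto)
      ultimately show ?thesis by simp
    qed
    have out1: "norm (integral (cbox (- pi) (- d)) (w N)) \<le> (B * q ^ N) * measure lborel (cbox (- pi) (- d))"
      by (rule integrable_bound) (use wi B0 pq outer d dpi in \<open>auto simp: abs_if\<close>)
    have out2: "norm (integral (cbox d pi) (w N)) \<le> (B * q ^ N) * measure lborel (cbox d pi)"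
      by (rule integrable_bound) (use wi B0 pq outer d dpi in \<open>auto simp: abs_if\<close>)
    have Rek: "1/2 \<le> Re (k u)" if "\<bar>u\<bar> \<le> d" for u using d0(2)[of u] that d by linarith
    have wnn: "0 \<le> w N u" if "\<bar>u\<bar> \<le> d" for u
      unfolding w_def using Rek[OF that] cos_ge_minus_one[of u] by (intro mult_nonneg_nonneg zero_le_power) linarith+
    have "(d / 2) * p ^ N = integral {- (d/2)..d/2} (\<lambda>u. p ^ N * (1/2))" using d by simp
    also have "\<dots> \<le> integral {- (d/2)..d/2} (w N)"
    proof (rule integral_le[OF _ wi])
      fix u assume u: "u \<in> {- (d/2)..d/2}"
      have "cos (d/2) \<le> cos \<bar>u\<bar>" using u d dpi by (intro cos_monotone_0_pi_le) auto
      hence "p ^ N \<le> (1 + cos u) ^ N" using pq unfolding p_def by (intro power_mono) auto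
      moreover have "0 \<le> (1 + cos u) ^ N" using cos_ge_minus_one[of u] by (intro zero_le_power) linarith
      moreover have "1/2 \<le> Re (k u)" using u d by (intro Rek) auto
      ultimately show "p ^ N * (1/2) \<le> w N u" unfolding w_def by (intro mult_mono) auto
    qed (auto simp: integrable_const_ivl)
    also have "\<dots> \<le> integral {- d..d} (w N)"
      by (rule integral_subset_le) (use wi wnn d in auto)
    also have "\<dots> = - integral {- pi..- d} (w N) - integral {d..pi} (w N)"
    proof -
      have "w N = (\<lambda>u. (1 + cos u) ^ N * Re (k u))" by (rule ext) (simp add: w_def)
      hence "integral {- pi..pi} (w N) = 0" using re0[of N] by simp
      thus ?thesis using split by linarith
    qed
    also have "\<dots> \<le> (B * q ^ N) * (pi - d) + (B * q ^ N) * (pi - d)"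
    proof -
      have "\<bar>integral {- pi..- d} (w N)\<bar> \<le> (B * q ^ N) * (pi - d)" "\<bar>integral {d..pi} (w N)\<bar> \<le> (B * q ^ N) * (pi - d)"
        using out1 out2 d dpi by simp_all
      thus ?thesis by linarith
    qed
    also have "\<dots> \<le> 2 * pi * (B * q ^ N)"
    proof -
      have le: "(B * q ^ N) * (pi - d) \<le> (B * q ^ N) * pi" using B0 pq d by (intro mult_left_mono) auto
      have "(B * q ^ N) * pi + (B * q ^ N) * pi = 2 * pi * (B * q ^ N)" by simp
      with add_mono[OF le le] show ?thesis by (simp only:)
    qed
    finally show ?thesis .
  qed
  have "(\<lambda>N. (2 * pi * B) * (q / p) ^ N) \<longlonglongrightarrow> (2 * pi * B) * 0"
    using pq by (intro tendsto_intros LIMSEQ_power_zero) auto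
  moreover have "d / 2 \<le> (2 * pi * B) * (q / p) ^ N" for N
  proof -
    have "(d / 2) * p ^ N / p ^ N \<le> 2 * pi * (B * q ^ N) / p ^ N" using key[of N] pq by (intro divide_right_mono) auto
    thus ?thesis using pq by (simp add: power_divide)
  qed
  ultimately have "d / 2 \<le> (2 * pi * B) * 0" by (intro LIMSEQ_le_const) auto
  thus False using d by simp
qed

text \<open>\<open>g v\<close> and \<open>H u v\<close> are the first and second directional derivatives of \<open>f\<close>.\<close>

definition jet :: "real \<Rightarrow> ('a::real_normed_vector \<Rightarrow> complex) \<Rightarrow> ('a \<Rightarrow> 'a \<Rightarrow> complex) \<Rightarrow> ('a \<Rightarrow> 'a \<Rightarrow> 'a \<Rightarrow> complex) \<Rightarrow> bool" where
  "jet C f g H \<longleftrightarrow>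
    (continuous_on UNIV f \<and> (\<forall>v. continuous_on UNIV (g v)) \<and> (\<forall>u v. continuous_on UNIV (H u v))) \<and>
    ((\<forall>x. norm (f x) \<le> C) \<and> (\<forall>v x. norm (g v x) \<le> C * norm v) \<and> (\<forall>u v x. norm (H u v x) \<le> C * norm u * norm v)) \<and>
    ((\<forall>x. linear (\<lambda>v. g v x)) \<and> (\<forall>v x. linear (\<lambda>u. H u v x)) \<and> (\<forall>u x. linear (\<lambda>v. H u v x))) \<and>
    (\<forall>x v. ((\<lambda>r. f (x + r *\<^sub>R v)) has_vector_derivative g v x) (at 0)) \<and>
    (\<forall>x u v. ((\<lambda>r. g v (x + r *\<^sub>R u)) has_vector_derivative H u v x) (at 0))"

section \<open>Jets: Taylor bounds, limits and operations\<close>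

lemma jetD:
  assumes "jet C f g H"
  shows "continuous_on UNIV f" "continuous_on UNIV (g v)" "continuous_on UNIV (H u v)"
    "norm (f x) \<le> C" "norm (g v x) \<le> C * norm v" "norm (H u v x) \<le> C * norm u * norm v"
    "linear (\<lambda>v. g v x)" "linear (\<lambda>u. H u v x)" "linear (\<lambda>v. H u v x)"
    "((\<lambda>r. f (x + r *\<^sub>R v)) has_vector_derivative g v x) (at 0)"
    "((\<lambda>r. g v (x + r *\<^sub>R u)) has_vector_derivative H u v x) (at 0)"
  using assms unfolding jet_def by blast+

lemma jet_nonneg: "jet C f g H \<Longrightarrow> 0 \<le> C"
  using jetD(4) norm_ge_zero order_trans by metis

text \<open>A jet records derivatives at parameter 0 only, but at every base point; translating the
  base point gives them along the whole line.\<close>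

lemma has_vector_derivative_along:
  fixes f :: "'a::real_normed_vector \<Rightarrow> 'b::real_normed_vector"
  assumes "\<And>x. ((\<lambda>r. f (x + r *\<^sub>R v)) has_vector_derivative g x) (at 0)"
  shows "((\<lambda>r. f (x + r *\<^sub>R v)) has_vector_derivative g (x + r *\<^sub>R v)) (at r within B)"
proof -
  have "((\<lambda>s. f (x + r *\<^sub>R v + s *\<^sub>R v)) has_vector_derivative g (x + r *\<^sub>R v)) (at (- r + r))"
    using assms[of "x + r *\<^sub>R v"] by simp
  moreover have "x + r *\<^sub>R v + (- r + s) *\<^sub>R v = x + s *\<^sub>R v" for s by (simp add: algebra_simps)
  ultimately have "((\<lambda>s. f (x + s *\<^sub>R v)) has_vector_derivative g (x + r *\<^sub>R v)) (at r)"
    using has_vector_derivative_shift_arg[of "\<lambda>s. f (x + r *\<^sub>R v + s *\<^sub>R v)" _ "- r" r] by (simp only:)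
  thus ?thesis by (rule has_vector_derivative_at_within)
qed

lemma jet_g_Lipschitz:
  assumes J: "jet C f g H" shows "norm (g v (x + y) - g v x) \<le> C * norm v * norm y"
proof -
  have "norm (g v (x + 1 *\<^sub>R y) - g v (x + 0 *\<^sub>R y)) \<le> (C * norm y * norm v) * norm (1 - 0 :: real)"
  proof (rule differentiable_bound[of "{0..1}"])
    show "((\<lambda>r. g v (x + r *\<^sub>R y)) has_derivative (\<lambda>h. h *\<^sub>R H y v (x + r *\<^sub>R y))) (at r within {0..1})" for r
      using has_vector_derivative_along[OF jetD(11)[OF J]] unfolding has_vector_derivative_def .
    show "onorm (\<lambda>h :: real. h *\<^sub>R H y v (x + r *\<^sub>R y)) \<le> C * norm y * norm v" for r
      using jetD(6)[OF J, of y v "x + r *\<^sub>R y"] by (intro onorm_bound) (auto simp: mult.commute mult_left_mono jet_nonneg[OF J])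
  qed auto
  thus ?thesis by (simp add: mult_ac)
qed

lemma jet_taylor:
  assumes J: "jet C f g H" shows "norm (f (x + y) - f x - g y x) \<le> C * (norm y)\<^sup>2"
proof -
  have "norm (f (x + 1 *\<^sub>R y) - f (x + 0 *\<^sub>R y) - (1 - 0) *\<^sub>R g y (x + 0 *\<^sub>R y)) \<le> norm (1 - 0 :: real) * (C * (norm y)\<^sup>2)"
  proof (rule vector_differentiable_bound_linearization[of "{0..1}"])
    show "((\<lambda>r. f (x + r *\<^sub>R y)) has_vector_derivative g y (x + r *\<^sub>R y)) (at r within {0..1})" for r
      by (rule has_vector_derivative_along[OF jetD(10)[OF J]])
    show "norm (g y (x + r *\<^sub>R y) - g y (x + 0 *\<^sub>R y)) \<le> C * (norm y)\<^sup>2" if r: "r \<in> {0..1}" for r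
    proof -
      have "norm (g y (x + r *\<^sub>R y) - g y x) \<le> C * norm y * norm (r *\<^sub>R y)" by (rule jet_g_Lipschitz[OF J])
      also have "\<dots> = (C * (norm y)\<^sup>2) * r" using r by (simp add: power2_eq_square)
      also have "\<dots> \<le> (C * (norm y)\<^sup>2) * 1" using r jet_nonneg[OF J] by (intro mult_left_mono) auto
      finally show ?thesis by simp
    qed
  qed (auto simp: closed_segment_eq_real_ivl)
  thus ?thesis by simp
qed

text \<open>The point and the directions may move together: linearity and the norm bounds control
  the change of direction, continuity the change of point.\<close>

lemma jet_seq:
  assumes J: "jet C f g H" and x: "x \<longlonglongrightarrow> x0" and u: "u \<longlonglongrightarrow> u0" and v: "v \<longlonglongrightarrow> v0"
  shows "(\<lambda>n. f (x n)) \<longlonglongrightarrow> f x0" "(\<lambda>n. g (v n) (x n)) \<longlonglongrightarrow> g v0 x0" "(\<lambda>n. H (u n) (v n) (x n)) \<longlonglongrightarrow> H u0 v0 x0"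
proof -
  have cl: "(\<lambda>n. k (x n)) \<longlonglongrightarrow> k x0" if "continuous_on UNIV k" for k :: "'a \<Rightarrow> complex"
    using that x by (metis continuous_on_eq_continuous_at isCont_tendsto_compose open_UNIV UNIV_I)
  show "(\<lambda>n. f (x n)) \<longlonglongrightarrow> f x0" by (rule cl[OF jetD(1)[OF J]])
  have "(\<lambda>n. g (v n - v0) (x n)) \<longlonglongrightarrow> 0"
  proof (rule Lim_null_comparison[where g="\<lambda>n. C * norm (v n - v0)"])
    show "(\<lambda>n. C * norm (v n - v0)) \<longlonglongrightarrow> 0" by (intro tendsto_mult_right_zero tendsto_norm_zero LIM_zero v)
  qed (use jetD(5)[OF J] in auto)
  hence "(\<lambda>n. g (v n - v0) (x n) + g v0 (x n)) \<longlonglongrightarrow> 0 + g v0 x0" by (intro tendsto_add cl jetD[OF J])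
  thus "(\<lambda>n. g (v n) (x n)) \<longlonglongrightarrow> g v0 x0" using linear_diff[OF jetD(7)[OF J]] by simp
  have bu: "Bseq v" using v convergent_imp_Bseq convergentI by blast
  then obtain K where K: "\<And>n. norm (v n) \<le> K" by (auto simp: Bseq_def)
  have "(\<lambda>n. H (u n - u0) (v n) (x n)) \<longlonglongrightarrow> 0"
  proof (rule Lim_null_comparison[where g="\<lambda>n. (C * K) * norm (u n - u0)"])
    show "(\<lambda>n. (C * K) * norm (u n - u0)) \<longlonglongrightarrow> 0" by (intro tendsto_mult_right_zero tendsto_norm_zero LIM_zero u)
    have "norm (H (u n - u0) (v n) (x n)) \<le> (C * K) * norm (u n - u0)" for n
    proof -
      have "C * norm (u n - u0) * norm (v n) \<le> C * norm (u n - u0) * K"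
        using K jet_nonneg[OF J] by (intro mult_left_mono) auto
      thus ?thesis using jetD(6)[OF J, of "u n - u0" "v n" "x n"] by (simp add: mult_ac)
    qed
    thus "\<forall>\<^sub>F n in sequentially. norm (H (u n - u0) (v n) (x n)) \<le> (C * K) * norm (u n - u0)" by simp
  qed
  moreover have "(\<lambda>n. H u0 (v n - v0) (x n)) \<longlonglongrightarrow> 0"
  proof (rule Lim_null_comparison[where g="\<lambda>n. (C * norm u0) * norm (v n - v0)"])
    show "(\<lambda>n. (C * norm u0) * norm (v n - v0)) \<longlonglongrightarrow> 0" by (intro tendsto_mult_right_zero tendsto_norm_zero LIM_zero v)
  qed (use jetD(6)[OF J] in auto)
  ultimately have "(\<lambda>n. H (u n - u0) (v n) (x n) + H u0 (v n - v0) (x n) + H u0 v0 (x n)) \<longlonglongrightarrow> 0 + 0 + H u0 v0 x0"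
    by (intro tendsto_add cl jetD[OF J])
  moreover have "H (u n - u0) (v n) (x n) + H u0 (v n - v0) (x n) + H u0 v0 (x n) = H (u n) (v n) (x n)" for n
    using linear_diff[OF jetD(8)[OF J]] linear_diff[OF jetD(9)[OF J]] by simp
  ultimately show "(\<lambda>n. H (u n) (v n) (x n)) \<longlonglongrightarrow> H u0 v0 x0" by simp
qed

text \<open>The function determines its derivatives. Periodicity or a closed form of
  \<open>f\<close> thereby passes to \<open>g\<close> and \<open>H\<close> without further
  computation.\<close>

lemma jet_unique:
  assumes J: "jet C f g H" and J': "jet C' f g' H'"
  shows "g = g'" "H = H'"
proof -
  show 1: "g = g'" using jetD(10)[OF J] jetD(10)[OF J'] vector_derivative_unique_at by (intro ext) blast
  show "H = H'" using jetD(11)[OF J] jetD(11)[OF J'] vector_derivative_unique_at unfolding 1 by (intro ext) blast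
qed

lemma jet_mono: "jet C f g H \<Longrightarrow> C \<le> C' \<Longrightarrow> jet C' f g H"
  unfolding jet_def
  by (elim conjE, intro conjI allI) (blast | (erule allE, erule order_trans, (intro mult_right_mono | assumption), auto) |
    (erule allE, erule allE, erule order_trans, intro mult_right_mono, auto) |
    (erule allE, erule allE, erule allE, erule order_trans, intro mult_right_mono, auto))+

lemma jet_shift: "jet C f g H \<Longrightarrow> jet C (\<lambda>x. f (x + w)) (\<lambda>v x. g v (x + w)) (\<lambda>u v x. H u v (x + w))"
proof -
  assume J: "jet C f g H"
  have c: "continuous_on UNIV (\<lambda>x. k (x + w))" if "continuous_on UNIV k" for k :: "'a \<Rightarrow> complex"
    by (rule continuous_on_compose2[OF that]) (auto intro!: continuous_intros)
  have d1: "((\<lambda>r. f (x + r *\<^sub>R v + w)) has_vector_derivative g v (x + w)) (at 0)" for x v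
    using jetD(10)[OF J, of "x + w" v] by (simp add: add_ac)
  have d2: "((\<lambda>r. g v (x + r *\<^sub>R u + w)) has_vector_derivative H u v (x + w)) (at 0)" for x u v
    using jetD(11)[OF J, of v "x + w" u] by (simp add: add_ac)
  show ?thesis unfolding jet_def
    by (intro conjI allI c jetD[OF J] d1 d2)
qed

lemma jet_iexp:
  fixes h :: "'a::real_inner"
  shows "jet ((1 + norm h)\<^sup>2) (\<lambda>x. iexp (x \<bullet> h)) (\<lambda>v x. \<i> * of_real (v \<bullet> h) * iexp (x \<bullet> h))
     (\<lambda>u v x. - of_real (u \<bullet> h) * of_real (v \<bullet> h) * iexp (x \<bullet> h))"
proof -
  have h1: "1 \<le> (1 + norm h)\<^sup>2" "norm h \<le> (1 + norm h)\<^sup>2" "norm h * norm h \<le> (1 + norm h)\<^sup>2"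
    by (auto simp: power2_eq_square algebra_simps intro!: add_increasing2)
  have d: "((\<lambda>r. iexp ((x + r *\<^sub>R v) \<bullet> h)) has_vector_derivative \<i> * of_real (v \<bullet> h) * iexp (x \<bullet> h)) (at 0)" for x v
  proof -
    have "((\<lambda>z. exp (\<i> * of_real (x \<bullet> h) + \<i> * of_real (v \<bullet> h) * z)) has_field_derivative \<i> * of_real (v \<bullet> h) * iexp (x \<bullet> h)) (at (of_real 0))"
      by (auto intro!: derivative_eq_intros)
    from has_vector_derivative_real_field[OF this]
    show ?thesis by (simp add: inner_add_left algebra_simps)
  qed
  have b1: "norm (\<i> * of_real (v \<bullet> h) * iexp (x \<bullet> h)) \<le> (1 + norm h)\<^sup>2 * norm v" for v x
  proof -
    have "\<bar>v \<bullet> h\<bar> \<le> norm h * norm v" using Cauchy_Schwarz_ineq2[of v h] by (simp add: mult.commute)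
    also have "\<dots> \<le> (1 + norm h)\<^sup>2 * norm v" using h1 by (intro mult_right_mono) auto
    finally show ?thesis by (simp add: norm_mult)
  qed
  have b2: "norm (- of_real (u \<bullet> h) * of_real (v \<bullet> h) * iexp (x \<bullet> h)) \<le> (1 + norm h)\<^sup>2 * norm u * norm v" for u v x
  proof -
    have "\<bar>u \<bullet> h\<bar> * \<bar>v \<bullet> h\<bar> \<le> (norm u * norm h) * (norm v * norm h)" by (intro mult_mono Cauchy_Schwarz_ineq2) auto
    also have "\<dots> = (norm h * norm h) * (norm u * norm v)" by (simp add: mult_ac)
    also have "\<dots> \<le> (1 + norm h)\<^sup>2 * (norm u * norm v)" using h1 by (intro mult_right_mono) auto
    finally show ?thesis by (simp add: norm_mult mult.assoc)
  qed
  have d2: "((\<lambda>r. \<i> * of_real (v \<bullet> h) * iexp ((x + r *\<^sub>R u) \<bullet> h)) has_vector_derivative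
      - of_real (u \<bullet> h) * of_real (v \<bullet> h) * iexp (x \<bullet> h)) (at 0)" for x u v
    using has_vector_derivative_mult_right[OF d[of x u], of "\<i> * of_real (v \<bullet> h)"] by (simp add: mult_ac)
  show ?thesis unfolding jet_def
    using h1(1) by (intro conjI allI continuous_intros b1 b2 d d2 linearI)
      (auto simp: inner_add_left algebra_simps scaleR_conv_of_real)
qed

lemma jet_scale: "jet C f g H \<Longrightarrow> jet (cmod c * C) (\<lambda>x. c * f x) (\<lambda>v x. c * g v x) (\<lambda>u v x. c * H u v x)"
proof -
  assume J: "jet C f g H"
  have lin: "linear (\<lambda>v. c * k v)" if "linear k" for k :: "'a \<Rightarrow> complex"
    using that by (auto simp: linear_iff distrib_left)
  show ?thesis unfolding jet_def
    by (intro conjI allI continuous_on_mult_left lin jetD[OF J] has_vector_derivative_mult_right)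
      (auto simp: norm_mult mult.assoc intro!: mult_left_mono jetD(4)[OF J] jetD(5)[OF J]
         order_trans[OF jetD(6)[OF J]] )
qed


text \<open>The \<open>j\<close>-th Fourier coefficient, without the factor
  \<open>1 / (2 * pi)\<close>, of \<open>f\<close> along the line through \<open>x\<close> in
  direction \<open>e\<close> with period \<open>2 * pi * R\<close>. It is kept as a function of
  \<open>x\<close>, which makes it a jet again.\<close>

definition fcoef :: "int \<Rightarrow> real \<Rightarrow> 'a::real_normed_vector \<Rightarrow> ('a \<Rightarrow> complex) \<Rightarrow> 'a \<Rightarrow> complex" where
  "fcoef j R e f x = integral {- pi..pi} (\<lambda>u. iexp (- of_int j * u) * f (x + (R * u) *\<^sub>R e))"

lemma fcoef_integrable:
  fixes f :: "'a::real_normed_vector \<Rightarrow> complex"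
  assumes f: "continuous_on UNIV f"
  shows "(\<lambda>u. iexp (- of_int j * u) * f (x + (R * u) *\<^sub>R e)) integrable_on {a..b}"
  by (intro integrable_continuous_real continuous_intros continuous_on_compose2[OF f]) auto

text \<open>Differentiation under the integral sign; the factor \<open>2 * pi\<close> is the length
  of the interval.\<close>

lemma jet_fcoef:
  assumes J: "jet C f g H"
  shows "jet (2 * pi * C) (fcoef j R e f) (\<lambda>v. fcoef j R e (g v)) (\<lambda>u v. fcoef j R e (H u v))"
proof -
  have cp: "continuous_on (UNIV \<times> cbox a b) (\<lambda>(x, u). iexp (- of_int j * u) * k (x + (R * u) *\<^sub>R e))"
    if "continuous_on UNIV k" for k :: "'a \<Rightarrow> complex" and a b :: real
    unfolding case_prod_beta by (intro continuous_intros continuous_on_compose2[OF that]) auto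
  have cont: "continuous_on UNIV (fcoef j R e k)" if k: "continuous_on UNIV k" for k
  proof -
    have "fcoef j R e k = (\<lambda>x. integral (cbox (- pi) pi) (\<lambda>u. iexp (- of_int j * u) * k (x + (R * u) *\<^sub>R e)))"
      by (simp add: fcoef_def fun_eq_iff)
    thus ?thesis by (simp only: integral_continuous_on_param[OF cp[OF k]])
  qed
  have bound: "norm (fcoef j R e k x) \<le> 2 * pi * B" if k: "continuous_on UNIV k" "\<And>x. norm (k x) \<le> B" for k B x
  proof -
    have "0 \<le> B" using k(2) norm_ge_zero order_trans by blast
    hence "norm (integral (cbox (- pi) pi) (\<lambda>u. iexp (- of_int j * u) * k (x + (R * u) *\<^sub>R e))) \<le> B * measure lborel (cbox (- pi) pi)"
      using fcoef_integrable[OF k(1)] k(2) by (intro integrable_bound) (auto simp: norm_mult)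
    thus ?thesis by (simp add: fcoef_def mult_ac)
  qed
  have lin: "linear (\<lambda>v. fcoef j R e (K v) x)" if K: "\<And>v. continuous_on UNIV (K v)" "\<And>x. linear (\<lambda>v. K v x)"
    for K :: "'a \<Rightarrow> 'a \<Rightarrow> complex" and x
  proof (rule linearI)
    fix v w :: 'a and c :: real
    show "fcoef j R e (K (v + w)) x = fcoef j R e (K v) x + fcoef j R e (K w) x"
      unfolding fcoef_def integral_add[OF fcoef_integrable[OF K(1)] fcoef_integrable[OF K(1)], symmetric]
      by (simp add: linear_add[OF K(2)] distrib_left)
    have "iexp (- of_int j * u) * K (c *\<^sub>R v) (x + (R * u) *\<^sub>R e) = c *\<^sub>R (iexp (- of_int j * u) * K v (x + (R * u) *\<^sub>R e))" for u
      by (simp add: linear_scale[OF K(2)])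
    thus "fcoef j R e (K (c *\<^sub>R v)) x = c *\<^sub>R fcoef j R e (K v) x" unfolding fcoef_def by (simp only: integral_cmul)
  qed
  have deriv: "((\<lambda>r. fcoef j R e k (x + r *\<^sub>R v)) has_vector_derivative fcoef j R e k' x) (at 0)"
    if k: "continuous_on UNIV k" "continuous_on UNIV k'" "\<And>x. ((\<lambda>r. k (x + r *\<^sub>R v)) has_vector_derivative k' x) (at 0)" for k k' x v
  proof -
    have "((\<lambda>r. integral (cbox (- pi) pi) (\<lambda>u. iexp (- of_int j * u) * k (x + r *\<^sub>R v + (R * u) *\<^sub>R e))) has_vector_derivative
        integral (cbox (- pi) pi) (\<lambda>u. iexp (- of_int j * u) * k' (x + 0 *\<^sub>R v + (R * u) *\<^sub>R e))) (at 0 within UNIV)"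
    proof (rule leibniz_rule_vector_derivative)
      fix r u
      show "((\<lambda>r. iexp (- of_int j * u) * k (x + r *\<^sub>R v + (R * u) *\<^sub>R e)) has_vector_derivative
          iexp (- of_int j * u) * k' (x + r *\<^sub>R v + (R * u) *\<^sub>R e)) (at r within UNIV)"
        using has_vector_derivative_along[OF k(3), of "x + (R * u) *\<^sub>R e" r]
        by (intro has_vector_derivative_mult_right) (simp add: add_ac)
      show "(\<lambda>u. iexp (- of_int j * u) * k (x + r *\<^sub>R v + (R * u) *\<^sub>R e)) integrable_on cbox (- pi) pi"
        unfolding cbox_interval by (rule fcoef_integrable[OF k(1)])
    next
      show "continuous_on (UNIV \<times> cbox (- pi) pi) (\<lambda>(r, u). iexp (- of_int j * u) * k' (x + r *\<^sub>R v + (R * u) *\<^sub>R e))"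
        unfolding case_prod_beta by (intro continuous_intros continuous_on_compose2[OF k(2)]) auto
    qed auto
    thus ?thesis by (simp add: fcoef_def)
  qed
  have b1: "norm (fcoef j R e (g v) x) \<le> 2 * pi * C * norm v" for v x
    by (rule order_trans[OF bound[OF jetD(2)[OF J] jetD(5)[OF J]]]) (simp add: mult_ac)
  have b2: "norm (fcoef j R e (H u v) x) \<le> 2 * pi * C * norm u * norm v" for u v x
    by (rule order_trans[OF bound[OF jetD(3)[OF J] jetD(6)[OF J]]]) (simp add: mult_ac)
  show ?thesis unfolding jet_def
    by (intro conjI allI cont lin deriv b1 b2 bound jetD[OF J])
qed

text \<open>Moving along \<open>e\<close> translates the periodic integrand, which changes its
  integral by a phase only: the coefficient is a pure exponential in this direction.\<close>

lemma fcoef_shift: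
  assumes f: "continuous_on UNIV f" and R: "R > 0" and per: "\<And>x. f (x + (2 * pi * R) *\<^sub>R e) = f x"
  shows "fcoef j R e f (x + r *\<^sub>R e) = iexp (of_int j * r / R) * fcoef j R e f x"
proof -
  define w where "w u = iexp (- of_int j * u) * f (x + (R * u) *\<^sub>R e)" for u
  have cw: "continuous_on UNIV w"
    unfolding w_def by (intro continuous_intros continuous_on_compose2[OF f]) auto
  have wper: "w (u + 2 * pi) = w u" for u
  proof -
    have "iexp (- of_int j * (u + 2 * pi)) = iexp (- of_int j * u) * exp (- (of_int (2 * j) * pi * \<i>))"
      by (simp add: algebra_simps flip: exp_add)
    also have "exp (- (of_int (2 * j) * pi * \<i>)) = 1"
      using exp_integer_2pi[of "of_int (- j)"] by (simp add: algebra_simps)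
    finally have "iexp (- of_int j * (u + 2 * pi)) = iexp (- of_int j * u)" by simp
    moreover have "f (x + (R * (u + 2 * pi)) *\<^sub>R e) = f (x + (R * u) *\<^sub>R e)"
      using per[of "x + (R * u) *\<^sub>R e"] by (simp add: algebra_simps)
    ultimately show ?thesis by (simp only: w_def)
  qed
  have "iexp (- of_int j * u) * f (x + r *\<^sub>R e + (R * u) *\<^sub>R e) = iexp (of_int j * r / R) * w (u + r / R)" for u
  proof -
    have "x + r *\<^sub>R e + (R * u) *\<^sub>R e = x + (R * (u + r / R)) *\<^sub>R e" using R by (simp add: algebra_simps)
    moreover have "iexp (- of_int j * u) = iexp (of_int j * r / R) * iexp (- of_int j * (u + r / R))"
      using R by (simp add: field_simps flip: exp_add)
    ultimately show ?thesis by (simp only: w_def mult.assoc)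
  qed
  hence "fcoef j R e f (x + r *\<^sub>R e) = iexp (of_int j * r / R) * integral {- pi..pi} (\<lambda>u. w (u + r / R))"
    by (simp add: fcoef_def)
  also have "integral {- pi..pi} (\<lambda>u. w (u + r / R)) = fcoef j R e f x"
    unfolding periodic_integral_shift[OF cw wper] unfolding fcoef_def w_def ..
  finally show ?thesis .
qed

text \<open>Weaker than \<open>Cb2\<close>: the Hessian is bounded as an operator and continuous
  entry by entry. This admits the Gaussian, whose Hessian at 0 is minus the identity and hence not
  Hilbert-Schmidt in infinite dimension.\<close>

definition C2b :: "real \<Rightarrow> ('a::real_inner \<Rightarrow> real) \<Rightarrow> ('a \<Rightarrow> 'a) \<Rightarrow> ('a \<Rightarrow> 'a \<Rightarrow> 'a) \<Rightarrow> bool" where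
  "C2b C f g h \<longleftrightarrow> (\<forall>x. GDERIV f x :> g x) \<and> (\<forall>x. (g has_derivative h x) (at x)) \<and>
     (\<forall>x. \<bar>f x\<bar> \<le> C) \<and> (\<forall>x. norm (g x) \<le> C) \<and> (\<forall>x v. norm (h x v) \<le> C * norm v) \<and>
     (\<forall>u v. continuous_on UNIV (\<lambda>x. h x u \<bullet> v))"

definition dsine :: "real \<Rightarrow> 'a::real_inner set \<Rightarrow> 'a \<Rightarrow> 'a \<Rightarrow> 'a" where
  "dsine R E x v = (\<Sum>e\<in>E. (cos ((x \<bullet> e) / R) * (v \<bullet> e)) *\<^sub>R e)"

definition ddsine :: "real \<Rightarrow> 'a::real_inner set \<Rightarrow> 'a \<Rightarrow> 'a \<Rightarrow> 'a \<Rightarrow> 'a" where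
  "ddsine R E x u v = (\<Sum>e\<in>E. (- (1 / R) * sin ((x \<bullet> e) / R) * (u \<bullet> e) * (v \<bullet> e)) *\<^sub>R e)"

lemma C2bD:
  assumes "C2b C f g h"
  shows "GDERIV f x :> g x" "(f has_derivative (\<lambda>v. v \<bullet> g x)) (at x)" "(g has_derivative h x) (at x)"
    "\<bar>f x\<bar> \<le> C" "norm (g x) \<le> C" "norm (h x v) \<le> C * norm v"
    "continuous_on UNIV (\<lambda>x. h x u \<bullet> w)" "linear (h x)" "continuous_on UNIV f" "continuous_on UNIV g"
proof -
  have d: "\<forall>x. GDERIV f x :> g x" "\<forall>x. (g has_derivative h x) (at x)"
    and o: "\<forall>x. \<bar>f x\<bar> \<le> C" "\<forall>x. norm (g x) \<le> C" "\<forall>x v. norm (h x v) \<le> C * norm v"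
     "\<forall>u v. continuous_on UNIV (\<lambda>x. h x u \<bullet> v)"
    using assms unfolding C2b_def by blast+
  show 1: "GDERIV f x :> g x" for x using d by blast
  thus 2: "(f has_derivative (\<lambda>v. v \<bullet> g x)) (at x)" for x unfolding gderiv_def .
  show 3: "(g has_derivative h x) (at x)" for x using d by blast
  show "\<bar>f x\<bar> \<le> C" "norm (g x) \<le> C" "norm (h x v) \<le> C * norm v" "continuous_on UNIV (\<lambda>x. h x u \<bullet> w)"
    using o by blast+
  show "linear (h x)" using has_derivative_linear[OF 3] .
  show "continuous_on UNIV f" "continuous_on UNIV g"
    using has_derivative_continuous[OF 2] has_derivative_continuous[OF 3]
    by (simp_all add: continuous_on_eq_continuous_at)
qed

lemma jet_C2b:
  assumes c: "C2b C f g h"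
  shows "jet C (\<lambda>x. of_real (f x)) (\<lambda>v x. of_real (g x \<bullet> v)) (\<lambda>u v x. of_real (h x u \<bullet> v))"
proof -
  have line: "((\<lambda>r. x + r *\<^sub>R v) has_derivative (\<lambda>r. r *\<^sub>R v)) (at 0)" for x v :: 'a
    by (auto intro!: derivative_eq_intros)
  have d1: "((\<lambda>r. complex_of_real (f (x + r *\<^sub>R v))) has_vector_derivative of_real (g x \<bullet> v)) (at 0)" for x v
  proof -
    have "((\<lambda>r. f (x + r *\<^sub>R v)) has_derivative (\<lambda>r. (r *\<^sub>R v) \<bullet> g x)) (at 0)"
      using has_derivative_compose[OF line, of f "\<lambda>v. v \<bullet> g x" x v] C2bD(2)[OF c, of x] by simp
    hence "((\<lambda>r. f (x + r *\<^sub>R v)) has_vector_derivative (g x \<bullet> v)) (at 0)"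
      by (simp add: has_vector_derivative_def inner_commute)
    thus ?thesis by (rule bounded_linear.has_vector_derivative[OF bounded_linear_of_real])
  qed
  have d2: "((\<lambda>r. complex_of_real (g (x + r *\<^sub>R u) \<bullet> v)) has_vector_derivative of_real (h x u \<bullet> v)) (at 0)" for x u v
  proof -
    have "((\<lambda>r. g (x + r *\<^sub>R u)) has_derivative (\<lambda>r. h x (r *\<^sub>R u))) (at 0)"
      using has_derivative_compose[OF line, of g "h x" x u] C2bD(3)[OF c, of x] by simp
    hence "((\<lambda>r. g (x + r *\<^sub>R u)) has_vector_derivative h x u) (at 0)"
      by (simp add: has_vector_derivative_def linear_scale[OF C2bD(8)[OF c]])
    hence "((\<lambda>r. g (x + r *\<^sub>R u) \<bullet> v) has_vector_derivative h x u \<bullet> v) (at 0)"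
      by (rule bounded_linear.has_vector_derivative[OF bounded_linear_inner_left])
    thus ?thesis by (rule bounded_linear.has_vector_derivative[OF bounded_linear_of_real])
  qed
  have b1: "norm (complex_of_real (g x \<bullet> v)) \<le> C * norm v" for v x
    using order_trans[OF Cauchy_Schwarz_ineq2[of "g x" v] mult_right_mono[OF C2bD(5)[OF c, of x] norm_ge_zero]] by simp
  have b2: "norm (complex_of_real (h x u \<bullet> v)) \<le> C * norm u * norm v" for u v x
    using order_trans[OF Cauchy_Schwarz_ineq2[of "h x u" v] mult_right_mono[OF C2bD(6)[OF c, of x u] norm_ge_zero]] by simp
  have l: "linear (\<lambda>v. complex_of_real (w \<bullet> v))" for w :: 'a
    by (rule linearI) (auto simp: inner_add_right scaleR_conv_of_real)
  have l2: "linear (\<lambda>u. complex_of_real (h x u \<bullet> v))" for x v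
    by (rule linearI) (auto simp: linear_add[OF C2bD(8)[OF c]] linear_scale[OF C2bD(8)[OF c]] inner_add_left scaleR_conv_of_real)
  show ?thesis unfolding jet_def
    by (intro conjI allI continuous_intros C2bD(7,9,10)[OF c] d1 d2 b1 b2 l l2) (use C2bD(4)[OF c] in simp)
qed

section \<open>Composition with the sine map\<close>

context
  fixes E :: "'a::{real_inner, complete_space} set" and R :: real
  assumes E: "finite E" "E \<subseteq> the_onb" and R: "1 \<le> R"
begin

lemma sine_map_deriv: "((\<lambda>r. sine_map R E (x + r *\<^sub>R v)) has_vector_derivative dsine R E x v) (at 0)"
  unfolding sine_map_def dsine_def
proof (rule has_vector_derivative_sum)
  fix e
  have "((\<lambda>r. R * sin (((x + r *\<^sub>R v) \<bullet> e) / R)) has_real_derivative (cos ((x \<bullet> e) / R) * (v \<bullet> e))) (at 0)"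
    using R by (auto intro!: derivative_eq_intros simp: inner_add_left)
  from has_vector_derivative_scaleR[OF this has_vector_derivative_const[of e]]
  show "((\<lambda>r. (R * sin (((x + r *\<^sub>R v) \<bullet> e) / R)) *\<^sub>R e) has_vector_derivative (cos ((x \<bullet> e) / R) * (v \<bullet> e)) *\<^sub>R e) (at 0)"
    by simp
qed

lemma dsine_deriv: "((\<lambda>r. dsine R E (x + r *\<^sub>R u) v) has_vector_derivative ddsine R E x u v) (at 0)"
  unfolding ddsine_def dsine_def
proof (rule has_vector_derivative_sum)
  fix e
  have "((\<lambda>r. cos (((x + r *\<^sub>R u) \<bullet> e) / R) * (v \<bullet> e)) has_real_derivative (- (1 / R) * sin ((x \<bullet> e) / R) * (u \<bullet> e) * (v \<bullet> e))) (at 0)"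
    using R by (auto intro!: derivative_eq_intros simp: inner_add_left)
  from has_vector_derivative_scaleR[OF this has_vector_derivative_const[of e]]
  show "((\<lambda>r. (cos (((x + r *\<^sub>R u) \<bullet> e) / R) * (v \<bullet> e)) *\<^sub>R e) has_vector_derivative
      (- (1 / R) * sin ((x \<bullet> e) / R) * (u \<bullet> e) * (v \<bullet> e)) *\<^sub>R e) (at 0)"
    by simp
qed

lemma norm_dsine: "norm (dsine R E x v) \<le> norm v"
  using norm_diag_onb_le[OF E, of 1 "\<lambda>e. cos ((x \<bullet> e) / R) * (v \<bullet> e)" v]
  by (simp add: dsine_def abs_mult mult_left_le_one_le)

text \<open>The coordinates of \<open>u\<close> are bounded by \<open>norm u\<close>, and what is
  left is diagonal in \<open>v\<close>; the bound does not involve the size of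
  \<open>E\<close>.\<close>

lemma norm_ddsine: "norm (ddsine R E x u v) \<le> (1 / R) * (norm u * norm v)"
proof -
  have "norm (ddsine R E x u v) \<le> (1 / R * norm u) * norm v"
    unfolding ddsine_def
  proof (rule norm_diag_onb_le[OF E])
    fix e assume "e \<in> E"
    hence "\<bar>u \<bullet> e\<bar> \<le> norm u" using onb_inner_le E by blast
    moreover have "\<bar>sin ((x \<bullet> e) / R)\<bar> \<le> 1" by simp
    ultimately have "\<bar>sin ((x \<bullet> e) / R)\<bar> * \<bar>u \<bullet> e\<bar> \<le> 1 * norm u" by (intro mult_mono) auto
    hence "(1 / R) * (\<bar>sin ((x \<bullet> e) / R)\<bar> * \<bar>u \<bullet> e\<bar>) * \<bar>v \<bullet> e\<bar> \<le> (1 / R) * (1 * norm u) * \<bar>v \<bullet> e\<bar>"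
      using R by (intro mult_right_mono mult_left_mono) auto
    thus "\<bar>- (1 / R) * sin ((x \<bullet> e) / R) * (u \<bullet> e) * (v \<bullet> e)\<bar> \<le> 1 / R * norm u * \<bar>v \<bullet> e\<bar>"
      using R by (simp add: abs_mult mult_ac)
  qed (use R in auto)
  thus ?thesis by (simp add: mult_ac)
qed

text \<open>Chain rule. The first derivative of the sine map is a contraction and the second has
  norm at most \<open>1 / R \<le> 1\<close>, so the constant \<open>2 * C\<close> is the same for
  all \<open>E\<close> and \<open>R\<close>. Passing to the limit of these jets rests on
  this.\<close>

lemma jet_sine_map:
  assumes c: "C2b C f g h"
  shows "jet (2 * C) (\<lambda>x. of_real (f (sine_map R E x))) (\<lambda>v x. of_real (g (sine_map R E x) \<bullet> dsine R E x v))
    (\<lambda>u v x. of_real (h (sine_map R E x) (dsine R E x u) \<bullet> dsine R E x v + g (sine_map R E x) \<bullet> ddsine R E x u v))"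
proof -
  note J = jet_C2b[OF c]
  have C0: "0 \<le> C" by (rule jet_nonneg[OF J])
  have cds: "continuous_on UNIV (\<lambda>x. dsine R E x v)" "continuous_on UNIV (\<lambda>x. ddsine R E x u v)" for u v
    unfolding dsine_def ddsine_def divide_inverse by (intro continuous_intros)+
  have seqI: "continuous_on UNIV k" if "\<And>x x0. x \<longlonglongrightarrow> x0 \<Longrightarrow> (\<lambda>n. k (x n)) \<longlonglongrightarrow> k x0" for k :: "'a \<Rightarrow> complex"
    using that unfolding continuous_on_sequentially by (auto simp: o_def)
  have at: "(\<lambda>n. k (x n)) \<longlonglongrightarrow> k x0" if "continuous_on UNIV k" "x \<longlonglongrightarrow> x0" for k :: "'a \<Rightarrow> 'a" and x x0
    using that by (metis UNIV_I continuous_on_eq_continuous_at isCont_tendsto_compose open_UNIV)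
  have c1: "continuous_on UNIV (\<lambda>x. complex_of_real (f (sine_map R E x)))"
    by (intro seqI jet_seq(1)[OF J _ tendsto_const tendsto_const] at[OF continuous_sine_map])
  have c2: "continuous_on UNIV (\<lambda>x. complex_of_real (g (sine_map R E x) \<bullet> dsine R E x v))" for v
    by (intro seqI jet_seq(2)[OF J _ tendsto_const] at[OF continuous_sine_map] at[OF cds(1)])
  have c3: "continuous_on UNIV (\<lambda>x. complex_of_real (h (sine_map R E x) (dsine R E x u) \<bullet> dsine R E x v + g (sine_map R E x) \<bullet> ddsine R E x u v))" for u v
    unfolding of_real_add
    by (intro continuous_on_add seqI jet_seq(3)[OF J] jet_seq(2)[OF J _ tendsto_const] at[OF continuous_sine_map] at[OF cds(1)] at[OF cds(2)])
  have ds: "linear (dsine R E x)" "linear (\<lambda>u. ddsine R E x u v)" "linear (ddsine R E x u)" for x u v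
    unfolding dsine_def ddsine_def
    by (intro linear_compose_sum ballI linearI; simp add: inner_add_left algebra_simps add_divide_distrib)+
  have b1: "norm (complex_of_real (f (sine_map R E x))) \<le> 2 * C" for x
    using C2bD(4)[OF c, of "sine_map R E x"] C0 by simp
  have b2: "norm (complex_of_real (g (sine_map R E x) \<bullet> dsine R E x v)) \<le> 2 * C * norm v" for x v
  proof -
    have "norm (complex_of_real (g (sine_map R E x) \<bullet> dsine R E x v)) \<le> C * norm (dsine R E x v)" by (rule jetD(5)[OF J])
    also have "\<dots> \<le> C * norm v" by (intro mult_left_mono norm_dsine C0)
    also have "\<dots> \<le> 2 * C * norm v" using C0 by (intro mult_right_mono) auto
    finally show ?thesis .
  qed
  have b3: "norm (complex_of_real (h (sine_map R E x) (dsine R E x u) \<bullet> dsine R E x v + g (sine_map R E x) \<bullet> ddsine R E x u v)) \<le> 2 * C * norm u * norm v" for x u v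
  proof -
    have 1: "norm (complex_of_real (h (sine_map R E x) (dsine R E x u) \<bullet> dsine R E x v)) \<le> C * norm u * norm v"
    proof -
      have "C * norm (dsine R E x u) * norm (dsine R E x v) \<le> C * norm u * norm v"
        by (intro mult_mono mult_left_mono norm_dsine C0 mult_nonneg_nonneg) auto
      thus ?thesis using jetD(6)[OF J, of "sine_map R E x" "dsine R E x u" "dsine R E x v"] by linarith
    qed
    have 2: "norm (complex_of_real (g (sine_map R E x) \<bullet> ddsine R E x u v)) \<le> C * norm u * norm v"
    proof -
      have "1 / R * (norm u * norm v) \<le> 1 * (norm u * norm v)" using R by (intro mult_right_mono) auto
      hence "norm (ddsine R E x u v) \<le> norm u * norm v" using norm_ddsine[of x u v] by simp
      hence "C * norm (ddsine R E x u v) \<le> C * (norm u * norm v)" by (intro mult_left_mono C0)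
      thus ?thesis using jetD(5)[OF J, of "sine_map R E x" "ddsine R E x u v"] by (simp add: mult.assoc)
    qed
    show ?thesis unfolding of_real_add using norm_triangle_mono[OF 1 2] by (simp add: mult_ac)
  qed
  have d1: "((\<lambda>r. complex_of_real (f (sine_map R E (x + r *\<^sub>R v)))) has_vector_derivative of_real (g (sine_map R E x) \<bullet> dsine R E x v)) (at 0)" for x v
  proof -
    have "((\<lambda>r. f (sine_map R E (x + r *\<^sub>R v))) has_derivative (\<lambda>r. (r *\<^sub>R dsine R E x v) \<bullet> g (sine_map R E x))) (at 0)"
      by (rule has_derivative_compose[OF sine_map_deriv[unfolded has_vector_derivative_def]]) (use C2bD(2)[OF c, of "sine_map R E x"] in simp)
    hence "((\<lambda>r. f (sine_map R E (x + r *\<^sub>R v))) has_vector_derivative g (sine_map R E x) \<bullet> dsine R E x v) (at 0)"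
      by (simp add: has_vector_derivative_def inner_commute)
    thus ?thesis by (rule bounded_linear.has_vector_derivative[OF bounded_linear_of_real])
  qed
  have d2: "((\<lambda>r. complex_of_real (g (sine_map R E (x + r *\<^sub>R u)) \<bullet> dsine R E (x + r *\<^sub>R u) v)) has_vector_derivative
     of_real (h (sine_map R E x) (dsine R E x u) \<bullet> dsine R E x v + g (sine_map R E x) \<bullet> ddsine R E x u v)) (at 0)" for x u v
  proof -
    have "((\<lambda>r. g (sine_map R E (x + r *\<^sub>R u))) has_derivative (\<lambda>r. h (sine_map R E x) (r *\<^sub>R dsine R E x u))) (at 0)"
      by (rule has_derivative_compose[OF sine_map_deriv[unfolded has_vector_derivative_def]]) (use C2bD(3)[OF c, of "sine_map R E x"] in simp)
    hence "((\<lambda>r. g (sine_map R E (x + r *\<^sub>R u))) has_vector_derivative h (sine_map R E x) (dsine R E x u)) (at 0)"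
      by (simp add: has_vector_derivative_def linear_scale[OF C2bD(8)[OF c]])
    from bounded_bilinear.has_vector_derivative[OF bounded_bilinear_inner this dsine_deriv[of x u v]]
    have "((\<lambda>r. g (sine_map R E (x + r *\<^sub>R u)) \<bullet> dsine R E (x + r *\<^sub>R u) v) has_vector_derivative
      h (sine_map R E x) (dsine R E x u) \<bullet> dsine R E x v + g (sine_map R E x) \<bullet> ddsine R E x u v) (at 0)"
      by (simp add: add.commute)
    thus ?thesis by (rule bounded_linear.has_vector_derivative[OF bounded_linear_of_real])
  qed
  have l1: "linear (\<lambda>v. complex_of_real (w \<bullet> dsine R E x v))" for w x
    by (rule linearI) (auto simp: linear_add[OF ds(1)] linear_scale[OF ds(1)] inner_add_right scaleR_conv_of_real)
  have l2: "linear (\<lambda>u. complex_of_real (h (sine_map R E x) (dsine R E x u) \<bullet> dsine R E x v + g (sine_map R E x) \<bullet> ddsine R E x u v))" for x v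
    by (rule linearI) (auto simp: linear_add[OF ds(1)] linear_scale[OF ds(1)] linear_add[OF ds(2)] linear_scale[OF ds(2)]
      linear_add[OF C2bD(8)[OF c]] linear_scale[OF C2bD(8)[OF c]] inner_add_right inner_add_left scaleR_conv_of_real distrib_left)
  have l3: "linear (\<lambda>v. complex_of_real (h (sine_map R E x) (dsine R E x u) \<bullet> dsine R E x v + g (sine_map R E x) \<bullet> ddsine R E x u v))" for x u
    by (rule linearI) (auto simp: linear_add[OF ds(1)] linear_scale[OF ds(1)] linear_add[OF ds(3)] linear_scale[OF ds(3)]
      inner_add_right inner_add_left scaleR_conv_of_real distrib_left)
  show ?thesis unfolding jet_def
    by (intro conjI allI c1 c2 c3 d1 d2 b1 b2 b3 l1 l2 l3)
qed

lemma sine_map_periodic: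
  assumes e: "e \<in> E" shows "sine_map R E (x + (2 * pi * R) *\<^sub>R e) = sine_map R E x"
  unfolding sine_map_def
proof (rule sum.cong[OF refl])
  fix d assume d: "d \<in> E"
  have "sin (((x + (2 * pi * R) *\<^sub>R e) \<bullet> d) / R) = sin (x \<bullet> d / R)"
  proof (cases "d = e")
    case True
    have "((x + (2 * pi * R) *\<^sub>R e) \<bullet> d) / R = x \<bullet> d / R + 2 * pi"
      using True d e E R onb_inner[of e e] by (simp add: inner_add_left add_divide_distrib subset_iff)
    thus ?thesis by (simp only: sin_periodic)
  next
    case False
    thus ?thesis using d e E onb_inner[of e d] by (simp add: inner_add_left subset_iff)
  qed
  thus "(R * sin (((x + (2 * pi * R) *\<^sub>R e) \<bullet> d) / R)) *\<^sub>R d = (R * sin (x \<bullet> d / R)) *\<^sub>R d" by simp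
qed

lemma sine_map_orth:
  assumes "\<And>e. e \<in> E \<Longrightarrow> v \<bullet> e = 0" shows "sine_map R E (x + v) = sine_map R E x"
  unfolding sine_map_def using assms by (intro sum.cong) (auto simp: inner_add_left)

end

lemma dsine_LIMSEQ:
  fixes x v :: "'a::{real_inner, polish_space}"
  shows "(\<lambda>n. dsine (real (Suc n)) (onb_upto n) x v) \<longlonglongrightarrow> v"
proof -
  have "(\<lambda>n. \<Sum>e\<in>onb_upto n. (v \<bullet> e) *\<^sub>R e) \<longlonglongrightarrow> v" by (rule onb_upto_LIMSEQ[OF onb_expansion])
  moreover have "(\<lambda>n. dsine (real (Suc n)) (onb_upto n) x v - (\<Sum>e\<in>onb_upto n. (v \<bullet> e) *\<^sub>R e)) \<longlonglongrightarrow> 0"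
  proof (rule Lim_null_comparison[where g="\<lambda>n. (norm x * norm v) * (recip n)"])
    have "norm (\<Sum>e\<in>onb_upto n. ((cos ((x \<bullet> e) / real (Suc n)) - 1) * (v \<bullet> e)) *\<^sub>R e) \<le> (norm x / real (Suc n)) * norm v" for n
    proof (rule norm_diag_onb_le[OF finite_onb_upto onb_upto_subset])
      fix e :: 'a assume "e \<in> onb_upto n"
      hence e: "e \<in> the_onb" using onb_upto_subset by blast
      have "\<bar>cos s - 1\<bar> \<le> \<bar>s\<bar>" for s :: real
      proof -
        have "norm (cos s - cos 0) \<le> 1 * norm (s - 0)"
          by (rule field_differentiable_bound[of UNIV cos "\<lambda>x. - sin x"]) (auto intro!: derivative_eq_intros)
        thus ?thesis by simp
      qed
      from this[of "(x \<bullet> e) / real (Suc n)"]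
      have "\<bar>cos ((x \<bullet> e) / real (Suc n)) - 1\<bar> \<le> \<bar>x \<bullet> e\<bar> / real (Suc n)" by simp
      also have "\<dots> \<le> norm x / real (Suc n)" by (intro divide_right_mono onb_inner_le e) auto
      finally show "\<bar>(cos ((x \<bullet> e) / real (Suc n)) - 1) * (v \<bullet> e)\<bar> \<le> norm x / real (Suc n) * \<bar>v \<bullet> e\<bar>"
        unfolding abs_mult by (intro mult_right_mono) auto
    qed simp
    thus "\<forall>\<^sub>F n in sequentially. norm (dsine (real (Suc n)) (onb_upto n) x v - (\<Sum>e\<in>onb_upto n. (v \<bullet> e) *\<^sub>R e)) \<le> (norm x * norm v) * (recip n)"
      by (simp add: dsine_def scaleR_diff_left sum_subtractf left_diff_distrib)
    have "(\<lambda>n. (norm x * norm v) * (recip n)) \<longlonglongrightarrow> (norm x * norm v) * 0"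
      by (intro tendsto_intros LIMSEQ_Suc lim_1_over_n)
    thus "(\<lambda>n. (norm x * norm v) * (recip n)) \<longlonglongrightarrow> 0" by simp
  qed
  ultimately have "(\<lambda>n. (\<Sum>e\<in>onb_upto n. (v \<bullet> e) *\<^sub>R e) + (dsine (real (Suc n)) (onb_upto n) x v - (\<Sum>e\<in>onb_upto n. (v \<bullet> e) *\<^sub>R e))) \<longlonglongrightarrow> v + 0"
    by (rule tendsto_add)
  thus ?thesis by simp
qed

lemma ddsine_LIMSEQ:
  fixes x u v :: "'a::{real_inner, polish_space}"
  shows "(\<lambda>n. ddsine (real (Suc n)) (onb_upto n) x u v) \<longlonglongrightarrow> 0"
proof (rule Lim_null_comparison[where g="\<lambda>n. (norm u * norm v) * (recip n)"])
  show "\<forall>\<^sub>F n in sequentially. norm (ddsine (real (Suc n)) (onb_upto n) x u v) \<le> (norm u * norm v) * (recip n)"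
    using norm_ddsine[OF finite_onb_upto onb_upto_subset, of "real (Suc _)" _ x u v] by (simp add: mult.commute)
  have "(\<lambda>n. (norm u * norm v) * (recip n)) \<longlonglongrightarrow> (norm u * norm v) * 0"
    by (intro tendsto_intros LIMSEQ_Suc lim_1_over_n)
  thus "(\<lambda>n. (norm u * norm v) * (recip n)) \<longlonglongrightarrow> 0" by simp
qed

section \<open>The forward equation for the stochastic convolution\<close>

lemma isCont_seq: "continuous_on UNIV k \<Longrightarrow> x \<longlonglongrightarrow> x0 \<Longrightarrow> (\<lambda>n. k (x n)) \<longlonglongrightarrow> k x0"
  for k :: "'a::first_countable_topology \<Rightarrow> 'b::topological_space"
  by (rule continuous_on_tendsto_compose[of UNIV k]) auto

lemma continuous_on_UNIV_seqI:
  fixes k :: "'a::metric_space \<Rightarrow> 'b::topological_space"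
  assumes "\<And>x x0. x \<longlonglongrightarrow> x0 \<Longrightarrow> (\<lambda>n. k (x n)) \<longlonglongrightarrow> k x0"
  shows "continuous_on UNIV k"
  using assms by (intro continuous_at_imp_continuous_on ballI) (simp add: continuous_at_sequentially o_def)

text \<open>Intended for Riemann sums of Fourier coefficients: the constant depends on the total
  weight and not on the number of translates.\<close>

lemma jet_weighted_sum:
  assumes J: "jet C f g H" and I: "finite I" and W: "(\<Sum>k\<in>I. cmod (c k)) \<le> W"
  shows "jet (W * C) (\<lambda>x. \<Sum>k\<in>I. c k * f (x + w k)) (\<lambda>v x. \<Sum>k\<in>I. c k * g v (x + w k)) (\<lambda>u v x. \<Sum>k\<in>I. c k * H u v (x + w k))"
proof -
  note Js = jet_shift[OF J]
  have bd: "norm (\<Sum>k\<in>I. c k * z k) \<le> W * B" if "\<And>k. norm (z k) \<le> B" for z B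
  proof -
    have "0 \<le> B" using that norm_ge_zero order_trans by blast
    have "norm (\<Sum>k\<in>I. c k * z k) \<le> (\<Sum>k\<in>I. cmod (c k) * B)"
      by (rule sum_norm_le) (simp add: norm_mult mult_left_mono that)
    also have "\<dots> = (\<Sum>k\<in>I. cmod (c k)) * B" by (simp add: sum_distrib_right)
    also have "\<dots> \<le> W * B" using W \<open>0 \<le> B\<close> by (rule mult_right_mono)
    finally show ?thesis .
  qed
  have lin: "linear (\<lambda>v. \<Sum>k\<in>I. c k * K k v)" if "\<And>k. linear (K k)" for K :: "'b \<Rightarrow> 'a \<Rightarrow> complex"
    by (rule linearI) (simp_all add: linear_add[OF that] linear_scale[OF that] distrib_left sum.distrib scaleR_sum_right)
  have b1: "norm (\<Sum>k\<in>I. c k * g v (x + w k)) \<le> W * C * norm v" for v x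
    using bd[of "\<lambda>k. g v (x + w k)" "C * norm v"] jetD(5)[OF J] by (simp add: mult.assoc)
  have b2: "norm (\<Sum>k\<in>I. c k * H u v (x + w k)) \<le> W * C * norm u * norm v" for u v x
    using bd[of "\<lambda>k. H u v (x + w k)" "C * norm u * norm v"] jetD(6)[OF J] by (simp add: mult.assoc)
  show ?thesis unfolding jet_def
    by (intro conjI allI continuous_on_sum continuous_on_mult_left b1 b2 bd lin has_vector_derivative_sum
        has_vector_derivative_mult_right jetD[OF Js] jetD(4)[OF J])
qed

context ou_setting
begin

definition Jop :: "real \<Rightarrow> ('h \<Rightarrow> complex) \<Rightarrow> ('h \<Rightarrow> 'h \<Rightarrow> complex) \<Rightarrow> 'h \<Rightarrow> 'h \<Rightarrow> complex" where
  "Jop s f g x y = f (x + S s y) - f x - of_real (trunc y) * g (S s y) x"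

text \<open>The generator of \<open>Y\<close> at time \<open>s\<close>: drift, covariance and jumps
  of \<open>Z\<close> transported by \<open>S s\<close>. The truncation inside \<open>Jop\<close>
  refers to the original jump \<open>y\<close> and not to \<open>S s y\<close>, in agreement with
  \<open>\<psi> (Sa s h)\<close>.\<close>

definition Lop :: "real \<Rightarrow> ('h \<Rightarrow> complex) \<Rightarrow> ('h \<Rightarrow> 'h \<Rightarrow> complex) \<Rightarrow> ('h \<Rightarrow> 'h \<Rightarrow> 'h \<Rightarrow> complex) \<Rightarrow> 'h \<Rightarrow> complex" where
  "Lop s f g H x = (LINT y|\<nu>. Jop s f g x y) + 1/2 * (\<Sum>k. H (S s (qu k)) (S s (qv k)) x) + g (S s a) x"

text \<open>A common bound for the operators \<open>Lop s\<close> with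
  \<open>0 \<le> s \<le> T\<close> on jets with constant 1; the three summands account for jumps,
  trace and drift.\<close>

definition KT :: "real \<Rightarrow> real" where
  "KT T = (2 + (Mb T)\<^sup>2) * (LINT y|\<nu>. min 1 ((norm y)\<^sup>2)) + 1/2 * ((Mb T)\<^sup>2 * (\<Sum>k. norm (qu k) * norm (qv k))) + Mb T * norm a"

lemma KT_nonneg: "0 \<le> KT T"
  unfolding KT_def by (intro add_nonneg_nonneg mult_nonneg_nonneg Bochner_Integration.integral_nonneg suminf_nonneg quv(1)) auto

text \<open>Second order Taylor expansion for jumps of norm at most 1, the sup bound for the larger
  ones.\<close>

lemma Jop_bound:
  assumes J: "jet C f g H" and s: "0 \<le> s" "s \<le> T"
  shows "norm (Jop s f g x y) \<le> (C * (2 + (Mb T)\<^sup>2)) * min 1 ((norm y)\<^sup>2)"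
proof (cases "norm y \<le> 1")
  case True
  note C = jet_nonneg[OF J]
  have "norm (Jop s f g x y) \<le> C * (norm (S s y))\<^sup>2"
    using jet_taylor[OF J, of x "S s y"] True by (simp add: Jop_def trunc_simps)
  also have "\<dots> \<le> C * (Mb T * norm y)\<^sup>2" using Mb(2)[OF s, of y] C by (intro mult_left_mono power_mono) auto
  also have "\<dots> = (C * (Mb T)\<^sup>2) * (norm y)\<^sup>2" by (simp add: power_mult_distrib)
  also have "\<dots> \<le> (C * (2 + (Mb T)\<^sup>2)) * (norm y)\<^sup>2" using C by (intro mult_right_mono mult_left_mono) auto
  finally show ?thesis using True by (simp add: min1_sq)
next
  case False
  have "norm (Jop s f g x y) \<le> norm (f (x + S s y)) + norm (f x)"
    using False norm_triangle_ineq4 by (simp add: Jop_def trunc_simps)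
  also have "\<dots> \<le> C * 2" using jetD(4)[OF J, of "x + S s y"] jetD(4)[OF J, of x] by simp
  also have "\<dots> \<le> C * (2 + (Mb T)\<^sup>2)" using jet_nonneg[OF J] by (intro mult_left_mono) auto
  finally show ?thesis using False by (simp add: min1_sq)
qed

lemma Jop_measurable:
  assumes J: "jet C f g H" and s: "0 \<le> s"
  shows "Jop s f g x \<in> bm"
proof -
  have Sc: "(\<lambda>n. S s (y n)) \<longlonglongrightarrow> S s y0" if "y \<longlonglongrightarrow> y0" for y y0
    by (rule S_seq) (use s that in auto)
  have "continuous_on UNIV (\<lambda>y. f (x + S s y))"
    by (intro continuous_on_UNIV_seqI isCont_seq[OF jetD(1)[OF J]] tendsto_intros Sc)
  moreover have "continuous_on UNIV (\<lambda>y. g (S s y) x)"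
    by (intro continuous_on_UNIV_seqI jet_seq(2)[OF J tendsto_const tendsto_const] Sc)
  ultimately have [measurable]: "(\<lambda>y. f (x + S s y)) \<in> bm" "(\<lambda>y. g (S s y) x) \<in> bm"
    by (auto intro: borel_measurable_continuous_onI)
  show ?thesis unfolding Jop_def by measurable
qed

lemma Jop_integrable:
  assumes J: "jet C f g H" and s: "0 \<le> s"
  shows "integrable \<nu> (Jop s f g x)"
  by (rule Bochner_Integration.integrable_bound[OF integrable_mult_right[OF \<nu>_int, of "C * (2 + (Mb s)\<^sup>2)"]])
    (use Jop_measurable[OF assms] Jop_bound[OF J s order_refl] jet_nonneg[OF J] in \<open>auto simp: abs_mult\<close>)

lemma trace_term_bound:
  assumes J: "jet C f g H" and s: "0 \<le> s" "s \<le> T"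
  shows "norm (H (S s (qu k)) (S s (qv k)) x) \<le> (C * (Mb T)\<^sup>2) * (norm (qu k) * norm (qv k))"
proof -
  have "norm (H (S s (qu k)) (S s (qv k)) x) \<le> C * norm (S s (qu k)) * norm (S s (qv k))" by (rule jetD(6)[OF J])
  also have "\<dots> \<le> C * (Mb T * norm (qu k)) * (Mb T * norm (qv k))"
    using jet_nonneg[OF J] by (intro mult_mono mult_left_mono Mb(2)[OF s] mult_nonneg_nonneg) auto
  finally show ?thesis by (simp add: power2_eq_square mult_ac)
qed

lemma trace_term_summable:
  assumes J: "jet C f g H" and s: "0 \<le> s"
  shows "summable (\<lambda>k. H (S s (qu k)) (S s (qv k)) x)"
  by (rule summable_comparison_test'[OF summable_mult[OF quv(1)]]) (rule trace_term_bound[OF J s order_refl])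

lemma Lop_bound:
  assumes J: "jet C f g H" and s: "0 \<le> s" "s \<le> T"
  shows "norm (Lop s f g H x) \<le> C * KT T"
proof -
  have 1: "norm (LINT y|\<nu>. Jop s f g x y) \<le> (C * (2 + (Mb T)\<^sup>2)) * (LINT y|\<nu>. min 1 ((norm y)\<^sup>2))"
  proof -
    have "norm (LINT y|\<nu>. Jop s f g x y) \<le> (LINT y|\<nu>. (C * (2 + (Mb T)\<^sup>2)) * min 1 ((norm y)\<^sup>2))"
      by (intro order_trans[OF integral_norm_bound Bochner_Integration.integral_mono])
        (use Jop_integrable[OF J s(1), THEN integrable_norm] \<nu>_int Jop_bound[OF J s] in auto)
    thus ?thesis by simp
  qed
  have 2: "norm (\<Sum>k. H (S s (qu k)) (S s (qv k)) x) \<le> (C * (Mb T)\<^sup>2) * (\<Sum>k. norm (qu k) * norm (qv k))"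
  proof -
    have sm: "summable (\<lambda>k. norm (H (S s (qu k)) (S s (qv k)) x))"
      by (rule summable_comparison_test'[OF summable_mult[OF quv(1)]]) (use trace_term_bound[OF J s] in auto)
    have "norm (\<Sum>k. H (S s (qu k)) (S s (qv k)) x) \<le> (\<Sum>k. norm (H (S s (qu k)) (S s (qv k)) x))"
      by (rule summable_norm[OF sm])
    also have "\<dots> \<le> (\<Sum>k. (C * (Mb T)\<^sup>2) * (norm (qu k) * norm (qv k)))"
      by (intro suminf_le sm summable_mult quv(1) trace_term_bound[OF J s])
    finally show ?thesis by (simp add: suminf_mult[OF quv(1)])
  qed
  have 3: "norm (g (S s a) x) \<le> C * (Mb T * norm a)"
    using jetD(5)[OF J, of "S s a" x] mult_left_mono[OF Mb(2)[OF s, of a] jet_nonneg[OF J]] by linarith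
  have "norm (Lop s f g H x) \<le> norm (LINT y|\<nu>. Jop s f g x y) + norm (1/2 * (\<Sum>k. H (S s (qu k)) (S s (qv k)) x)) + norm (g (S s a) x)"
    unfolding Lop_def by (intro norm_triangle_le add_right_mono norm_triangle_ineq)
  also have "\<dots> \<le> (C * (2 + (Mb T)\<^sup>2)) * (LINT y|\<nu>. min 1 ((norm y)\<^sup>2)) + 1/2 * ((C * (Mb T)\<^sup>2) * (\<Sum>k. norm (qu k) * norm (qv k))) + C * (Mb T * norm a)"
    using 1 2 3 by (intro add_mono) (auto simp: norm_mult)
  also have "\<dots> = C * KT T" by (simp add: KT_def algebra_simps)
  finally show ?thesis .
qed

text \<open>Functions, times and points move at once, so the same statement yields continuity of
  \<open>Lop\<close> in time and space as well as convergence along approximating jets.\<close>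

lemma Lop_tendsto:
  assumes J: "\<And>n. jet C (F n) (G n) (K n)" and J0: "jet C f g H"
    and s: "\<And>n. 0 \<le> s n" "\<And>n. s n \<le> T" "0 \<le> s0"
    and c1: "\<And>y. (\<lambda>n. F n (x n + S (s n) y)) \<longlonglongrightarrow> f (x0 + S s0 y)"
    and c2: "\<And>v. (\<lambda>n. G n (S (s n) v) (x n)) \<longlonglongrightarrow> g (S s0 v) x0"
    and c3: "\<And>u v. (\<lambda>n. K n (S (s n) u) (S (s n) v) (x n)) \<longlonglongrightarrow> H (S s0 u) (S s0 v) x0"
  shows "(\<lambda>n. Lop (s n) (F n) (G n) (K n) (x n)) \<longlonglongrightarrow> Lop s0 f g H x0"
  unfolding Lop_def
proof (intro tendsto_add tendsto_mult tendsto_const c2)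
  have c0: "(\<lambda>n. F n (x n)) \<longlonglongrightarrow> f x0" using c1[of 0] s by (simp add: S_zero)
  show "(\<lambda>n. LINT y|\<nu>. Jop (s n) (F n) (G n) (x n) y) \<longlonglongrightarrow> (LINT y|\<nu>. Jop s0 f g x0 y)"
  proof (rule integral_dominated_convergence)
    show "integrable \<nu> (\<lambda>y. (C * (2 + (Mb T)\<^sup>2)) * min 1 ((norm y)\<^sup>2))" using \<nu>_int by simp
    show "Jop s0 f g x0 \<in> borel_measurable \<nu>" using Jop_measurable[OF J0 s(3)] by simp
    show "Jop (s n) (F n) (G n) (x n) \<in> borel_measurable \<nu>" for n using Jop_measurable[OF J s(1)] by simp
    show "AE y in \<nu>. (\<lambda>n. Jop (s n) (F n) (G n) (x n) y) \<longlonglongrightarrow> Jop s0 f g x0 y"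
      unfolding Jop_def by (intro AE_I2 tendsto_intros c0 c1 c2)
    show "AE y in \<nu>. norm (Jop (s n) (F n) (G n) (x n) y) \<le> (C * (2 + (Mb T)\<^sup>2)) * min 1 ((norm y)\<^sup>2)" for n
      using Jop_bound[OF J s(1,2)] by simp
  qed
  show "(\<lambda>n. \<Sum>k. K n (S (s n) (qu k)) (S (s n) (qv k)) (x n)) \<longlonglongrightarrow> (\<Sum>k. H (S s0 (qu k)) (S s0 (qv k)) x0)"
    by (rule suminf_dominated[OF c3 trace_term_bound[OF J s(1,2)] summable_mult[OF quv(1)]])
qed

lemma Lop_seq:
  assumes J: "jet C f g H" and s: "\<And>n. 0 \<le> s n" "s \<longlonglongrightarrow> s0" and x: "x \<longlonglongrightarrow> x0"
  shows "(\<lambda>n. Lop (s n) f g H (x n)) \<longlonglongrightarrow> Lop s0 f g H x0"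
proof -
  have s0: "0 \<le> s0" using s by (intro LIMSEQ_le_const[OF s(2)]) auto
  have "Bseq s" using s(2) convergent_imp_Bseq convergentI by blast
  then obtain T where T: "\<And>n. \<bar>s n\<bar> \<le> T" by (auto simp: Bseq_def)
  show ?thesis
  proof (rule Lop_tendsto[OF J J s(1) _ s0])
    show "s n \<le> T" for n by (rule abs_le_D1[OF T])
    show "(\<lambda>n. f (x n + S (s n) y)) \<longlonglongrightarrow> f (x0 + S s0 y)" for y
      by (intro isCont_seq[OF jetD(1)[OF J]] tendsto_intros x S_seq s)
    show "(\<lambda>n. g (S (s n) v) (x n)) \<longlonglongrightarrow> g (S s0 v) x0" for v
      by (intro jet_seq(2)[OF J x tendsto_const] S_seq s tendsto_const)
    show "(\<lambda>n. H (S (s n) u) (S (s n) v) (x n)) \<longlonglongrightarrow> H (S s0 u) (S s0 v) x0" for u v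
      by (intro jet_seq(3)[OF J x] S_seq s tendsto_const)
  qed
qed

lemma Lop_sum:
  assumes J: "\<And>k. k \<in> I \<Longrightarrow> jet (C k) (f k) (g k) (H k)" and I: "finite I" and s: "0 \<le> s"
  shows "Lop s (\<lambda>x. \<Sum>k\<in>I. c k * f k x) (\<lambda>v x. \<Sum>k\<in>I. c k * g k v x) (\<lambda>u v x. \<Sum>k\<in>I. c k * H k u v x) x =
    (\<Sum>k\<in>I. c k * Lop s (f k) (g k) (H k) x)"
proof -
  have "Jop s (\<lambda>x. \<Sum>k\<in>I. c k * f k x) (\<lambda>v x. \<Sum>k\<in>I. c k * g k v x) x y = (\<Sum>k\<in>I. c k * Jop s (f k) (g k) x y)" for y
    unfolding Jop_def right_diff_distrib sum_subtractf sum_distrib_left by (simp add: mult.left_commute)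
  hence "(LINT y|\<nu>. Jop s (\<lambda>x. \<Sum>k\<in>I. c k * f k x) (\<lambda>v x. \<Sum>k\<in>I. c k * g k v x) x y) = (\<Sum>k\<in>I. c k * (LINT y|\<nu>. Jop s (f k) (g k) x y))"
    using Jop_integrable[OF J s] by (simp add: Bochner_Integration.integral_sum)
  moreover have "(\<Sum>n. \<Sum>k\<in>I. c k * H k (S s (qu n)) (S s (qv n)) x) = (\<Sum>k\<in>I. c k * (\<Sum>n. H k (S s (qu n)) (S s (qv n)) x))"
    using trace_term_summable[OF J s] by (subst suminf_sum) (auto intro!: sum.cong suminf_mult summable_mult)
  ultimately show ?thesis
    unfolding Lop_def by (simp add: distrib_left sum.distrib sum_distrib_left mult.left_commute)
qed

lemma lev_S: "s \<ge> 0 \<Longrightarrow> lev (Sa s h) y = iexp (S s y \<bullet> h) - 1 - of_real (trunc y) * (\<i> * of_real (S s y \<bullet> h))"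
  using Sa[of s y h] by (simp add: lev_def inner_commute[of "Sa s h"])

text \<open>Exponentials are eigenfunctions of an operator with constant coefficients, and the three
  summands assemble to the symbol \<open>- \<psi> (Sa s h)\<close>.\<close>

lemma Lop_iexp:
  assumes s: "s \<ge> 0"
  shows "Lop s (\<lambda>x. iexp (x \<bullet> h)) (\<lambda>v x. \<i> * of_real (v \<bullet> h) * iexp (x \<bullet> h))
     (\<lambda>u v x. - of_real (u \<bullet> h) * of_real (v \<bullet> h) * iexp (x \<bullet> h)) x = - \<psi> (Sa s h) * iexp (x \<bullet> h)"
proof -
  have "Jop s (\<lambda>x. iexp (x \<bullet> h)) (\<lambda>v x. \<i> * of_real (v \<bullet> h) * iexp (x \<bullet> h)) x y = iexp (x \<bullet> h) * lev (Sa s h) y" for y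
    unfolding Jop_def lev_S[OF s] by (simp add: inner_add_left algebra_simps exp_add)
  hence 1: "(LINT y|\<nu>. Jop s (\<lambda>x. iexp (x \<bullet> h)) (\<lambda>v x. \<i> * of_real (v \<bullet> h) * iexp (x \<bullet> h)) x y) = iexp (x \<bullet> h) * (LINT y|\<nu>. lev (Sa s h) y)"
    by simp
  have qs: "summable (\<lambda>k. (qu k \<bullet> Sa s h) * (qv k \<bullet> Sa s h))" using sums_summable[OF Q_inner_sums] .
  have "(\<Sum>k. - complex_of_real (S s (qu k) \<bullet> h) * of_real (S s (qv k) \<bullet> h) * iexp (x \<bullet> h)) =
     (\<Sum>k. (- iexp (x \<bullet> h)) * of_real ((qu k \<bullet> Sa s h) * (qv k \<bullet> Sa s h)))"
    by (rule suminf_cong) (simp add: Sa[OF s] mult_ac)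
  also have "\<dots> = (- iexp (x \<bullet> h)) * (\<Sum>k. of_real ((qu k \<bullet> Sa s h) * (qv k \<bullet> Sa s h)))"
    by (rule suminf_mult) (use summable_of_real[OF qs] in simp)
  also have "(\<Sum>k. of_real ((qu k \<bullet> Sa s h) * (qv k \<bullet> Sa s h))) = complex_of_real (\<Sum>k. (qu k \<bullet> Sa s h) * (qv k \<bullet> Sa s h))"
    by (rule suminf_of_real[OF qs, symmetric])
  finally show ?thesis
    unfolding Lop_def psi_eq 1 by (simp add: Sa[OF s] algebra_simps)
qed

text \<open>The laws extended by \<open>law 0\<close> to negative times, which gives a probability
  kernel on the whole real line.\<close>

definition lk :: "real \<Rightarrow> 'h measure" where "lk s = law (max 0 s)"

lemma lk_sets [measurable_cong, simp]: "sets (lk s) = sets borel"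
  and space_lk [simp]: "space (lk s) = UNIV"
  and prob_lk: "prob_space (lk s)"
  by (auto simp: lk_def prob_law)

lemma lk_char: "s \<ge> 0 \<Longrightarrow> (LINT y|lk s. iexp (y \<bullet> h)) = cc s h"
  by (simp add: lk_def law_char)

lemma lk_integrable:
  fixes f :: "'h \<Rightarrow> 'b::{banach, second_countable_topology}"
  assumes "f \<in> bm" "\<And>y. norm (f y) \<le> C"
  shows "integrable (lk s) f"
proof -
  interpret L: prob_space "lk s" by (rule prob_lk)
  show ?thesis by (rule L.integrable_bounded[where C=C]) (use assms in auto)
qed

lemma lk_integral_bound:
  fixes f :: "'h \<Rightarrow> complex"
  assumes "f \<in> bm" "\<And>y. norm (f y) \<le> C"
  shows "norm (LINT y|lk s. f y) \<le> C"
proof -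
  interpret L: prob_space "lk s" by (rule prob_lk)
  have "norm (LINT y|lk s. f y) \<le> (LINT y|lk s. C)"
    by (intro order_trans[OF integral_norm_bound Bochner_Integration.integral_mono])
      (use lk_integrable[OF assms, THEN integrable_norm] assms(2) in auto)
  thus ?thesis using L.prob_space by simp
qed

text \<open>For exponentials the integral is continuous in \<open>s\<close> because
  \<open>cc\<close> is; sums and bounded limits preserve measurability.\<close>

lemma lk_measurable_continuous:
  fixes f :: "'h \<Rightarrow> real"
  assumes "continuous_on UNIV f" "\<And>x. \<bar>f x\<bar> \<le> C"
  shows "(\<lambda>s. LINT y|lk s. f y) \<in> bm"
  using assms
proof (induct rule: bounded_continuous_trig_induct)
  case (cos h c)
  have "(LINT y|lk s. cos (y \<bullet> h + c)) = Re (iexp c * cc (max 0 s) h)" for s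
  proof -
    have "Re (iexp c * cc (max 0 s) h) = Re (LINT y|lk s. iexp c * iexp (y \<bullet> h))"
      using law_char[of "max 0 s" h] by (simp add: lk_def)
    also have "\<dots> = (LINT y|lk s. Re (iexp c * iexp (y \<bullet> h)))"
      by (rule integral_Re[symmetric]) (rule lk_integrable[where C=1]; simp add: norm_mult)
    also have "\<dots> = (LINT y|lk s. cos (y \<bullet> h + c))"
      by (simp add: Re_exp Im_exp cos_add mult.commute)
    finally show ?thesis by simp
  qed
  moreover have "continuous_on UNIV (\<lambda>s. Re (iexp c * cc (max 0 s) h))"
    by (intro continuous_intros continuous_on_compose2[OF cc_cont[of "{0..}" h]]) auto
  ultimately show ?case by (simp add: borel_measurable_continuous_onI)
next
  case (scale u c D) thus ?case by simp
next
  case (add u v D D')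
  have "(LINT y|lk s. u y + v y) = (LINT y|lk s. u y) + (LINT y|lk s. v y)" for s
    by (intro Bochner_Integration.integral_add lk_integrable[where C=D] lk_integrable[where C=D'])
      (use add in \<open>auto intro: borel_measurable_continuous_onI\<close>)
  thus ?case using add by simp
next
  case (lim U u D)
  have Um: "U n \<in> bm" for n by (rule borel_measurable_continuous_onI[OF lim(1)])
  have um: "u \<in> bm" using lim(3) by (rule borel_measurable_LIMSEQ_real[OF _ Um])
  have "(\<lambda>n. LINT y|lk s. U n y) \<longlonglongrightarrow> (LINT y|lk s. u y)" for s
  proof -
    interpret L: prob_space "lk s" by (rule prob_lk)
    show ?thesis by (rule integral_dominated_convergence[where w="\<lambda>_. D"]) (use lim Um um in auto)
  qed
  thus ?case by (rule borel_measurable_LIMSEQ_real[OF _ lim(4)])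
qed

lemma lk_measurable: "lk \<in> measurable borel (prob_algebra borel)"
proof (rule measurable_prob_algebra_generated[where G="{F. closed F}" and \<Omega>=UNIV])
  show "sets (borel :: 'h measure) = sigma_sets UNIV {F. closed F}"
    by (simp add: borel_eq_closed sets_measure_of_conv)
  show "Int_stable {F :: 'h set. closed F}" by (auto simp: Int_stable_def)
  show "prob_space (lk s)" for s by (rule prob_lk)
  fix F :: "'h set" assume "F \<in> {F. closed F}"
  hence F: "closed F" by simp
  show "(\<lambda>s. emeasure (lk s) F) \<in> bm"
  proof (cases "F = {}")
    case False
    obtain u :: "nat \<Rightarrow> 'h \<Rightarrow> real" where cu: "\<And>n. continuous_on UNIV (u n)" and bu: "\<And>n x. \<bar>u n x\<bar> \<le> 1"
      and ind: "\<And>x. (\<lambda>n. u n x) \<longlonglongrightarrow> indicator F x"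
      using closed_indicator_approx[OF F False] by blast
    have "(\<lambda>n. LINT y|lk s. u n y) \<longlonglongrightarrow> measure (lk s) F" for s
    proof -
      interpret L: prob_space "lk s" by (rule prob_lk)
      have "(\<lambda>n. LINT y|lk s. u n y) \<longlonglongrightarrow> (LINT y|lk s. indicator F y)"
      proof (rule integral_dominated_convergence[where w="\<lambda>_. 1"])
        show "(indicator F :: 'h \<Rightarrow> real) \<in> borel_measurable (lk s)"
          using F by (intro borel_measurable_indicator) simp
        show "u n \<in> borel_measurable (lk s)" for n using borel_measurable_continuous_onI[OF cu[of n]] by simp
      qed (use ind bu in auto)
      thus ?thesis using F by simp
    qed
    hence "(\<lambda>s. measure (lk s) F) \<in> bm"
      by (rule borel_measurable_LIMSEQ_real[OF _ lk_measurable_continuous[OF cu bu]])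
    moreover have "emeasure (lk s) F = ennreal (measure (lk s) F)" for s
    proof -
      interpret L: prob_space "lk s" by (rule prob_lk)
      show ?thesis by (rule L.emeasure_eq_measure)
    qed
    ultimately show ?thesis by simp
  qed simp
qed auto

text \<open>The integral is taken against the image of \<open>lk s\<close> under
  \<open>y \<mapsto> (s, y)\<close>, a kernel into the product space, and kernels integrate jointly
  measurable functions to measurable ones.\<close>

lemma lk_integral_measurable:
  fixes G :: "real \<Rightarrow> 'h \<Rightarrow> complex"
  assumes G[measurable]: "(\<lambda>(s, y). G s y) \<in> borel_measurable (borel \<Otimes>\<^sub>M borel)"
  shows "(\<lambda>s. LINT y|lk s. G s y) \<in> bm"
proof -
  have [measurable]: "lk \<in> measurable borel (subprob_algebra borel)"
    by (rule measurable_prob_algebraD[OF lk_measurable])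
  note measurable_distr2[measurable]
  have "(\<lambda>s. integral\<^sup>L (distr (lk s) (borel \<Otimes>\<^sub>M borel) (\<lambda>y. (s, y))) (\<lambda>(s, y). G s y)) \<in> bm"
    by measurable
  moreover have "integral\<^sup>L (distr (lk s) (borel \<Otimes>\<^sub>M borel) (\<lambda>y. (s, y))) (\<lambda>(s, y). G s y) = (LINT y|lk s. G s y)" for s
    by (subst integral_distr) auto
  ultimately show ?thesis by simp
qed

section \<open>The defect of the forward equation\<close>

definition AL :: "real \<Rightarrow> 'h \<Rightarrow> ('h \<Rightarrow> complex) \<Rightarrow> ('h \<Rightarrow> 'h \<Rightarrow> complex) \<Rightarrow> ('h \<Rightarrow> 'h \<Rightarrow> 'h \<Rightarrow> complex) \<Rightarrow> complex" where
  "AL s x f g H = (LINT y|lk s. Lop (max 0 s) f g H (x + y))"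

text \<open>The defect of the forward equation started at \<open>x\<close>, defined for arbitrary
  jets. It is linear, compatible with translations and continuous under bounded convergence, and
  through these properties it is shown to vanish.\<close>

definition Lam :: "real \<Rightarrow> 'h \<Rightarrow> ('h \<Rightarrow> complex) \<Rightarrow> ('h \<Rightarrow> 'h \<Rightarrow> complex) \<Rightarrow> ('h \<Rightarrow> 'h \<Rightarrow> 'h \<Rightarrow> complex) \<Rightarrow> complex" where
  "Lam t x f g H = (LINT y|lk t. f (x + y)) - f x - (LINT s:{0..t}|lborel. AL s x f g H)"

lemma Lop_measurable:
  assumes J: "jet C f g H"
  shows "(\<lambda>y. Lop (max 0 s) f g H (x + y)) \<in> bm"
  by (intro borel_measurable_continuous_onI continuous_on_UNIV_seqI Lop_seq[OF J] tendsto_intros) auto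

lemma AL_measurable:
  assumes J: "jet C f g H"
  shows "(\<lambda>s. AL s x f g H) \<in> bm"
  unfolding AL_def
proof (rule lk_integral_measurable)
  have "continuous_on UNIV (\<lambda>p. Lop (max 0 (fst p)) f g H (x + snd p))"
    by (intro continuous_on_UNIV_seqI Lop_seq[OF J] tendsto_intros) auto
  hence "(\<lambda>p. Lop (max 0 (fst p)) f g H (x + snd p)) \<in> bm" by (rule borel_measurable_continuous_onI)
  thus "(\<lambda>(s, y). Lop (max 0 s) f g H (x + y)) \<in> borel_measurable (borel \<Otimes>\<^sub>M borel)"
    by (simp add: borel_prod case_prod_beta)
qed

lemma AL_bound:
  assumes J: "jet C f g H" and s: "s \<le> T" "0 \<le> T"
  shows "norm (AL s x f g H) \<le> C * KT T"
  unfolding AL_def by (rule lk_integral_bound[OF Lop_measurable[OF J] Lop_bound[OF J]]) (use s in auto)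

lemma AL_set_integrable:
  assumes J: "jet C f g H"
  shows "set_integrable lborel {0..t} (\<lambda>s. AL s x f g H)"
  unfolding set_integrable_def
proof (rule Bochner_Integration.integrable_bound)
  show "integrable lborel (\<lambda>s. indicator {0..t} s *\<^sub>R (C * KT t))"
    using borel_integrable_atLeastAtMost'[of 0 t "\<lambda>_. C * KT t"] unfolding set_integrable_def by simp
  show "(\<lambda>s. indicator {0..t} s *\<^sub>R AL s x f g H) \<in> borel_measurable lborel"
    using AL_measurable[OF J] by measurable
  show "AE s in lborel. norm (indicator {0..t} s *\<^sub>R AL s x f g H) \<le> norm (indicator {0..t} s *\<^sub>R (C * KT t))"
    using AL_bound[OF J, of _ t] jet_nonneg[OF J] KT_nonneg[of t] by (auto simp: indicator_def abs_mult)
qed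

text \<open>One jet constant for the whole sequence dominates the jump integrals, the integrals over
  the laws and the time integral.\<close>

lemma Lam_tendsto:
  assumes J: "\<And>n. jet C (F n) (G n) (K n)" and J0: "jet C f g H"
    and c1: "\<And>z. (\<lambda>n. F n z) \<longlonglongrightarrow> f z" and c2: "\<And>v z. (\<lambda>n. G n v z) \<longlonglongrightarrow> g v z"
    and c3: "\<And>u v z. (\<lambda>n. K n u v z) \<longlonglongrightarrow> H u v z"
  shows "(\<lambda>n. Lam t x (F n) (G n) (K n)) \<longlonglongrightarrow> Lam t x f g H"
  unfolding Lam_def
proof (intro tendsto_diff c1)
  have meas: "(\<lambda>y. k (x + y)) \<in> bm" if "continuous_on UNIV k" for k :: "'h \<Rightarrow> complex"
    by (intro borel_measurable_continuous_onI continuous_on_compose2[OF that] continuous_intros) auto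
  show "(\<lambda>n. LINT y|lk t. F n (x + y)) \<longlonglongrightarrow> (LINT y|lk t. f (x + y))"
  proof -
    interpret L: prob_space "lk t" by (rule prob_lk)
    show ?thesis
      by (rule integral_dominated_convergence[where w="\<lambda>_. C"])
        (use meas[OF jetD(1)[OF J]] meas[OF jetD(1)[OF J0]] jetD(4)[OF J] c1 in auto)
  qed
  have AL: "(\<lambda>n. AL s x (F n) (G n) (K n)) \<longlonglongrightarrow> AL s x f g H" for s
  proof -
    interpret L: prob_space "lk s" by (rule prob_lk)
    show ?thesis
      unfolding AL_def
    proof (rule integral_dominated_convergence[where w="\<lambda>_. C * KT (max 0 s)"])
      show "AE y in lk s. (\<lambda>n. Lop (max 0 s) (F n) (G n) (K n) (x + y)) \<longlonglongrightarrow> Lop (max 0 s) f g H (x + y)"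
        by (intro AE_I2 Lop_tendsto[OF J J0, of "\<lambda>_. max 0 s" "max 0 s"] c1 c2 c3) auto
      show "AE y in lk s. norm (Lop (max 0 s) (F n) (G n) (K n) (x + y)) \<le> C * KT (max 0 s)" for n
        by (intro AE_I2 Lop_bound[OF J]) auto
    qed (use Lop_measurable[OF J] Lop_measurable[OF J0] in auto)
  qed
  show "(\<lambda>n. LINT s:{0..t}|lborel. AL s x (F n) (G n) (K n)) \<longlonglongrightarrow> (LINT s:{0..t}|lborel. AL s x f g H)"
    unfolding set_lebesgue_integral_def
  proof (rule integral_dominated_convergence)
    show "integrable lborel (\<lambda>s. indicator {0..t} s *\<^sub>R (C * KT t))"
      using borel_integrable_atLeastAtMost'[of 0 t "\<lambda>_. C * KT t"] unfolding set_integrable_def by simp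
    show "AE s in lborel. (\<lambda>n. indicator {0..t} s *\<^sub>R AL s x (F n) (G n) (K n)) \<longlonglongrightarrow> indicator {0..t} s *\<^sub>R AL s x f g H"
      by (intro AE_I2 tendsto_intros AL)
    show "AE s in lborel. norm (indicator {0..t} s *\<^sub>R AL s x (F n) (G n) (K n)) \<le> indicator {0..t} s *\<^sub>R (C * KT t)" for n
      using AL_bound[OF J, of _ t] by (auto simp: indicator_def)
    show "(\<lambda>s. indicator {0..t} s *\<^sub>R AL s x f g H) \<in> borel_measurable lborel"
      "(\<lambda>s. indicator {0..t} s *\<^sub>R AL s x (F n) (G n) (K n)) \<in> borel_measurable lborel" for n
      using AL_measurable[OF J0] AL_measurable[OF J] by measurable
  qed
qed

text \<open>The operators \<open>Lop s\<close> have constant coefficients and so commute with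
  translations.\<close>

lemma Lam_shift: "Lam t x (\<lambda>z. f (z + w)) (\<lambda>v z. g v (z + w)) (\<lambda>u v z. H u v (z + w)) = Lam t (x + w) f g H"
proof -
  have "Lop s (\<lambda>z. f (z + w)) (\<lambda>v z. g v (z + w)) (\<lambda>u v z. H u v (z + w)) z = Lop s f g H (z + w)" for s z
    unfolding Lop_def Jop_def by (simp add: add_ac)
  thus ?thesis unfolding Lam_def AL_def by (simp add: add_ac)
qed

lemma Lam_sum:
  assumes J: "\<And>k. k \<in> I \<Longrightarrow> jet (C k) (f k) (g k) (H k)" and I: "finite I"
  shows "Lam t x (\<lambda>x. \<Sum>k\<in>I. c k * f k x) (\<lambda>v x. \<Sum>k\<in>I. c k * g k v x) (\<lambda>u v x. \<Sum>k\<in>I. c k * H k u v x) =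
    (\<Sum>k\<in>I. c k * Lam t x (f k) (g k) (H k))"
proof -
  have 1: "(LINT y|lk t. (\<Sum>k\<in>I. c k * f k (x + y))) = (\<Sum>k\<in>I. c k * (LINT y|lk t. f k (x + y)))"
  proof -
    have "integrable (lk t) (\<lambda>y. f k (x + y))" if "k \<in> I" for k
      by (rule lk_integrable[OF _ jetD(4)[OF J[OF that]]])
        (intro borel_measurable_continuous_onI continuous_on_compose2[OF jetD(1)[OF J[OF that]]] continuous_intros, auto)
    thus ?thesis by (simp add: Bochner_Integration.integral_sum)
  qed
  have AL: "AL s x (\<lambda>x. \<Sum>k\<in>I. c k * f k x) (\<lambda>v x. \<Sum>k\<in>I. c k * g k v x) (\<lambda>u v x. \<Sum>k\<in>I. c k * H k u v x) =
     (\<Sum>k\<in>I. c k * AL s x (f k) (g k) (H k))" for s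
  proof -
    have "integrable (lk s) (\<lambda>y. Lop (max 0 s) (f k) (g k) (H k) (x + y))" if "k \<in> I" for k
      by (rule lk_integrable[OF Lop_measurable[OF J[OF that]] Lop_bound[OF J[OF that], of _ "max 0 s"]]) auto
    thus ?thesis unfolding AL_def by (simp add: Lop_sum[OF J I] Bochner_Integration.integral_sum)
  qed
  have 2: "(LINT s:{0..t}|lborel. (\<Sum>k\<in>I. c k * AL s x (f k) (g k) (H k))) = (\<Sum>k\<in>I. c k * (LINT s:{0..t}|lborel. AL s x (f k) (g k) (H k)))"
  proof -
    have i: "integrable lborel (\<lambda>s. indicator {0..t} s *\<^sub>R AL s x (f k) (g k) (H k))" if "k \<in> I" for k
      using AL_set_integrable[OF J[OF that]] unfolding set_integrable_def .
    have "(\<lambda>s. indicator {0..t} s *\<^sub>R (\<Sum>k\<in>I. c k * AL s x (f k) (g k) (H k))) =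
       (\<lambda>s. \<Sum>k\<in>I. c k * (indicator {0..t} s *\<^sub>R AL s x (f k) (g k) (H k)))"
      by (simp add: scaleR_sum_right)
    thus ?thesis unfolding set_lebesgue_integral_def using i by (simp add: Bochner_Integration.integral_sum del: mult_scaleR_right)
  qed
  show ?thesis unfolding Lam_def AL 1 2 by (simp add: right_diff_distrib sum_subtractf)
qed

lemma Lam_scale:
  assumes J: "jet C f g H"
  shows "Lam t x (\<lambda>x. c * f x) (\<lambda>v x. c * g v x) (\<lambda>u v x. c * H u v x) = c * Lam t x f g H"
  using Lam_sum[of "{()}" "\<lambda>_. C" "\<lambda>_. f" "\<lambda>_. g" "\<lambda>_. H" t x "\<lambda>_. c"] J by simp

text \<open>On exponentials the forward equation is the integrated differential equation of
  \<open>cc\<close> in time.\<close>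

lemma Lam_iexp:
  assumes t: "t \<ge> 0"
  shows "Lam t x (\<lambda>x. iexp (x \<bullet> h)) (\<lambda>v x. \<i> * of_real (v \<bullet> h) * iexp (x \<bullet> h))
     (\<lambda>u v x. - of_real (u \<bullet> h) * of_real (v \<bullet> h) * iexp (x \<bullet> h)) = 0" (is "Lam t x ?f ?g ?H = 0")
proof -
  have e: "(LINT y|lk s. iexp ((x + y) \<bullet> h)) = iexp (x \<bullet> h) * cc s h" if "s \<ge> 0" for s
    using lk_char[OF that, of h] by (simp add: inner_add_left distrib_left exp_add)
  have "AL s x ?f ?g ?H = iexp (x \<bullet> h) * (- \<psi> (Sa s h) * cc s h)" if "s \<ge> 0" for s
  proof -
    have "AL s x ?f ?g ?H = (LINT y|lk s. - \<psi> (Sa s h) * iexp ((x + y) \<bullet> h))"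
      unfolding AL_def using that by (simp only: Lop_iexp[OF max.cobounded1]) simp
    thus ?thesis using e[OF that] by simp
  qed
  hence "(LINT s:{0..t}|lborel. AL s x ?f ?g ?H) = (LINT s:{0..t}|lborel. iexp (x \<bullet> h) * (- \<psi> (Sa s h) * cc s h))"
    by (intro set_lebesgue_integral_cong) auto
  also have "\<dots> = iexp (x \<bullet> h) * (LINT s:{0..t}|lborel. - \<psi> (Sa s h) * cc s h)" by (rule set_integral_mult_right)
  also have "(LINT s:{0..t}|lborel. - \<psi> (Sa s h) * cc s h) = cc t h - cc 0 h"
    unfolding set_lebesgue_integral_def
  proof (rule integral_FTC_atLeastAtMost[OF t])
    show "((\<lambda>t. cc t h) has_vector_derivative - \<psi> (Sa s h) * cc s h) (at s within {0..t})" if "0 \<le> s" "s \<le> t" for s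
      by (rule cc_deriv[OF that])
    show "continuous_on {0..t} (\<lambda>s. - \<psi> (Sa s h) * cc s h)"
      by (intro continuous_intros psi_Sa_cont cc_cont) auto
  qed
  finally show ?thesis unfolding Lam_def using e[OF t] by (simp add: algebra_simps)
qed

text \<open>A translation moves the base point into the function, where convergence of jets
  applies.\<close>

lemma Lam_seq:
  assumes J: "jet C f g H" and x: "x \<longlonglongrightarrow> x0"
  shows "(\<lambda>n. Lam t (x n) f g H) \<longlonglongrightarrow> Lam t x0 f g H"
proof -
  have "(\<lambda>n. Lam t 0 (\<lambda>z. f (z + x n)) (\<lambda>v z. g v (z + x n)) (\<lambda>u v z. H u v (z + x n))) \<longlonglongrightarrow>
     Lam t 0 (\<lambda>z. f (z + x0)) (\<lambda>v z. g v (z + x0)) (\<lambda>u v z. H u v (z + x0))"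
    by (intro Lam_tendsto[OF jet_shift[OF J] jet_shift[OF J]] isCont_seq[OF jetD(1)[OF J]] isCont_seq[OF jetD(2)[OF J]]
      isCont_seq[OF jetD(3)[OF J]] tendsto_intros x)
  thus ?thesis unfolding Lam_shift by simp
qed

lemma fcoef_riemann:
  assumes k: "continuous_on UNIV k"
  shows "(\<lambda>n. \<Sum>i<Suc n. ((2 * pi / real (Suc n)) *\<^sub>R iexp (- of_int j * (2 * pi * real i / real (Suc n) - pi))) *
     k (x + (R * (2 * pi * real i / real (Suc n) - pi)) *\<^sub>R e)) \<longlonglongrightarrow> fcoef j R e k (x :: 'h)"
proof -
  let ?g = "\<lambda>u. iexp (- of_int j * (u - pi)) * k (x + (R * (u - pi)) *\<^sub>R e)"
  have "continuous_on {0..2 * pi} ?g" by (intro continuous_intros continuous_on_compose2[OF k]) auto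
  from riemann_sum_LIMSEQ[OF this]
  have "(\<lambda>n. \<Sum>i<Suc n. (2 * pi / real (Suc n)) *\<^sub>R ?g (2 * pi * real i / real (Suc n))) \<longlonglongrightarrow> integral {0..2 * pi} ?g" by simp
  moreover have "integral {0..2 * pi} ?g = fcoef j R e k x"
  proof -
    have "integral {0 - pi..2 * pi - pi} (\<lambda>u. ?g (u + pi)) = integral {0..2 * pi} ?g"
      by (rule integral_shift_real_ivl)
    thus ?thesis by (simp add: fcoef_def)
  qed
  ultimately show ?thesis by simp
qed

text \<open>A Fourier coefficient is a limit of weighted sums of translates with total weight
  \<open>2 * pi\<close>. The defect commutes with such sums and with the limit, hence with the
  coefficient.\<close>

lemma Lam_fcoef:
  assumes J: "jet C f g H"
  shows "Lam t x (fcoef j R e f) (\<lambda>v. fcoef j R e (g v)) (\<lambda>u v. fcoef j R e (H u v)) = fcoef j R e (\<lambda>x. Lam t x f g H) x"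
proof (rule LIMSEQ_unique)
  define c where "c n i = (2 * pi / real (Suc n)) *\<^sub>R iexp (- of_int j * (2 * pi * real i / real (Suc n) - pi))" for n i
  define w where "w n i = (R * (2 * pi * real i / real (Suc n) - pi)) *\<^sub>R e" for n i
  have cs: "(\<Sum>i<Suc n. cmod (c n i)) \<le> 2 * pi" for n
    unfolding c_def by simp
  show "(\<lambda>n. Lam t x (\<lambda>x. \<Sum>i<Suc n. c n i * f (x + w n i)) (\<lambda>v x. \<Sum>i<Suc n. c n i * g v (x + w n i)) (\<lambda>u v x. \<Sum>i<Suc n. c n i * H u v (x + w n i)))
      \<longlonglongrightarrow> Lam t x (fcoef j R e f) (\<lambda>v. fcoef j R e (g v)) (\<lambda>u v. fcoef j R e (H u v))"
  proof (rule Lam_tendsto[OF jet_weighted_sum[OF J finite_lessThan cs] jet_fcoef[OF J]])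
    show "(\<lambda>n. \<Sum>i<Suc n. c n i * f (z + w n i)) \<longlonglongrightarrow> fcoef j R e f z" for z
      unfolding c_def w_def by (rule fcoef_riemann[OF jetD(1)[OF J]])
    show "(\<lambda>n. \<Sum>i<Suc n. c n i * g v (z + w n i)) \<longlonglongrightarrow> fcoef j R e (g v) z" for v z
      unfolding c_def w_def by (rule fcoef_riemann[OF jetD(2)[OF J]])
    show "(\<lambda>n. \<Sum>i<Suc n. c n i * H u v (z + w n i)) \<longlonglongrightarrow> fcoef j R e (H u v) z" for u v z
      unfolding c_def w_def by (rule fcoef_riemann[OF jetD(3)[OF J]])
  qed
  have "Lam t x (\<lambda>x. \<Sum>i<Suc n. c n i * f (x + w n i)) (\<lambda>v x. \<Sum>i<Suc n. c n i * g v (x + w n i)) (\<lambda>u v x. \<Sum>i<Suc n. c n i * H u v (x + w n i)) =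
     (\<Sum>i<Suc n. c n i * Lam t (x + w n i) f g H)" for n
    by (subst Lam_sum[OF jet_shift[OF J]]) (simp_all add: Lam_shift)
  moreover have "continuous_on UNIV (\<lambda>x. Lam t x f g H)" by (intro continuous_on_UNIV_seqI Lam_seq[OF J])
  ultimately show "(\<lambda>n. Lam t x (\<lambda>x. \<Sum>i<Suc n. c n i * f (x + w n i)) (\<lambda>v x. \<Sum>i<Suc n. c n i * g v (x + w n i)) (\<lambda>u v x. \<Sum>i<Suc n. c n i * H u v (x + w n i)))
      \<longlonglongrightarrow> fcoef j R e (\<lambda>x. Lam t x f g H) x"
    using fcoef_riemann[of "\<lambda>x. Lam t x f g H" j x R e] by (simp only: c_def w_def)
qed

text \<open>Induction on the set of coordinates in which the function is not yet a pure exponential: all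
  Fourier coefficients of the defect in such a coordinate vanish by the induction hypothesis.\<close>

lemma Lam_periodic_eq_0:
  assumes E: "finite E" "E \<subseteq> the_onb" and R: "R > 0" and U: "U \<subseteq> E"
    and J: "jet C f g H" and per: "\<And>e x. e \<in> E \<Longrightarrow> f (x + (2 * pi * R) *\<^sub>R e) = f x"
    and orth: "\<And>x v. (\<And>e. e \<in> E \<Longrightarrow> v \<bullet> e = 0) \<Longrightarrow> f (x + v) = f x"
    and quasi: "\<And>e. e \<in> E - U \<Longrightarrow> \<exists>j::int. \<forall>x r. f (x + r *\<^sub>R e) = iexp (of_int j * r / R) * f x"
    and t: "t \<ge> 0"
  shows "Lam t x f g H = 0"
proof -
  have "finite U" using E U finite_subset by blast
  thus ?thesis using U J per orth quasi
  proof (induct U arbitrary: C f g H x)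
    \<comment> \<open>The function is exponential along every vector of \<open>E\<close> and
      constant orthogonally to \<open>E\<close>, hence a multiple of a single exponential.\<close>
    case empty
    hence "\<forall>e\<in>E. \<exists>j::int. \<forall>x r. f (x + r *\<^sub>R e) = iexp (of_int j * r / R) * f x" by simp
    then obtain j where j: "\<And>e x r. e \<in> E \<Longrightarrow> f (x + r *\<^sub>R e) = iexp (of_int (j e) * r / R) * f x" by metis
    define h where "h = (\<Sum>e\<in>E. (of_int (j e) / R) *\<^sub>R e)"
    have fE: "f (\<Sum>e\<in>E'. c e *\<^sub>R e) = iexp (\<Sum>e\<in>E'. c e * (of_int (j e) / R)) * f 0" if "E' \<subseteq> E" for E' c
    proof -
      have "finite E'" using that E finite_subset by blast
      thus ?thesis using that
      proof induct
        case (insert e E')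
        have "f (\<Sum>e\<in>insert e E'. c e *\<^sub>R e) = f ((\<Sum>e\<in>E'. c e *\<^sub>R e) + c e *\<^sub>R e)"
          using insert by (simp add: add.commute)
        also have "\<dots> = iexp (of_int (j e) * c e / R) * f (\<Sum>e\<in>E'. c e *\<^sub>R e)" using insert by (intro j) auto
        finally show ?case using insert by (simp add: exp_add distrib_left mult_ac)
      qed simp
    qed
    have f: "f z = f 0 * iexp (z \<bullet> h)" for z
    proof -
      define p where "p = (\<Sum>e\<in>E. (z \<bullet> e) *\<^sub>R e)"
      have "f (p + (z - p)) = f p"
        by (rule empty(4)) (simp add: p_def inner_diff_left inner_sum_onb[OF E])
      moreover have "f p = iexp (\<Sum>e\<in>E. (z \<bullet> e) * (of_int (j e) / R)) * f 0" unfolding p_def by (rule fE) simp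
      moreover have "(\<Sum>e\<in>E. (z \<bullet> e) * (of_int (j e) / R)) = z \<bullet> h" by (simp add: h_def inner_sum_right mult.commute)
      ultimately have "f (p + (z - p)) = iexp (z \<bullet> h) * f 0" by (simp only:)
      thus ?thesis by (simp add: mult.commute)
    qed
    have feq: "f = (\<lambda>z. f 0 * iexp (z \<bullet> h))" by (rule ext) (rule f)
    have J1: "jet C (\<lambda>z. f 0 * iexp (z \<bullet> h)) g H" using empty(2) feq by simp
    note uniq = jet_unique[OF J1 jet_scale[OF jet_iexp, of "f 0" h]]
    have "Lam t x f g H = Lam t x (\<lambda>z. f 0 * iexp (z \<bullet> h)) (\<lambda>v x. f 0 * (\<i> * of_real (v \<bullet> h) * iexp (x \<bullet> h)))
        (\<lambda>u v x. f 0 * (- of_real (u \<bullet> h) * of_real (v \<bullet> h) * iexp (x \<bullet> h)))"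
      by (subst feq) (simp only: uniq)
    also have "\<dots> = f 0 * 0" by (simp only: Lam_scale[OF jet_iexp] Lam_iexp[OF t])
    finally show ?case by simp
  next
    case (insert e U)
    have e: "e \<in> E" "U \<subseteq> E" using insert by auto
    note J = insert(5) and per = insert(6) and orth = insert(7) and quasi = insert(8)
    have "fcoef j R e (\<lambda>x. Lam t x f g H) x = 0" for j :: int and x
      unfolding Lam_fcoef[OF J, symmetric]
    proof (rule insert(3)[OF e(2) jet_fcoef[OF J]])
      show "fcoef j R e f (x + (2 * pi * R) *\<^sub>R e') = fcoef j R e f x" if "e' \<in> E" for e' x
      proof -
        have "f (x + (2 * pi * R) *\<^sub>R e' + w) = f (x + w)" for w using per[OF that, of "x + w"] by (simp add: add_ac)
        thus ?thesis by (simp add: fcoef_def)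
      qed
      show "fcoef j R e f (x + v) = fcoef j R e f x" if "\<And>e. e \<in> E \<Longrightarrow> v \<bullet> e = 0" for x v
      proof -
        have "f (x + v + w) = f (x + w)" for w using orth[OF that, of "x + w"] by (simp add: add_ac)
        thus ?thesis by (simp add: fcoef_def)
      qed
      \<comment> \<open>Along \<open>e\<close> the coefficient has become exponential with frequency
        \<open>j\<close>; along the directions treated before it inherits the frequency of
        \<open>f\<close>.\<close>
      show "\<exists>i::int. \<forall>x r. fcoef j R e f (x + r *\<^sub>R e') = iexp (of_int i * r / R) * fcoef j R e f x" if "e' \<in> E - U" for e'
      proof (cases "e' = e")
        case True
        show ?thesis unfolding True
          by (intro exI[of _ j] allI fcoef_shift[OF jetD(1)[OF J] R per[OF e(1)]])
      next
        case False
        hence "e' \<in> E - insert e U" using that by blast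
        from quasi[OF this] obtain i :: int where i: "\<forall>x r. f (x + r *\<^sub>R e') = iexp (of_int i * r / R) * f x" ..
        have sh: "f (x + r *\<^sub>R e' + w) = iexp (of_int i * r / R) * f (x + w)" for x r w
          using i[rule_format, of "x + w" r] by (simp only: add_ac)
        have "fcoef j R e f (x + r *\<^sub>R e') = iexp (of_int i * r / R) * fcoef j R e f x" for x r
          unfolding fcoef_def sh by (simp only: mult.left_commute[of "iexp (- of_int j * _)"] integral_mult_right)
        thus ?thesis by blast
      qed
    qed
    hence z: "integral {- pi..pi} (\<lambda>u. iexp (- of_int j * u) * Lam t (x + (R * u) *\<^sub>R e) f g H) = 0" for j :: int
      by (simp add: fcoef_def)
    \<comment> \<open>The defect at \<open>x\<close> is the value at \<open>u = 0\<close> of the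
      defect along the line in direction \<open>e\<close>, a continuous periodic function with
      vanishing Fourier coefficients.\<close>
    have "Lam t (x + (R * 0) *\<^sub>R e) f g H = 0"
    proof (rule periodic_fourier_zero[of "\<lambda>u. Lam t (x + (R * u) *\<^sub>R e) f g H"])
      show "continuous_on UNIV (\<lambda>u. Lam t (x + (R * u) *\<^sub>R e) f g H)"
        by (intro continuous_on_UNIV_seqI Lam_seq[OF J] tendsto_intros)
      show "Lam t (x + (R * (u + 2 * pi)) *\<^sub>R e) f g H = Lam t (x + (R * u) *\<^sub>R e) f g H" for u
      proof -
        let ?w = "(2 * pi * R) *\<^sub>R e"
        \<comment> \<open>Only the function is assumed periodic; uniqueness of jets makes its
          derivatives periodic and with them the defect.\<close>
        have "(\<lambda>z. f (z + ?w)) = f" using per[OF e(1)] by auto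
        hence "jet C f (\<lambda>v z. g v (z + ?w)) (\<lambda>u v z. H u v (z + ?w))" using jet_shift[OF J, of ?w] by simp
        from jet_unique[OF this J] have "Lam t z f g H = Lam t (z + ?w) f g H" for z
          using Lam_shift[of t z f ?w g H] \<open>(\<lambda>z. f (z + ?w)) = f\<close> by simp
        from this[of "x + (R * u) *\<^sub>R e"] show ?thesis by (simp add: algebra_simps)
      qed
    qed (rule z)
    thus ?case by simp
  qed
qed

text \<open>Composition with the sine map leads to the periodic case with \<open>U\<close> equal to
  \<open>E\<close>, where no direction has to be exponential beforehand. The common constant
  \<open>2 * C\<close> then permits the limit.\<close>

theorem forward_equation:
  assumes c: "C2b C f g h" and t: "t \<ge> 0"
  shows "Lam t x (\<lambda>x. of_real (f x)) (\<lambda>v x. of_real (g x \<bullet> v)) (\<lambda>u v x. of_real (h x u \<bullet> v)) = 0"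
proof -
  let ?R = "\<lambda>n. real (Suc n)" and ?E = "onb_upto :: nat \<Rightarrow> 'h set"
  note J = jet_C2b[OF c]
  note Jn = jet_sine_map[OF finite_onb_upto onb_upto_subset _ c]
  have R1: "1 \<le> ?R n" for n by simp
  have J2: "jet (2 * C) (\<lambda>x. of_real (f x)) (\<lambda>v x. of_real (g x \<bullet> v)) (\<lambda>u v x. of_real (h x u \<bullet> v))"
    by (rule jet_mono[OF J]) (use jet_nonneg[OF J] in simp)
  have "(\<lambda>n. Lam t x (\<lambda>x. of_real (f (sine_map (?R n) (?E n) x))) (\<lambda>v x. of_real (g (sine_map (?R n) (?E n) x) \<bullet> dsine (?R n) (?E n) x v))
    (\<lambda>u v x. of_real (h (sine_map (?R n) (?E n) x) (dsine (?R n) (?E n) x u) \<bullet> dsine (?R n) (?E n) x v + g (sine_map (?R n) (?E n) x) \<bullet> ddsine (?R n) (?E n) x u v)))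
    \<longlonglongrightarrow> Lam t x (\<lambda>x. of_real (f x)) (\<lambda>v x. of_real (g x \<bullet> v)) (\<lambda>u v x. of_real (h x u \<bullet> v))"
  proof (rule Lam_tendsto[OF Jn[OF R1] J2])
    show "(\<lambda>n. complex_of_real (f (sine_map (?R n) (?E n) z))) \<longlonglongrightarrow> of_real (f z)" for z
      by (rule jet_seq(1)[OF J sine_map_LIMSEQ tendsto_const tendsto_const])
    show "(\<lambda>n. complex_of_real (g (sine_map (?R n) (?E n) z) \<bullet> dsine (?R n) (?E n) z v)) \<longlonglongrightarrow> of_real (g z \<bullet> v)" for v z
      by (rule jet_seq(2)[OF J sine_map_LIMSEQ tendsto_const dsine_LIMSEQ])
    show "(\<lambda>n. complex_of_real (h (sine_map (?R n) (?E n) z) (dsine (?R n) (?E n) z u) \<bullet> dsine (?R n) (?E n) z v + g (sine_map (?R n) (?E n) z) \<bullet> ddsine (?R n) (?E n) z u v))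
        \<longlonglongrightarrow> of_real (h z u \<bullet> v)" for u v z
    proof -
      have a: "(\<lambda>n. complex_of_real (h (sine_map (?R n) (?E n) z) (dsine (?R n) (?E n) z u) \<bullet> dsine (?R n) (?E n) z v)) \<longlonglongrightarrow> of_real (h z u \<bullet> v)"
        by (rule jet_seq(3)[OF J sine_map_LIMSEQ dsine_LIMSEQ dsine_LIMSEQ])
      have b: "(\<lambda>n. complex_of_real (g (sine_map (?R n) (?E n) z) \<bullet> ddsine (?R n) (?E n) z u v)) \<longlonglongrightarrow> of_real (g z \<bullet> 0)"
        by (rule jet_seq(2)[OF J sine_map_LIMSEQ tendsto_const ddsine_LIMSEQ])
      show ?thesis using tendsto_add[OF a b] by simp
    qed
  qed
  moreover have "Lam t x (\<lambda>x. of_real (f (sine_map (?R n) (?E n) x))) (\<lambda>v x. of_real (g (sine_map (?R n) (?E n) x) \<bullet> dsine (?R n) (?E n) x v))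
    (\<lambda>u v x. of_real (h (sine_map (?R n) (?E n) x) (dsine (?R n) (?E n) x u) \<bullet> dsine (?R n) (?E n) x v + g (sine_map (?R n) (?E n) x) \<bullet> ddsine (?R n) (?E n) x u v)) = 0" for n
  proof (rule Lam_periodic_eq_0[OF finite_onb_upto onb_upto_subset _ order_refl Jn[OF R1] _ _ _ t])
    show "complex_of_real (f (sine_map (?R n) (?E n) (x + (2 * pi * ?R n) *\<^sub>R e))) = of_real (f (sine_map (?R n) (?E n) x))" if "e \<in> ?E n" for e x
      using sine_map_periodic[OF finite_onb_upto onb_upto_subset R1 that] by simp
    show "complex_of_real (f (sine_map (?R n) (?E n) (x + v))) = of_real (f (sine_map (?R n) (?E n) x))" if "\<And>e. e \<in> ?E n \<Longrightarrow> v \<bullet> e = 0" for x v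
      using sine_map_orth[OF finite_onb_upto onb_upto_subset R1 that] by simp
  qed auto
  ultimately show ?thesis by (simp add: LIMSEQ_const_iff)
qed

end

section \<open>Small time asymptotics of the transition semigroup\<close>

lemma
  fixes m :: "'a::{real_inner, second_countable_topology} measure"
  assumes "finite_measure m" "sets m = sets borel"
  shows integral_cos_inner: "(LINT x|m. cos (x \<bullet> h)) = Re (LINT x|m. iexp (x \<bullet> h))"
    and integral_sin_inner: "(LINT x|m. sin (x \<bullet> h)) = Im (LINT x|m. iexp (x \<bullet> h))"
proof -
  interpret m: finite_measure m by fact
  note [measurable_cong] = assms(2)
  have i: "integrable m (\<lambda>x. iexp (x \<bullet> h))" by (rule m.integrable_bounded[where C=1]; simp)
  show "(LINT x|m. cos (x \<bullet> h)) = Re (LINT x|m. iexp (x \<bullet> h))"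
    unfolding integral_Re[OF i, symmetric] by (simp add: Re_exp)
  show "(LINT x|m. sin (x \<bullet> h)) = Im (LINT x|m. iexp (x \<bullet> h))"
    unfolding integral_Im[OF i, symmetric] by (simp add: Im_exp)
qed

lemma one_plus_mult_exp_le: "(1 + s) * exp (- s / 2) \<le> (2 :: real)" if "s \<ge> 0"
proof -
  have "1 + s \<le> 2 * (1 + s / 2)" by simp
  also have "\<dots> \<le> 2 * exp (s / 2)" using exp_ge_add_one_self[of "s / 2"] by (intro mult_left_mono) auto
  finally have "(1 + s) * exp (- s / 2) \<le> (2 * exp (s / 2)) * exp (- s / 2)" by (intro mult_right_mono) auto
  also have "\<dots> = 2" by (simp flip: exp_add)
  finally show ?thesis .
qed

text \<open>The test function that measures the tails of the law: it is 1 at 0 and smaller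
  elsewhere. The bounds on its derivatives come from
  \<open>(1 + (norm x)\<^sup>2) * exp (- (x \<bullet> x) / 2) \<le> 2\<close>.\<close>

lemma C2b_gaussian:
  "C2b 3 (\<lambda>x. exp (- (x \<bullet> x) / 2)) (\<lambda>x. - exp (- (x \<bullet> x) / 2) *\<^sub>R x)
     (\<lambda>x v. (exp (- (x \<bullet> x) / 2) * (v \<bullet> x)) *\<^sub>R x - exp (- (x \<bullet> x) / 2) *\<^sub>R v)"
  unfolding C2b_def
proof (intro conjI allI)
  fix x v w :: 'a
  let ?e = "exp (- (x \<bullet> x) / 2)"
  have d: "((\<lambda>x. exp (- (x \<bullet> x) / 2)) has_derivative (\<lambda>v. - (?e * (v \<bullet> x)))) (at x)"
    by (auto intro!: derivative_eq_intros simp: inner_commute algebra_simps)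
  show "GDERIV (\<lambda>x. exp (- (x \<bullet> x) / 2)) x :> - ?e *\<^sub>R x"
    unfolding gderiv_def using d by simp
  show "((\<lambda>x. - exp (- (x \<bullet> x) / 2) *\<^sub>R x) has_derivative (\<lambda>v. (?e * (v \<bullet> x)) *\<^sub>R x - ?e *\<^sub>R v)) (at x)"
    by (rule has_derivative_eq_rhs[OF has_derivative_scaleR[OF has_derivative_minus[OF d] has_derivative_ident]])
      (auto simp: fun_eq_iff)
  have e2: "(1 + (norm x)\<^sup>2) * ?e \<le> 2" using one_plus_mult_exp_le[of "(norm x)\<^sup>2"] by (simp add: power2_norm_eq_inner)
  have "?e \<le> exp 0" by (subst exp_le_cancel_iff) simp
  thus "\<bar>?e\<bar> \<le> 3" by (simp only: abs_of_pos[OF exp_gt_zero] exp_zero)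
  have n1: "norm x \<le> 1 + (norm x)\<^sup>2"
  proof (cases "norm x \<le> 1")
    case True thus ?thesis using zero_le_power2[of "norm x"] by linarith
  next
    case False
    hence "norm x * 1 \<le> norm x * norm x" by (intro mult_left_mono) auto
    thus ?thesis by (simp add: power2_eq_square)
  qed
  have "norm x * ?e \<le> (1 + (norm x)\<^sup>2) * ?e" using n1 by (intro mult_right_mono) auto
  with e2 have "norm x * ?e \<le> 3" by linarith
  thus "norm (- ?e *\<^sub>R x) \<le> 3" by (simp add: mult.commute)
  have "norm ((?e * (v \<bullet> x)) *\<^sub>R x - ?e *\<^sub>R v) \<le> norm ((?e * (v \<bullet> x)) *\<^sub>R x) + norm (?e *\<^sub>R v)" by (rule norm_triangle_ineq4)
  also have "\<dots> \<le> ?e * (norm v * norm x) * norm x + ?e * norm v"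
  proof (intro add_mono)
    have "?e * \<bar>v \<bullet> x\<bar> * norm x \<le> ?e * (norm v * norm x) * norm x"
      by (intro mult_right_mono mult_left_mono Cauchy_Schwarz_ineq2) auto
    thus "norm ((?e * (v \<bullet> x)) *\<^sub>R x) \<le> ?e * (norm v * norm x) * norm x" by (simp add: abs_mult)
  qed simp
  also have "\<dots> = ((1 + (norm x)\<^sup>2) * ?e) * norm v" by (simp add: power2_eq_square algebra_simps)
  also have "\<dots> \<le> 3 * norm v" using e2 by (intro mult_right_mono) auto
  finally show "norm ((?e * (v \<bullet> x)) *\<^sub>R x - ?e *\<^sub>R v) \<le> 3 * norm v" .
  show "continuous_on UNIV (\<lambda>x. ((exp (- (x \<bullet> x) / 2) * (v \<bullet> x)) *\<^sub>R x - exp (- (x \<bullet> x) / 2) *\<^sub>R v) \<bullet> w)"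
    by (intro continuous_intros) auto
qed

context ou_setting
begin

section \<open>The transition operators and their semigroup law\<close>

lemma law_lk: "t \<ge> 0 \<Longrightarrow> law t = lk t" by (simp add: lk_def)

lemma ou_law:
  fixes f :: "'h \<Rightarrow> 'b::{banach, second_countable_topology}"
  assumes t: "t \<ge> 0" and f: "f \<in> bm"
  shows "ou_semigroup M S Y t f x = (LINT y|lk t. f (S t x + y))"
  unfolding ou_semigroup_def law_lk[OF t, symmetric] law_def
  by (subst integral_distr) (use Y_measurable[OF t] f in auto)

lemma P_integrable:
  fixes f :: "'h \<Rightarrow> 'b::{banach, second_countable_topology}"
  assumes f[measurable]: "f \<in> bm" and C: "\<And>x. norm (f x) \<le> C"
  shows "integrable (lk t) (\<lambda>y. f (z + y))"
  by (rule lk_integrable[OF _ C]) simp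

lemma P_bound:
  fixes f :: "'h \<Rightarrow> real"
  assumes t: "t \<ge> 0" and f: "f \<in> bm" "\<And>x. \<bar>f x\<bar> \<le> C"
  shows "\<bar>ou_semigroup M S Y t f x\<bar> \<le> C"
proof -
  interpret L: prob_space "lk t" by (rule prob_lk)
  have "\<bar>ou_semigroup M S Y t f x\<bar> \<le> (LINT y|lk t. C)"
    unfolding ou_law[OF t f(1)]
    by (intro order_trans[OF integral_abs_bound Bochner_Integration.integral_mono] integrable_abs P_integrable[of f C]) (use f in auto)
  thus ?thesis using L.prob_space by simp
qed

lemma P_measurable:
  fixes f :: "'h \<Rightarrow> real"
  assumes t: "t \<ge> 0" and f[measurable]: "f \<in> bm"
  shows "(\<lambda>x. ou_semigroup M S Y t f x) \<in> bm"
proof -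
  interpret L: prob_space "lk t" by (rule prob_lk)
  note [measurable] = S_borel[OF t]
  have "(\<lambda>x. LINT y|lk t. f (S t x + y)) \<in> bm"
    by (rule L.borel_measurable_lebesgue_integral) measurable
  thus ?thesis by (simp add: ou_law[OF t f])
qed

lemma convolution_integral:
  fixes k :: "'h \<Rightarrow> 'b::{banach, second_countable_topology}"
  assumes t: "t \<ge> 0" and s: "s \<ge> 0" and [measurable]: "k \<in> bm" and b: "\<And>x. norm (k x) \<le> B"
  shows "(LINT x|distr (lk s \<Otimes>\<^sub>M lk t) borel (\<lambda>(y, z). S t y + z). k x) = (LINT y|lk s. (LINT z|lk t. k (S t y + z)))"
proof -
  note [measurable] = S_borel[OF t]
  interpret L1: prob_space "lk s" by (rule prob_lk)
  interpret L2: prob_space "lk t" by (rule prob_lk)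
  interpret LP: pair_prob_space "lk s" "lk t" ..
  have mm: "(\<lambda>(y, z). S t y + z) \<in> measurable (lk s \<Otimes>\<^sub>M lk t) borel" by measurable
  have "(LINT x|distr (lk s \<Otimes>\<^sub>M lk t) borel (\<lambda>(y, z). S t y + z). k x) = (LINT p|(lk s \<Otimes>\<^sub>M lk t). (\<lambda>(y, z). k (S t y + z)) p)"
    by (subst integral_distr[OF mm]) (auto simp: case_prod_unfold)
  also have "\<dots> = (LINT y|lk s. (LINT z|lk t. k (S t y + z)))"
  proof -
    have "integrable (lk s \<Otimes>\<^sub>M lk t) (\<lambda>(y, z). k (S t y + z))"
      by (rule LP.P.integrable_bounded[where C=B], measurable) (auto simp: b)
    from LP.integral_fst'[OF this] show ?thesis by (simp add: case_prod_unfold)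
  qed
  finally show ?thesis .
qed

text \<open>The image of \<open>Y s\<close> under \<open>S t\<close> plus an independent copy of
  \<open>Y t\<close> has the characteristic function of \<open>Y (t + s)\<close> by
  \<open>cc_add\<close>, and equal transforms give equal integrals.\<close>

lemma P_semigroup:
  fixes f :: "'h \<Rightarrow> real"
  assumes t: "t \<ge> 0" and s: "s \<ge> 0" and f[measurable]: "f \<in> bm" and C: "\<And>x. \<bar>f x\<bar> \<le> C"
  shows "ou_semigroup M S Y (t + s) f x = ou_semigroup M S Y s (\<lambda>x. ou_semigroup M S Y t f x) x"
proof -
  note [measurable] = S_borel[OF t]
  interpret L1: prob_space "lk s" by (rule prob_lk)
  interpret L2: prob_space "lk t" by (rule prob_lk)
  interpret LP: pair_prob_space "lk s" "lk t" ..
  define m where "m = distr (lk s \<Otimes>\<^sub>M lk t) borel (\<lambda>(y, z). S t y + z)"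
  have mm: "(\<lambda>(y, z). S t y + z) \<in> measurable (lk s \<Otimes>\<^sub>M lk t) borel" by measurable
  have pm: "prob_space m" unfolding m_def by (rule LP.prob_space_distr[OF mm])
  have fm: "finite_measure m" by (rule prob_space.finite_measure[OF pm])
  note ml = convolution_integral[OF t s, folded m_def]
  have char: "(LINT x|m. iexp (x \<bullet> h)) = (LINT x|lk (t + s). iexp (x \<bullet> h))" for h
  proof -
    have "(LINT x|m. iexp (x \<bullet> h)) = (LINT y|lk s. (LINT z|lk t. iexp ((S t y + z) \<bullet> h)))"
      by (rule ml[where B=1]; simp)
    also have "\<dots> = (LINT y|lk s. iexp (y \<bullet> Sa t h) * cc t h)"
      using lk_char[OF t, of h] by (simp add: inner_add_left distrib_left exp_add Sa[OF t])
    also have "\<dots> = cc s (Sa t h) * cc t h" using lk_char[OF s, of "Sa t h"] by simp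
    also have "\<dots> = (LINT x|lk (t + s). iexp (x \<bullet> h))" using t s by (simp add: lk_char cc_add)
    finally show ?thesis .
  qed
  let ?k = "\<lambda>w. f (S (t + s) x + w)"
  have km[measurable]: "?k \<in> bm" by measurable
  have "(LINT w|m. ?k w) = (LINT w|lk (t + s). ?k w)"
  proof (rule integral_eq_of_char_eq[where C=C])
    show "finite_measure m" by (rule fm)
    show "finite_measure (lk (t + s))" by (rule prob_space.finite_measure[OF prob_lk])
    show "sets m = sets borel" "sets (lk (t + s)) = sets borel" by (auto simp: m_def)
    show "(LINT x|m. cos (x \<bullet> h)) = (LINT x|lk (t + s). cos (x \<bullet> h))" for h
      by (subst (1 2) integral_cos_inner) (auto simp: m_def fm[unfolded m_def] char[unfolded m_def] prob_space.finite_measure[OF prob_lk])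
    show "(LINT x|m. sin (x \<bullet> h)) = (LINT x|lk (t + s). sin (x \<bullet> h))" for h
      by (subst (1 2) integral_sin_inner) (auto simp: m_def fm[unfolded m_def] char[unfolded m_def] prob_space.finite_measure[OF prob_lk])
  qed (use C km in auto)
  moreover have "(LINT w|m. ?k w) = (LINT y|lk s. (LINT z|lk t. ?k (S t y + z)))"
    by (rule ml[where B=C]) (use C in auto)
  moreover have "?k (S t y + z) = f (S t (S s x + y) + z)" for y z
    using S_add[OF t s, of x] S_plus[OF t] by (simp add: add_ac)
  moreover have "ou_semigroup M S Y s (\<lambda>x. ou_semigroup M S Y t f x) x = (LINT y|lk s. ou_semigroup M S Y t f (S s x + y))"
    by (rule ou_law[OF s P_measurable[OF t f]])
  ultimately show ?thesis using t s by (simp add: ou_law[OF _ f])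
qed

section \<open>Small time bounds and limits\<close>

lemma Lam_zero_increment:
  assumes c: "C2b C f g h" and t: "t \<ge> 0"
  shows "complex_of_real ((LINT y|lk t. f (x + y)) - f x) =
    (LINT s:{0..t}|lborel. AL s x (\<lambda>x. of_real (f x)) (\<lambda>v x. of_real (g x \<bullet> v)) (\<lambda>u v x. of_real (h x u \<bullet> v)))"
  using forward_equation[OF c t, of x] by (simp add: Lam_def)

lemma increment_bound:
  assumes c: "C2b C f g h" and t: "0 \<le> t" "t \<le> T"
  shows "\<bar>(LINT y|lk t. f (x + y)) - f x\<bar> \<le> t * (C * KT T)"
proof -
  let ?AL = "\<lambda>s. AL s x (\<lambda>x. of_real (f x)) (\<lambda>v x. of_real (g x \<bullet> v)) (\<lambda>u v x. of_real (h x u \<bullet> v))"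
  note J = jet_C2b[OF c]
  have "\<bar>(LINT y|lk t. f (x + y)) - f x\<bar> = norm (LINT s:{0..t}|lborel. ?AL s)"
    unfolding Lam_zero_increment[OF c t(1), symmetric] norm_of_real ..
  also have "\<dots> \<le> (LINT s|lborel. indicator {0..t} s *\<^sub>R (C * KT T))"
    unfolding set_lebesgue_integral_def
  proof (intro order_trans[OF integral_norm_bound Bochner_Integration.integral_mono])
    show "integrable lborel (\<lambda>s. norm (indicator {0..t} s *\<^sub>R ?AL s))"
      using AL_set_integrable[OF J, of t x] unfolding set_integrable_def by (rule integrable_norm)
    show "integrable lborel (\<lambda>s. indicator {0..t} s *\<^sub>R (C * KT T))"
      using borel_integrable_atLeastAtMost'[of 0 t "\<lambda>_. C * KT T"] unfolding set_integrable_def by simp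
    show "norm (indicator {0..t} s *\<^sub>R ?AL s) \<le> indicator {0..t} s *\<^sub>R (C * KT T)" for s
      using AL_bound[OF J, of s T x] t by (auto simp: indicator_def)
  qed
  also have "\<dots> = t * (C * KT T)" using t by simp
  finally show ?thesis .
qed

text \<open>One minus the Gaussian dominates a multiple of the indicator of the tail, and by the
  forward equation for the Gaussian its expectation is of order \<open>t\<close>.\<close>

lemma law_tail:
  assumes t: "0 \<le> t" "t \<le> 1" and \<rho>: "\<rho> > 0"
  shows "(1 - exp (- \<rho>\<^sup>2 / 2)) * measure (lk t) {y. \<rho> \<le> norm y} \<le> t * (3 * KT 1)"
proof -
  interpret L: prob_space "lk t" by (rule prob_lk)
  let ?f = "\<lambda>x :: 'h. exp (- (x \<bullet> x) / 2)"
  have fi: "integrable (lk t) ?f" by (rule lk_integrable[where C=1]) auto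
  have B: "{y :: 'h. \<rho> \<le> norm y} \<in> sets (lk t)" by simp measurable
  have "(1 - exp (- \<rho>\<^sup>2 / 2)) * measure (lk t) {y. \<rho> \<le> norm y} =
      (LINT y|lk t. (1 - exp (- \<rho>\<^sup>2 / 2)) * indicator {y. \<rho> \<le> norm y} y)" by simp
  also have "\<dots> \<le> (LINT y|lk t. 1 - ?f y)"
  proof (rule Bochner_Integration.integral_mono)
    show "integrable (lk t) (\<lambda>y. (1 - exp (- \<rho>\<^sup>2 / 2)) * indicator {y. \<rho> \<le> norm y} y)"
      using B by (intro integrable_mult_right integrable_real_indicator) (auto simp: L.emeasure_eq_measure)
    show "integrable (lk t) (\<lambda>y. 1 - ?f y)" using fi by simp
    fix y :: 'h
    show "(1 - exp (- \<rho>\<^sup>2 / 2)) * indicator {y. \<rho> \<le> norm y} y \<le> 1 - ?f y"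
    proof (cases "\<rho> \<le> norm y")
      case True
      hence "\<rho>\<^sup>2 \<le> (norm y)\<^sup>2" using \<rho> by (intro power_mono) auto
      thus ?thesis using True by (simp add: power2_norm_eq_inner)
    qed simp
  qed
  also have "\<dots> = - ((LINT y|lk t. ?f (0 + y)) - ?f 0)" using fi L.prob_space by simp
  also have "\<dots> \<le> t * (3 * KT 1)" using increment_bound[OF C2b_gaussian t, of 0] by (simp only: abs_le_iff)
  finally show ?thesis .
qed

text \<open>\<open>Lop\<close> is continuous at \<open>(0, x)\<close>, so small values of the noise
  change it little; larger values have probability of order \<open>s\<close>, and \<open>Lop\<close>
  is bounded.\<close>

lemma AL_near_0:
  assumes J: "jet C f g H" and e: "e > 0"
  shows "\<exists>\<delta>>0. \<forall>s z. 0 \<le> s \<and> s < \<delta> \<and> norm (z - x) < \<delta> \<longrightarrow> norm (AL s z f g H - Lop 0 f g H x) \<le> e"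
proof -
  have "continuous_on UNIV (\<lambda>p. Lop (max 0 (fst p)) f g H (snd p))"
    by (intro continuous_on_UNIV_seqI Lop_seq[OF J] tendsto_intros) auto
  hence "isCont (\<lambda>p. Lop (max 0 (fst p)) f g H (snd p)) (0, x)" by (simp add: continuous_on_eq_continuous_at)
  hence "\<forall>e>0. \<exists>d>0. \<forall>p. dist p (0, x) < d \<longrightarrow> dist (Lop (max 0 (fst p)) f g H (snd p)) (Lop 0 f g H x) < e"
    unfolding continuous_at_eps_delta by simp
  hence "\<exists>d>0. \<forall>p. dist p (0, x) < d \<longrightarrow> dist (Lop (max 0 (fst p)) f g H (snd p)) (Lop 0 f g H x) < e / 2"
    by (rule allE[of _ "e / 2"]) (use e in simp)
  then obtain d where d: "d > 0" "\<And>p. dist p (0, x) < d \<Longrightarrow> dist (Lop (max 0 (fst p)) f g H (snd p)) (Lop 0 f g H x) < e / 2"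
    by blast
  \<comment> \<open>A third of \<open>d\<close> each for \<open>s\<close>, for \<open>z - x\<close>
    and for \<open>y\<close>.\<close>
  define \<rho> where "\<rho> = d / 3"
  have \<rho>: "\<rho> > 0" using d by (simp add: \<rho>_def)
  define K where "K = C * KT 1"
  have K: "K \<ge> 0" using jet_nonneg[OF J] KT_nonneg by (simp add: K_def)
  define \<theta> where "\<theta> = 1 - exp (- \<rho>\<^sup>2 / 2)"
  have \<theta>: "\<theta> > 0" using \<rho> by (simp add: \<theta>_def)
  \<comment> \<open>\<open>B - 1\<close> is the factor of \<open>s\<close> in the tail term, so
    \<open>s \<le> e / (2 * B)\<close> makes this term at most \<open>e / 2\<close>; the summand 1
    keeps \<open>B\<close> positive.\<close>
  define B where "B = 2 * K * (3 * KT 1) / \<theta> + 1"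
  have B: "B > 0" using K KT_nonneg[of 1] \<theta> by (simp add: B_def add_nonneg_pos)
  define \<delta> where "\<delta> = min (min \<rho> 1) (e / (2 * B))"
  have \<delta>: "\<delta> > 0" "\<delta> \<le> \<rho>" "\<delta> \<le> 1" "\<delta> \<le> e / (2 * B)" using \<rho> e B by (auto simp: \<delta>_def)
  have "norm (AL s z f g H - Lop 0 f g H x) \<le> e" if s: "0 \<le> s" "s < \<delta>" and z: "norm (z - x) < \<delta>" for s z
  proof -
    interpret L: prob_space "lk s" by (rule prob_lk)
    let ?F = "\<lambda>y. Lop (max 0 s) f g H (z + y)"
    have Fb: "norm (?F y) \<le> K" for y unfolding K_def by (rule Lop_bound[OF J]) (use s \<delta> in auto)
    have L0b: "norm (Lop 0 f g H x) \<le> K" unfolding K_def by (rule Lop_bound[OF J]) auto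
    have Fi: "integrable (lk s) ?F" by (rule lk_integrable[OF Lop_measurable[OF J] Fb])
    have Bs: "{y :: 'h. \<rho> \<le> norm y} \<in> sets (lk s)" by simp measurable
    have "AL s z f g H - Lop 0 f g H x = (LINT y|lk s. ?F y - Lop 0 f g H x)"
      using Fi L.prob_space by (simp add: AL_def)
    hence "norm (AL s z f g H - Lop 0 f g H x) \<le> (LINT y|lk s. norm (?F y - Lop 0 f g H x))" by simp
    also have "\<dots> \<le> (LINT y|lk s. e / 2 + 2 * K * indicator {y. \<rho> \<le> norm y} y)"
    proof (rule Bochner_Integration.integral_mono)
      show "integrable (lk s) (\<lambda>y. norm (?F y - Lop 0 f g H x))" using Fi by (intro integrable_norm Bochner_Integration.integrable_diff) auto
      show "integrable (lk s) (\<lambda>y. e / 2 + 2 * K * indicator {y. \<rho> \<le> norm y} y)"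
        using Bs by (intro Bochner_Integration.integrable_add integrable_mult_right integrable_real_indicator) (auto simp: L.emeasure_eq_measure)
      fix y :: 'h
      show "norm (?F y - Lop 0 f g H x) \<le> e / 2 + 2 * K * indicator {y. \<rho> \<le> norm y} y"
      proof (cases "\<rho> \<le> norm y")
        case True
        have "norm (?F y - Lop 0 f g H x) \<le> K + K" using norm_triangle_ineq4[of "?F y" "Lop 0 f g H x"] Fb[of y] L0b by linarith
        thus ?thesis using True e by simp
      next
        case False
        have "dist (s, z + y) (0, x) \<le> \<bar>s\<bar> + norm (z + y - x)"
          using norm_Pair_le[of s "z + y - x"] by (simp add: dist_norm)
        also have "\<dots> < \<rho> + (\<rho> + \<rho>)" using False s z \<delta> norm_triangle_ineq[of "z - x" y] by (simp add: algebra_simps)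
        finally have "dist (?F y) (Lop 0 f g H x) < e / 2" using d(2)[of "(s, z + y)"] by (simp add: \<rho>_def)
        thus ?thesis using False by (simp add: dist_norm)
      qed
    qed
    also have "\<dots> = e / 2 + 2 * K * measure (lk s) {y. \<rho> \<le> norm y}"
    proof -
      have "integrable (lk s) (\<lambda>y. 2 * K * indicator {y. \<rho> \<le> norm y} y)"
        using Bs by (intro integrable_mult_right integrable_real_indicator) (auto simp: L.emeasure_eq_measure)
      thus ?thesis using L.prob_space by simp
    qed
    also have "\<dots> \<le> e / 2 + 2 * K * (s * (3 * KT 1) / \<theta>)"
    proof -
      have "\<theta> * measure (lk s) {y. \<rho> \<le> norm y} \<le> s * (3 * KT 1)" unfolding \<theta>_def by (rule law_tail) (use s \<delta> \<rho> in auto)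
      hence "measure (lk s) {y. \<rho> \<le> norm y} \<le> s * (3 * KT 1) / \<theta>" using \<theta> by (simp add: pos_le_divide_eq mult.commute)
      thus ?thesis using K by (intro add_left_mono mult_left_mono) auto
    qed
    also have "2 * K * (s * (3 * KT 1) / \<theta>) = s * (B - 1)" by (simp add: B_def)
    also have "s * (B - 1) \<le> (e / (2 * B)) * B"
    proof (rule mult_mono)
      show "s \<le> e / (2 * B)" using s \<delta> by linarith
      show "0 \<le> B - 1" using K KT_nonneg[of 1] \<theta> by (simp add: B_def)
      show "0 \<le> e / (2 * B)" using e B by simp
    qed simp
    also have "(e / (2 * B)) * B = e / 2" using B by simp
    finally show ?thesis by simp
  qed
  thus ?thesis using \<delta>(1) by blast
qed

text \<open>The base points move because the transition operator averages \<open>f\<close> around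
  \<open>S t x\<close> and not around \<open>x\<close>.\<close>

lemma small_time_limit:
  assumes c: "C2b C f g h" and t: "\<And>n. 0 < t n" "t \<longlonglongrightarrow> 0" and z: "z \<longlonglongrightarrow> x"
  shows "(\<lambda>n. ((LINT y|lk (t n). f (z n + y)) - f (z n)) / t n) \<longlonglongrightarrow>
    Re (Lop 0 (\<lambda>x. of_real (f x)) (\<lambda>v x. of_real (g x \<bullet> v)) (\<lambda>u v x. of_real (h x u \<bullet> v)) x)"
    (is "_ \<longlonglongrightarrow> Re ?L")
proof (rule LIMSEQ_I)
  fix e :: real assume "e > 0"
  hence e2: "e / 2 > 0" by simp
  note J = jet_C2b[OF c]
  let ?AL = "\<lambda>s z. AL s z (\<lambda>x. of_real (f x)) (\<lambda>v x. of_real (g x \<bullet> v)) (\<lambda>u v x. of_real (h x u \<bullet> v))"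
  obtain \<delta> where \<delta>: "\<delta> > 0" "\<And>s z. 0 \<le> s \<Longrightarrow> s < \<delta> \<Longrightarrow> norm (z - x) < \<delta> \<Longrightarrow> norm (?AL s z - ?L) \<le> e / 2"
    using AL_near_0[OF J e2, of x] by blast
  have "\<forall>\<^sub>F n in sequentially. t n < \<delta>" by (rule order_tendstoD(2)[OF t(2) \<delta>(1)])
  moreover have "\<forall>\<^sub>F n in sequentially. dist (z n) x < \<delta>" by (rule tendstoD[OF z \<delta>(1)])
  ultimately have "\<forall>\<^sub>F n in sequentially. norm (((LINT y|lk (t n). f (z n + y)) - f (z n)) / t n - Re ?L) < e"
  proof eventually_elim
    case (elim n)
    have i: "set_integrable lborel {0..t n} (\<lambda>s. ?AL s (z n))" by (rule AL_set_integrable[OF J])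
    have ic: "set_integrable lborel {0..t n} (\<lambda>s. ?L)" by (rule borel_integrable_atLeastAtMost') simp
    have "complex_of_real ((LINT y|lk (t n). f (z n + y)) - f (z n)) - t n * ?L = (LINT s:{0..t n}|lborel. ?AL s (z n) - ?L)"
      using set_integral_diff(2)[OF i ic] Lam_zero_increment[OF c less_imp_le[OF t(1)], of n "z n"] t(1)[of n]
      by (simp add: set_lebesgue_integral_def scaleR_conv_of_real)
    also have "norm \<dots> \<le> (LINT s|lborel. indicator {0..t n} s *\<^sub>R (e / 2))"
      unfolding set_lebesgue_integral_def
    proof (intro order_trans[OF integral_norm_bound Bochner_Integration.integral_mono])
      show "integrable lborel (\<lambda>s. norm (indicator {0..t n} s *\<^sub>R (?AL s (z n) - ?L)))"
        using set_integral_diff(1)[OF i ic] unfolding set_integrable_def by (rule integrable_norm)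
      show "integrable lborel (\<lambda>s. indicator {0..t n} s *\<^sub>R (e / 2))"
        using borel_integrable_atLeastAtMost'[of 0 "t n" "\<lambda>_. e / 2"] unfolding set_integrable_def by simp
      show "norm (indicator {0..t n} s *\<^sub>R (?AL s (z n) - ?L)) \<le> indicator {0..t n} s *\<^sub>R (e / 2)" for s
        using \<delta>(2)[of s "z n"] elim by (auto simp: indicator_def dist_norm)
    qed
    also have "\<dots> = t n * (e / 2)" using t(1)[of n] by simp
    finally have le: "norm (complex_of_real ((LINT y|lk (t n). f (z n + y)) - f (z n)) - t n * ?L) \<le> t n * (e / 2)" .
    have "\<bar>((LINT y|lk (t n). f (z n + y)) - f (z n)) - t n * Re ?L\<bar> \<le> t n * (e / 2)"
      using order_trans[OF abs_Re_le_cmod le] by simp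
    hence "\<bar>((LINT y|lk (t n). f (z n + y)) - f (z n)) - t n * Re ?L\<bar> / t n \<le> e / 2"
      using t(1)[of n] by (simp add: pos_divide_le_eq mult.commute)
    moreover have "\<bar>((LINT y|lk (t n). f (z n + y)) - f (z n)) - t n * Re ?L\<bar> / t n = \<bar>((LINT y|lk (t n). f (z n + y)) - f (z n)) / t n - Re ?L\<bar>"
    proof -
      have "((LINT y|lk (t n). f (z n + y)) - f (z n)) / t n - Re ?L = (((LINT y|lk (t n). f (z n + y)) - f (z n)) - t n * Re ?L) / t n"
        using t(1)[of n] by (simp add: diff_divide_distrib)
      thus ?thesis using t(1)[of n] by (simp only: abs_divide abs_of_pos)
    qed
    ultimately show ?case using \<open>e > 0\<close> by simp
  qed
  thus "\<exists>N. \<forall>n\<ge>N. norm (((LINT y|lk (t n). f (z n + y)) - f (z n)) / t n - Re ?L) < e"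
    by (simp add: eventually_sequentially)
qed

end

section \<open>Existence\<close>

lemma bcontfun_bound:
  assumes "f \<in> bcontfun" obtains C where "0 \<le> C" "\<And>x. norm (f x :: 'b::real_normed_vector) \<le> C"
proof -
  have "bounded (range f)" using assms unfolding bcontfun_def by auto
  then obtain C where C: "\<And>x. norm (f x) \<le> C" unfolding bounded_iff by auto
  moreover have "0 \<le> C" using C[of undefined] norm_ge_zero order_trans by blast
  ultimately show ?thesis using that by blast
qed

lemma bcontfun_I:
  fixes f :: "'a::topological_space \<Rightarrow> 'b::real_normed_vector"
  shows "continuous_on UNIV f \<Longrightarrow> (\<And>x. norm (f x) \<le> C) \<Longrightarrow> f \<in> bcontfun"
  unfolding bcontfun_def bounded_iff by auto

lemma bcontfun_cont: "f \<in> bcontfun \<Longrightarrow> continuous_on UNIV f"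
  unfolding bcontfun_def by auto

text \<open>Cauchy-Schwarz on the coordinates of a truncation of \<open>v\<close>, followed by the
  limit over \<open>onb_upto\<close>.\<close>

lemma hs_norm_apply_le:
  fixes T :: "'a::{real_inner, polish_space} \<Rightarrow> 'a"
  assumes T: "hilbert_schmidt T"
  shows "norm (T v) \<le> hs_norm T * norm v"
proof -
  have bl: "bounded_linear T" and sm: "(\<lambda>e. (norm (T e))\<^sup>2) summable_on the_onb"
    using T unfolding hilbert_schmidt_def by auto
  have le: "norm (T (\<Sum>e\<in>onb_upto n. (v \<bullet> e) *\<^sub>R e)) \<le> hs_norm T * norm v" for n
  proof -
    let ?E = "onb_upto n :: 'a set"
    have "T (\<Sum>e\<in>?E. (v \<bullet> e) *\<^sub>R e) = (\<Sum>e\<in>?E. (v \<bullet> e) *\<^sub>R T e)"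
      using bl by (simp add: linear_sum linear_scale bounded_linear.linear)
    hence "norm (T (\<Sum>e\<in>?E. (v \<bullet> e) *\<^sub>R e)) \<le> (\<Sum>e\<in>?E. \<bar>v \<bullet> e\<bar> * \<bar>norm (T e)\<bar>)"
      by (simp add: sum_norm_le)
    also have "\<dots> \<le> L2_set (\<lambda>e. v \<bullet> e) ?E * L2_set (\<lambda>e. norm (T e)) ?E" by (rule L2_set_mult_ineq)
    also have "\<dots> \<le> norm v * hs_norm T"
    proof (rule mult_mono)
      show "L2_set (\<lambda>e. v \<bullet> e) ?E \<le> norm v"
        unfolding L2_set_def using bessel_finite[OF finite_onb_upto onb_upto_subset, of v n] by (simp add: real_le_lsqrt)
      have "(\<Sum>e\<in>?E. (norm (T e))\<^sup>2) \<le> (\<Sum>\<^sub>\<infinity>e\<in>the_onb. (norm (T e))\<^sup>2)"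
        by (rule finite_sum_le_infsum[OF sm finite_onb_upto onb_upto_subset]) simp
      thus "L2_set (\<lambda>e. norm (T e)) ?E \<le> hs_norm T" unfolding L2_set_def hs_norm_def by simp
    qed (auto simp: L2_set_def sum_nonneg)
    finally show ?thesis by (simp add: mult.commute)
  qed
  have "(\<lambda>n. T (\<Sum>e\<in>onb_upto n. (v \<bullet> e) *\<^sub>R e)) \<longlonglongrightarrow> T v"
    by (rule bounded_linear.tendsto[OF bl onb_upto_LIMSEQ[OF onb_expansion]])
  from tendsto_norm[OF this] show ?thesis by (rule LIMSEQ_le_const2) (use le in blast)
qed

lemma power2_norm_diff_le: "(norm (x - y))\<^sup>2 \<le> 2 * (norm x)\<^sup>2 + 2 * (norm (y::'a::real_inner))\<^sup>2"
  using parallelogram_law[of x y] zero_le_power2[of "norm (x + y)"] by linarith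

lemma hilbert_schmidt_diff:
  assumes "hilbert_schmidt T" "hilbert_schmidt T'"
  shows "hilbert_schmidt (\<lambda>v. T v - T' v)"
  unfolding hilbert_schmidt_def
proof
  show "bounded_linear (\<lambda>v. T v - T' v)" using assms unfolding hilbert_schmidt_def by (intro bounded_linear_sub) auto
  have "(\<lambda>e. 2 * (norm (T e))\<^sup>2 + 2 * (norm (T' e))\<^sup>2) summable_on the_onb"
    using assms unfolding hilbert_schmidt_def by (intro summable_on_add summable_on_cmult_right) auto
  thus "(\<lambda>e. (norm (T e - T' e))\<^sup>2) summable_on the_onb"
    by (rule summable_on_comparison_test) (auto intro: order_trans[OF _ power2_norm_diff_le])
qed

lemma grad_eq: "GDERIV f x :> g \<Longrightarrow> grad f x = g"
  unfolding grad_def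
proof (rule the_equality)
  fix g' assume "GDERIV f x :> g'" and g: "GDERIV f x :> g"
  hence "(\<lambda>v. v \<bullet> g') = (\<lambda>v. v \<bullet> g)" unfolding gderiv_def by (rule has_derivative_unique)
  thus "g' = g" by (metis vector_eq_ldot)
qed

lemma GDERIV_grad:
  fixes f :: "'a::{real_inner, complete_space} \<Rightarrow> real"
  assumes "f differentiable (at x)" shows "GDERIV f x :> grad f x"
proof -
  obtain f' where f': "(f has_derivative f') (at x)" using assms unfolding differentiable_def by blast
  obtain z where z: "\<And>v. f' v = v \<bullet> z" using riesz_representation[OF has_derivative_bounded_linear[OF f']] by blast
  have "GDERIV f x :> z" unfolding gderiv_def using f' z by (simp add: fun_eq_iff[symmetric] ext[of f' "\<lambda>v. v \<bullet> z"])
  thus ?thesis using grad_eq by metis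
qed

text \<open>The Hilbert-Schmidt norm dominates the operator norm, so boundedness and continuity in
  the former give an operator bound and continuous entries.\<close>

lemma Cb2_C2b:
  fixes f :: "'a::{real_inner, polish_space} \<Rightarrow> real"
  assumes f: "f \<in> Cb2"
  shows "\<exists>C. C2b C f (grad f) (hess f)"
proof -
  from f have fb: "f \<in> bcontfun" and d1: "\<And>x. f differentiable (at x)" and d2: "\<And>x. grad f differentiable (at x)"
    and gb: "grad f \<in> bcontfun" and hs: "\<And>x. hilbert_schmidt (hess f x)"
    and hb: "\<exists>C. \<forall>x. hs_norm (hess f x) \<le> C"
    and hc: "\<And>x. ((\<lambda>y. hs_norm (\<lambda>v. hess f y v - hess f x v)) \<longlongrightarrow> 0) (at x)"
    unfolding Cb2_def by auto
  obtain C1 where C1: "0 \<le> C1" "\<And>x. norm (f x) \<le> C1" using bcontfun_bound[OF fb] by blast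
  obtain C2 where C2: "0 \<le> C2" "\<And>x. norm (grad f x) \<le> C2" using bcontfun_bound[OF gb] by blast
  obtain C3 where C3: "\<And>x. hs_norm (hess f x) \<le> C3" using hb by blast
  define C where "C = C1 + C2 + \<bar>C3\<bar>"
  have cont: "continuous_on UNIV (\<lambda>x. hess f x u \<bullet> v)" for u v
    unfolding continuous_on_eq_continuous_at[OF open_UNIV]
  proof
    fix x
    have "((\<lambda>y. hess f y u \<bullet> v - hess f x u \<bullet> v) \<longlongrightarrow> 0) (at x)"
    proof (rule Lim_null_comparison[where g="\<lambda>y. hs_norm (\<lambda>v. hess f y v - hess f x v) * norm u * norm v"])
      show "\<forall>\<^sub>F y in at x. norm (hess f y u \<bullet> v - hess f x u \<bullet> v) \<le> hs_norm (\<lambda>v. hess f y v - hess f x v) * norm u * norm v"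
      proof (rule always_eventually, rule allI)
        fix y
        have "norm (hess f y u \<bullet> v - hess f x u \<bullet> v) \<le> norm (hess f y u - hess f x u) * norm v"
          using Cauchy_Schwarz_ineq2[of "hess f y u - hess f x u" v] by (simp add: inner_diff_left)
        also have "\<dots> \<le> (hs_norm (\<lambda>v. hess f y v - hess f x v) * norm u) * norm v"
          using hs_norm_apply_le[OF hilbert_schmidt_diff[OF hs[of y] hs[of x]], of u] by (intro mult_right_mono) auto
        finally show "norm (hess f y u \<bullet> v - hess f x u \<bullet> v) \<le> hs_norm (\<lambda>v. hess f y v - hess f x v) * norm u * norm v" .
      qed
      show "((\<lambda>y. hs_norm (\<lambda>v. hess f y v - hess f x v) * norm u * norm v) \<longlongrightarrow> 0) (at x)"
        by (intro tendsto_mult_left_zero hc)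
    qed
    thus "isCont (\<lambda>x. hess f x u \<bullet> v) x" unfolding isCont_def by (rule LIM_zero_cancel)
  qed
  have "C2b C f (grad f) (hess f)"
    unfolding C2b_def
  proof (intro conjI allI)
    fix x v
    show "GDERIV f x :> grad f x" by (rule GDERIV_grad[OF d1])
    show "(grad f has_derivative hess f x) (at x)"
      unfolding hess_def using d2 by (simp add: frechet_derivative_works[symmetric])
    show "\<bar>f x\<bar> \<le> C" "norm (grad f x) \<le> C" using C1(2)[of x] C2(2)[of x] C1(1) C2(1) by (auto simp: C_def)
    have "norm (hess f x v) \<le> hs_norm (hess f x) * norm v" by (rule hs_norm_apply_le[OF hs])
    also have "\<dots> \<le> C * norm v" using C3[of x] C1(1) C2(1) by (intro mult_right_mono) (auto simp: C_def)
    finally show "norm (hess f x v) \<le> C * norm v" .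
  qed (rule cont)
  thus ?thesis by blast
qed

text \<open>The measure equation is stated with the Lebesgue measure, whereas the time integrals are
  computed with the Borel one.\<close>

lemma lborel_to_lebesgue:
  fixes f :: "real \<Rightarrow> real"
  assumes "set_integrable lborel B f"
  shows "f absolutely_integrable_on B" "(LINT x:B|lebesgue. f x) = (LINT x:B|lborel. f x)"
proof -
  have m: "(\<lambda>x. indicator B x *\<^sub>R f x) \<in> borel_measurable lborel"
    using assms unfolding set_integrable_def by (rule borel_measurable_integrable)
  show "f absolutely_integrable_on B"
    using assms unfolding set_integrable_def by (simp only: integrable_completion[OF m])
  show "(LINT x:B|lebesgue. f x) = (LINT x:B|lborel. f x)"
    unfolding set_lebesgue_integral_def by (rule integral_completion[OF m])
qed

lemma Lipschitz_continuous_on_nonneg: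
  fixes u :: "real \<Rightarrow> real"
  assumes L: "\<And>s t. 0 \<le> s \<Longrightarrow> s \<le> t \<Longrightarrow> \<bar>u t - u s\<bar> \<le> L * (t - s)"
  shows "continuous_on {0..} u"
proof (rule continuous_on_sequentiallyI)
  fix x s assume x: "\<forall>n. x n \<in> {0::real..}" "s \<in> {0..}" "x \<longlonglongrightarrow> s"
  have "(\<lambda>n. u (x n) - u s) \<longlonglongrightarrow> 0"
  proof (rule Lim_null_comparison[where g="\<lambda>n. L * \<bar>x n - s\<bar>"])
    have "\<bar>u (x n) - u s\<bar> \<le> L * \<bar>x n - s\<bar>" for n
      using L[of s "x n"] L[of "x n" s] x(1,2) by (cases "s \<le> x n") (auto simp: abs_minus_commute)
    thus "\<forall>\<^sub>F n in sequentially. norm (u (x n) - u s) \<le> L * \<bar>x n - s\<bar>" by simp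
    show "(\<lambda>n. L * \<bar>x n - s\<bar>) \<longlonglongrightarrow> 0" by (intro tendsto_mult_right_zero tendsto_rabs_zero LIM_zero x(3))
  qed
  thus "(\<lambda>n. u (x n)) \<longlonglongrightarrow> u s" by (rule LIM_zero_cancel)
qed

lemma Lipschitz_abs_continuous:
  assumes "L \<ge> 0" "\<And>s t. p \<le> s \<Longrightarrow> s \<le> t \<Longrightarrow> t \<le> q \<Longrightarrow> \<bar>F t - F s\<bar> \<le> L * (t - s)"
  shows "abs_continuous_on_Icc p q F"
  unfolding abs_continuous_on_Icc_def
proof (intro allI impI)
  fix e :: real assume e: "e > 0"
  show "\<exists>\<delta>>0. \<forall>n u v. (\<forall>i<n. p \<le> u i \<and> u i \<le> v i \<and> v i \<le> q) \<and>
      (\<forall>i<n. \<forall>j<n. i \<noteq> j \<longrightarrow> {u i<..<v i} \<inter> {u j<..<v j} = {}) \<and> (\<Sum>i<n. v i - u i) < \<delta> \<longrightarrow>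
      (\<Sum>i<n. \<bar>F (v i) - F (u i)\<bar>) < e"
  proof (intro exI[of _ "e / (L + 1)"] conjI allI impI, goal_cases)
    case 1 show ?case using e assms(1) by simp
  next
    case (2 n u v)
    have "(\<Sum>i<n. \<bar>F (v i) - F (u i)\<bar>) \<le> (\<Sum>i<n. L * (v i - u i))"
      using 2 by (intro sum_mono assms(2)) auto
    also have "\<dots> = L * (\<Sum>i<n. v i - u i)" by (simp add: sum_distrib_left)
    also have "\<dots> \<le> L * (e / (L + 1))" using 2 assms(1) by (intro mult_left_mono) auto
    also have "\<dots> < e" using e assms(1) by (simp add: field_simps)
    finally show ?case .
  qed
qed

section \<open>The generator on the test functions\<close>

context ou_setting
begin

abbreviation "PP t f x \<equiv> ou_semigroup M S Y t (f :: 'h \<Rightarrow> real) x"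
abbreviation "LL \<equiv> L0 D A Q a \<nu>"

text \<open>Parseval evaluates the sum over the basis for each \<open>k\<close>, and Tannery's
  theorem along the net of finite sets interchanges it with the sum over \<open>k\<close>.
  Cauchy-Schwarz and Bessel provide the summable majorant.\<close>

lemma trace_formula:
  assumes T: "bounded_linear T"
  shows "trace_op (\<lambda>v. Q (T v)) = (\<Sum>k. T (qu k) \<bullet> qv k)"
proof -
  define ad where "ad = hadjoint T"
  have ad: "T x \<bullet> y = x \<bullet> ad y" for x y unfolding ad_def by (rule hadjoint[OF T])
  obtain B where B: "\<And>x. norm (T x) \<le> norm x * B" "0 \<le> B" using bounded_linear.nonneg_bounded[OF T] by blast
  have nad: "norm (ad y) \<le> B * norm y" for y
  proof (rule norm_le_of_inner)
    fix x
    have "x \<bullet> ad y \<le> norm (T x) * norm y" unfolding ad[symmetric] by (rule norm_cauchy_schwarz)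
    also have "\<dots> \<le> (norm x * B) * norm y" by (intro mult_right_mono B) auto
    finally show "x \<bullet> ad y \<le> B * norm y * norm x" by (simp add: mult_ac)
  qed (use B in auto)
  define F where "F e = Q (T e) \<bullet> e" for e
  have Fe: "(\<lambda>k. (qu k \<bullet> e) * (ad (qv k) \<bullet> e)) sums F e" for e
  proof -
    \<comment> \<open>Symmetry moves \<open>Q\<close> from \<open>T e\<close> to the basis vector
      \<open>e\<close>, where the nuclear series is expanded.\<close>
    have "Q x \<bullet> y = x \<bullet> Q y" for x y using Q_sym unfolding nonneg_symmetric_def by blast
    hence "F e = T e \<bullet> Q e" unfolding F_def .
    hence "F e = Q e \<bullet> T e" by (simp only: inner_commute)
    moreover have "(\<lambda>k. (qu k \<bullet> e) * (qv k \<bullet> T e)) sums (Q e \<bullet> T e)" by (rule Q_inner_sums)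
    moreover have "qv k \<bullet> T e = ad (qv k) \<bullet> e" for k using ad[of e "qv k"] by (simp add: inner_commute)
    ultimately show ?thesis by simp
  qed
  let ?FF = "finite_subsets_at_top (the_onb :: 'h set)"
  have bnd: "\<bar>\<Sum>e\<in>E. (qu k \<bullet> e) * (ad (qv k) \<bullet> e)\<bar> \<le> B * (norm (qu k) * norm (qv k))" if E: "finite E" "E \<subseteq> the_onb" for E k
  proof -
    have "\<bar>\<Sum>e\<in>E. (qu k \<bullet> e) * (ad (qv k) \<bullet> e)\<bar> \<le> (\<Sum>e\<in>E. \<bar>qu k \<bullet> e\<bar> * \<bar>ad (qv k) \<bullet> e\<bar>)"
      by (rule order_trans[OF sum_abs]) (simp add: abs_mult)
    also have "\<dots> \<le> L2_set (\<lambda>e. qu k \<bullet> e) E * L2_set (\<lambda>e. ad (qv k) \<bullet> e) E" by (rule L2_set_mult_ineq)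
    also have "\<dots> \<le> norm (qu k) * norm (ad (qv k))"
      unfolding L2_set_def using bessel_finite[OF E] by (intro mult_mono) (auto simp: real_le_lsqrt sum_nonneg)
    also have "\<dots> \<le> norm (qu k) * (B * norm (qv k))" by (intro mult_left_mono nad) auto
    finally show ?thesis by (simp add: mult_ac)
  qed
  have lim: "((\<lambda>E. \<Sum>k. \<Sum>e\<in>E. (qu k \<bullet> e) * (ad (qv k) \<bullet> e)) \<longlongrightarrow> (\<Sum>k. qu k \<bullet> ad (qv k))) ?FF"
  proof (rule tannerys_theorem[where M="\<lambda>k. B * (norm (qu k) * norm (qv k))", THEN conjunct2, THEN conjunct2])
    show "((\<lambda>E. \<Sum>e\<in>E. (qu k \<bullet> e) * (ad (qv k) \<bullet> e)) \<longlongrightarrow> qu k \<bullet> ad (qv k)) ?FF" for k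
      using parseval[of "qu k" "ad (qv k)"] unfolding has_sum_def .
    have "\<forall>\<^sub>F E in ?FF. finite E \<and> E \<subseteq> the_onb" by (rule eventually_finite_subsets_at_top_weakI) simp
    thus "\<forall>\<^sub>F (k, E) in at_top \<times>\<^sub>F ?FF. norm (\<Sum>e\<in>E. (qu k \<bullet> e) * (ad (qv k) \<bullet> e)) \<le> B * (norm (qu k) * norm (qv k))"
      unfolding eventually_prod_filter
      by (intro exI[of _ "\<lambda>_. True"] exI[of _ "\<lambda>E. finite E \<and> E \<subseteq> the_onb"]) (auto intro!: bnd)
    show "summable (\<lambda>k. B * (norm (qu k) * norm (qv k)))" by (intro summable_mult quv)
  qed simp
  have "(\<Sum>k. \<Sum>e\<in>E. (qu k \<bullet> e) * (ad (qv k) \<bullet> e)) = sum F E" for E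
    using Fe by (subst suminf_sum) (auto simp: sums_iff)
  hence "(sum F \<longlongrightarrow> (\<Sum>k. qu k \<bullet> ad (qv k))) ?FF" using lim by simp
  hence "(F has_sum (\<Sum>k. qu k \<bullet> ad (qv k))) the_onb" unfolding has_sum_def .
  hence "trace_op (\<lambda>v. Q (T v)) = (\<Sum>k. qu k \<bullet> ad (qv k))" unfolding trace_op_def F_def by (rule infsumI)
  thus ?thesis by (simp add: ad)
qed

text \<open>The part of the generator due to the noise \<open>Z\<close>; the full operator adds the
  drift \<open>x \<bullet> As (grad f x)\<close>.\<close>

definition Lc :: "('h \<Rightarrow> real) \<Rightarrow> 'h \<Rightarrow> real" where
  "Lc f x = Re (Lop 0 (\<lambda>x. of_real (f x)) (\<lambda>v x. of_real (grad f x \<bullet> v)) (\<lambda>u v x. of_real (hess f x u \<bullet> v)) x)"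

lemma LL_eq:
  assumes c: "C2b C f (grad f) (hess f)" and hs: "\<And>x. bounded_linear (hess f x)"
  shows "LL f x = x \<bullet> As (grad f x) + Lc f x"
proof -
  note J = jet_C2b[OF c]
  have "Jop 0 (\<lambda>x. of_real (f x)) (\<lambda>v x. of_real (grad f x \<bullet> v)) x y =
     complex_of_real (f (x + y) - f x - indicator {y. norm y \<le> 1} y * (y \<bullet> grad f x))" for y
    by (simp add: Jop_def trunc_def inner_commute)
  hence 1: "(LINT y|\<nu>. Jop 0 (\<lambda>x. of_real (f x)) (\<lambda>v x. of_real (grad f x \<bullet> v)) x y) =
     complex_of_real (LINT y|\<nu>. f (x + y) - f x - indicator {y. norm y \<le> 1} y * (y \<bullet> grad f x))"
    by (simp only: integral_complex_of_real)
  have sm: "summable (\<lambda>k. hess f x (qu k) \<bullet> qv k)"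
    using trace_term_summable[OF J order_refl, of x] by (simp add: summable_of_real_iff)
  have 2: "(\<Sum>k. complex_of_real (hess f x (S 0 (qu k)) \<bullet> S 0 (qv k))) = complex_of_real (trace_op (\<lambda>v. Q (hess f x v)))"
    unfolding trace_formula[OF hs] suminf_of_real[OF sm] by simp
  show ?thesis unfolding Lc_def Lop_def 1 2 L0_def by (simp add: inner_commute)
qed

lemma D0_tildeD:
  assumes f: "f \<in> D0_tilde D A"
  shows "\<exists>C. C2b C f (grad f) (hess f)" "\<And>x. grad f x \<in> Ds" "(\<lambda>x. x \<bullet> As (grad f x)) \<in> bcontfun"
    "LL f x = x \<bullet> As (grad f x) + Lc f x" "continuous_on UNIV f" "f \<in> bcontfun"
proof -
  have f2: "f \<in> Cb2" and "\<And>x. grad f x \<in> Ds" "(\<lambda>x. x \<bullet> As (grad f x)) \<in> bcontfun"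
    using f unfolding D0_tilde_def CA2_def by auto
  thus "\<And>x. grad f x \<in> Ds" "(\<lambda>x. x \<bullet> As (grad f x)) \<in> bcontfun" by auto
  show 1: "\<exists>C. C2b C f (grad f) (hess f)" by (rule Cb2_C2b[OF f2])
  have "bounded_linear (hess f x)" for x using f2 unfolding Cb2_def hilbert_schmidt_def by auto
  thus "LL f x = x \<bullet> As (grad f x) + Lc f x" using 1 LL_eq by blast
  show "f \<in> bcontfun" using f2 unfolding Cb2_def by auto
  thus "continuous_on UNIV f" by (rule bcontfun_cont)
qed



text \<open>On \<open>D\<close> the orbit is right differentiable, so the chain rule gives the inner
  product of the gradient with \<open>A (S t z)\<close>, and the adjoint takes \<open>A\<close> over
  to the gradient.\<close>

lemma flow_integral_D:
  assumes f: "f \<in> D0_tilde D A" and z: "z \<in> D" and T: "T \<ge> 0"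
  shows "f (S T z) - f z = (LINT t:{0..T}|lborel. S t z \<bullet> As (grad f (S t z)))"
proof -
  obtain C where c: "C2b C f (grad f) (hess f)" using D0_tildeD(1)[OF f] by blast
  note J = jet_C2b[OF c]
  define q where "q n = real (Suc n) *\<^sub>R (S (recip n) z - z)" for n
  have q: "q \<longlonglongrightarrow> A z" unfolding q_def by (rule D_seq[OF z])
  have Sq: "S (t + recip n) z = S t z + (recip n) *\<^sub>R S t (q n)" if "t \<ge> 0" for t n
    using that S_add[of t "recip n" z] by (simp add: q_def S_scaleR S_minus)
  have "Bseq q" using q convergent_imp_Bseq convergentI by blast
  then obtain K where K: "\<And>n. norm (q n) \<le> K" by (auto simp: Bseq_def)
  have C0: "0 \<le> C" by (rule jet_nonneg[OF J])
  have lin: "\<bar>f (x + v) - f x - grad f x \<bullet> v\<bar> \<le> C * (norm v)\<^sup>2" for x v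
  proof -
    have "norm (complex_of_real (f (x + v)) - of_real (f x) - of_real (grad f x \<bullet> v)) \<le> C * (norm v)\<^sup>2" by (rule jet_taylor[OF J])
    thus ?thesis by (metis norm_of_real of_real_diff)
  qed
  have nSq: "norm (S t (q n)) \<le> Mb T * K" if "0 \<le> t" "t \<le> T" for t n
    using Mb(2)[OF that, of "q n"] mult_left_mono[OF K[of n] Mb_nonneg[of T]] by linarith
  have diffq: "\<bar>real (Suc n) * (f (S (t + recip n) z) - f (S t z)) - grad f (S t z) \<bullet> S t (q n)\<bar> \<le> C * (Mb T * K)\<^sup>2 * (recip n)"
    if t: "0 \<le> t" "t \<le> T" for t n
  proof -
    let ?v = "(recip n) *\<^sub>R S t (q n)"
    have "real (Suc n) * (f (S (t + recip n) z) - f (S t z)) - grad f (S t z) \<bullet> S t (q n) =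
      real (Suc n) * (f (S t z + ?v) - f (S t z) - grad f (S t z) \<bullet> ?v)"
      unfolding Sq[OF t(1)] by (simp add: right_diff_distrib)
    hence "\<bar>real (Suc n) * (f (S (t + recip n) z) - f (S t z)) - grad f (S t z) \<bullet> S t (q n)\<bar> =
      real (Suc n) * \<bar>f (S t z + ?v) - f (S t z) - grad f (S t z) \<bullet> ?v\<bar>" by (simp only: abs_mult abs_of_nat)
    also have "\<dots> \<le> real (Suc n) * (C * (norm ?v)\<^sup>2)" by (intro mult_left_mono lin) auto
    also have "\<dots> = C * (norm (S t (q n)))\<^sup>2 * (recip n)" by (simp add: power2_eq_square power_divide)
    also have "\<dots> \<le> C * (Mb T * K)\<^sup>2 * (recip n)"
      using C0 by (intro mult_right_mono mult_left_mono power_mono nSq t) auto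
    finally show ?thesis .
  qed
  have gq: "\<bar>grad f (S t z) \<bullet> S t (q n)\<bar> \<le> C * (Mb T * K)" if t: "0 \<le> t" "t \<le> T" for t n
  proof -
    have "\<bar>grad f (S t z) \<bullet> S t (q n)\<bar> \<le> norm (grad f (S t z)) * norm (S t (q n))" by (rule Cauchy_Schwarz_ineq2)
    also have "\<dots> \<le> C * (Mb T * K)" using C0 by (intro mult_mono C2bD(5)[OF c] nSq t) auto
    finally show ?thesis .
  qed
  have bd: "\<bar>real (Suc n) * (f (S (t + recip n) z) - f (S t z))\<bar> \<le> C * (Mb T * K) + C * (Mb T * K)\<^sup>2"
    if t: "0 \<le> t" "t \<le> T" for t n
  proof -
    have "C * (Mb T * K)\<^sup>2 * (recip n) \<le> C * (Mb T * K)\<^sup>2 * 1" using C0 by (intro mult_left_mono) auto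
    thus ?thesis using diffq[OF t, of n] gq[OF t, of n] by linarith
  qed
  have lim: "(\<lambda>n. real (Suc n) * (f (S (t + recip n) z) - f (S t z))) \<longlonglongrightarrow> S t z \<bullet> As (grad f (S t z))"
    if t: "0 \<le> t" "t \<le> T" for t
  proof -
    have "(\<lambda>n. real (Suc n) * (f (S (t + recip n) z) - f (S t z)) - grad f (S t z) \<bullet> S t (q n)) \<longlonglongrightarrow> 0"
    proof (rule Lim_null_comparison[where g="\<lambda>n. C * (Mb T * K)\<^sup>2 * (recip n)"])
      show "(\<lambda>n. C * (Mb T * K)\<^sup>2 * (recip n)) \<longlonglongrightarrow> 0"
        by (intro tendsto_mult_right_zero LIMSEQ_Suc lim_1_over_n)
    qed (use diffq[OF t] in auto)
    moreover have "(\<lambda>n. grad f (S t z) \<bullet> S t (q n)) \<longlonglongrightarrow> grad f (S t z) \<bullet> S t (A z)"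
      by (intro tendsto_intros S_seq q) (use t in auto)
    ultimately have "(\<lambda>n. (real (Suc n) * (f (S (t + recip n) z) - f (S t z)) - grad f (S t z) \<bullet> S t (q n)) + grad f (S t z) \<bullet> S t (q n))
       \<longlonglongrightarrow> 0 + grad f (S t z) \<bullet> S t (A z)" by (rule tendsto_add)
    moreover have "grad f (S t z) \<bullet> S t (A z) = S t z \<bullet> As (grad f (S t z))"
    proof -
      have "A (S t z) \<bullet> grad f (S t z) = S t z \<bullet> As (grad f (S t z))" by (rule As[OF D0_tildeD(2)[OF f] S_D(1)[OF z t(1)]])
      moreover have "A (S t z) \<bullet> grad f (S t z) = grad f (S t z) \<bullet> S t (A z)" unfolding S_D(2)[OF z t(1)] by (rule inner_commute)
      ultimately show ?thesis by (simp only:)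
    qed
    ultimately show ?thesis by simp
  qed
  have cu: "continuous_on {0..} (\<lambda>t. f (S t z))"
    by (rule continuous_on_compose2[OF D0_tildeD(5)[OF f] S_cont]) simp
  have "(LINT t:{0..T}|lborel. S t z \<bullet> As (grad f (S t z))) = f (S T z) - f (S 0 z)"
    by (rule right_derivative_integral(2)[OF cu T bd lim, of 0]) auto
  thus ?thesis by simp
qed

text \<open>The right-hand side makes sense for every \<open>z\<close>, and membership in
  \<open>D0_tilde\<close> makes its integrand bounded and continuous in the orbit; density of
  \<open>D\<close> and dominated convergence extend the formula.\<close>

lemma flow_integral:
  assumes f: "f \<in> D0_tilde D A" and T: "T \<ge> 0"
  shows "f (S T z) - f z = (LINT t:{0..T}|lborel. S t z \<bullet> As (grad f (S t z)))"
proof -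
  let ?k = "\<lambda>x. x \<bullet> As (grad f x)"
  obtain K where K: "\<And>x. norm (?k x) \<le> K" using bcontfun_bound[OF D0_tildeD(3)[OF f]] by blast
  note ck = bcontfun_cont[OF D0_tildeD(3)[OF f]]
  obtain zs where zs: "\<And>n. zs n \<in> D" "zs \<longlonglongrightarrow> z" using D_dense by blast
  have 1: "(\<lambda>n. f (S T (zs n)) - f (zs n)) \<longlonglongrightarrow> f (S T z) - f z"
    by (intro tendsto_diff isCont_seq[OF D0_tildeD(5)[OF f]] S_seq zs T tendsto_const)
  have si: "set_integrable lborel {0..T} (\<lambda>t. ?k (S t w))" for w
    by (intro borel_integrable_atLeastAtMost' continuous_on_compose2[OF ck S_cont']) auto
  have 2: "(\<lambda>n. LINT t:{0..T}|lborel. ?k (S t (zs n))) \<longlonglongrightarrow> (LINT t:{0..T}|lborel. ?k (S t z))"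
    unfolding set_lebesgue_integral_def
  proof (rule integral_dominated_convergence)
    show "(\<lambda>t. indicator {0..T} t *\<^sub>R ?k (S t z)) \<in> borel_measurable lborel"
      "(\<lambda>t. indicator {0..T} t *\<^sub>R ?k (S t (zs n))) \<in> borel_measurable lborel" for n
      using si[unfolded set_integrable_def] by (auto intro: borel_measurable_integrable)
    show "integrable lborel (\<lambda>s. indicator {0..T} s *\<^sub>R K)"
      using borel_integrable_atLeastAtMost'[of 0 T "\<lambda>_. K"] unfolding set_integrable_def by simp
    show "AE t in lborel. (\<lambda>n. indicator {0..T} t *\<^sub>R ?k (S t (zs n))) \<longlonglongrightarrow> indicator {0..T} t *\<^sub>R ?k (S t z)"
    proof (rule AE_I2)
      fix t
      show "(\<lambda>n. indicator {0..T} t *\<^sub>R ?k (S t (zs n))) \<longlonglongrightarrow> indicator {0..T} t *\<^sub>R ?k (S t z)"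
      proof (cases "t \<in> {0..T}")
        case True
        thus ?thesis by (intro tendsto_scaleR tendsto_const isCont_seq[OF ck] S_seq zs) auto
      qed simp
    qed
    show "AE t in lborel. norm (indicator {0..T} t *\<^sub>R ?k (S t (zs n))) \<le> indicator {0..T} t *\<^sub>R K" for n
      using K by (auto simp: indicator_def)
  qed
  have "f (S T (zs n)) - f (zs n) = (LINT t:{0..T}|lborel. ?k (S t (zs n)))" for n
    by (rule flow_integral_D[OF f zs(1) T])
  with 1 have "(\<lambda>n. LINT t:{0..T}|lborel. ?k (S t (zs n))) \<longlonglongrightarrow> f (S T z) - f z" by simp
  from LIMSEQ_unique[OF this 2] show ?thesis .
qed

lemma flow_asymptotics:
  assumes f: "f \<in> D0_tilde D A"
  shows "\<exists>K\<ge>0. \<forall>t z. 0 \<le> t \<longrightarrow> \<bar>f (S t z) - f z\<bar> \<le> K * t"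
    "(\<lambda>n. real (Suc n) * (f (S (recip n) z) - f z)) \<longlonglongrightarrow> z \<bullet> As (grad f z)"
proof -
  let ?k = "\<lambda>x. x \<bullet> As (grad f x)"
  obtain K where K: "0 \<le> K" "\<And>x. norm (?k x) \<le> K" using bcontfun_bound[OF D0_tildeD(3)[OF f]] by blast
  note ck = bcontfun_cont[OF D0_tildeD(3)[OF f]]
  have si: "set_integrable lborel {0..T} (\<lambda>t. ?k (S t w))" for w T
    by (intro borel_integrable_atLeastAtMost' continuous_on_compose2[OF ck S_cont']) auto
  have eq: "f (S T w) - f w = integral {0..T} (\<lambda>t. ?k (S t w))" if "T \<ge> 0" for T w
    using flow_integral[OF f that] set_borel_integral_eq_integral(2)[OF si] by simp
  have "\<bar>f (S t w) - f w\<bar> \<le> K * t" if "0 \<le> t" for t w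
  proof -
    have "norm (integral (cbox 0 t) (\<lambda>t. ?k (S t w))) \<le> K * measure lborel (cbox 0 t)"
      using set_borel_integral_eq_integral(1)[OF si] K by (intro integrable_bound) auto
    thus ?thesis using eq[OF that] that by simp
  qed
  thus "\<exists>K\<ge>0. \<forall>t z. 0 \<le> t \<longrightarrow> \<bar>f (S t z) - f z\<bar> \<le> K * t" using K(1) by blast
  have "(\<lambda>n. real (Suc n) * integral {0..0 + recip n} (\<lambda>t. ?k (S t z))) \<longlonglongrightarrow> ?k (S 0 z)"
    by (rule forward_average_LIMSEQ) (auto intro!: continuous_on_compose2[OF ck S_cont'])
  thus "(\<lambda>n. real (Suc n) * (f (S (recip n) z) - f z)) \<longlonglongrightarrow> ?k z" by (simp add: eq)
qed

text \<open>For \<open>t \<le> 1\<close> the flow and the noise each contribute a bound linear in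
  \<open>t\<close>; for \<open>t > 1\<close> the sup bound \<open>2 * C\<close> is smaller than the
  constant times \<open>t\<close>.\<close>

lemma generator_bound:
  assumes f: "f \<in> D0_tilde D A"
  shows "\<exists>K\<ge>0. \<forall>t x. 0 \<le> t \<longrightarrow> \<bar>PP t f x - f x\<bar> \<le> K * t"
proof -
  obtain C where c: "C2b C f (grad f) (hess f)" using D0_tildeD(1)[OF f] by blast
  obtain K1 where K1: "0 \<le> K1" "\<And>t z. 0 \<le> t \<Longrightarrow> \<bar>f (S t z) - f z\<bar> \<le> K1 * t" using flow_asymptotics(1)[OF f] by blast
  have fm: "f \<in> bm" by (rule borel_measurable_continuous_onI[OF D0_tildeD(5)[OF f]])
  have C0: "0 \<le> C" by (rule jet_nonneg[OF jet_C2b[OF c]])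
  define K where "K = K1 + C * KT 1 + 2 * C"
  have K0: "0 \<le> K" using K1(1) C0 KT_nonneg[of 1] by (simp add: K_def)
  have "\<bar>PP t f x - f x\<bar> \<le> K * t" if t: "0 \<le> t" for t x
  proof (cases "t \<le> 1")
    case True
    have "\<bar>PP t f x - f (S t x)\<bar> \<le> t * (C * KT 1)" unfolding ou_law[OF t fm] by (rule increment_bound[OF c t True])
    moreover have "K1 * t + t * (C * KT 1) \<le> K * t" using C0 t by (simp add: K_def algebra_simps)
    ultimately show ?thesis using K1(2)[OF t, of x] by linarith
  next
    case False
    have "\<bar>PP t f x\<bar> \<le> C" by (rule P_bound[OF t fm C2bD(4)[OF c]])
    hence "\<bar>PP t f x - f x\<bar> \<le> 2 * C" using C2bD(4)[OF c, of x] by linarith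
    also have "\<dots> \<le> K * 1" using K1(1) C0 KT_nonneg[of 1] by (simp add: K_def)
    also have "\<dots> \<le> K * t" using False K0 by (intro mult_left_mono) auto
    finally show ?thesis .
  qed
  thus ?thesis using K0 by blast
qed

text \<open>Split at \<open>S t x\<close>: the noise started from there gives \<open>Lc\<close>, and
  the deterministic move from \<open>x\<close> to \<open>S t x\<close> gives the term with the
  adjoint generator.\<close>

lemma generator_limit:
  assumes f: "f \<in> D0_tilde D A"
  shows "(\<lambda>n. real (Suc n) * (PP (recip n) f x - f x)) \<longlonglongrightarrow> LL f x"
proof -
  obtain C where c: "C2b C f (grad f) (hess f)" using D0_tildeD(1)[OF f] by blast
  have fm: "f \<in> bm" by (rule borel_measurable_continuous_onI[OF D0_tildeD(5)[OF f]])
  have "(\<lambda>n. ((LINT y|lk (recip n). f (S (recip n) x + y)) - f (S (recip n) x)) / (recip n)) \<longlonglongrightarrow> Lc f x"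
    unfolding Lc_def
    by (rule small_time_limit[OF c _ LIMSEQ_Suc[OF lim_1_over_n] S_seq_0]) (auto intro!: LIMSEQ_Suc lim_1_over_n simp del: of_nat_Suc)
  hence "(\<lambda>n. real (Suc n) * (PP (recip n) f x - f (S (recip n) x))) \<longlonglongrightarrow> Lc f x"
    by (simp add: ou_law[OF _ fm] mult.commute)
  from tendsto_add[OF this flow_asymptotics(2)[OF f, of x]]
  show ?thesis by (simp add: D0_tildeD(4)[OF f] algebra_simps)
qed

section \<open>The dual semigroup as a solution\<close>

abbreviation "dual t \<mu> \<equiv> dual_semigroup M S Y t \<mu>"

lemma P_add:
  assumes t: "t \<ge> 0" and f: "f \<in> bm" "\<And>x. \<bar>f x\<bar> \<le> C" and g: "g \<in> bm" "\<And>x. \<bar>g x\<bar> \<le> C'"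
  shows "PP t (\<lambda>x. f x + g x) x = PP t f x + PP t g x"
  using P_integrable[of f C t "S t x"] P_integrable[of g C' t "S t x"] f g by (simp add: ou_law[OF t])

lemma P_cmult:
  assumes t: "t \<ge> 0" and f: "f \<in> bm"
  shows "PP t (\<lambda>x. c * f x) x = c * PP t f x"
  using f by (simp add: ou_law[OF t])

lemma P_LIMSEQ:
  assumes t: "t \<ge> 0" and f: "\<And>n. f n \<in> bm" "\<And>n x. \<bar>f n x\<bar> \<le> C" "\<And>x. (\<lambda>n. f n x) \<longlonglongrightarrow> g x"
  shows "(\<lambda>n. PP t (f n) x) \<longlonglongrightarrow> PP t g x"
proof -
  interpret L: prob_space "lk t" by (rule prob_lk)
  note f(1)[measurable]
  have g[measurable]: "g \<in> bm" using f(3) by (rule borel_measurable_LIMSEQ_real[OF _ f(1)])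
  show ?thesis unfolding ou_law[OF t f(1)] ou_law[OF t g]
    by (rule integral_dominated_convergence[where w="\<lambda>_. C"]) (use f(2,3) in auto)
qed

lemma JP_add:
  assumes \<mu>: "\<mu> \<in> signed_measures" and t: "t \<ge> 0"
    and f: "f \<in> bm" "\<And>x. \<bar>f x\<bar> \<le> C" and g: "g \<in> bm" "\<And>x. \<bar>g x\<bar> \<le> C'"
  shows "signed_integral \<mu> (PP t (\<lambda>x. f x + g x)) = signed_integral \<mu> (PP t f) + signed_integral \<mu> (PP t g)"
proof -
  have "PP t (\<lambda>x. f x + g x) = (\<lambda>x. PP t f x + PP t g x)" by (rule ext) (rule P_add[OF t f g])
  thus ?thesis using signed_integral_add[OF \<mu> P_measurable[OF t f(1)] P_bound[OF t f] P_measurable[OF t g(1)] P_bound[OF t g]] by simp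
qed

lemma JP_LIMSEQ:
  assumes \<mu>: "\<mu> \<in> signed_measures" and t: "t \<ge> 0" and f: "\<And>n. f n \<in> bm" "\<And>n x. \<bar>f n x\<bar> \<le> C" "\<And>x. (\<lambda>n. f n x) \<longlonglongrightarrow> g x"
  shows "(\<lambda>n. signed_integral \<mu> (PP t (f n))) \<longlonglongrightarrow> signed_integral \<mu> (PP t g)"
  by (rule signed_integral_dominated_convergence[OF \<mu> P_measurable[OF t f(1)] P_bound[OF t f(1,2)] P_LIMSEQ[OF t f]])

lemma dual_signed:
  assumes \<mu>: "\<mu> \<in> signed_measures" and t: "t \<ge> 0"
  shows "dual t \<mu> \<in> signed_measures"
  unfolding signed_measures_def mem_Collect_eq
proof (intro conjI allI impI)
  show "dual t \<mu> B = 0" if "B \<notin> sets borel" for B using that by (simp add: dual_semigroup_def)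
  have z: "PP t (\<lambda>x. 0) = (\<lambda>x. 0)" by (rule ext) (simp add: ou_semigroup_def)
  have si0: "signed_integral \<mu> (\<lambda>x. 0) = 0" by (simp add: signed_integral_def)
  have e: "indicator {} = (\<lambda>x :: 'h. 0 :: real)" by (auto simp: indicator_def)
  show "dual t \<mu> {} = 0" by (simp add: dual_semigroup_def e z si0)
  fix F :: "nat \<Rightarrow> 'h set" assume F: "range F \<subseteq> sets borel \<and> disjoint_family F"
  hence Fb: "F n \<in> sets borel" for n by blast
  define s where "s n x = (\<Sum>i<n. indicator (F i) x :: real)" for n x
  have sm: "s n \<in> bm" for n unfolding s_def using Fb by measurable
  have s_eq: "s n = indicator (\<Union>i<n. F i)" for n
    unfolding s_def by (rule ext) (rule indicator_UN_disjoint[symmetric], use F in \<open>auto simp: disjoint_family_on_def\<close>)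
  have sb: "\<bar>s n x\<bar> \<le> 1" for n x unfolding s_eq by simp
  have lim: "(\<lambda>n. s n x) \<longlonglongrightarrow> indicator (\<Union>n. F n) x" for x unfolding s_eq by (rule LIMSEQ_indicator_UN)
  have part: "signed_integral \<mu> (PP t (s n)) = (\<Sum>i<n. dual t \<mu> (F i))" for n
  proof (induction n)
    case 0
    have "s 0 = (\<lambda>x. 0)" by (rule ext) (simp add: s_def)
    thus ?case by (simp add: z si0)
  next
    case (Suc n)
    have "s (Suc n) = (\<lambda>x. s n x + indicator (F n) x)" by (rule ext) (simp add: s_def)
    moreover have "signed_integral \<mu> (PP t (\<lambda>x. s n x + indicator (F n) x)) = signed_integral \<mu> (PP t (s n)) + signed_integral \<mu> (PP t (indicator (F n)))"
      by (rule JP_add[OF \<mu> t sm sb, where C'=1]) (use Fb in auto)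
    ultimately show ?case using Suc Fb by (simp add: dual_semigroup_def)
  qed
  have "(\<lambda>n. signed_integral \<mu> (PP t (s n))) \<longlonglongrightarrow> signed_integral \<mu> (PP t (indicator (\<Union>n. F n)))"
    by (rule JP_LIMSEQ[OF \<mu> t sm sb lim])
  thus "(\<lambda>n. dual t \<mu> (F n)) sums dual t \<mu> (\<Union>n. F n)"
    unfolding sums_def part using Fb by (simp add: dual_semigroup_def sets.countable_UN)
qed

text \<open>Both sides agree on indicators by definition, and the right-hand side has the linearity
  and continuity that characterise an integral.\<close>

lemma dual_integral:
  assumes \<mu>: "\<mu> \<in> signed_measures" and t: "t \<ge> 0" and f: "f \<in> bm" "\<And>x. \<bar>f x\<bar> \<le> C"
  shows "signed_integral (dual t \<mu>) f = signed_integral \<mu> (PP t f)"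
proof (rule signed_integral_unique[OF dual_signed[OF \<mu> t] f])
  fix u v :: "'h \<Rightarrow> real" and c D
  assume u: "u \<in> bm" "\<And>x. \<bar>u x\<bar> \<le> D"
  have "PP t (\<lambda>x. c * u x) = (\<lambda>x. c * PP t u x)" by (rule ext) (rule P_cmult[OF t u(1)])
  thus "signed_integral \<mu> (PP t (\<lambda>x. c * u x)) = c * signed_integral \<mu> (PP t u)" by (simp add: signed_integral_cmult)
next
  fix u v :: "'h \<Rightarrow> real" and D
  assume u: "u \<in> bm" "v \<in> bm" "\<And>x. \<bar>u x\<bar> \<le> D" "\<And>x. \<bar>v x\<bar> \<le> D"
  show "signed_integral \<mu> (PP t (\<lambda>x. u x + v x)) = signed_integral \<mu> (PP t u) + signed_integral \<mu> (PP t v)"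
    by (rule JP_add[OF \<mu> t u(1,3,2,4)])
next
  fix U :: "nat \<Rightarrow> 'h \<Rightarrow> real" and u D
  assume U: "\<And>n. U n \<in> bm" "\<And>n x. \<bar>U n x\<bar> \<le> D" "\<And>x. (\<lambda>n. U n x) \<longlonglongrightarrow> u x"
  show "(\<lambda>n. signed_integral \<mu> (PP t (U n))) \<longlonglongrightarrow> signed_integral \<mu> (PP t u)" by (rule JP_LIMSEQ[OF \<mu> t U])
qed (simp add: dual_semigroup_def)

lemma dual_integral_add:
  assumes \<mu>: "\<mu> \<in> signed_measures" and t: "t \<ge> 0" and s: "s \<ge> 0" and f: "f \<in> bm" "\<And>x. \<bar>f x\<bar> \<le> C"
  shows "signed_integral (dual (t + s) \<mu>) f = signed_integral (dual t \<mu>) (PP s f)"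
proof -
  have "PP (t + s) f = PP t (PP s f)" using P_semigroup[OF s t f] by (intro ext) (simp add: add.commute)
  thus ?thesis
    using dual_integral[OF \<mu> _ f, of "t + s"] dual_integral[OF \<mu> t P_measurable[OF s f(1)] P_bound[OF s f]] t s by simp
qed

lemma signed_integral_le_measure:
  assumes \<gamma>: "\<gamma> \<in> signed_measures" and f: "f \<in> bm" "\<And>x. 0 \<le> f x" "\<And>x. f x \<le> (1::real)"
  shows "signed_integral \<gamma> f \<le> measure (pos_part \<gamma>) UNIV" "- signed_integral \<gamma> f \<le> measure (neg_part \<gamma>) UNIV"
proof -
  have fb: "\<bar>f x\<bar> \<le> 1" for x using f(2,3) by simp
  interpret P: finite_measure "pos_part \<gamma>" by (rule finite_pos_part[OF \<gamma>])
  interpret N: finite_measure "neg_part \<gamma>" by (rule finite_neg_part[OF \<gamma>])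
  have 1: "integral\<^sup>L (pos_part \<gamma>) f \<le> (LINT x|pos_part \<gamma>. 1)" "integral\<^sup>L (neg_part \<gamma>) f \<le> (LINT x|neg_part \<gamma>. 1)"
    by (intro Bochner_Integration.integral_mono integrable_pos_part[OF \<gamma> f(1) fb] integrable_neg_part[OF \<gamma> f(1) fb]
      P.integrable_const N.integrable_const f(3))+
  have 2: "0 \<le> integral\<^sup>L (pos_part \<gamma>) f" "0 \<le> integral\<^sup>L (neg_part \<gamma>) f" using f(2) by simp_all
  show "signed_integral \<gamma> f \<le> measure (pos_part \<gamma>) UNIV" "- signed_integral \<gamma> f \<le> measure (neg_part \<gamma>) UNIV"
    using 1 2 \<gamma> by (simp_all add: signed_integral_def)
qed

text \<open>The transition operators map indicators into \<open>[0, 1]\<close>, so the values of the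
  later measure are bounded by the variations of the earlier one. Monotonicity in time is also the
  source of measurability of the norm.\<close>

lemma tv_dual_mono:
  assumes \<mu>: "\<mu> \<in> signed_measures" and s: "0 \<le> s" "s \<le> t"
  shows "tv_norm (dual t \<mu>) \<le> tv_norm (dual s \<mu>)"
proof -
  note ds = dual_signed[OF \<mu> s(1)]
  have B: "dual t \<mu> B = signed_integral (dual s \<mu>) (PP (t - s) (indicator B))" if "B \<in> sets borel" for B
    using signed_integral_indicator[OF dual_signed[OF \<mu>] that, of t] dual_integral_add[OF \<mu> s(1), of "t - s" "indicator B" 1] s that
    by (simp add: indicator_def)
  have range: "0 \<le> PP (t - s) (indicator B) x" "PP (t - s) (indicator B) x \<le> 1" for B x
  proof -
    show "0 \<le> PP (t - s) (indicator B) x" unfolding ou_semigroup_def by simp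
    show "PP (t - s) (indicator B) x \<le> 1"
    \<comment> \<open>\<open>B\<close> is arbitrary here; if the indicator is not integrable, the
      integral is 0 by convention.\<close>
    proof (cases "integrable M (\<lambda>\<omega>. indicator B (S (t - s) x + Y (t - s) \<omega>) :: real)")
      case True
      hence "PP (t - s) (indicator B) x \<le> (LINT \<omega>|M. 1)" unfolding ou_semigroup_def by (intro integral_mono) (auto simp: indicator_def)
      thus ?thesis by (simp add: prob_space)
    qed (simp add: ou_semigroup_def not_integrable_integral_eq)
  qed
  have m: "PP (t - s) (indicator B) \<in> bm" if "B \<in> sets borel" for B
    using that s by (intro P_measurable) auto
  show ?thesis
    unfolding tv_norm_def[of "dual s \<mu>"]
  proof (rule tv_norm_le[OF dual_signed[OF \<mu>]])
    show "dual t \<mu> B \<le> measure (pos_part (dual s \<mu>)) UNIV" if "B \<in> sets borel" for B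
      unfolding B[OF that] by (rule signed_integral_le_measure(1)[OF ds m[OF that] range])
    show "- dual t \<mu> B \<le> measure (neg_part (dual s \<mu>)) UNIV" if "B \<in> sets borel" for B
      unfolding B[OF that] by (rule signed_integral_le_measure(2)[OF ds m[OF that] range])
  qed (use s in auto)
qed

lemma tv_dual_integrable:
  assumes \<mu>: "\<mu> \<in> signed_measures"
  shows "(\<lambda>t. tv_norm (dual t \<mu>)) absolutely_integrable_on {0<..<T}"
proof (rule lborel_to_lebesgue(1))
  \<comment> \<open>Extended to negative times by its value at 0, the norm is decreasing on the
    whole line and therefore Borel.\<close>
  have "mono (\<lambda>t. - tv_norm (dual (max 0 t) \<mu>))"
    by (rule monoI) (auto intro!: tv_dual_mono[OF \<mu>])
  hence "(\<lambda>t. - tv_norm (dual (max 0 t) \<mu>)) \<in> bm" by (rule borel_measurable_mono)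
  hence m: "(\<lambda>t. tv_norm (dual (max 0 t) \<mu>)) \<in> bm" by simp
  show "set_integrable lborel {0<..<T} (\<lambda>t. tv_norm (dual t \<mu>))"
    unfolding set_integrable_def
  proof (rule Bochner_Integration.integrable_bound)
    show "integrable lborel (\<lambda>s. indicator {0..T} s *\<^sub>R tv_norm (dual 0 \<mu>))"
      using borel_integrable_atLeastAtMost'[of 0 T "\<lambda>_. tv_norm (dual 0 \<mu>)"] unfolding set_integrable_def by simp
    have "(\<lambda>t. indicator {0<..<T} t *\<^sub>R tv_norm (dual t \<mu>)) = (\<lambda>t. indicator {0<..<T} t *\<^sub>R tv_norm (dual (max 0 t) \<mu>))"
      by (auto simp: indicator_def)
    thus "(\<lambda>t. indicator {0<..<T} t *\<^sub>R tv_norm (dual t \<mu>)) \<in> borel_measurable lborel" using m by simp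
    show "AE t in lborel. norm (indicator {0<..<T} t *\<^sub>R tv_norm (dual t \<mu>)) \<le> norm (indicator {0..T} t *\<^sub>R tv_norm (dual 0 \<mu>))"
    proof (rule AE_I2)
      fix t
      show "norm (indicator {0<..<T} t *\<^sub>R tv_norm (dual t \<mu>)) \<le> norm (indicator {0..T} t *\<^sub>R tv_norm (dual 0 \<mu>))"
      proof (cases "t \<in> {0<..<T}")
        case True
        hence "t \<in> {0..T}" "0 \<le> t" by auto
        with True show ?thesis using tv_dual_mono[OF \<mu> order_refl \<open>0 \<le> t\<close>] tv_norm_nonneg[of "dual t \<mu>"] by simp
      qed simp
    qed
  qed
qed

text \<open>The characteristic function of \<open>Y 0\<close> is constantly 1, so its law is the
  Dirac measure at 0.\<close>

lemma P_0:
  assumes f: "f \<in> bm" "\<And>x. \<bar>f x\<bar> \<le> C"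
  shows "PP 0 f x = f x"
proof -
  have fm: "(\<lambda>y. f (x + y)) \<in> bm" using f(1) by measurable
  have pr: "prob_space (return borel (0 :: 'h))" by (rule prob_space_return) simp
  have c: "(LINT y|lk 0. iexp (y \<bullet> h)) = 1" for h using lk_char[of 0 h] by simp
  have "(LINT y|lk 0. f (x + y)) = (LINT y|return borel 0. f (x + y))"
  proof (rule integral_eq_of_char_eq[where C=C])
    show "(LINT y|lk 0. cos (y \<bullet> h)) = (LINT y|return borel 0. cos (y \<bullet> h))" for h
      by (subst integral_cos_inner) (auto simp: prob_space.finite_measure[OF prob_lk] c integral_return)
    show "(LINT y|lk 0. sin (y \<bullet> h)) = (LINT y|return borel 0. sin (y \<bullet> h))" for h
      by (subst integral_sin_inner) (auto simp: prob_space.finite_measure[OF prob_lk] c integral_return)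
  qed (use f fm pr prob_lk in \<open>auto intro: prob_space.finite_measure\<close>)
  also have "\<dots> = f x" using fm by (subst integral_return) auto
  finally show ?thesis by (simp add: ou_law[OF order_refl f(1)])
qed

lemma dual_0: "\<mu> \<in> signed_measures \<Longrightarrow> dual 0 \<mu> = \<mu>"
proof (rule signed_measures_ext[OF dual_signed])
  fix B :: "'h set" assume \<mu>: "\<mu> \<in> signed_measures" and B: "B \<in> sets borel"
  have "PP 0 (indicator B) = (indicator B :: 'h \<Rightarrow> real)"
    by (rule ext, rule P_0[where C=1]) (use B in auto)
  thus "dual 0 \<mu> B = \<mu> B" using B signed_integral_indicator[OF \<mu> B] by (simp add: dual_semigroup_def)
qed auto

theorem dual_solution:
  assumes \<mu>: "\<mu> \<in> signed_measures"
  shows "measure_equation_solution LL (D0_tilde D A) \<mu> (\<lambda>t. dual t \<mu>)"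
  unfolding measure_equation_solution_def
proof (intro conjI allI impI ballI)
  show "dual t \<mu> \<in> signed_measures" if "0 \<le> t" for t by (rule dual_signed[OF \<mu> that])
  show "(\<lambda>t. tv_norm (dual t \<mu>)) absolutely_integrable_on {0<..<T}" for T by (rule tv_dual_integrable[OF \<mu>])
  show "dual 0 \<mu> = \<mu>" by (rule dual_0[OF \<mu>])
  fix f assume f: "f \<in> D0_tilde D A"
  obtain K where K: "0 \<le> K" "\<And>t x. 0 \<le> t \<Longrightarrow> \<bar>PP t f x - f x\<bar> \<le> K * t" using generator_bound[OF f] by blast
  obtain C where C: "\<And>x. \<bar>f x\<bar> \<le> C" using bcontfun_bound[OF D0_tildeD(6)[OF f]] by auto
  have fm: "f \<in> bm" by (rule borel_measurable_continuous_onI[OF D0_tildeD(5)[OF f]])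
  define U where "U t = signed_integral (dual t \<mu>) f" for t
  define L where "L = K * tv_norm \<mu>"
  have L0: "0 \<le> L" unfolding L_def by (intro mult_nonneg_nonneg K tv_norm_nonneg)
  have tv: "tv_norm (dual t \<mu>) \<le> tv_norm \<mu>" if "t \<ge> 0" for t
    using tv_dual_mono[OF \<mu> order_refl that] dual_0[OF \<mu>] by simp
  have incr: "U (t + h) - U t = signed_integral (dual t \<mu>) (\<lambda>x. PP h f x - f x)" if "t \<ge> 0" "h \<ge> 0" for t h
    unfolding U_def dual_integral_add[OF \<mu> that fm C]
    by (rule signed_integral_diff[OF dual_signed[OF \<mu> that(1)] P_measurable[OF that(2) fm] P_bound[OF that(2) fm C] fm C, symmetric])
  have dm: "(\<lambda>x. PP h f x - f x) \<in> bm" if "h \<ge> 0" for h using P_measurable[OF that fm] fm by measurable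
  have Lip: "\<bar>U (t + h) - U t\<bar> \<le> L * h" if t: "t \<ge> 0" and h: "h \<ge> 0" for t h
  proof -
    have "\<bar>U (t + h) - U t\<bar> \<le> (K * h) * tv_norm (dual t \<mu>)"
      unfolding incr[OF t h] by (rule signed_integral_bound[OF dual_signed[OF \<mu> t] dm[OF h] K(2)[OF h]])
    also have "\<dots> \<le> (K * h) * tv_norm \<mu>" using K(1) h by (intro mult_left_mono tv t) auto
    finally show ?thesis by (simp add: L_def mult_ac)
  qed
  have Lip': "\<bar>U t - U s\<bar> \<le> L * (t - s)" if "0 \<le> s" "s \<le> t" for s t using Lip[of s "t - s"] that by simp
  show "abs_continuous_on_Icc 0 T (\<lambda>t. signed_integral (dual t \<mu>) f)" for T
    unfolding U_def[symmetric] by (rule Lipschitz_abs_continuous[OF L0 Lip'])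
  have Uc: "continuous_on {0..} U"
    by (rule Lipschitz_continuous_on_nonneg[OF Lip'])
  \<comment> \<open>The semigroup law puts the difference quotient under the integral against the
    measure at time \<open>t\<close>, where bounded convergence to the generator applies.\<close>
  have quot: "real (Suc n) * (U (t + recip n) - U t) =
      signed_integral (dual t \<mu>) (\<lambda>x. real (Suc n) * (PP (recip n) f x - f x))" if "t \<ge> 0" for t n
    using incr[OF that, of "recip n"] by (simp add: signed_integral_cmult)
  have qlim: "(\<lambda>n. real (Suc n) * (U (t + recip n) - U t)) \<longlonglongrightarrow> signed_integral (dual t \<mu>) (LL f)" if t: "t \<ge> 0" for t
    unfolding quot[OF t]
  proof (rule signed_integral_dominated_convergence[OF dual_signed[OF \<mu> t]])
    show "(\<lambda>x. real (Suc n) * (PP (recip n) f x - f x)) \<in> bm" for n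
      using dm[of "recip n"] by measurable
    have "\<bar>real (Suc n) * (PP (recip n) f x - f x)\<bar> \<le> K" for n x
    proof -
      have "real (Suc n) * \<bar>PP (recip n) f x - f x\<bar> \<le> real (Suc n) * (K * (recip n))"
        by (intro mult_left_mono K(2)) auto
      thus ?thesis by (simp add: abs_mult)
    qed
    thus "\<bar>real (Suc n) * (PP (recip n) f x - f x)\<bar> \<le> K" for n x .
  qed (rule generator_limit[OF f])
  have qbd: "\<bar>real (Suc n) * (U (t + recip n) - U t)\<bar> \<le> L" if "t \<ge> 0" for t n
  proof -
    have "real (Suc n) * \<bar>U (t + recip n) - U t\<bar> \<le> real (Suc n) * (L * (recip n))"
      using that by (intro mult_left_mono Lip) auto
    thus ?thesis by (simp add: abs_mult)
  qed
  fix t :: real assume t: "0 \<le> t"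
  note R = right_derivative_integral[OF Uc t qbd qlim, of 0]
  show "(\<lambda>s. signed_integral (dual s \<mu>) (LL f)) absolutely_integrable_on {0..t}"
    by (rule lborel_to_lebesgue(1)[OF R(1)])
  have "U t - U 0 = (LINT s:{0..t}|lebesgue. signed_integral (dual s \<mu>) (LL f))"
    by (rule trans[OF R(2)[symmetric] lborel_to_lebesgue(2)[OF R(1), symmetric]])
  thus "signed_integral (dual t \<mu>) f - signed_integral \<mu> f = (LINT s:{0..t}|lebesgue. signed_integral (dual s \<mu>) (LL f))"
    by (simp add: U_def dual_0[OF \<mu>])
qed

end

section \<open>The test functions of exponential type\<close>

lemma has_derivative_quadratic:
  fixes f :: "'a::real_normed_vector \<Rightarrow> 'b::real_normed_vector"
  assumes F: "bounded_linear F" and q: "\<And>v. norm (f (x + v) - f x - F v) \<le> K * (norm v)\<^sup>2"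
  shows "(f has_derivative F) (at x)"
  unfolding has_derivative_at
proof
  show "(\<lambda>v. norm (f (x + v) - f x - F v) / norm v) \<midarrow>0\<rightarrow> 0"
  proof (rule Lim_null_comparison[where g="\<lambda>v. K * norm v"])
    have "norm (f (x + v) - f x - F v) / norm v \<le> K * norm v" for v
      using q[of v] by (cases "v = 0") (auto simp: field_simps power2_eq_square)
    thus "\<forall>\<^sub>F v in at 0. norm (norm (f (x + v) - f x - F v) / norm v) \<le> K * norm v" by simp
    show "(\<lambda>v. K * norm v) \<midarrow>0\<rightarrow> 0" by (intro tendsto_mult_right_zero tendsto_norm_zero tendsto_ident_at)
  qed
qed (rule F)

lemma sq_out: "(p * q * v) * c * d * e = (p * q * c * d * e) * (v :: real)"
  by (simp only: mult_ac)

lemma Lipschitz_bcontfun: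
  fixes f :: "'a::real_normed_vector \<Rightarrow> 'b::real_normed_vector"
  assumes L: "\<And>x v. norm (f (x + v) - f x) \<le> K * norm v" and C: "\<And>x. norm (f x) \<le> C"
  shows "f \<in> bcontfun"
proof (rule bcontfun_I[OF continuous_on_UNIV_seqI C])
  fix x :: "nat \<Rightarrow> 'a" and x0 assume x: "x \<longlonglongrightarrow> x0"
  have "(\<lambda>n. f (x n) - f x0) \<longlonglongrightarrow> 0"
  proof (rule Lim_null_comparison[where g="\<lambda>n. K * norm (x n - x0)"])
    show "(\<lambda>n. K * norm (x n - x0)) \<longlonglongrightarrow> 0" by (intro tendsto_mult_right_zero tendsto_norm_zero LIM_zero x)
    show "\<forall>\<^sub>F n in sequentially. norm (f (x n) - f x0) \<le> K * norm (x n - x0)" using L[of x0 "x _ - x0"] by simp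
  qed
  thus "(\<lambda>n. f (x n)) \<longlonglongrightarrow> f x0" by (rule LIM_zero_cancel)
qed

lemma integral_abs_le:
  fixes f :: "real \<Rightarrow> real"
  assumes "0 \<le> b" "continuous_on {0..b} f" "\<And>s. 0 \<le> s \<Longrightarrow> s \<le> b \<Longrightarrow> \<bar>f s\<bar> \<le> C"
  shows "\<bar>integral {0..b} f\<bar> \<le> C * b"
  using integral_bound[OF assms(1,2), of C] assms(3) by simp

lemma bcontfun_add:
  assumes f: "f \<in> bcontfun" and g: "g \<in> bcontfun"
  shows "(\<lambda>x. f x + g x :: 'b::real_normed_vector) \<in> bcontfun"
proof -
  obtain C where C: "\<And>x. norm (f x) \<le> C" using bcontfun_bound[OF f] by blast
  obtain C' where C': "\<And>x. norm (g x) \<le> C'" using bcontfun_bound[OF g] by blast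
  show ?thesis
    by (rule bcontfun_I[OF continuous_on_add[OF bcontfun_cont[OF f] bcontfun_cont[OF g]]])
      (rule norm_triangle_le[OF add_mono[OF C C']])
qed

lemma hs_norm_nonneg: "0 \<le> hs_norm T"
  unfolding hs_norm_def by (simp add: infsum_nonneg)

text \<open>The factor 2 stems from the elementary inequality for the square of a sum; it is
  harmless for boundedness and for limits equal to 0.\<close>

lemma hilbert_schmidt_add:
  assumes T: "hilbert_schmidt T" and T': "hilbert_schmidt T'"
  shows "hilbert_schmidt (\<lambda>v. T v + T' v)" "hs_norm (\<lambda>v. T v + T' v) \<le> 2 * (hs_norm T + hs_norm T')"
proof -
  have le: "(norm (T e + T' e))\<^sup>2 \<le> 2 * (norm (T e))\<^sup>2 + 2 * (norm (T' e))\<^sup>2" for e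
    using power2_norm_diff_le[of "T e" "- T' e"] by simp
  have s: "(\<lambda>e. (norm (T e))\<^sup>2) summable_on the_onb" "(\<lambda>e. (norm (T' e))\<^sup>2) summable_on the_onb"
    using T T' unfolding hilbert_schmidt_def by auto
  have s2: "(\<lambda>e. 2 * (norm (T e))\<^sup>2) summable_on the_onb" "(\<lambda>e. 2 * (norm (T' e))\<^sup>2) summable_on the_onb"
    using s by (intro summable_on_cmult_right; simp)+
  have sm: "(\<lambda>e. (norm (T e + T' e))\<^sup>2) summable_on the_onb"
    by (rule summable_on_comparison_test[OF summable_on_add[OF s2]]) (use le in auto)
  show "hilbert_schmidt (\<lambda>v. T v + T' v)"
    unfolding hilbert_schmidt_def using T T' sm by (auto simp: hilbert_schmidt_def intro: bounded_linear_add)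
  have sq: "(hs_norm U)\<^sup>2 = (\<Sum>\<^sub>\<infinity>e\<in>the_onb. (norm (U e))\<^sup>2)" for U :: "'a \<Rightarrow> 'a"
    unfolding hs_norm_def by (simp add: infsum_nonneg)
  have "(hs_norm (\<lambda>v. T v + T' v))\<^sup>2 \<le> (\<Sum>\<^sub>\<infinity>e\<in>the_onb. 2 * (norm (T e))\<^sup>2 + 2 * (norm (T' e))\<^sup>2)"
    unfolding sq by (rule infsum_mono[OF sm summable_on_add[OF s2] le])
  also have "\<dots> = 2 * (hs_norm T)\<^sup>2 + 2 * (hs_norm T')\<^sup>2"
    unfolding sq infsum_add[OF s2] by (simp add: infsum_cmult_right' )
  also have "\<dots> \<le> (2 * (hs_norm T + hs_norm T'))\<^sup>2"
    using hs_norm_nonneg[of T] hs_norm_nonneg[of T'] by (simp add: power2_eq_square algebra_simps)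
  finally show "hs_norm (\<lambda>v. T v + T' v) \<le> 2 * (hs_norm T + hs_norm T')"
    by (rule power2_le_imp_le) (simp add: hs_norm_nonneg)
qed

section \<open>Hilbert-Schmidt operators built from adjoint orbits\<close>

context c0_semigroup
begin

text \<open>The weak integral over \<open>[0, b]\<close> of \<open>\<theta> s\<close> times the rank
  one operator that maps \<open>v\<close> to \<open>(v \<bullet> Sa s h) *\<^sub>R Sa s h\<close>.
  The Hessian of \<phi> is of this form.\<close>

definition TT :: "real \<Rightarrow> (real \<Rightarrow> real) \<Rightarrow> 'h \<Rightarrow> 'h \<Rightarrow> 'h" where
  "TT b \<theta> h v = adj_int b (\<lambda>s. \<theta> s * (v \<bullet> Sa s h)) h"

context
  fixes b :: real and \<theta> :: "real \<Rightarrow> real" and h :: 'h and c :: real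
  assumes b: "b \<ge> 0" and \<theta>: "continuous_on {0..b} \<theta>" "\<And>s. 0 \<le> s \<Longrightarrow> s \<le> b \<Longrightarrow> \<bar>\<theta> s\<bar> \<le> c"
begin

lemma TT_weight_cont: "continuous_on {0..b} (\<lambda>s. \<theta> s * (v \<bullet> Sa s h))"
  by (intro continuous_on_mult \<theta> Sa_weak_cont) auto

lemma TT_inner: "u \<bullet> TT b \<theta> h v = integral {0..b} (\<lambda>s. \<theta> s * (v \<bullet> Sa s h) * (u \<bullet> Sa s h))"
  unfolding TT_def adj_int[OF b TT_weight_cont] by (rule integral_cong) (simp add: Sa)

lemma TT_integrable: "(\<lambda>s. \<theta> s * (v \<bullet> Sa s h) * (u \<bullet> Sa s h)) integrable_on {0..b}"
  by (intro integrable_continuous_real continuous_on_mult TT_weight_cont Sa_weak_cont) auto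

lemma inner_Sa_le: "0 \<le> s \<Longrightarrow> s \<le> b \<Longrightarrow> \<bar>v \<bullet> Sa s h\<bar> \<le> norm v * (Mb b * norm h)"
  by (rule order_trans[OF Cauchy_Schwarz_ineq2]) (intro mult_left_mono norm_Sa, auto)

lemma TT_norm: "norm (TT b \<theta> h v) \<le> norm v * (c * (Mb b * norm h) * Mb b * norm h * b)"
proof -
  have "norm (TT b \<theta> h v) \<le> (c * (norm v * (Mb b * norm h))) * Mb b * norm h * b"
    unfolding TT_def
  proof (rule norm_adj_int[OF b TT_weight_cont])
    show "\<bar>\<theta> s * (v \<bullet> Sa s h)\<bar> \<le> c * (norm v * (Mb b * norm h))" if "0 \<le> s" "s \<le> b" for s
      unfolding abs_mult using \<theta>(2)[OF that] inner_Sa_le[OF that] by (intro mult_mono) auto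
  qed
  thus ?thesis by (simp only: mult_ac)
qed

lemma TT_linear: "bounded_linear (TT b \<theta> h)"
proof (rule bounded_linear_intro[OF _ _ TT_norm])
  fix v v' :: 'h and r :: real
  have "u \<bullet> TT b \<theta> h (v + v') = u \<bullet> (TT b \<theta> h v + TT b \<theta> h v')" for u
    unfolding inner_add_right TT_inner integral_add[OF TT_integrable TT_integrable, symmetric]
    by (rule integral_cong) (simp add: inner_add_left algebra_simps)
  thus "TT b \<theta> h (v + v') = TT b \<theta> h v + TT b \<theta> h v'" using vector_eq_ldot by blast
  have "u \<bullet> TT b \<theta> h (r *\<^sub>R v) = u \<bullet> (r *\<^sub>R TT b \<theta> h v)" for u
    unfolding inner_scaleR_right TT_inner integral_mult_right[symmetric]
    by (rule integral_cong) (simp add: algebra_simps)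
  thus "TT b \<theta> h (r *\<^sub>R v) = r *\<^sub>R TT b \<theta> h v" using vector_eq_ldot by blast
qed

text \<open>The sum of \<open>(norm (TT b \<theta> h e))\<^sup>2\<close> over finitely many basis
  vectors is the integral of \<open>\<theta> s\<close> times the sum of the products of
  \<open>e \<bullet> Sa s h\<close> and \<open>TT b \<theta> h e \<bullet> Sa s h\<close>.
  Cauchy-Schwarz and Bessel bound it by a constant times its own square root, uniformly in the
  finite set.\<close>

lemma TT_hs: "hilbert_schmidt (TT b \<theta> h)" "hs_norm (TT b \<theta> h) \<le> c * ((Mb b * norm h)\<^sup>2 * b)"
proof -
  let ?T = "TT b \<theta> h"
  define B where "B = Mb b * norm h"
  define G where "G = c * (B\<^sup>2 * b)"
  have c: "0 \<le> c" using \<theta>(2)[of 0] b by linarith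
  have G0: "0 \<le> G" using c b by (simp add: G_def)
  have nS: "norm (Sa s h) \<le> B" if "0 \<le> s" "s \<le> b" for s unfolding B_def by (rule norm_Sa[OF that])
  have fin: "(\<Sum>e\<in>E. (norm (?T e))\<^sup>2) \<le> G\<^sup>2" if E: "finite E" "E \<subseteq> the_onb" for E
  proof -
    define \<sigma> where "\<sigma> = L2_set (\<lambda>e. norm (?T e)) E"
    have \<sigma>: "\<sigma>\<^sup>2 = (\<Sum>e\<in>E. (norm (?T e))\<^sup>2)" unfolding \<sigma>_def L2_set_def by (simp add: sum_nonneg)
    have \<sigma>0: "0 \<le> \<sigma>" unfolding \<sigma>_def by (rule L2_set_nonneg)
    have "\<sigma>\<^sup>2 = (\<Sum>e\<in>E. integral {0..b} (\<lambda>s. \<theta> s * (e \<bullet> Sa s h) * (?T e \<bullet> Sa s h)))"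
      unfolding \<sigma> power2_norm_eq_inner by (subst TT_inner) (rule refl)
    also have "\<dots> = integral {0..b} (\<lambda>s. \<Sum>e\<in>E. \<theta> s * (e \<bullet> Sa s h) * (?T e \<bullet> Sa s h))"
      by (rule integral_sum[symmetric]) (use E TT_integrable in auto)
    also have "\<dots> \<le> (c * (B * (B * \<sigma>))) * b"
    proof (rule order_trans[OF abs_ge_self integral_abs_le[OF b]])
      show "continuous_on {0..b} (\<lambda>s. \<Sum>e\<in>E. \<theta> s * (e \<bullet> Sa s h) * (?T e \<bullet> Sa s h))"
        by (intro continuous_on_sum continuous_on_mult TT_weight_cont Sa_weak_cont) auto
      fix s assume s: "0 \<le> s" "s \<le> b"
      have "\<bar>\<Sum>e\<in>E. (e \<bullet> Sa s h) * (?T e \<bullet> Sa s h)\<bar> \<le> (\<Sum>e\<in>E. \<bar>e \<bullet> Sa s h\<bar> * \<bar>?T e \<bullet> Sa s h\<bar>)"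
        by (rule order_trans[OF sum_abs]) (simp add: abs_mult)
      also have "\<dots> \<le> L2_set (\<lambda>e. e \<bullet> Sa s h) E * L2_set (\<lambda>e. ?T e \<bullet> Sa s h) E" by (rule L2_set_mult_ineq)
      also have "\<dots> \<le> B * (B * \<sigma>)"
      proof (rule mult_mono)
        have "(\<Sum>e\<in>E. (e \<bullet> Sa s h)\<^sup>2) \<le> (norm (Sa s h))\<^sup>2"
          using bessel_finite[OF E, of "Sa s h"] by (simp only: inner_commute)
        hence "L2_set (\<lambda>e. e \<bullet> Sa s h) E \<le> norm (Sa s h)" unfolding L2_set_def by (rule real_le_lsqrt[rotated]) auto
        thus "L2_set (\<lambda>e. e \<bullet> Sa s h) E \<le> B" using nS[OF s] by linarith
        have "L2_set (\<lambda>e. \<bar>?T e \<bullet> Sa s h\<bar>) E \<le> L2_set (\<lambda>e. B * norm (?T e)) E"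
        proof (rule L2_set_mono)
          fix e
          have "\<bar>?T e \<bullet> Sa s h\<bar> \<le> norm (?T e) * norm (Sa s h)" by (rule Cauchy_Schwarz_ineq2)
          also have "\<dots> \<le> norm (?T e) * B" by (intro mult_left_mono nS s) auto
          finally show "\<bar>?T e \<bullet> Sa s h\<bar> \<le> B * norm (?T e)" by (simp only: mult.commute)
        qed auto
        thus "L2_set (\<lambda>e. ?T e \<bullet> Sa s h) E \<le> B * \<sigma>"
          unfolding \<sigma>_def L2_set_right_distrib[of B, unfolded B_def, OF mult_nonneg_nonneg[OF Mb_nonneg norm_ge_zero], folded B_def]
          by (simp add: L2_set_def)
      qed (auto simp: B_def)
      finally have "\<bar>\<Sum>e\<in>E. (e \<bullet> Sa s h) * (?T e \<bullet> Sa s h)\<bar> \<le> B * (B * \<sigma>)" .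
      hence "\<bar>\<theta> s\<bar> * \<bar>\<Sum>e\<in>E. (e \<bullet> Sa s h) * (?T e \<bullet> Sa s h)\<bar> \<le> c * (B * (B * \<sigma>))"
        using \<theta>(2)[OF s] c by (intro mult_mono) auto
      thus "\<bar>\<Sum>e\<in>E. \<theta> s * (e \<bullet> Sa s h) * (?T e \<bullet> Sa s h)\<bar> \<le> c * (B * (B * \<sigma>))"
        by (simp add: abs_mult[symmetric] sum_distrib_left mult.assoc)
    qed
    also have "\<dots> = G * \<sigma>" by (simp add: G_def power2_eq_square)
    finally have "\<sigma> * \<sigma> \<le> G * \<sigma>" by (simp add: power2_eq_square)
    hence "\<sigma> \<le> G" using \<sigma>0 G0 by (cases "\<sigma> = 0") auto
    thus ?thesis unfolding \<sigma>[symmetric] using \<sigma>0 by (intro power_mono)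
  qed
  have sm: "(\<lambda>e. (norm (?T e))\<^sup>2) summable_on the_onb"
    by (rule nonneg_bdd_above_summable_on) (auto intro!: bdd_aboveI[of _ "G\<^sup>2"] fin)
  show "hilbert_schmidt ?T" unfolding hilbert_schmidt_def using TT_linear sm by simp
  have "(\<Sum>\<^sub>\<infinity>e\<in>the_onb. (norm (?T e))\<^sup>2) \<le> G\<^sup>2"
    using sm fin by (intro infsum_le_finite_sums) auto
  hence "hs_norm ?T \<le> G" unfolding hs_norm_def using G0 by (simp add: real_le_lsqrt)
  thus "hs_norm ?T \<le> c * ((Mb b * norm h)\<^sup>2 * b)" by (simp add: G_def B_def)
qed

end

end

section \<open>Derivatives of the functions phi and membership in the domain\<close>

context ou_setting
begin

text \<open>\<open>ww z h x s\<close> is \<open>z P\<^sub>s e\<^sub>h(x)\<close>, \<open>ff z b h\<close> is the real part of \<open>z \<phi>\<^sub>b\<^sub>,\<^sub>h\<close>, and \<open>gg z b h h\<close> is its gradient.\<close>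

definition ww :: "complex \<Rightarrow> 'h \<Rightarrow> 'h \<Rightarrow> real \<Rightarrow> complex" where
  "ww z h x s = z * cc s h * iexp (x \<bullet> Sa s h)"

definition ff :: "complex \<Rightarrow> real \<Rightarrow> 'h \<Rightarrow> 'h \<Rightarrow> real" where
  "ff z b h x = integral {0..b} (\<lambda>s. Re (ww z h x s))"

definition gg :: "complex \<Rightarrow> real \<Rightarrow> 'h \<Rightarrow> 'h \<Rightarrow> 'h \<Rightarrow> 'h" where
  "gg z b h k x = adj_int b (\<lambda>s. - Im (ww z h x s)) k"

lemma ww_cont: "B \<subseteq> {0..} \<Longrightarrow> continuous_on B (ww z h x)"
  unfolding ww_def by (intro continuous_intros cc_cont Sa_weak_cont)

lemma cmod_ww:
  assumes "s \<ge> 0" shows "cmod (ww z h x s) \<le> cmod z"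
proof -
  have "cmod z * cmod (cc s h) \<le> cmod z * 1" using cmod_cc[OF assms] by (intro mult_left_mono) auto
  thus ?thesis by (simp add: ww_def norm_mult)
qed

lemma ww_increment:
  assumes s: "s \<ge> 0"
  shows "cmod (ww z h (x + v) s - ww z h x s) \<le> cmod z * \<bar>v \<bullet> Sa s h\<bar>"
    "cmod (ww z h (x + v) s - ww z h x s - \<i> * of_real (v \<bullet> Sa s h) * ww z h x s) \<le> cmod z * (v \<bullet> Sa s h)\<^sup>2"
proof -
  have e: "ww z h (x + v) s = ww z h x s * iexp (v \<bullet> Sa s h)"
    by (simp add: ww_def inner_add_left distrib_left exp_add mult.assoc)
  have "ww z h (x + v) s - ww z h x s = ww z h x s * (iexp (v \<bullet> Sa s h) - 1)" unfolding e by (simp add: algebra_simps)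
  thus "cmod (ww z h (x + v) s - ww z h x s) \<le> cmod z * \<bar>v \<bullet> Sa s h\<bar>"
    using cmod_ww[OF s] iexp_minus_1_bounds(1) by (simp only: norm_mult) (intro mult_mono; simp)
  have "ww z h (x + v) s - ww z h x s - \<i> * of_real (v \<bullet> Sa s h) * ww z h x s =
     ww z h x s * (iexp (v \<bullet> Sa s h) - 1 - \<i> * of_real (v \<bullet> Sa s h))" unfolding e by (simp add: algebra_simps)
  thus "cmod (ww z h (x + v) s - ww z h x s - \<i> * of_real (v \<bullet> Sa s h) * ww z h x s) \<le> cmod z * (v \<bullet> Sa s h)\<^sup>2"
    using cmod_ww[OF s] iexp_minus_1_bounds(2) by (simp only: norm_mult) (intro mult_mono; simp)
qed

context
  fixes z :: complex and b :: real and h :: 'h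
  assumes b: "b \<ge> 0"
begin

abbreviation "B0 \<equiv> Mb b * norm h"


lemma Sa_le: "0 \<le> s \<Longrightarrow> s \<le> b \<Longrightarrow> \<bar>v \<bullet> Sa s h\<bar> \<le> norm v * B0"
  by (rule order_trans[OF Cauchy_Schwarz_ineq2]) (intro mult_left_mono norm_Sa, auto)

lemma ww_increment':
  assumes s: "0 \<le> s" "s \<le> b"
  shows "cmod (ww z h (x + v) s - ww z h x s) \<le> cmod z * B0 * norm v"
    "cmod (ww z h (x + v) s - ww z h x s - \<i> * of_real (v \<bullet> Sa s h) * ww z h x s) \<le> cmod z * B0\<^sup>2 * (norm v)\<^sup>2"
proof -
  have "cmod z * \<bar>v \<bullet> Sa s h\<bar> \<le> cmod z * (norm v * B0)" by (intro mult_left_mono Sa_le s) auto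
  thus "cmod (ww z h (x + v) s - ww z h x s) \<le> cmod z * B0 * norm v"
    using ww_increment(1)[OF s(1), of z h x v] by (simp add: mult_ac)
  have "\<bar>v \<bullet> Sa s h\<bar>\<^sup>2 \<le> (norm v * B0)\<^sup>2" by (intro power_mono Sa_le s) auto
  hence "cmod z * (v \<bullet> Sa s h)\<^sup>2 \<le> cmod z * (norm v * B0)\<^sup>2" by (intro mult_left_mono) auto
  thus "cmod (ww z h (x + v) s - ww z h x s - \<i> * of_real (v \<bullet> Sa s h) * ww z h x s) \<le> cmod z * B0\<^sup>2 * (norm v)\<^sup>2"
    using ww_increment(2)[OF s(1), of z h x v] by (simp add: power_mult_distrib mult_ac)
qed

lemma Re_cont: "continuous_on {0..b} (\<lambda>s. Re (ww z h x s))"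
  and Im_cont: "continuous_on {0..b} (\<lambda>s. - Im (ww z h x s))"
  by (intro continuous_intros ww_cont; simp)+

lemma gg_norm: "norm (gg z b h k x) \<le> cmod z * Mb b * norm k * b"
  unfolding gg_def
  by (rule norm_adj_int[OF b Im_cont]) (use order_trans[OF abs_Im_le_cmod cmod_ww] in simp)

lemma gg_Lipschitz: "norm (gg z b h k (x + v) - gg z b h k x) \<le> (cmod z * B0 * Mb b * norm k * b) * norm v"
proof -
  have "norm (gg z b h k (x + v) - gg z b h k x) \<le> (cmod z * B0 * norm v) * Mb b * norm k * b"
    unfolding gg_def adj_int_diff[OF b Im_cont Im_cont]
  proof (rule norm_adj_int[OF b])
    show "continuous_on {0..b} (\<lambda>s. - Im (ww z h (x + v) s) - - Im (ww z h x s))" by (intro continuous_on_diff Im_cont)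
    fix s assume s: "0 \<le> s" "s \<le> b"
    show "\<bar>- Im (ww z h (x + v) s) - - Im (ww z h x s)\<bar> \<le> cmod z * B0 * norm v"
      using order_trans[OF abs_Im_le_cmod ww_increment'(1)[OF s, of x v]] by (simp add: abs_minus_commute)
  qed
  thus ?thesis by (simp only: mult_ac)
qed

text \<open>The integrand differs from its linearisation by a quadratic term, uniformly in
  \<open>s\<close>, and integration preserves this.\<close>

lemma ff_deriv: "GDERIV (ff z b h) x :> gg z b h h x"
  unfolding gderiv_def
proof (rule has_derivative_quadratic)
  show "bounded_linear (\<lambda>v. v \<bullet> gg z b h h x)" by (rule bounded_linear_inner_left)
  fix v
  let ?r = "\<lambda>s. ww z h (x + v) s - ww z h x s - \<i> * of_real (v \<bullet> Sa s h) * ww z h x s"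
  have i: "(\<lambda>s. Re (ww z h y s)) integrable_on {0..b}" for y by (rule integrable_continuous_real[OF Re_cont])
  have j: "(\<lambda>s. - Im (ww z h x s) * (v \<bullet> Sa s h)) integrable_on {0..b}"
    by (intro integrable_continuous_real continuous_on_mult Im_cont Sa_weak_cont) auto
  have vg: "v \<bullet> gg z b h h x = integral {0..b} (\<lambda>s. - Im (ww z h x s) * (v \<bullet> Sa s h))"
    unfolding gg_def adj_int[OF b Im_cont] by (rule integral_cong) (simp add: Sa)
  have "ff z b h (x + v) - ff z b h x - v \<bullet> gg z b h h x = integral {0..b} (\<lambda>s. Re (?r s))"
    unfolding ff_def vg integral_diff[OF i i, symmetric] integral_diff[OF integrable_diff[OF i i] j, symmetric]
    by (rule integral_cong) (simp add: algebra_simps)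
  moreover have "\<bar>integral {0..b} (\<lambda>s. Re (?r s))\<bar> \<le> (cmod z * B0\<^sup>2 * (norm v)\<^sup>2) * b"
  proof (rule integral_abs_le[OF b])
    show "continuous_on {0..b} (\<lambda>s. Re (?r s))" by (intro continuous_intros ww_cont Sa_weak_cont) auto
  qed (rule order_trans[OF abs_Re_le_cmod ww_increment'(2)])
  ultimately show "norm (ff z b h (x + v) - ff z b h x - v \<bullet> gg z b h h x) \<le> (cmod z * B0\<^sup>2 * b) * (norm v)\<^sup>2"
    by (simp add: mult_ac)
qed

lemma gg_deriv: "(gg z b h h has_derivative TT b (\<lambda>s. - Re (ww z h x s)) h) (at x)"
proof (rule has_derivative_quadratic)
  have c: "continuous_on {0..b} (\<lambda>s. - Re (ww z h x s))" by (intro continuous_on_minus Re_cont)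
  show "bounded_linear (TT b (\<lambda>s. - Re (ww z h x s)) h)"
    by (rule TT_linear[OF b c, where c="cmod z"]) (use order_trans[OF abs_Re_le_cmod cmod_ww] in simp)
  fix v
  let ?r = "\<lambda>s. ww z h (x + v) s - ww z h x s - \<i> * of_real (v \<bullet> Sa s h) * ww z h x s"
  have c': "continuous_on {0..b} (\<lambda>s. - Re (ww z h x s) * (v \<bullet> Sa s h))"
    by (intro continuous_on_mult c Sa_weak_cont) auto
  have cd: "continuous_on {0..b} (\<lambda>s. - Im (ww z h (x + v) s) - - Im (ww z h x s))"
    by (intro continuous_on_diff Im_cont)
  have g1: "gg z b h h (x + v) - gg z b h h x = adj_int b (\<lambda>s. - Im (ww z h (x + v) s) - - Im (ww z h x s)) h"
    unfolding gg_def by (rule adj_int_diff[OF b Im_cont Im_cont])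
  note cD = continuous_on_diff[OF cd c']
  have g2: "gg z b h h (x + v) - gg z b h h x - TT b (\<lambda>s. - Re (ww z h x s)) h v =
    adj_int b (\<lambda>s. - Im (ww z h (x + v) s) - - Im (ww z h x s) - - Re (ww z h x s) * (v \<bullet> Sa s h)) h"
    unfolding g1 TT_def by (rule adj_int_diff[OF b cd c'])
  have n: "norm (gg z b h h (x + v) - gg z b h h x - TT b (\<lambda>s. - Re (ww z h x s)) h v) \<le>
      (cmod z * B0\<^sup>2 * (norm v)\<^sup>2) * Mb b * norm h * b"
    unfolding g2
  proof (rule norm_adj_int[OF b cD])
    fix s assume s: "0 \<le> s" "s \<le> b"
    have e: "- Im (ww z h (x + v) s) - - Im (ww z h x s) - - Re (ww z h x s) * (v \<bullet> Sa s h) = - Im (?r s)"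
      by (simp add: algebra_simps)
    show "\<bar>- Im (ww z h (x + v) s) - - Im (ww z h x s) - - Re (ww z h x s) * (v \<bullet> Sa s h)\<bar> \<le> cmod z * B0\<^sup>2 * (norm v)\<^sup>2"
      unfolding e abs_minus_cancel by (rule order_trans[OF abs_Im_le_cmod ww_increment'(2)[OF s]])
  qed
  show "norm (gg z b h h (x + v) - gg z b h h x - TT b (\<lambda>s. - Re (ww z h x s)) h v) \<le> (cmod z * B0\<^sup>2 * Mb b * norm h * b) * (norm v)\<^sup>2"
    by (rule order_trans[OF n eq_refl[OF sq_out]])
qed

lemma grad_ff: "grad (ff z b h) = gg z b h h"
  by (rule ext) (rule grad_eq[OF ff_deriv])

lemma hess_ff: "hess (ff z b h) x = TT b (\<lambda>s. - Re (ww z h x s)) h"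
  unfolding hess_def grad_ff by (rule frechet_derivative_at[OF gg_deriv, symmetric])

lemma ff_bound: "\<bar>ff z b h x\<bar> \<le> cmod z * b"
  unfolding ff_def by (rule integral_abs_le[OF b Re_cont]) (rule order_trans[OF abs_Re_le_cmod cmod_ww])

lemma ff_cont: "continuous_on UNIV (ff z b h)"
  by (intro continuous_at_imp_continuous_on ballI has_derivative_continuous[OF ff_deriv[unfolded gderiv_def]])

lemma ff_Cb2: "ff z b h \<in> Cb2"
  unfolding Cb2_def mem_Collect_eq
proof (intro conjI allI)
  have c: "continuous_on {0..b} (\<lambda>s. - Re (ww z h x s))" for x by (intro continuous_on_minus Re_cont)
  have cb: "\<bar>- Re (ww z h x s)\<bar> \<le> cmod z" if "0 \<le> s" "s \<le> b" for s x
    using order_trans[OF abs_Re_le_cmod cmod_ww[OF that(1), of z h x]] by simp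
  show "ff z b h \<in> bcontfun" by (rule bcontfun_I[OF ff_cont]) (use ff_bound in simp)
  fix x
  show "ff z b h differentiable (at x)" using ff_deriv unfolding gderiv_def differentiable_def by blast
  show "grad (ff z b h) differentiable (at x)" unfolding grad_ff using gg_deriv unfolding differentiable_def by blast
  show "grad (ff z b h) \<in> bcontfun" unfolding grad_ff by (rule Lipschitz_bcontfun[OF gg_Lipschitz gg_norm])
  show "hilbert_schmidt (hess (ff z b h) x)" unfolding hess_ff by (rule TT_hs(1)[OF b c cb])
  show "\<exists>C. \<forall>x. hs_norm (hess (ff z b h) x) \<le> C" unfolding hess_ff by (intro exI allI) (rule TT_hs(2)[OF b c cb])
  let ?T = "\<lambda>y. TT b (\<lambda>s. - Re (ww z h y s) - - Re (ww z h x s)) h"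
  have c': "continuous_on {0..b} (\<lambda>s. - Re (ww z h y s) - - Re (ww z h x s))" for y by (intro continuous_on_diff c)
  \<comment> \<open>The difference of two Hessians is \<open>TT\<close> for the difference of the
    weights, which is Lipschitz in the point; this gives continuity in the Hilbert-Schmidt
    norm.\<close>
  have eq: "(\<lambda>v. hess (ff z b h) y v - hess (ff z b h) x v) = ?T y" for y
  proof
    fix v
    have m: "continuous_on {0..b} (\<lambda>s. - Re (ww z h w s) * (v \<bullet> Sa s h))" for w
      by (intro continuous_on_mult c Sa_weak_cont) auto
    show "hess (ff z b h) y v - hess (ff z b h) x v = ?T y v"
      unfolding hess_ff TT_def adj_int_diff[OF b m m] left_diff_distrib ..
  qed
  have le: "hs_norm (?T y) \<le> (cmod z * B0 * norm (y - x)) * (B0\<^sup>2 * b)" for y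
  proof (rule TT_hs(2)[OF b c'])
    fix s assume s: "0 \<le> s" "s \<le> b"
    have "cmod (ww z h y s - ww z h x s) \<le> cmod z * B0 * norm (y - x)" using ww_increment'(1)[OF s, of x "y - x"] by simp
    thus "\<bar>- Re (ww z h y s) - - Re (ww z h x s)\<bar> \<le> cmod z * B0 * norm (y - x)"
      using abs_Re_le_cmod[of "ww z h y s - ww z h x s"] by simp
  qed
  show "((\<lambda>y. hs_norm (\<lambda>v. hess (ff z b h) y v - hess (ff z b h) x v)) \<longlongrightarrow> 0) (at x)"
    unfolding eq
  proof (rule Lim_null_comparison[where g="\<lambda>y. (cmod z * B0 * norm (y - x)) * (B0\<^sup>2 * b)"])
    have "0 \<le> hs_norm (?T y)" for y unfolding hs_norm_def by (simp add: infsum_nonneg)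
    thus "\<forall>\<^sub>F y in at x. norm (hs_norm (?T y)) \<le> (cmod z * B0 * norm (y - x)) * (B0\<^sup>2 * b)" using le by simp
    show "((\<lambda>y. (cmod z * B0 * norm (y - x)) * (B0\<^sup>2 * b)) \<longlongrightarrow> 0) (at x)"
      by (intro tendsto_mult_left_zero tendsto_mult_right_zero tendsto_norm_zero LIM_zero tendsto_ident_at)
  qed
qed

context
  assumes h: "h \<in> Ds"
begin

text \<open>The adjoint generator acts on the adjoint orbit through its starting vector, which is
  why \<open>gg\<close> carries the separate argument \<open>k\<close>.\<close>

lemma grad_ff_Ds: "grad (ff z b h) x \<in> Ds" "As (grad (ff z b h) x) = gg z b h (As h) x"
  unfolding grad_ff gg_def using adj_int_Ds[OF h b Im_cont] by auto

text \<open>\<open>x \<bullet> Sa s h\<close> is differentiable in \<open>s\<close> for every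
  \<open>x\<close> because \<open>h\<close> lies in the domain of the adjoint generator; the product
  rule with \<open>cc\<close> does the rest.\<close>

lemma ww_deriv:
  assumes s: "s \<in> {0..b}"
  shows "(ww z h x has_vector_derivative (\<i> * of_real (S s x \<bullet> As h) - \<psi> (Sa s h)) * ww z h x s) (at s within {0..b})"
proof -
  have "((\<lambda>s. integral {0..s} (\<lambda>r. S r x \<bullet> As h)) has_vector_derivative S s x \<bullet> As h) (at s within {0..b})"
    using s by (intro integral_has_vector_derivative continuous_intros S_cont') auto
  from has_vector_derivative_add[OF has_vector_derivative_const this, of "x \<bullet> h"]
  have d: "((\<lambda>s. x \<bullet> h + integral {0..s} (\<lambda>r. S r x \<bullet> As h)) has_vector_derivative S s x \<bullet> As h) (at s within {0..b})"
    by simp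
  have "x \<bullet> Sa r h = x \<bullet> h + integral {0..r} (\<lambda>r. S r x \<bullet> As h)" if "r \<in> {0..b}" for r
    using S_Ds_integral[OF h, of r x] that Sa[of r x h] by simp
  from has_vector_derivative_transform[OF s this d]
  have p: "((\<lambda>s. x \<bullet> Sa s h) has_vector_derivative S s x \<bullet> As h) (at s within {0..b})" .
  have e: "((\<lambda>s. iexp (x \<bullet> Sa s h)) has_vector_derivative \<i> * of_real (S s x \<bullet> As h) * iexp (x \<bullet> Sa s h)) (at s within {0..b})"
  proof -
    have "((\<lambda>s. \<i> * complex_of_real (x \<bullet> Sa s h)) has_vector_derivative \<i> * of_real (S s x \<bullet> As h)) (at s within {0..b})"
      by (intro has_vector_derivative_mult_right bounded_linear.has_vector_derivative[OF bounded_linear_of_real] p)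
    from field_vector_diff_chain_within[OF this has_field_derivative_at_within[OF DERIV_exp]]
    show ?thesis by (simp only: o_def)
  qed
  have "((\<lambda>s. cc s h * iexp (x \<bullet> Sa s h)) has_vector_derivative
      (cc s h * (\<i> * of_real (S s x \<bullet> As h) * iexp (x \<bullet> Sa s h)) + (- \<psi> (Sa s h) * cc s h) * iexp (x \<bullet> Sa s h))) (at s within {0..b})"
    by (intro has_vector_derivative_mult cc_deriv e) (use s in auto)
  from has_vector_derivative_mult_right[OF this, of z]
  show ?thesis unfolding ww_def by (simp add: algebra_simps)
qed

text \<open>The factor \<open>S s x \<bullet> As h\<close> makes the expression look unbounded in
  \<open>x\<close>, but up to a multiple of \<open>\<psi>\<close> the integrand is the time
  derivative of \<open>ww\<close>. The fundamental theorem leaves boundary values and an integral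
  that are bounded in \<open>x\<close>; this puts \<phi> into \<open>D0_tilde\<close>.\<close>

lemma inner_As_grad_ff:
  "x \<bullet> As (grad (ff z b h) x) = Re (ww z h x b) - Re (ww z h x 0) + integral {0..b} (\<lambda>s. Re (\<psi> (Sa s h) * ww z h x s))"
proof -
  have "((\<lambda>s. (\<i> * of_real (S s x \<bullet> As h) - \<psi> (Sa s h)) * ww z h x s) has_integral ww z h x b - ww z h x 0) {0..b}"
    by (rule fundamental_theorem_of_calculus[OF b ww_deriv])
  from has_integral_linear[OF this bounded_linear_Re]
  have 1: "((\<lambda>s. Re ((\<i> * of_real (S s x \<bullet> As h) - \<psi> (Sa s h)) * ww z h x s)) has_integral Re (ww z h x b) - Re (ww z h x 0)) {0..b}"
    by (simp add: o_def)
  have 2: "((\<lambda>s. Re (\<psi> (Sa s h) * ww z h x s)) has_integral integral {0..b} (\<lambda>s. Re (\<psi> (Sa s h) * ww z h x s))) {0..b}"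
    by (intro integrable_integral integrable_continuous_real continuous_intros psi_Sa_cont ww_cont) auto
  have "(\<lambda>s. Re ((\<i> * of_real (S s x \<bullet> As h) - \<psi> (Sa s h)) * ww z h x s) + Re (\<psi> (Sa s h) * ww z h x s)) =
      (\<lambda>s. - Im (ww z h x s) * (S s x \<bullet> As h))" by (rule ext) (simp add: algebra_simps)
  with has_integral_add[OF 1 2] show ?thesis
    unfolding grad_ff_Ds gg_def adj_int[OF b Im_cont] by (simp only: integral_unique)
qed

lemma ff_D0_tilde: "ff z b h \<in> D0_tilde D A"
  unfolding D0_tilde_def CA2_def mem_Collect_eq
proof (intro conjI allI ff_Cb2 grad_ff_Ds(1))
  show "(\<lambda>x. As (grad (ff z b h) x)) \<in> bcontfun"
    unfolding grad_ff_Ds by (rule Lipschitz_bcontfun[OF gg_Lipschitz gg_norm])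
  have pc: "continuous_on {0..b} (\<lambda>s. \<psi> (Sa s h))" by (rule psi_Sa_cont) auto
  have "bounded ((\<lambda>s. \<psi> (Sa s h)) ` {0..b})" by (intro compact_imp_bounded compact_continuous_image pc compact_Icc)
  then obtain P where P: "\<And>s. 0 \<le> s \<Longrightarrow> s \<le> b \<Longrightarrow> cmod (\<psi> (Sa s h)) \<le> P" unfolding bounded_iff by force
  have P0: "0 \<le> P" using P[of 0] b norm_ge_zero order_trans by blast
  let ?I = "\<lambda>x. integral {0..b} (\<lambda>s. Re (\<psi> (Sa s h) * ww z h x s))"
  have c: "continuous_on {0..b} (\<lambda>s. Re (\<psi> (Sa s h) * ww z h x s))" for x
    by (intro continuous_intros pc ww_cont) auto
  have I1: "\<bar>?I x\<bar> \<le> (P * cmod z) * b" for x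
  proof (rule integral_abs_le[OF b c])
    fix s assume s: "0 \<le> s" "s \<le> b"
    have "cmod (\<psi> (Sa s h) * ww z h x s) \<le> P * cmod z"
      unfolding norm_mult by (intro mult_mono P s cmod_ww) (use P0 in auto)
    thus "\<bar>Re (\<psi> (Sa s h) * ww z h x s)\<bar> \<le> P * cmod z" by (rule order_trans[OF abs_Re_le_cmod])
  qed
  have I2: "\<bar>?I (x + v) - ?I x\<bar> \<le> (P * (cmod z * B0 * norm v)) * b" for x v
  proof -
    note ic = integrable_continuous_real[OF c]
    have "?I (x + v) - ?I x = integral {0..b} (\<lambda>s. Re (\<psi> (Sa s h) * (ww z h (x + v) s - ww z h x s)))"
      unfolding integral_diff[OF ic ic, symmetric] by (rule integral_cong) (simp only: right_diff_distrib minus_complex.simps)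
    also have "\<bar>\<dots>\<bar> \<le> (P * (cmod z * B0 * norm v)) * b"
    proof (rule integral_abs_le[OF b])
      show "continuous_on {0..b} (\<lambda>s. Re (\<psi> (Sa s h) * (ww z h (x + v) s - ww z h x s)))"
        by (intro continuous_intros pc ww_cont) auto
      fix s assume s: "0 \<le> s" "s \<le> b"
      have "cmod (\<psi> (Sa s h) * (ww z h (x + v) s - ww z h x s)) \<le> P * (cmod z * B0 * norm v)"
        unfolding norm_mult by (intro mult_mono P s ww_increment') (use P0 in auto)
      thus "\<bar>Re (\<psi> (Sa s h) * (ww z h (x + v) s - ww z h x s))\<bar> \<le> P * (cmod z * B0 * norm v)" by (rule order_trans[OF abs_Re_le_cmod])
    qed
    finally show ?thesis .
  qed
  have W1: "\<bar>Re (ww z h x s)\<bar> \<le> cmod z" if "0 \<le> s" for x s by (rule order_trans[OF abs_Re_le_cmod cmod_ww[OF that]])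
  have W2: "\<bar>Re (ww z h (x + v) s) - Re (ww z h x s)\<bar> \<le> cmod z * B0 * norm v" if "0 \<le> s" "s \<le> b" for x v s
    using order_trans[OF abs_Re_le_cmod ww_increment'(1)[OF that, of x v]] by simp
  show "(\<lambda>x. x \<bullet> As (grad (ff z b h) x)) \<in> bcontfun"
    unfolding inner_As_grad_ff
  proof (rule Lipschitz_bcontfun[where K="cmod z * B0 + cmod z * B0 + (P * (cmod z * B0)) * b" and C="cmod z + cmod z + (P * cmod z) * b"])
    fix x v
    show "norm (Re (ww z h x b) - Re (ww z h x 0) + ?I x) \<le> cmod z + cmod z + (P * cmod z) * b"
      using W1[OF b, of x] W1[of 0 x] I1[of x] unfolding real_norm_def by linarith
    have "\<bar>(Re (ww z h (x + v) b) - Re (ww z h (x + v) 0) + ?I (x + v)) - (Re (ww z h x b) - Re (ww z h x 0) + ?I x)\<bar>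
       \<le> cmod z * B0 * norm v + cmod z * B0 * norm v + (P * (cmod z * B0 * norm v)) * b"
      using W2[OF b order_refl, of x v] W2[OF order_refl b, of x v] I2[of x v] by linarith
    also have "\<dots> = (cmod z * B0 + cmod z * B0 + (P * (cmod z * B0)) * b) * norm v" by (simp add: algebra_simps)
    finally show "norm ((Re (ww z h (x + v) b) - Re (ww z h (x + v) 0) + ?I (x + v)) - (Re (ww z h x b) - Re (ww z h x 0) + ?I x))
       \<le> (cmod z * B0 + cmod z * B0 + (P * (cmod z * B0)) * b) * norm v" by simp
  qed
qed

end

end

text \<open>The identity \<open>P_t (P_s e_h) = P_{t + s} e_h\<close>, obtained from characteristic
  functions and \<open>cc_add\<close>.\<close>

lemma P_ww:
  assumes t: "t \<ge> 0" and s: "s \<ge> 0"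
  shows "(\<lambda>x. ww z h x s) \<in> bm" "(LINT y|lk t. ww z h (S t x + y) s) = ww z h x (t + s)"
    "(LINT y|lk t. Re (ww z h (S t x + y) s)) = Re (ww z h x (t + s))"
proof -
  show m: "(\<lambda>x. ww z h x s) \<in> bm" unfolding ww_def by measurable
  have "(LINT y|lk t. ww z h (S t x + y) s) = (LINT y|lk t. (z * cc s h * iexp (S t x \<bullet> Sa s h)) * iexp (y \<bullet> Sa s h))"
    by (simp add: ww_def inner_add_left distrib_left exp_add mult.assoc)
  also have "\<dots> = (z * cc s h * iexp (S t x \<bullet> Sa s h)) * cc t (Sa s h)"
    by (simp add: lk_char[OF t])
  also have "\<dots> = ww z h x (t + s)"
  proof -
    have "cc (t + s) h = cc s h * cc t (Sa s h)" using cc_add[OF s t, of h] by (simp only: add.commute)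
    thus ?thesis by (simp add: ww_def Sa[OF t] Sa_add[OF t s] mult_ac)
  qed
  finally show 1: "(LINT y|lk t. ww z h (S t x + y) s) = ww z h x (t + s)" .
  have "(LINT y|lk t. Re (ww z h (S t x + y) s)) = Re (LINT y|lk t. ww z h (S t x + y) s)"
    by (rule integral_Re) (rule P_integrable[OF m cmod_ww[OF s]])
  thus "(LINT y|lk t. Re (ww z h (S t x + y) s)) = Re (ww z h x (t + s))" unfolding 1 .
qed

abbreviation (input) "RS z b h n x \<equiv> \<Sum>k<Suc n. (b / real (Suc n)) * Re (ww z h x (b * real k / real (Suc n)))"

text \<open>These sums interchange the time integral with other integrals: whatever respects finite
  sums and bounded pointwise limits passes from \<open>ww\<close> to \<open>ff\<close>.\<close>

lemma ff_riemann:
  assumes b: "b \<ge> 0"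
  shows "(\<lambda>x. RS z b h n x) \<in> bm"
    "\<bar>RS z b h n x\<bar> \<le> cmod z * b"
    "(\<lambda>n. RS z b h n x) \<longlonglongrightarrow> ff z b h x"
proof -
  have u0: "0 \<le> b * real k / real (Suc n)" for k using b by simp
  show "(\<lambda>x. RS z b h n x) \<in> bm"
    using P_ww(1)[OF order_refl u0] by measurable
  have "\<bar>RS z b h n x\<bar> \<le> (\<Sum>k<Suc n. (b / real (Suc n)) * cmod z)"
  proof (rule order_trans[OF sum_abs sum_mono])
    fix k
    show "\<bar>(b / real (Suc n)) * Re (ww z h x (b * real k / real (Suc n)))\<bar> \<le> (b / real (Suc n)) * cmod z"
      unfolding abs_mult using b order_trans[OF abs_Re_le_cmod cmod_ww[OF u0]] by (intro mult_mono) auto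
  qed
  thus "\<bar>RS z b h n x\<bar> \<le> cmod z * b"
    by (simp add: mult.commute)
  show "(\<lambda>n. RS z b h n x) \<longlonglongrightarrow> ff z b h x"
    using riemann_sum_LIMSEQ[OF Re_cont[OF b] b] unfolding ff_def real_scaleR_def .
qed

lemma P_ff:
  assumes b: "b \<ge> 0" and t: "t \<ge> 0"
  shows "PP t (ff z b h) x = integral {0..b} (\<lambda>s. Re (ww z h x (t + s)))"
proof -
  have u0: "0 \<le> b * real k / real (Suc n)" for n k using b by simp
  note F = ff_riemann[OF b]
  have Re_int: "integrable (lk t) (\<lambda>y. Re (ww z h (S t x + y) (b * real k / real (Suc n))))" for n k
    by (intro integrable_Re P_integrable[OF P_ww(1)[OF t u0] cmod_ww[OF u0]])
  have "PP t (\<lambda>x. RS z b h n x) x =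
      (\<Sum>k<Suc n. (b / real (Suc n)) *\<^sub>R Re (ww z h x (t + b * real k / real (Suc n))))" for n
  proof -
    have "PP t (\<lambda>x. RS z b h n x) x =
        (\<Sum>k<Suc n. (b / real (Suc n)) * (LINT y|lk t. Re (ww z h (S t x + y) (b * real k / real (Suc n)))))"
      unfolding ou_law[OF t F(1)]
      by (subst Bochner_Integration.integral_sum) (auto intro!: integrable_mult_right Re_int simp del: sum.lessThan_Suc of_nat_Suc)
    thus ?thesis unfolding P_ww(3)[OF t u0] real_scaleR_def .
  qed
  moreover have "(\<lambda>n. \<Sum>k<Suc n. (b / real (Suc n)) *\<^sub>R Re (ww z h x (t + b * real k / real (Suc n)))) \<longlonglongrightarrow> integral {0..b} (\<lambda>s. Re (ww z h x (t + s)))"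
  proof (rule riemann_sum_LIMSEQ[OF _ b])
    show "continuous_on {0..b} (\<lambda>s. Re (ww z h x (t + s)))"
      by (intro continuous_on_Re continuous_on_compose2[OF ww_cont[OF order_refl]] continuous_intros) (use t in auto)
  qed
  ultimately show ?thesis using LIMSEQ_unique[OF P_LIMSEQ[OF t F]] by (simp only:)
qed

text \<open>The value is found as a limit of \<open>(P_t \<phi> - \<phi>) / t\<close> instead of
  evaluating the generator: \<open>P_t \<phi> - \<phi>\<close> is the integral of
  \<open>P_s e_h\<close> over \<open>[b, b + t]\<close> minus that over
  \<open>[0, t]\<close>.\<close>

lemma LL_ff:
  assumes b: "b \<ge> 0" and h: "h \<in> Ds"
  shows "LL (ff z b h) x = Re (ww z h x b) - Re (ww z h x 0)"
proof -
  let ?u = "\<lambda>s. Re (ww z h x s)"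
  have uc: "continuous_on {0..} ?u" by (intro continuous_on_Re ww_cont order_refl)
  have ui: "?u integrable_on {p..q}" if "0 \<le> p" for p q
    by (intro integrable_continuous_real continuous_on_subset[OF uc]) (use that in auto)
  have "PP t (ff z b h) x - ff z b h x = integral {b..b + t} ?u - integral {0..0 + t} ?u" if t: "t \<ge> 0" for t
  proof -
    have "integral {0..b} (?u \<circ> (\<lambda>s. s + t)) = integral {0 + t..b + t} ?u"
      by (rule integral_shift) (rule continuous_on_subset[OF uc], use t in auto)
    hence 1: "PP t (ff z b h) x = integral {t..b + t} ?u" unfolding P_ff[OF b t] by (simp add: o_def add.commute)
    have "integral {0..t} ?u + integral {t..b + t} ?u = integral {0..b + t} ?u"
      by (rule Henstock_Kurzweil_Integration.integral_combine) (use t b ui in auto)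
    moreover have "integral {0..b} ?u + integral {b..b + t} ?u = integral {0..b + t} ?u"
      by (rule Henstock_Kurzweil_Integration.integral_combine) (use t b ui in auto)
    ultimately show ?thesis unfolding 1 ff_def by simp
  qed
  hence "real (Suc n) * (PP (recip n) (ff z b h) x - ff z b h x) =
      real (Suc n) * integral {b..b + recip n} ?u - real (Suc n) * integral {0..0 + recip n} ?u" for n
    by (simp only: right_diff_distrib of_nat_0_le_iff zero_le_divide_1_iff)
  moreover have "(\<lambda>n. real (Suc n) * integral {b..b + recip n} ?u - real (Suc n) * integral {0..0 + recip n} ?u) \<longlonglongrightarrow> ?u b - ?u 0"
    by (intro tendsto_diff forward_average_LIMSEQ[OF uc] b order_refl)
  ultimately have "(\<lambda>n. real (Suc n) * (PP (recip n) (ff z b h) x - ff z b h x)) \<longlonglongrightarrow> ?u b - ?u 0" by simp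
  from LIMSEQ_unique[OF generator_limit[OF ff_D0_tilde[OF b h]] this] show ?thesis .
qed

text \<open>An imaginary part is the real part of \<open>- \<i>\<close> times the function, so the
  parameter \<open>z\<close> covers both kinds of generators of \<open>D1\<close>.\<close>

lemma phi_ff:
  assumes b: "b \<ge> 0"
  shows "Re (phi M S Y b h x) = ff 1 b h x" "Im (phi M S Y b h x) = ff (- \<i>) b h x"
proof -
  have "ou_semigroup M S Y s (\<lambda>z. iexp (z \<bullet> h)) x = ww 1 h x s" if "s \<ge> 0" for s
    using P_ww(2)[OF that order_refl, of 1 h x] ou_law[OF that, of "\<lambda>z. iexp (z \<bullet> h)" x] by (simp add: ww_def)
  hence "phi M S Y b h x = (LINT s:{0..b}|lborel. ww 1 h x s)"
    unfolding phi_def by (intro set_lebesgue_integral_cong) auto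
  also have "\<dots> = integral {0..b} (ww 1 h x)"
    by (intro set_borel_integral_eq_integral borel_integrable_atLeastAtMost' ww_cont) auto
  finally have 1: "phi M S Y b h x = integral {0..b} (ww 1 h x)" .
  have i: "ww 1 h x integrable_on {0..b}" by (intro integrable_continuous_real ww_cont) auto
  show "Re (phi M S Y b h x) = ff 1 b h x"
    unfolding 1 ff_def using integral_linear[OF i bounded_linear_Re] by (simp add: o_def)
  have "ww (- \<i>) h x s = - \<i> * ww 1 h x s" for s by (simp add: ww_def)
  thus "Im (phi M S Y b h x) = ff (- \<i>) b h x"
    unfolding 1 ff_def using integral_linear[OF i bounded_linear_Im] by (simp add: o_def)
qed

text \<open>Coefficients of a linear combination are absorbed into \<open>z\<close>, so that only
  sums remain to be treated for the span.\<close>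

lemma ff_cmult: "c * ff z b h x = ff (of_real c * z) b h x"
proof -
  have "Re (ww (of_real c * z) h x s) = c * Re (ww z h x s)" for s by (simp add: ww_def mult.assoc)
  thus ?thesis unfolding ff_def by simp
qed

lemma D0_tilde_add:
  assumes f: "f \<in> D0_tilde D A" and g: "g \<in> D0_tilde D A"
  shows "(\<lambda>x. f x + g x) \<in> D0_tilde D A"
proof -
  obtain C where F: "C2b C f (grad f) (hess f)" using D0_tildeD(1)[OF f] by blast
  obtain C' where G: "C2b C' g (grad g) (hess g)" using D0_tildeD(1)[OF g] by blast
  let ?s = "\<lambda>x. f x + g x"
  have d1: "GDERIV ?s x :> grad f x + grad g x" for x
    using has_derivative_add[OF C2bD(2)[OF F, of x] C2bD(2)[OF G, of x]] by (simp add: gderiv_def inner_add_right)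
  have gr: "grad ?s = (\<lambda>x. grad f x + grad g x)" by (rule ext) (rule grad_eq[OF d1])
  have d2: "((\<lambda>x. grad f x + grad g x) has_derivative (\<lambda>v. hess f x v + hess g x v)) (at x)" for x
    by (rule has_derivative_add[OF C2bD(3)[OF F] C2bD(3)[OF G]])
  have he: "hess ?s x = (\<lambda>v. hess f x v + hess g x v)" for x
    unfolding hess_def[of ?s] gr by (rule frechet_derivative_at[OF d2, symmetric])
  have AsI: "grad ?s x \<in> Ds" "As (grad ?s x) = As (grad f x) + As (grad g x)" for x
  proof -
    have "A y \<bullet> grad ?s x = y \<bullet> (As (grad f x) + As (grad g x))" if "y \<in> D" for y
      unfolding gr inner_add_right using As[OF D0_tildeD(2)[OF f] that] As[OF D0_tildeD(2)[OF g] that] by simp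
    from adj_I[OF this] show "grad ?s x \<in> Ds" "As (grad ?s x) = As (grad f x) + As (grad g x)" by auto
  qed
  have f2: "f \<in> Cb2" "g \<in> Cb2" "(\<lambda>x. As (grad f x)) \<in> bcontfun" "(\<lambda>x. As (grad g x)) \<in> bcontfun"
    using f g unfolding D0_tilde_def CA2_def by auto
  hence hf: "\<And>x. hilbert_schmidt (hess f x)" "\<exists>C. \<forall>x. hs_norm (hess f x) \<le> C" "\<And>x. ((\<lambda>y. hs_norm (\<lambda>v. hess f y v - hess f x v)) \<longlongrightarrow> 0) (at x)"
    and hg: "\<And>x. hilbert_schmidt (hess g x)" "\<exists>C. \<forall>x. hs_norm (hess g x) \<le> C" "\<And>x. ((\<lambda>y. hs_norm (\<lambda>v. hess g y v - hess g x v)) \<longlongrightarrow> 0) (at x)"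
    and gb: "grad f \<in> bcontfun" "grad g \<in> bcontfun"
    unfolding Cb2_def by auto
  obtain K1 where K1: "\<And>x. hs_norm (hess f x) \<le> K1" using hf(2) by blast
  obtain K2 where K2: "\<And>x. hs_norm (hess g x) \<le> K2" using hg(2) by blast
  have cb2: "?s \<in> Cb2"
    unfolding Cb2_def mem_Collect_eq
  proof (intro conjI allI)
    show "?s \<in> bcontfun" by (rule bcontfun_add[OF D0_tildeD(6)[OF f] D0_tildeD(6)[OF g]])
    fix x
    show "?s differentiable (at x)" using d1 unfolding gderiv_def differentiable_def by blast
    show "grad ?s differentiable (at x)" unfolding gr using d2 unfolding differentiable_def by blast
    show "grad ?s \<in> bcontfun" unfolding gr by (rule bcontfun_add[OF gb])
    show "hilbert_schmidt (hess ?s x)" unfolding he by (rule hilbert_schmidt_add(1)[OF hf(1) hg(1)])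
    show "\<exists>C. \<forall>x. hs_norm (hess ?s x) \<le> C"
    proof (intro exI allI)
      fix x show "hs_norm (hess ?s x) \<le> 2 * (K1 + K2)"
        unfolding he by (rule order_trans[OF hilbert_schmidt_add(2)[OF hf(1) hg(1)] mult_left_mono[OF add_mono[OF K1 K2]]]) simp
    qed
    have eq: "(\<lambda>v. hess ?s y v - hess ?s x v) = (\<lambda>v. (hess f y v - hess f x v) + (hess g y v - hess g x v))" for y
      unfolding he by (rule ext) simp
    show "((\<lambda>y. hs_norm (\<lambda>v. hess ?s y v - hess ?s x v)) \<longlongrightarrow> 0) (at x)"
      unfolding eq
    proof (rule Lim_null_comparison[OF always_eventually[OF allI]])
      fix y
      show "norm (hs_norm (\<lambda>v. (hess f y v - hess f x v) + (hess g y v - hess g x v))) \<le>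
          2 * (hs_norm (\<lambda>v. hess f y v - hess f x v) + hs_norm (\<lambda>v. hess g y v - hess g x v))"
        using hilbert_schmidt_add(2)[OF hilbert_schmidt_diff[OF hf(1) hf(1)] hilbert_schmidt_diff[OF hg(1) hg(1)], of y x y x]
        by (simp add: hs_norm_nonneg)
      show "((\<lambda>y. 2 * (hs_norm (\<lambda>v. hess f y v - hess f x v) + hs_norm (\<lambda>v. hess g y v - hess g x v))) \<longlongrightarrow> 0) (at x)"
        by (intro tendsto_mult_right_zero tendsto_add_zero hf hg)
    qed
  qed
  show ?thesis
    unfolding D0_tilde_def CA2_def mem_Collect_eq
  proof (intro conjI allI cb2 AsI(1))
    show "(\<lambda>x. As (grad ?s x)) \<in> bcontfun" unfolding AsI(2) by (rule bcontfun_add[OF f2(3,4)])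
    show "(\<lambda>x. x \<bullet> As (grad ?s x)) \<in> bcontfun" unfolding AsI(2) inner_add_right
      by (rule bcontfun_add[OF D0_tildeD(3)[OF f] D0_tildeD(3)[OF g]])
  qed
qed

lemma ff_in_D1:
  assumes b: "b > 0" and h: "h \<in> Ds"
  shows "ff 1 b h \<in> D1 M S Y D A" "ff (- \<i>) b h \<in> D1 M S Y D A"
proof -
  have I: "g \<in> D1 M S Y D A" if g: "g = (\<lambda>x. Re (phi M S Y b h x)) \<or> g = (\<lambda>x. Im (phi M S Y b h x))" for g
    unfolding D1_def mem_Collect_eq
  proof (intro exI conjI allI impI bexI)
    show "g = (\<lambda>x. \<Sum>i<1::nat. 1 * g x)" by simp
  qed (rule b, rule g, rule h)
  show "ff 1 b h \<in> D1 M S Y D A" "ff (- \<i>) b h \<in> D1 M S Y D A"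
    by (rule I; use phi_ff[of b h] b in \<open>simp add: fun_eq_iff\<close>)+
qed

lemma D1_subset: "D1 M S Y D A \<subseteq> D0_tilde D A"
proof
  fix f assume "f \<in> D1 M S Y D A"
  then obtain n :: nat and c g where f: "f = (\<lambda>x. \<Sum>i<n. c i * g i x)"
    and g: "\<And>i. i < n \<Longrightarrow> \<exists>b>0. \<exists>h\<in>Ds. g i = (\<lambda>x. Re (phi M S Y b h x)) \<or> g i = (\<lambda>x. Im (phi M S Y b h x))"
    unfolding D1_def by blast
  have cg: "(\<lambda>x. c i * g i x) \<in> D0_tilde D A" if i: "i < n" for i
  proof -
    obtain b h where b: "b > 0" and h: "h \<in> Ds" and gi: "g i = (\<lambda>x. Re (phi M S Y b h x)) \<or> g i = (\<lambda>x. Im (phi M S Y b h x))"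
      using g[OF i] by blast
    from gi obtain z where "g i = ff z b h" using phi_ff[of b h] b by force
    hence "(\<lambda>x. c i * g i x) = ff (of_real (c i) * z) b h" by (simp add: ff_cmult fun_eq_iff)
    thus ?thesis using ff_D0_tilde[OF _ h] b by simp
  qed
  have "(\<lambda>x. \<Sum>i<m. c i * g i x) \<in> D0_tilde D A" if "m \<le> n" for m
    using that
  proof (induction m)
    case 0
    \<comment> \<open>The empty sum is the zero function, obtained as the degenerate case
      \<open>z = 0\<close>, \<open>b = 0\<close>, \<open>h = 0\<close> of \<open>ff\<close>.\<close>
    have "(0 :: 'h) \<in> Ds" by (rule adj_I(1)[where z=0]) simp
    from ff_D0_tilde[OF order_refl this, of 0]
    have "ff 0 0 0 \<in> D0_tilde D A" .
    moreover have "ff 0 0 0 = (\<lambda>x. 0)" by (simp add: ff_def fun_eq_iff)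
    ultimately show ?case by simp
  next
    case (Suc m)
    thus ?case using D0_tilde_add[OF Suc.IH cg[of m]] by simp
  qed
  thus "f \<in> D0_tilde D A" unfolding f by simp
qed

end

section \<open>Uniqueness\<close>

text \<open>With \<open>W\<close> the integral of \<open>w\<close> in \<open>r\<close> and
  \<open>Z\<close> that in \<open>t\<close>, the equation reads
  \<open>W t r = Z t r - Z t 0\<close>. Both partial derivatives of \<open>K\<close>, the integral
  of \<open>Z\<close> in \<open>t\<close>, equal \<open>Z\<close>, so \<open>K\<close> is constant
  along \<open>t + r\<close> and vanishes, as it does at \<open>t = 0\<close>. The second
  integration is there because \<open>w\<close> is only integrable in \<open>t\<close>, so
  \<open>Z\<close> need not have \<open>w\<close> as its derivative at every time.\<close>

lemma transport_vanishing:
  fixes w :: "real \<Rightarrow> real \<Rightarrow> real" and m :: "real \<Rightarrow> real"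
  assumes cont: "\<And>t. 0 \<le> t \<Longrightarrow> continuous_on {0..} (w t)"
    and bd: "\<And>t r. 0 \<le> t \<Longrightarrow> 0 \<le> r \<Longrightarrow> \<bar>w t r\<bar> \<le> m t"
    and mi: "\<And>T. m integrable_on {0..T}"
    and eq: "\<And>t r. 0 \<le> t \<Longrightarrow> 0 < r \<Longrightarrow> ((\<lambda>s. w s r - w s 0) has_integral integral {0..r} (w t)) {0..t}"
    and t: "0 \<le> t"
  shows "w t 0 = 0"
proof -
  let ?d = "\<lambda>n :: nat. recip n"
  note combine = Henstock_Kurzweil_Integration.integral_combine
  note norm_le = Henstock_Kurzweil_Integration.integral_norm_bound_integral
  define W where "W t r = integral {0..r} (w t)" for t r
  define Z where "Z t r = integral {0..t} (\<lambda>s. w s r)" for t r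
  define K where "K t r = integral {0..t} (\<lambda>s. Z s r)" for t r
  define N where "N t = integral {0..t} m" for t
  have mi': "m integrable_on {p..q}" if "0 \<le> p" for p q
    by (rule integrable_subinterval_real[OF mi[of q]]) (use that in auto)
  have wc: "w t integrable_on {p..q}" if "0 \<le> t" "0 \<le> p" for t p q
    by (intro integrable_continuous_real continuous_on_subset[OF cont]) (use that in auto)
  have W_incr: "W t r' - W t r = integral {r..r'} (w t)" if "0 \<le> t" "0 \<le> r" "r \<le> r'" for t r r'
    using combine[OF that(2,3) wc[OF that(1) order_refl]] by (simp add: W_def)
  have W_le: "\<bar>W t r' - W t r\<bar> \<le> m t * (r' - r)" if "0 \<le> t" "0 \<le> r" "r \<le> r'" for t r r'
    unfolding W_incr[OF that]
    using integral_bound[OF that(3) continuous_on_subset[OF cont[OF that(1)]], of "m t"] that bd by auto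
  have W0 [simp]: "W t 0 = 0" for t by (simp add: W_def)
  have Wlim: "(\<lambda>n. real (Suc n) * (W t (r + ?d n) - W t r)) \<longlonglongrightarrow> w t r" if "0 \<le> t" "0 \<le> r" for t r
    using forward_average_LIMSEQ[OF cont[OF that(1)] that(2)] that by (subst W_incr) auto
  have Wbd: "\<bar>real (Suc n) * (W t (r + ?d n) - W t r)\<bar> \<le> m t" if "0 \<le> t" "0 \<le> r" for t r n
  proof -
    have "real (Suc n) * \<bar>W t (r + ?d n) - W t r\<bar> \<le> real (Suc n) * (m t * (r + ?d n - r))"
      by (intro mult_left_mono W_le that) auto
    thus ?thesis by (simp add: abs_mult)
  qed
  \<comment> \<open>The equation exhibits \<open>W\<close> as an indefinite integral in
    \<open>t\<close>, although \<open>w\<close> itself need not be continuous in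
    \<open>t\<close>.\<close>
  have Wcont: "continuous_on {0..T} (\<lambda>s. W s r)" if "0 \<le> r" "0 \<le> T" for r T
  proof (cases "r = 0")
    case False
    hence r: "0 < r" using that by simp
    have "continuous_on {0..T} (\<lambda>x. integral {0..x} (\<lambda>s. w s r - w s 0))"
      using eq[OF that(2) r] by (intro indefinite_integral_continuous_1) (auto simp: integrable_on_def)
    moreover have "W s r = integral {0..s} (\<lambda>s. w s r - w s 0)" if "s \<in> {0..T}" for s
      using eq[of s r] r that by (simp add: W_def integral_unique)
    ultimately show ?thesis by (subst continuous_on_cong[OF refl]) auto
  qed simp
  have W_int: "(\<lambda>s. W s r) integrable_on {0..T}" if "0 \<le> r" for r T
    by (rule integrable_subinterval_real[OF integrable_continuous_real[OF Wcont[OF that, of "max 0 T"]]]) auto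
  \<comment> \<open>The equation provides integrability of differences only; the boundary value is a
    limit of difference quotients of \<open>W\<close> dominated by \<open>m\<close>.\<close>
  have w0_int: "(\<lambda>s. w s 0) integrable_on {0..T}" for T
  proof (rule dominated_convergence(1)[OF _ mi])
    show "(\<lambda>s. real (Suc n) * (W s (0 + ?d n) - W s 0)) integrable_on {0..T}" for n
      using W_int[of "?d n" T] by (intro integrable_on_mult_right) simp
    show "norm (real (Suc n) * (W s (0 + ?d n) - W s 0)) \<le> m s" if "s \<in> {0..T}" for n s
      using Wbd[of s 0 n] that by simp
    show "(\<lambda>n. real (Suc n) * (W s (0 + ?d n) - W s 0)) \<longlonglongrightarrow> w s 0" if "s \<in> {0..T}" for s
      using Wlim[of s 0] that by simp
  qed
  have w_int: "(\<lambda>s. w s r) integrable_on {0..T}" if r: "0 \<le> r" for r T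
  proof (cases "0 < r \<and> 0 \<le> T")
    case True
    hence "(\<lambda>s. (w s r - w s 0) + w s 0) integrable_on {0..T}"
      using eq[of T r] by (intro integrable_add w0_int) (auto simp: integrable_on_def)
    thus ?thesis by simp
  next
    case False thus ?thesis using r w0_int by (cases "r = 0") auto
  qed
  have w_int': "(\<lambda>s. w s r) integrable_on {p..q}" if "0 \<le> r" "0 \<le> p" for r p q
    by (rule integrable_subinterval_real[OF w_int[OF that(1), of q]]) (use that in auto)
  have ZW: "Z t r = W t r + Z t 0" if "0 \<le> t" "0 \<le> r" for t r
  proof (cases "r = 0")
    case False
    hence "integral {0..t} (\<lambda>s. w s r - w s 0) = W t r" using eq[of t r] that by (simp add: W_def integral_unique)
    thus ?thesis unfolding Z_def using integral_diff[OF w_int[OF that(2)] w0_int, of t] by simp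
  qed simp
  have Zcont: "continuous_on {0..T} (\<lambda>s. Z s r)" if "0 \<le> r" for r T
    unfolding Z_def by (rule indefinite_integral_continuous_1[OF w_int[OF that]])
  have Z_int: "(\<lambda>s. Z s r) integrable_on {p..q}" if "0 \<le> r" "0 \<le> p" for r p q
    by (intro integrable_continuous_real continuous_on_subset[OF Zcont[OF that(1), of q]]) (use that in auto)
  \<comment> \<open>\<open>N\<close> controls the oscillation of \<open>Z\<close> in
    \<open>t\<close> uniformly in \<open>r\<close>.\<close>
  have Z_incr: "\<bar>Z t r - Z s r\<bar> \<le> N t - N s" if "0 \<le> s" "s \<le> t" "0 \<le> r" for s t r
  proof -
    have "Z t r - Z s r = integral {s..t} (\<lambda>s. w s r)"
      using combine[OF that(1,2) w_int'[OF that(3) order_refl]] by (simp add: Z_def)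
    moreover have "N t - N s = integral {s..t} m"
      using combine[OF that(1,2) mi'[OF order_refl]] by (simp add: N_def)
    moreover have "norm (integral {s..t} (\<lambda>s. w s r)) \<le> integral {s..t} m"
      by (rule norm_le[OF w_int'[OF that(3,1)] mi'[OF that(1)]]) (use bd that in auto)
    ultimately show ?thesis by simp
  qed
  have N_mono: "N s \<le> N t" if "0 \<le> s" "s \<le> t" for s t using Z_incr[OF that order_refl] by linarith
  have Z_bd: "\<bar>Z t r\<bar> \<le> N t" if "0 \<le> t" "0 \<le> r" for t r
    using Z_incr[OF order_refl that] by (simp add: Z_def N_def)
  have N0: "0 \<le> N t" if "0 \<le> t" for t using Z_bd[OF that order_refl] by linarith
  have K_dt: "K t r - K s r = integral {s..t} (\<lambda>s. Z s r)" if "0 \<le> s" "s \<le> t" "0 \<le> r" for s t r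
    using combine[OF that(1,2) Z_int[OF that(3) order_refl]] by (simp add: K_def)
  have K_dr: "K t r' - K t r = integral {0..t} (\<lambda>s. W s r' - W s r)" if "0 \<le> t" "0 \<le> r" "0 \<le> r'" for t r r'
  proof -
    have "K t r' - K t r = integral {0..t} (\<lambda>s. Z s r' - Z s r)"
      unfolding K_def by (rule integral_diff[symmetric]) (use Z_int that in auto)
    also have "\<dots> = integral {0..t} (\<lambda>s. W s r' - W s r)"
    proof (rule integral_cong)
      show "Z s r' - Z s r = W s r' - W s r" if "s \<in> {0..t}" for s
        using ZW[of s r'] ZW[of s r] that \<open>0 \<le> r\<close> \<open>0 \<le> r'\<close> by simp
    qed
    finally show ?thesis .
  qed
  have K0 [simp]: "K 0 r = 0" for r by (simp add: K_def)
  have K_limr: "(\<lambda>n. real (Suc n) * (K t (r + ?d n) - K t r)) \<longlonglongrightarrow> Z t r" if "0 \<le> t" "0 \<le> r" for t r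
  proof -
    have "(\<lambda>n. integral {0..t} (\<lambda>s. real (Suc n) * (W s (r + ?d n) - W s r))) \<longlonglongrightarrow> integral {0..t} (\<lambda>s. w s r)"
    proof (rule dominated_convergence(2)[OF _ mi])
      show "(\<lambda>s. real (Suc n) * (W s (r + ?d n) - W s r)) integrable_on {0..t}" for n
        by (intro integrable_on_mult_right integrable_diff W_int that add_nonneg_nonneg) simp
    qed (use Wbd Wlim that in auto)
    moreover have "integral {0..t} (\<lambda>s. real (Suc n) * (W s (r + ?d n) - W s r)) = real (Suc n) * (K t (r + ?d n) - K t r)" for n
      unfolding integral_mult_right by (subst K_dr) (use that in auto)
    ultimately show ?thesis unfolding Z_def by simp
  qed
  have K_vanish: "K c r0 = 0" if c: "0 \<le> c" and r0: "0 \<le> r0" for c r0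
  proof -
    \<comment> \<open>\<open>K\<close> along the characteristic through \<open>(c, r0)\<close>. The
      cut-off at 0 extends it by 0 beyond \<open>\<tau> = c\<close>, because difference quotients
      reach past the end of the interval.\<close>
    define u where "u \<tau> = K (max 0 (c - \<tau>)) (r0 + \<tau>)" for \<tau>
    have Lip: "\<bar>u \<tau>' - u \<tau>\<bar> \<le> (2 * N c) * (\<tau>' - \<tau>)" if "0 \<le> \<tau>" "\<tau> \<le> \<tau>'" for \<tau> \<tau>'
    proof -
      define t t' r r' where d: "t = max 0 (c - \<tau>)" "t' = max 0 (c - \<tau>')" "r = r0 + \<tau>" "r' = r0 + \<tau>'"
      have o: "0 \<le> t'" "t' \<le> t" "t \<le> c" "t - t' \<le> \<tau>' - \<tau>" "0 \<le> r" "r \<le> r'" "r' - r = \<tau>' - \<tau>" "0 \<le> t" "0 \<le> r'"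
        using that c r0 by (auto simp: d)
      have "\<bar>K t r' - K t r\<bar> \<le> N c * (\<tau>' - \<tau>)"
      proof -
        have "norm (integral {0..t} (\<lambda>s. W s r' - W s r)) \<le> integral {0..t} (\<lambda>s. m s * (r' - r))"
        proof (rule norm_le)
          show "norm (W s r' - W s r) \<le> m s * (r' - r)" if "s \<in> {0..t}" for s
            unfolding real_norm_def by (rule W_le) (use that o(5,6) in auto)
        qed (intro integrable_diff integrable_on_mult_left W_int mi o)+
        also have "\<dots> = N t * (\<tau>' - \<tau>)" by (simp add: N_def o)
        also have "\<dots> \<le> N c * (\<tau>' - \<tau>)" using o that by (intro mult_right_mono N_mono) auto
        finally show ?thesis unfolding K_dr[OF o(8,5,9)] by simp
      qed
      moreover have "\<bar>K t r' - K t' r'\<bar> \<le> N c * (\<tau>' - \<tau>)"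
      proof -
        have "norm (integral {t'..t} (\<lambda>s. Z s r')) \<le> N c * (t - t')"
        proof (rule integral_bound[OF o(2) continuous_on_subset[OF Zcont[OF o(9), of t]]])
          show "norm (Z s r') \<le> N c" if "s \<in> {t'..t}" for s
            unfolding real_norm_def by (rule order_trans[OF Z_bd N_mono]) (use that o in auto)
        qed (use o(1) in auto)
        also have "\<dots> \<le> N c * (\<tau>' - \<tau>)" using o N0[OF c] by (intro mult_left_mono) auto
        finally show ?thesis unfolding K_dt[OF o(1,2,9)] by simp
      qed
      ultimately have "\<bar>K t' r' - K t r\<bar> \<le> N c * (\<tau>' - \<tau>) + N c * (\<tau>' - \<tau>)" by linarith
      thus ?thesis unfolding u_def d by (simp add: algebra_simps)
    qed
    have uc: "continuous_on {0..} u" by (rule Lipschitz_continuous_on_nonneg[OF Lip])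
    have qb: "\<bar>real (Suc n) * (u (\<tau> + ?d n) - u \<tau>)\<bar> \<le> 2 * N c" if "0 \<le> \<tau>" for n \<tau>
    proof -
      have "real (Suc n) * \<bar>u (\<tau> + ?d n) - u \<tau>\<bar> \<le> real (Suc n) * ((2 * N c) * (\<tau> + ?d n - \<tau>))"
        by (intro mult_left_mono Lip that) auto
      thus ?thesis by (simp add: abs_mult)
    qed
    have ql: "(\<lambda>n. real (Suc n) * (u (\<tau> + ?d n) - u \<tau>)) \<longlonglongrightarrow> 0" if \<tau>: "0 \<le> \<tau>" for \<tau>
    proof (cases "\<tau> < c")
      case False
      have z: "u \<sigma> = 0" if "c \<le> \<sigma>" for \<sigma> using that by (simp add: u_def max_absorb1)
      have "0 \<le> ?d n" for n by simp
      hence "c \<le> \<tau> + ?d n" for n using False by (smt (verit))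
      hence "u (\<tau> + ?d n) = 0" "u \<tau> = 0" for n using z False by auto
      thus ?thesis by simp
    next
      case True
      define t r where d: "t = c - \<tau>" "r = r0 + \<tau>"
      have tr: "0 < t" "0 \<le> r" using True \<tau> r0 by (auto simp: d)
      have dl: "?d \<longlonglongrightarrow> 0" by (rule LIMSEQ_Suc[OF lim_1_over_n])
      have ev: "\<forall>\<^sub>F n in sequentially. ?d n < t" by (rule order_tendstoD(2)[OF dl tr(1)])
      have Nc: "continuous_on {0..t} N" unfolding N_def by (rule indefinite_integral_continuous_1[OF mi])
      have "(\<lambda>n. N (max 0 (t - ?d n))) \<longlonglongrightarrow> N t"
      proof (rule continuous_on_tendsto_compose[OF Nc])
        have "(\<lambda>n. max 0 (t - ?d n)) \<longlonglongrightarrow> max 0 (t - 0)"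
          by (rule tendsto_max[OF tendsto_const tendsto_diff[OF tendsto_const dl]])
        thus "(\<lambda>n. max 0 (t - ?d n)) \<longlonglongrightarrow> t" using tr by simp
      qed (use tr in auto)
      hence "(\<lambda>n. (N t - N (max 0 (t - ?d n))) + m t * ?d n) \<longlonglongrightarrow> (N t - N t) + m t * 0"
        by (rule tendsto_add[OF tendsto_diff[OF tendsto_const] tendsto_mult[OF tendsto_const dl]])
      hence e0: "(\<lambda>n. (N t - N (max 0 (t - ?d n))) + m t * ?d n) \<longlonglongrightarrow> 0" by simp
      \<comment> \<open>The backward quotient in \<open>t\<close> is the mean of
        \<open>Z s (r + 1/(n+1))\<close> over the last \<open>1/(n+1)\<close> before
        \<open>t\<close>. It differs from \<open>Z t r\<close> by at most the increment of
        \<open>N\<close> over this interval plus \<open>m t / (n+1)\<close> for the shift in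
        \<open>r\<close>.\<close>
      have A: "(\<lambda>n. real (Suc n) * (K t (r + ?d n) - K (max 0 (t - ?d n)) (r + ?d n)) - Z t r) \<longlonglongrightarrow> 0"
      proof (rule Lim_null_comparison[OF _ e0])
        show "\<forall>\<^sub>F n in sequentially. norm (real (Suc n) * (K t (r + ?d n) - K (max 0 (t - ?d n)) (r + ?d n)) - Z t r)
            \<le> (N t - N (max 0 (t - ?d n))) + m t * ?d n"
          using ev
        proof eventually_elim
          case (elim n)
          let ?t = "t - ?d n" and ?r = "r + ?d n"
          have o: "0 \<le> ?t" "?t \<le> t" "0 \<le> ?r" using elim tr by (auto simp del: of_nat_Suc)
          define E where "E = (N t - N ?t) + m t * ?d n"
          have pt: "norm (Z s ?r - Z t r) \<le> E" if "s \<in> {?t..t}" for s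
          proof -
            have "\<bar>Z t ?r - Z s ?r\<bar> \<le> N t - N s" using that o by (intro Z_incr) auto
            moreover have "N ?t \<le> N s" using that o by (intro N_mono) auto
            moreover have "\<bar>W t ?r - W t r\<bar> \<le> m t * (?r - r)" using tr by (intro W_le) auto
            hence "\<bar>Z t ?r - Z t r\<bar> \<le> m t * ?d n" using ZW[of t ?r] ZW[of t r] tr o by simp
            ultimately show ?thesis unfolding E_def real_norm_def by linarith
          qed
          have "norm (integral {?t..t} (\<lambda>s. Z s ?r - Z t r)) \<le> E * (t - ?t)"
          proof (rule integral_bound[OF o(2) continuous_on_diff[OF _ continuous_on_const] pt])
            show "continuous_on {?t..t} (\<lambda>s. Z s ?r)"
              by (rule continuous_on_subset[OF Zcont[OF o(3), of t]]) (use o in auto)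
          qed
          moreover have "integral {?t..t} (\<lambda>s. Z s ?r - Z t r) = (K t ?r - K ?t ?r) - ?d n * Z t r"
            unfolding K_dt[OF o] by (subst integral_diff[OF Z_int[OF o(3,1)]]) auto
          ultimately have i: "\<bar>(K t ?r - K ?t ?r) - ?d n * Z t r\<bar> \<le> E * ?d n" by simp
          have "real (Suc n) * (K t ?r - K ?t ?r) - Z t r = real (Suc n) * ((K t ?r - K ?t ?r) - ?d n * Z t r)"
            by (simp add: right_diff_distrib)
          hence "\<bar>real (Suc n) * (K t ?r - K ?t ?r) - Z t r\<bar> = real (Suc n) * \<bar>(K t ?r - K ?t ?r) - ?d n * Z t r\<bar>"
            by (simp only: abs_mult abs_of_nat)
          also have "\<dots> \<le> real (Suc n) * (E * ?d n)" by (intro mult_left_mono i) auto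
          also have "\<dots> = E" by simp
          finally show ?case using o(1) by (simp add: E_def max_absorb2)
        qed
      qed
      \<comment> \<open>The forward quotient in \<open>r\<close> and the backward quotient in
        \<open>t\<close> both tend to \<open>Z t r\<close>, and their difference is the quotient of
        \<open>u\<close>.\<close>
      have "(\<lambda>n. real (Suc n) * (K t (r + ?d n) - K t r) - (real (Suc n) * (K t (r + ?d n) - K (max 0 (t - ?d n)) (r + ?d n)) - Z t r) - Z t r) \<longlonglongrightarrow> Z t r - 0 - Z t r"
        by (intro tendsto_diff A K_limr tendsto_const) (use tr in auto)
      moreover have "real (Suc n) * (K t (r + ?d n) - K t r) - (real (Suc n) * (K t (r + ?d n) - K (max 0 (t - ?d n)) (r + ?d n)) - Z t r) - Z t r
         = real (Suc n) * (u (\<tau> + ?d n) - u \<tau>)" for n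
      proof -
        have "u (\<tau> + ?d n) = K (max 0 (t - ?d n)) (r + ?d n)" "u \<tau> = K t r"
          unfolding u_def d diff_diff_eq add.assoc using True by (simp_all only: max_absorb2 less_imp_le diff_ge_0_iff_ge)
        thus ?thesis by (simp only: right_diff_distrib)
      qed
      ultimately show ?thesis by simp
    qed
    have "(LINT t:{0..c}|lborel. 0) = u c - u 0"
      by (rule right_derivative_integral(2)[OF uc c qb ql, of 0])
    thus ?thesis using c by (simp add: u_def)
  qed
  have Z_vanish: "Z t r = 0" if "0 \<le> t" "0 \<le> r" for t r
  proof -
    have zc: "continuous_on {0..} (\<lambda>s. Z s r)"
    proof (rule continuous_on_sequentiallyI)
      fix x s assume x: "\<forall>n. x n \<in> {0::real..}" "s \<in> {0..}" "x \<longlonglongrightarrow> s"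
      have "Bseq x" using x(3) convergent_imp_Bseq convergentI by blast
      then obtain T where T: "\<And>n. \<bar>x n\<bar> \<le> T" by (auto simp: Bseq_def)
      have "s \<le> T" by (rule LIMSEQ_le_const2[OF x(3)]) (use T abs_le_D1 in blast)
      thus "(\<lambda>n. Z (x n) r) \<longlonglongrightarrow> Z s r"
        using x T abs_le_D1 by (intro continuous_on_tendsto_compose[OF Zcont[OF that(2), of T] x(3)]) auto
    qed
    have "integral {t..t + ?d n} (\<lambda>s. Z s r) = 0" for n
      using K_dt[of t "t + ?d n" r] K_vanish[of t r] K_vanish[of "t + ?d n" r] that by (simp del: of_nat_Suc)
    with forward_average_LIMSEQ[OF zc that(1)] have "(\<lambda>n. 0 :: real) \<longlonglongrightarrow> Z t r" by simp
    thus ?thesis using LIMSEQ_unique tendsto_const by blast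
  qed
  have "W t r = 0" if "0 \<le> r" for r using ZW[OF t that] Z_vanish[OF t that] Z_vanish[OF t order_refl] by simp
  hence "(\<lambda>n. 0) \<longlonglongrightarrow> w t 0" using Wlim[OF t order_refl] by simp
  thus ?thesis using LIMSEQ_unique tendsto_const by blast
qed

lemma signed_integral_sum:
  assumes g: "\<gamma> \<in> signed_measures" and I: "finite I"
    and f: "\<And>k. f k \<in> bm" "\<And>k x. \<bar>f k x\<bar> \<le> C"
  shows "signed_integral \<gamma> (\<lambda>x. \<Sum>k\<in>I. c k * f k x) = (\<Sum>k\<in>I. c k * signed_integral \<gamma> (f k))"
  unfolding signed_integral_def
  by (simp add: Bochner_Integration.integral_sum integrable_pos_part[OF g f] integrable_neg_part[OF g f]
      right_diff_distrib sum_subtractf)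

section \<open>Comparison of two solutions\<close>

context ou_setting
begin

text \<open>The function \<open>w\<close> of the transport equation: \<open>r\<close> is the time of
  the transition operator inside the test function, while the time of the solution enters through
  \<open>\<gamma>\<close>.\<close>

definition GG :: "complex \<Rightarrow> 'h \<Rightarrow> ('h set \<Rightarrow> real) \<Rightarrow> real \<Rightarrow> real" where
  "GG z h \<gamma> r = signed_integral \<gamma> (\<lambda>x. Re (ww z h x r))"

lemma Re_ww:
  assumes "0 \<le> r"
  shows "(\<lambda>x. Re (ww z h x r)) \<in> bm" "\<bar>Re (ww z h x r)\<bar> \<le> cmod z"
  using P_ww(1)[OF order_refl assms, of z h] by measurable (rule order_trans[OF abs_Re_le_cmod cmod_ww[OF assms]])

lemma GG_bound: "\<gamma> \<in> signed_measures \<Longrightarrow> 0 \<le> r \<Longrightarrow> \<bar>GG z h \<gamma> r\<bar> \<le> cmod z * tv_norm \<gamma>"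
  unfolding GG_def by (rule signed_integral_bound[OF _ Re_ww])

lemma GG_cont:
  assumes g: "\<gamma> \<in> signed_measures" shows "continuous_on {0..} (GG z h \<gamma>)"
proof (rule continuous_on_sequentiallyI)
  fix u s assume u: "\<forall>n. u n \<in> {0::real..}" "s \<in> {0..}" "u \<longlonglongrightarrow> s"
  show "(\<lambda>n. GG z h \<gamma> (u n)) \<longlonglongrightarrow> GG z h \<gamma> s"
    unfolding GG_def
  proof (rule signed_integral_dominated_convergence[OF g Re_ww])
    show "(\<lambda>n. Re (ww z h x (u n))) \<longlonglongrightarrow> Re (ww z h x s)" for x
      by (intro tendsto_Re continuous_on_tendsto_compose[OF ww_cont[OF order_refl] u(3)]) (use u in auto)
  qed (use u in auto)
qed

text \<open>Riemann sums interchange the integral over space with the time integral in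
  \<phi>.\<close>

lemma signed_integral_ff:
  assumes g: "\<gamma> \<in> signed_measures" and b: "0 \<le> b"
  shows "signed_integral \<gamma> (ff z b h) = integral {0..b} (GG z h \<gamma>)"
proof -
  define u where "u n k = b * real k / real (Suc n)" for n k :: nat
  define F where "F n x = (\<Sum>k<Suc n. (b / real (Suc n)) * Re (ww z h x (u n k)))" for n x
  have u0: "0 \<le> u n k" for n k using b by (simp add: u_def)
  have "(\<lambda>n. signed_integral \<gamma> (F n)) \<longlonglongrightarrow> signed_integral \<gamma> (ff z b h)"
    unfolding F_def u_def by (rule signed_integral_dominated_convergence[OF g ff_riemann[OF b]])
  moreover have "signed_integral \<gamma> (F n) = (\<Sum>k<Suc n. (b / real (Suc n)) *\<^sub>R GG z h \<gamma> (b * real k / real (Suc n)))" for n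
    unfolding F_def by (subst signed_integral_sum[OF g finite_lessThan Re_ww[OF u0]]) (simp add: GG_def u_def)
  moreover have "(\<lambda>n. \<Sum>k<Suc n. (b / real (Suc n)) *\<^sub>R GG z h \<gamma> (b * real k / real (Suc n))) \<longlonglongrightarrow> integral {0..b} (GG z h \<gamma>)"
    by (rule riemann_sum_LIMSEQ[OF continuous_on_subset[OF GG_cont[OF g]] b]) auto
  ultimately show ?thesis using LIMSEQ_unique by simp
qed

text \<open>Testing with \<phi> over \<open>[0, r]\<close> yields the transport equation up to the
  integral of \<phi> against \<open>\<mu>\<close>, which cancels between two solutions with the same
  initial value.\<close>

lemma solution_GG:
  assumes sol: "measure_equation_solution LL \<D> \<mu> \<gamma>" and f: "ff z r h \<in> \<D>" and h: "h \<in> Ds" and r: "0 < r" and t: "0 \<le> t"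
  shows "((\<lambda>s. GG z h (\<gamma> s) r - GG z h (\<gamma> s) 0) has_integral
    integral {0..r} (GG z h (\<gamma> t)) - signed_integral \<mu> (ff z r h)) {0..t}"
proof -
  have g: "\<gamma> s \<in> signed_measures" if "0 \<le> s" for s using sol that unfolding measure_equation_solution_def by blast
  have i: "(\<lambda>s. signed_integral (\<gamma> s) (LL (ff z r h))) absolutely_integrable_on {0..t}"
    and e: "signed_integral (\<gamma> t) (ff z r h) - signed_integral \<mu> (ff z r h) = (LINT s:{0..t}|lebesgue. signed_integral (\<gamma> s) (LL (ff z r h)))"
    using sol f t unfolding measure_equation_solution_def by blast+
  have r': "0 \<le> r" using r by simp
  have LL: "signed_integral (\<gamma> s) (LL (ff z r h)) = GG z h (\<gamma> s) r - GG z h (\<gamma> s) 0" if "s \<in> {0..t}" for s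
  proof -
    have "LL (ff z r h) = (\<lambda>x. Re (ww z h x r) - Re (ww z h x 0))" by (rule ext) (rule LL_ff[OF r' h])
    thus ?thesis unfolding GG_def using that
      by (simp add: signed_integral_diff[OF g Re_ww[OF r'] Re_ww[OF order_refl]])
  qed
  have "((\<lambda>s. signed_integral (\<gamma> s) (LL (ff z r h))) has_integral
      signed_integral (\<gamma> t) (ff z r h) - signed_integral \<mu> (ff z r h)) {0..t}"
    unfolding e set_lebesgue_integral_eq_integral(2)[OF i]
    by (rule integrable_integral[OF set_lebesgue_integral_eq_integral(1)[OF i]])
  hence "((\<lambda>s. GG z h (\<gamma> s) r - GG z h (\<gamma> s) 0) has_integral
      signed_integral (\<gamma> t) (ff z r h) - signed_integral \<mu> (ff z r h)) {0..t}"
    by (rule has_integral_eq[rotated]) (rule LL)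
  thus ?thesis unfolding signed_integral_ff[OF g[OF t] r'] .
qed

lemma solution_tv_integrable:
  assumes sol: "measure_equation_solution LL \<D> \<mu> \<gamma>"
  shows "(\<lambda>s. tv_norm (\<gamma> s)) integrable_on {0..T}"
proof (rule integrable_subinterval_real)
  \<comment> \<open>\<open>max 1 T\<close> is a positive horizon for an arbitrary real
    \<open>T\<close>.\<close>
  have "(\<lambda>s. tv_norm (\<gamma> s)) absolutely_integrable_on box 0 (max 1 T)"
    using sol unfolding measure_equation_solution_def by simp
  thus "(\<lambda>s. tv_norm (\<gamma> s)) integrable_on {0..max 1 T}"
    using set_lebesgue_integral_eq_integral(1) integrable_on_open_interval by (metis cbox_interval)
qed auto

text \<open>The two solutions may refer to different classes of test functions as long as both
  contain the functions \<phi>: the constructed solution comes with \<open>D0_tilde\<close>, the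
  given one with the chosen class.\<close>

lemma solution_unique:
  assumes sol: "measure_equation_solution LL \<D> \<mu> \<gamma>" and sol': "measure_equation_solution LL \<D>' \<mu> \<gamma>'"
    and f: "\<And>b h. 0 < b \<Longrightarrow> h \<in> Ds \<Longrightarrow> ff 1 b h \<in> \<D> \<and> ff (- \<i>) b h \<in> \<D> \<and> ff 1 b h \<in> \<D>' \<and> ff (- \<i>) b h \<in> \<D>'"
    and t: "0 \<le> t"
  shows "\<gamma> t = \<gamma>' t"
proof -
  have g: "\<gamma> s \<in> signed_measures" "\<gamma>' s \<in> signed_measures" if "0 \<le> s" for s
    using sol sol' that unfolding measure_equation_solution_def by blast+
  have G: "GG z h (\<gamma> t) 0 = GG z h (\<gamma>' t) 0" if h: "h \<in> Ds" and fz: "\<And>b. 0 < b \<Longrightarrow> ff z b h \<in> \<D> \<and> ff z b h \<in> \<D>'" for z h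
  proof -
    let ?w = "\<lambda>s r. GG z h (\<gamma> s) r - GG z h (\<gamma>' s) r"
    let ?m = "\<lambda>s. cmod z * (tv_norm (\<gamma> s) + tv_norm (\<gamma>' s))"
    have "?w t 0 = 0"
    proof (rule transport_vanishing[where w="?w" and m="?m", OF _ _ _ _ t])
      fix s :: real assume s: "0 \<le> s"
      show "continuous_on {0..} (?w s)" by (intro continuous_on_diff GG_cont g s)
      show "\<bar>?w s r\<bar> \<le> ?m s" if "0 \<le> r" for r
        using GG_bound[OF g(1)[OF s] that, of z h] GG_bound[OF g(2)[OF s] that, of z h] by (simp add: distrib_left)
      fix r :: real assume r: "0 < r"
      have c: "GG z h \<delta> integrable_on {0..r}" if "\<delta> \<in> signed_measures" for \<delta>
        by (intro integrable_continuous_real continuous_on_subset[OF GG_cont[OF that]]) auto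
      note has_integral_diff[OF solution_GG[OF sol conjunct1[OF fz[OF r]] h r s] solution_GG[OF sol' conjunct2[OF fz[OF r]] h r s]]
      thus "((\<lambda>q. ?w q r - ?w q 0) has_integral integral {0..r} (?w s)) {0..s}"
        unfolding integral_diff[OF c[OF g(1)[OF s]] c[OF g(2)[OF s]]] by (simp add: algebra_simps)
    next
      show "?m integrable_on {0..T}" for T
        by (intro integrable_on_mult_right integrable_add solution_tv_integrable[OF sol] solution_tv_integrable[OF sol'])
    qed
    thus ?thesis by simp
  qed
  have trig: "signed_integral (\<gamma> t) (\<lambda>x. cos (x \<bullet> h)) = signed_integral (\<gamma>' t) (\<lambda>x. cos (x \<bullet> h))"
    "signed_integral (\<gamma> t) (\<lambda>x. sin (x \<bullet> h)) = signed_integral (\<gamma>' t) (\<lambda>x. sin (x \<bullet> h))" if h: "h \<in> Ds" for h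
  proof -
    have "Re (ww 1 h x 0) = cos (x \<bullet> h)" "Re (ww (- \<i>) h x 0) = sin (x \<bullet> h)" for x
      by (simp_all add: ww_def Re_exp Im_exp)
    with G[OF h, of 1] G[OF h, of "- \<i>"] f[OF _ h]
    show "signed_integral (\<gamma> t) (\<lambda>x. cos (x \<bullet> h)) = signed_integral (\<gamma>' t) (\<lambda>x. cos (x \<bullet> h))"
      "signed_integral (\<gamma> t) (\<lambda>x. sin (x \<bullet> h)) = signed_integral (\<gamma>' t) (\<lambda>x. sin (x \<bullet> h))"
      by (simp_all add: GG_def)
  qed
  \<comment> \<open>Equality for frequencies in the domain of the adjoint generator passes to all
    frequencies by bounded convergence along \<open>hs\<close>.\<close>
  have ext: "signed_integral (\<gamma> t) (\<lambda>x. k (x \<bullet> h)) = signed_integral (\<gamma>' t) (\<lambda>x. k (x \<bullet> h))"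
    if k: "continuous_on UNIV k" "\<And>r. \<bar>k r\<bar> \<le> 1"
      and e: "\<And>h. h \<in> Ds \<Longrightarrow> signed_integral (\<gamma> t) (\<lambda>x. k (x \<bullet> h)) = signed_integral (\<gamma>' t) (\<lambda>x. k (x \<bullet> h))"
    for k :: "real \<Rightarrow> real" and h
  proof -
    obtain hs where hs: "\<And>n. hs n \<in> Ds" "\<And>x. (\<lambda>n. x \<bullet> hs n) \<longlonglongrightarrow> x \<bullet> h"
      using Ds_weakly_dense[of h] by blast
    have km: "(\<lambda>x. k (x \<bullet> h)) \<in> bm" for h :: 'h
      using borel_measurable_continuous_onI[OF k(1)] by measurable
    have lim: "(\<lambda>n. signed_integral \<delta> (\<lambda>x. k (x \<bullet> hs n))) \<longlonglongrightarrow> signed_integral \<delta> (\<lambda>x. k (x \<bullet> h))"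
      if "\<delta> \<in> signed_measures" for \<delta>
      by (rule signed_integral_dominated_convergence[OF that km k(2)]) (rule isCont_seq[OF k(1) hs(2)])
    show ?thesis
      using lim[OF g(1)[OF t]] lim[OF g(2)[OF t]] unfolding e[OF hs(1)] by (rule LIMSEQ_unique)
  qed
  let ?\<delta> = "\<lambda>B. \<gamma> t B - \<gamma>' t B"
  have d: "?\<delta> B = 0" if B: "B \<in> sets borel" for B
  proof (rule signed_measure_char_eq_0[OF signed_measures_diff[OF g[OF t]] _ _ B])
    fix h :: 'h
    have m: "(\<lambda>x. cos (x \<bullet> h)) \<in> bm" "(\<lambda>x. sin (x \<bullet> h)) \<in> bm"
      by measurable
    have cs: "continuous_on UNIV (cos :: real \<Rightarrow> real)" "continuous_on UNIV (sin :: real \<Rightarrow> real)"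
      using continuous_on_cos[OF continuous_on_id] continuous_on_sin[OF continuous_on_id] by auto
    show "signed_integral ?\<delta> (\<lambda>x. cos (x \<bullet> h)) = 0"
      using signed_integral_diff_measure[OF g[OF t] m(1), of 1] ext[OF cs(1) abs_cos_le_one trig(1), of h] by simp
    show "signed_integral ?\<delta> (\<lambda>x. sin (x \<bullet> h)) = 0"
      using signed_integral_diff_measure[OF g[OF t] m(2), of 1] ext[OF cs(2) abs_sin_le_one trig(2), of h] by simp
  qed
  show ?thesis by (rule signed_measures_ext[OF g[OF t]]) (use d in simp)
qed

end

theorem theorem6p2:
  fixes Q A :: "'h::{real_inner, polish_space} \<Rightarrow> 'h"
    and D :: "'h set" and S :: "real \<Rightarrow> 'h \<Rightarrow> 'h"
    and a :: 'h and \<nu> :: "'h measure"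
    and M :: "'w measure" and Z Y :: "real \<Rightarrow> 'w \<Rightarrow> 'h"
    and \<D> :: "('h \<Rightarrow> real) set" and \<mu> :: "'h set \<Rightarrow> real"
  assumes "nonneg_symmetric Q" and "trace_class Q"
    and "jump_measure \<nu>"
    and "levy_process M Z"
    and "\<And>t h. t \<ge> 0 \<Longrightarrow>
           (LINT \<omega>|M. exp (\<i> * of_real (Z t \<omega> \<bullet> h))) = exp (- of_real t * levy_exponent Q a \<nu> h)"
    and "generates D A S"
    and "stochastic_convolution M S Z Y"
    and "\<D> = D0_tilde D A \<or> \<D> = D1 M S Y D A"
    and "\<mu> \<in> signed_measures"
  shows "measure_equation_solution (L0 D A Q a \<nu>) \<D> \<mu> (\<lambda>t. dual_semigroup M S Y t \<mu>) \<and>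
    (\<forall>\<gamma>. measure_equation_solution (L0 D A Q a \<nu>) \<D> \<mu> \<gamma> \<longrightarrow>
       (\<forall>t\<ge>0. \<gamma> t = dual_semigroup M S Y t \<mu>))"
proof -
  interpret ou_setting S D A Q a \<nu> M Z Y
  proof
    show "C0_semigroup S" using assms(6) unfolding generates_def by blast
  qed (fact assms)+
  \<comment> \<open>A solution for a class of test functions is one for every subclass, so existence
    for \<open>D0_tilde\<close> covers both choices of \<open>\<D>\<close>.\<close>
  have sub: "\<D> \<subseteq> D0_tilde D A" using assms(8) D1_subset by blast
  note sol = dual_solution[OF assms(9)]
  have ff: "ff 1 b h \<in> \<D> \<and> ff (- \<i>) b h \<in> \<D> \<and> ff 1 b h \<in> D0_tilde D A \<and> ff (- \<i>) b h \<in> D0_tilde D A"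
    if "0 < b" "h \<in> adj_dom D A" for b h
    using assms(8) ff_in_D1[OF that] D1_subset by blast
  show ?thesis
  proof (intro conjI allI impI)
    show "measure_equation_solution (L0 D A Q a \<nu>) \<D> \<mu> (\<lambda>t. dual_semigroup M S Y t \<mu>)"
      using sol sub unfolding measure_equation_solution_def by (auto dest: subsetD)
    fix \<gamma> and t :: real
    assume "measure_equation_solution (L0 D A Q a \<nu>) \<D> \<mu> \<gamma>" and t: "0 \<le> t"
    from solution_unique[OF this(1) sol ff t] show "\<gamma> t = dual_semigroup M S Y t \<mu>" .
  qed
qed

end
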